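(* Let $d\ge1$, let $a,b,o\in C^\infty(\mathbb{T}^{2d})$ with $a,b$ real-valued, and for $N\in\mathbb{N}$, $N\ge 1$, put $h=\frac{1}{2\pi N}$ (so $0<h\le 1$). Let $A=\mathrm{op}_N(a)$, $B=\mathrm{op}_N(b)$, $O=\mathrm{op}_N(o)$ be their quantizations as operators $H_N\to H_N$, and let $H=A+B$. Let $t>0$, $n\in\mathbb{N}$ with $n\ge 1$, $t=ns$, and define $$T(t):=e^{\mathrm{i}Ht/h}\,O\,e^{-\mathrm{i}Ht/h},$$ $$T_{2,n}(s):=\big(e^{\mathrm{i}As/(2h)}e^{\mathrm{i}Bs/h}e^{\mathrm{i}As/(2h)}\big)^n\,O\,\big(e^{-\mathrm{i}As/(2h)}e^{-\mathrm{i}Bs/h}e^{-\mathrm{i}As/(2h)}\big)^n.$$ Then $$\|T_{2,n}(s)-T(t)\|\le C_t\,s^2$$ for some constant $C_t$ (depending on $t$) independent of $n$ and $h$ (equivalently, of $n$ and $N$), where $\|\cdot\|$ is the operator norm on $H_N$.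
   Context: $\mathbb{T}=\mathbb{R}/\mathbb{Z}$. For $N\in\mathbb{N}$ let $H_N$ be the $N^d$-dimensional space of tempered distributions on $\mathbb{R}^d$ spanned by $$Q_n=N^{-d/2}\sum_{k\in\mathbb{Z}^d}\delta_{x=k+\frac nN},\qquad n\in\{0,1,\dots,N-1\}^d,$$ where $\delta_{x=y}$ is the Dirac distribution at $y$; $H_N$ is made a Hilbert space by declaring $(Q_n)$ to be an orthonormal basis. Thus operators on $H_N$ are $N^d\times N^d$ matrices in the basis $(Q_n)$, and the operator norm on $H_N$ is the spectral ($\ell^2\to\ell^2$) norm of the matrix. For $a\in C^\infty(\mathbb{T}^{2d})$, let $\tilde a$ be its lift to a $\mathbb{Z}^{2d}$-periodic smooth function on $T^*\mathbb{R}^d=\mathbb{R}^{2d}$. With $h=\frac1{2\pi N}$, set $\mathrm{op}_N(a):=\mathrm{op}_h(\tilde a)|_{H_N}$, which maps $H_N$ to itself, where $\mathrm{op}_h$ is the semiclassical Weyl quantization $$(\mathrm{op}_h(\tilde a)u)(x)=\frac{1}{(2\pi h)^d}\iint_{\mathbb{R}^{2d}}e^{\frac{\mathrm{i}}{h}\langle x-y,\xi\rangle}\tilde a\Big(\frac{x+y}{2},\xi\Big)u(y)\,dy\,d\xi ,$$ extended by duality to tempered distributions. *)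

theory Defs
  imports "HOL-Analysis.Analysis" "HOL-Library.Function_Algebras"
begin

primrec directional_derivs ::
    "'a list \<Rightarrow> ('a::euclidean_space \<Rightarrow> complex) \<Rightarrow> 'a \<Rightarrow> complex" where
  "directional_derivs [] f = f"
| "directional_derivs (v # vs) f =
     (\<lambda>x. frechet_derivative (directional_derivs vs f) (at x) v)"

text \<open>Every iterated directional derivative is differentiable; this forces all of them to be
  continuous, so it is \<open>C\<^sup>\<infinity>\<close>.\<close>

definition smooth :: "('a::euclidean_space \<Rightarrow> complex) \<Rightarrow> bool" where
  "smooth f \<longleftrightarrow> (\<forall>vs. directional_derivs vs f differentiable_on UNIV)"

definition schwartz :: "('a::euclidean_space \<Rightarrow> complex) \<Rightarrow> bool" where
  "schwartz f \<longleftrightarrow> smooth f \<and>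
     (\<forall>k vs. \<exists>C. \<forall>x. norm x ^ k * norm (directional_derivs vs f x) \<le> C)"

text \<open>A point \<open>(x, \<xi>)\<close> of phase space lies in \<open>real^'d \<times> real^'d\<close>, with \<open>d = CARD('d)\<close>. A smooth
  function on the torus is represented by its periodic lift to phase space.\<close>

definition int_vec :: "int^'d \<Rightarrow> real^'d" where
  "int_vec k = (\<chi> i. of_int (k $ i))"

definition smooth_torus :: "((real^'d) \<times> (real^'d) \<Rightarrow> complex) \<Rightarrow> bool" where
  "smooth_torus a \<longleftrightarrow> smooth a \<and>
     (\<forall>x \<xi> k l. a (x + int_vec k, \<xi> + int_vec l) = a (x, \<xi>))"

text \<open>Weyl quantization on Schwartz functions, as an iterated integral: for a bounded symbol with
  bounded derivatives, the inner \<open>y\<close>-integral decays rapidly in \<open>\<xi>\<close>, so both integrals converge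
  absolutely and no oscillatory regularization is needed.\<close>

definition weyl ::
    "real \<Rightarrow> ((real^'d) \<times> (real^'d) \<Rightarrow> complex) \<Rightarrow> (real^'d \<Rightarrow> complex) \<Rightarrow> real^'d \<Rightarrow> complex" where
  "weyl h a u x = complex_of_real (1 / (2 * pi * h) ^ CARD('d)) *
     (LINT \<xi>|lborel. LINT y|lborel.
        exp (\<i> / complex_of_real h * complex_of_real ((x - y) \<bullet> \<xi>)) *
        a ((1/2) *\<^sub>R (x + y), \<xi>) * u y)"

lemma lborel_integral_uminus:
  fixes f :: "'a::euclidean_space \<Rightarrow> complex"
  shows "(LINT x|lborel. f (- x)) = (LINT x|lborel. f x)"
proof -
  have d: "distr lborel borel (uminus :: 'a \<Rightarrow> 'a) = lborel"
    using lborel_affine[of "-1::real" "0::'a", symmetric] by (simp add: density_1)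
  have m: "(uminus :: 'a \<Rightarrow> 'a) \<in> borel_measurable borel"
    by simp
  show ?thesis
  proof (cases "f \<in> borel_measurable borel")
    case True
    then have "(LINT x|distr lborel borel uminus. f x) = (LINT x|lborel. f (- x))"
      by (intro integral_distr) auto
    then show ?thesis by (simp add: d)
  next
    case False
    have "(\<lambda>x. f (- x)) \<notin> borel_measurable borel"
    proof
      assume "(\<lambda>x. f (- x)) \<in> borel_measurable borel"
      from measurable_compose[OF m this] False show False by simp
    qed
    then have "\<not> integrable lborel (\<lambda>x. f (- x))"
      using borel_measurable_integrable[of lborel "\<lambda>x. f (- x)"] by auto
    then have 1: "(LINT x|lborel. f (- x)) = 0"
      by (rule not_integrable_integral_eq)
    have "\<not> integrable lborel f"
      using False borel_measurable_integrable[of lborel f] by auto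
    then have 2: "(LINT x|lborel. f x) = 0"
      by (rule not_integrable_integral_eq)
    from 1 2 show ?thesis by (rule trans[OF _ sym])
  qed
qed

lemma weyl_reflected:
  "weyl h (\<lambda>(x, \<xi>). a (x, - \<xi>)) \<phi> y = complex_of_real (1 / (2 * pi * h) ^ CARD('d)) *
     (LINT \<xi>|lborel. LINT x|lborel.
        exp (\<i> / complex_of_real h * complex_of_real ((x - y) \<bullet> \<xi>)) *
        a ((1/2) *\<^sub>R (x + y), \<xi>) * \<phi> x)"
  for a :: "(real^'d) \<times> (real^'d) \<Rightarrow> complex" and y :: "real^'d"
proof -
  define g where "g \<xi> = (LINT x|lborel.
        exp (\<i> / complex_of_real h * complex_of_real ((x - y) \<bullet> \<xi>)) *
        a ((1/2) *\<^sub>R (x + y), \<xi>) * \<phi> x)" for \<xi>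
  have "(y - x) \<bullet> \<xi> = (x - y) \<bullet> (- \<xi>)" for x \<xi> :: "real^'d"
    by (simp add: inner_diff_left)
  then have "weyl h (\<lambda>(x, \<xi>). a (x, - \<xi>)) \<phi> y =
      complex_of_real (1 / (2 * pi * h) ^ CARD('d)) * (LINT \<xi>|lborel. g (- \<xi>))"
    unfolding weyl_def g_def by (simp only: case_prod_conv add.commute[of y])
  then show ?thesis
    unfolding lborel_integral_uminus[of g] unfolding g_def .
qed

text \<open>A distribution is a functional on Schwartz functions, extended by \<open>0\<close> to all other functions
  so that equality of functionals is equality as distributions.\<close>

type_synonym 'd distribution = "(real^'d \<Rightarrow> complex) \<Rightarrow> complex"

text \<open>Extension by duality, \<open>\<langle>op u, \<phi>\<rangle> = \<langle>u, op\<^sup>t \<phi>\<rangle>\<close> for the bilinear pairing. The transpose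
  exchanges \<open>x\<close> and \<open>y\<close> in the kernel; after \<open>\<xi> \<mapsto> - \<xi>\<close> it is the quantization of
  \<open>a(x, - \<xi>)\<close> (lemma \<open>weyl_reflected\<close>).\<close>

definition weyl_distribution ::
    "real \<Rightarrow> ((real^'d) \<times> (real^'d) \<Rightarrow> complex) \<Rightarrow> 'd distribution \<Rightarrow> 'd distribution" where
  "weyl_distribution h a u =
     (\<lambda>\<phi>. if schwartz \<phi> then u (weyl h (\<lambda>(x, \<xi>). a (x, - \<xi>)) \<phi>) else 0)"

definition grid :: "nat \<Rightarrow> (nat^'d) set" where
  "grid N = {n. \<forall>i. n $ i < N}"

definition Q :: "nat \<Rightarrow> nat^'d \<Rightarrow> 'd distribution" where
  "Q N n = (\<lambda>\<phi>. if schwartz \<phi>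
     then complex_of_real (real N powr (- real CARD('d) / 2)) *
       (\<Sum>\<^sub>\<infinity>k\<in>UNIV. \<phi> (int_vec k + (\<chi> i. real (n $ i) / real N)))
     else 0)"

definition Q_comb :: "nat \<Rightarrow> (nat^'d \<Rightarrow> complex) \<Rightarrow> 'd distribution" where
  "Q_comb N c = (\<lambda>\<phi>. \<Sum>n\<in>grid N. c n * Q N n \<phi>)"

definition H_space :: "nat \<Rightarrow> ('d::finite) distribution set" where
  "H_space N = range (Q_comb N)"

definition coords :: "nat \<Rightarrow> ('d::finite) distribution \<Rightarrow> nat^'d \<Rightarrow> complex" where
  "coords N u = (THE c. u = Q_comb N c \<and> (\<forall>n. n \<notin> grid N \<longrightarrow> c n = 0))"

text \<open>The Hilbert norm for which the \<open>Q N n\<close> are orthonormal.\<close>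

definition H_norm :: "nat \<Rightarrow> ('d::finite) distribution \<Rightarrow> real" where
  "H_norm N u = L2_set (\<lambda>n. cmod (coords N u n)) (grid N)"

type_synonym 'd operator = "'d distribution \<Rightarrow> 'd distribution"

definition op_norm :: "nat \<Rightarrow> ('d::finite) operator \<Rightarrow> real" where
  "op_norm N T = (SUP u\<in>{u \<in> H_space N. H_norm N u \<le> 1}. H_norm N (T u))"

definition op_N :: "nat \<Rightarrow> ((real^'d) \<times> (real^'d) \<Rightarrow> complex) \<Rightarrow> 'd operator" where
  "op_N N a u = (if u \<in> H_space N then weyl_distribution (1 / (2 * pi * real N)) a u else 0)"

text \<open>The exponential \<open>e\<^sup>z\<^sup>T\<close>. On a finite-dimensional space of distributions, convergence of the
  power series against every test function is convergence in norm.\<close>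

definition exp_op :: "complex \<Rightarrow> 'd operator \<Rightarrow> 'd operator" where
  "exp_op z T u = (\<lambda>\<phi>. \<Sum>k. z ^ k / fact k * (T ^^ k) u \<phi>)"

end

theory Submission
  imports Defs "HOL-Probability.Characteristic_Functions" "HOL-Probability.Sinc_Integral" "HOL-Library.Real_Mod"
begin

text \<open>
  By Fourier expansion of the symbol, \<open>op\<^sub>N a\<close> is a rapidly convergent sum of Weyl translations,
  which act on the grid by phases and cyclic shifts. For an elementary translation \<open>u\<^sub>j\<close> put
  \<open>D\<^sub>j X = N (u\<^sub>j X u\<^sub>j\<^sup>-\<^sup>1 - X)\<close>. On quantizations, \<open>D\<^sub>j\<close> acts as differentiation of the symbol, up to
  errors uniform in \<open>N\<close>; conversely, as a translation by \<open>v\<close> is a product of \<open>|v|\<close> elementary ones,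
  the commutator of \<open>K = 2\<pi>iN op\<^sub>N a\<close> with \<open>X\<close> is bounded by the \<open>D\<^sub>j X\<close> with a constant
  independent of \<open>N\<close>, although \<open>K\<close> itself has norm of order \<open>N\<close>. Hence commuting with \<open>K\<close> costs one
  derivative in the norms \<open>sob k X\<close> (the sum of the norms of the iterated differences of order at most
  \<open>k\<close>), and a Gronwall argument shows that conjugation by \<open>e\<^sup>t\<^sup>K\<close> increases \<open>sob k\<close> at most by a
  factor \<open>e\<^sup>c\<^sup>t\<close> uniformly in \<open>N\<close>. The local error of the Strang splitting of the conjugation flow is
  \<open>s\<^sup>3\<close> times triple commutators, so at most \<open>s\<^sup>3\<close> times \<open>sob 3\<close> of the exactly evolved observable.
  Summing \<open>n\<close> local errors, with all splitting steps contractive in the operator norm, gives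
  \<open>n s\<^sup>3 = t s\<^sup>2\<close>.
\<close>

section \<open>Strang splitting of conjugation flows\<close>

text \<open>The difficulty is uniformity in \<open>N\<close>: the generators have norm of order
  \<open>N\<close>, so an error expressed by their norms would be of order
  \<open>N ^ 3 * s ^ 3\<close>. An asymptotic symbol calculus (Moyal product, Egorov's theorem) is
  avoided, because only bounds are needed. On the torus there are no position and momentum
  operators, only their exponentials, the elementary translations. Conjugation by these is
  multiplicative, so \<open>D j\<close> obeys an exact Leibniz rule with an additional term of order
  \<open>1 / N\<close>, and no remainder of an expansion in \<open>h\<close> ever appears. The grid
  depends on \<open>N\<close> and cannot serve as an index type. Matrices therefore become operators
  on square-summable families over all of \<open>nat^'d\<close>, so that one Banach algebra serves
  every \<open>N\<close>; restricting to the grid at the end can only decrease the norm. These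
  operators are real-linear, and the price is one extra difference, the one for multiplication by
  \<open>\<i>\<close>.\<close>

definition commutator :: "'m::ring \<Rightarrow> 'm \<Rightarrow> 'm" where
  "commutator K X = K * X - X * K"

definition conj_exp :: "real \<Rightarrow> 'm::{real_normed_algebra_1,banach} \<Rightarrow> 'm \<Rightarrow> 'm" where
  "conj_exp t K X = exp (t *\<^sub>R K) * X * exp (t *\<^sub>R (- K))"

text \<open>Asked for all real \<open>t\<close>, negative ones included, so that both factors of
  \<open>conj_exp\<close> are contractions.\<close>

definition isometric_generator :: "'m::{real_normed_algebra_1,banach} \<Rightarrow> bool" where
  "isometric_generator K \<longleftrightarrow> (\<forall>t. norm (exp (t *\<^sub>R K)) \<le> 1)"

lemma commutator_linear:
  fixes K :: "'m::real_algebra"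
  shows "commutator K (X + Y) = commutator K X + commutator K Y"
    "commutator K (X - Y) = commutator K X - commutator K Y"
    "commutator K (r *\<^sub>R X) = r *\<^sub>R commutator K X"
    "commutator (K + L) X = commutator K X + commutator L X"
  by (simp_all add: commutator_def algebra_simps)

lemma norm_commutator_le:
  fixes K :: "'m::real_normed_algebra"
  shows "norm (commutator K X) \<le> 2 * norm K * norm X"
proof -
  have "norm (commutator K X) \<le> norm (K * X) + norm (X * K)"
    unfolding commutator_def by (rule norm_triangle_ineq4)
  also have "\<dots> \<le> norm K * norm X + norm X * norm K"
    by (intro add_mono norm_mult_ineq)
  finally show ?thesis by (simp add: mult_ac)
qed

lemma conj_exp_linear:
  "conj_exp t K (X + Y) = conj_exp t K X + conj_exp t K Y"
  "conj_exp t K (X - Y) = conj_exp t K X - conj_exp t K Y"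
  "conj_exp t K (r *\<^sub>R X) = r *\<^sub>R conj_exp t K X"
  by (simp_all add: conj_exp_def algebra_simps)

lemma conj_exp_zero [simp]: "conj_exp 0 K X = X"
  by (simp add: conj_exp_def)

lemma conj_exp_add: "conj_exp s K (conj_exp t K X) = conj_exp (s + t) K X"
proof -
  have 1: "exp (s *\<^sub>R K) * exp (t *\<^sub>R K) = exp ((s + t) *\<^sub>R K)"
    by (subst exp_add_commuting[symmetric]) (simp_all add: algebra_simps)
  have 2: "exp (t *\<^sub>R (- K)) * exp (s *\<^sub>R (- K)) = exp ((s + t) *\<^sub>R (- K))"
    by (subst exp_add_commuting[symmetric]) (simp_all add: algebra_simps)
  show ?thesis unfolding conj_exp_def 1[symmetric] 2[symmetric] by (simp only: mult.assoc)
qed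

lemma norm_conj_exp_le:
  assumes "isometric_generator K"
  shows "norm (conj_exp t K X) \<le> norm X"
proof -
  have "t *\<^sub>R (- K) = (- t) *\<^sub>R K" by simp
  then have a: "norm (exp (t *\<^sub>R K)) \<le> 1" "norm (exp (t *\<^sub>R (- K))) \<le> 1"
    using assms unfolding isometric_generator_def by metis+
  have "norm (conj_exp t K X) \<le> norm (exp (t *\<^sub>R K)) * norm X * norm (exp (t *\<^sub>R (- K)))"
    unfolding conj_exp_def
    by (meson norm_mult_ineq order_trans mult_right_mono norm_ge_zero)
  also have "\<dots> \<le> 1 * norm X * 1"
    by (intro mult_mono a) auto
  finally show ?thesis by simp
qed

text \<open>The left exponential is differentiated with \<open>K\<close> on its right and the right
  one with \<open>K\<close> on its left, so both copies of \<open>K\<close> land next to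
  \<open>X\<close> and form a commutator under the same conjugation.\<close>

lemma conj_exp_has_vector_derivative:
  "((\<lambda>t. conj_exp t K X) has_vector_derivative conj_exp t K (commutator K X)) (at t within S)"
proof -
  have "((\<lambda>t. conj_exp t K X) has_vector_derivative
      exp (t *\<^sub>R K) * X * (- K * exp (t *\<^sub>R (- K))) + exp (t *\<^sub>R K) * K * X * exp (t *\<^sub>R (- K)))
      (at t within S)"
    unfolding conj_exp_def
    by (rule has_vector_derivative_mult has_vector_derivative_mult_left
        exp_scaleR_has_vector_derivative_right
        has_vector_derivative_at_within[OF exp_scaleR_has_vector_derivative_left])+
  then show ?thesis
    by (simp add: conj_exp_def commutator_def algebra_simps)
qed

text \<open>Mean value inequality against the primitive of \<open>c * x ^ n\<close>; each use
  integrates a bound once more. The case \<open>t = 0\<close> is separate because the inequality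
  needs a proper interval.\<close>

lemma conj_exp_taylor_step:
  fixes f :: "real \<Rightarrow> 'm::real_normed_vector"
  assumes "0 \<le> t" and "f 0 = 0"
    and "\<And>x. (f has_vector_derivative f' x) (at x)"
    and "\<And>x. 0 \<le> x \<Longrightarrow> norm (f' x) \<le> c * x ^ n"
  shows "norm (f t) \<le> c * t ^ Suc n / Suc n"
proof (cases "t = 0")
  case False
  with assms(1) have t: "0 < t" by simp
  have "norm (f t - f 0) \<le> c * t ^ Suc n / Suc n - c * 0 ^ Suc n / Suc n"
  proof (rule differentiable_bound_general[OF t])
    show "continuous_on {0..t} f"
      using assms(3) by (auto intro!: continuous_at_imp_continuous_on has_vector_derivative_continuous)
    show "continuous_on {0..t} (\<lambda>t. c * t ^ Suc n / Suc n)"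
      by (intro continuous_intros) auto
    show "(f has_vector_derivative f' x) (at x)" for x using assms(3) .
    show "((\<lambda>t. c * t ^ Suc n / Suc n) has_vector_derivative c * x ^ n) (at x)" for x
    proof -
      have "((\<lambda>t. t ^ Suc n) has_real_derivative Suc n * x ^ n) (at x)"
        using DERIV_pow[of "Suc n" x] by simp
      then have "((\<lambda>t. (c / Suc n) * t ^ Suc n) has_real_derivative (c / Suc n) * (Suc n * x ^ n)) (at x)"
        by (rule DERIV_cmult)
      moreover have "(c / Suc n) * (Suc n * x ^ n) = c * x ^ n"
        by (simp del: of_nat_Suc)
      ultimately show ?thesis
        unfolding has_real_derivative_iff_has_vector_derivative[symmetric] by simp
    qed
    show "norm (f' x) \<le> c * x ^ n" if "0 < x" "x < t" for x using assms(4) that by simp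
  qed
  then show ?thesis using assms(2) by simp
qed (use assms(2) in simp)

text \<open>The derivative of a Taylor remainder of \<open>X\<close> is the remainder of one order
  less of \<open>commutator K X\<close>. The recursion starts from contractivity of the flow, so no
  norm of \<open>K\<close> enters.\<close>

lemma conj_exp_taylor:
  fixes K :: "'m::{real_normed_algebra_1,banach}"
  assumes K: "isometric_generator K" and t: "0 \<le> t"
  shows "norm (conj_exp t K X - X) \<le> t * norm (commutator K X)"
    and "norm (conj_exp t K X - X - t *\<^sub>R commutator K X)
      \<le> t\<^sup>2 / 2 * norm (commutator K (commutator K X))"
    and "norm (conj_exp t K X - X - t *\<^sub>R commutator K X - (t\<^sup>2 / 2) *\<^sub>R commutator K (commutator K X))
      \<le> t ^ 3 / 6 * norm (commutator K (commutator K (commutator K X)))"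
proof -
  have 1: "norm (conj_exp t K X - X) \<le> t * norm (commutator K X)" if "0 \<le> t" for t X
  proof -
    have d: "((\<lambda>t. conj_exp t K X - X) has_vector_derivative conj_exp t K (commutator K X)) (at t)" for t
      by (auto intro!: derivative_eq_intros conj_exp_has_vector_derivative)
    show ?thesis
      using conj_exp_taylor_step[where n = 0 and c = "norm (commutator K X)", OF that _ d]
        norm_conj_exp_le[OF K] by (simp add: mult.commute)
  qed
  have 2: "norm (conj_exp t K X - X - t *\<^sub>R commutator K X)
      \<le> t\<^sup>2 / 2 * norm (commutator K (commutator K X))" if "0 \<le> t" for t X
  proof -
    have d: "((\<lambda>t. conj_exp t K X - X - t *\<^sub>R commutator K X) has_vector_derivative
        conj_exp t K (commutator K X) - commutator K X) (at t)" for t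
      by (auto intro!: derivative_eq_intros conj_exp_has_vector_derivative)
    show ?thesis
      using conj_exp_taylor_step[where n = 1 and c = "norm (commutator K (commutator K X))",
          OF that _ d] 1[of _ "commutator K X"]
      by (simp add: power2_eq_square mult_ac)
  qed
  have d: "((\<lambda>t. conj_exp t K X - X - t *\<^sub>R commutator K X - (t\<^sup>2 / 2) *\<^sub>R commutator K (commutator K X))
      has_vector_derivative
      conj_exp t K (commutator K X) - commutator K X - t *\<^sub>R commutator K (commutator K X)) (at t)" for t
    by (auto intro!: derivative_eq_intros conj_exp_has_vector_derivative)
  have 3: "norm (conj_exp t K X - X - t *\<^sub>R commutator K X - (t\<^sup>2 / 2) *\<^sub>R commutator K (commutator K X))
      \<le> t ^ 3 / 6 * norm (commutator K (commutator K (commutator K X)))"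
    using conj_exp_taylor_step[where n = 2 and
        c = "norm (commutator K (commutator K (commutator K X))) / 2", OF t _ d] 2[of _ "commutator K X"]
    by (simp add: power2_eq_square power3_eq_cube numeral_3_eq_3 mult_ac)
  show "norm (conj_exp t K X - X) \<le> t * norm (commutator K X)"
    "norm (conj_exp t K X - X - t *\<^sub>R commutator K X)
      \<le> t\<^sup>2 / 2 * norm (commutator K (commutator K X))"
    "norm (conj_exp t K X - X - t *\<^sub>R commutator K X - (t\<^sup>2 / 2) *\<^sub>R commutator K (commutator K X))
      \<le> t ^ 3 / 6 * norm (commutator K (commutator K (commutator K X)))"
    using 1[OF t] 2[OF t] 3 by auto
qed

section \<open>Local error of the symmetric splitting\<close>

definition strang :: "real \<Rightarrow> 'm::{real_normed_algebra_1,banach} \<Rightarrow> 'm \<Rightarrow> 'm \<Rightarrow> 'm" where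
  "strang s A B X = conj_exp (s / 2) A (conj_exp s B (conj_exp (s / 2) A X))"

text \<open>The splitting step and the exact flow have the same expansion through
  \<open>s ^ 2\<close>. What is left are remainders, and since contractivity removes the flows from
  them, they are bounded by triple commutators of \<open>X\<close> itself.\<close>

lemma strang_local_error:
  fixes A B :: "'m::{real_normed_algebra_1,banach}"
  assumes A: "isometric_generator A" and B: "isometric_generator B"
    and AB: "isometric_generator (A + B)" and s: "0 \<le> s"
    and M: "\<And>K L P. K \<in> {A, B} \<Longrightarrow> L \<in> {A, B} \<Longrightarrow> P \<in> {A, B} \<Longrightarrow>
      norm (commutator K (commutator L (commutator P X))) \<le> M"
  shows "norm (strang s A B X - conj_exp s (A + B) X) \<le> 3 * s ^ 3 * M"
proof -
  define a where "a = commutator A"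
  define b where "b = commutator B"
  define ea where "ea = conj_exp (s / 2) A"
  define eb where "eb = conj_exp s B"
  note lin = commutator_linear(1-3)[of A, folded a_def] commutator_linear(1-3)[of B, folded b_def]
    conj_exp_linear[of "s / 2" A, folded ea_def] conj_exp_linear[of s B, folded eb_def]
  have s2: "0 \<le> s / 2" using s by simp
  have M': "norm (a (a (a X))) \<le> M" "norm (a (a (b X))) \<le> M" "norm (a (b (a X))) \<le> M" "norm (a (b (b X))) \<le> M"
     "norm (b (a (a X))) \<le> M" "norm (b (a (b X))) \<le> M" "norm (b (b (a X))) \<le> M" "norm (b (b (b X))) \<le> M"
    unfolding a_def b_def by (auto intro!: M)
  have s3: "0 \<le> s ^ 3" "0 \<le> s\<^sup>2" using s by auto
  have nea: "norm (ea Y) \<le> norm Y" for Y unfolding ea_def by (rule norm_conj_exp_le[OF A])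
  have neb: "norm (eb Y) \<le> norm Y" for Y unfolding eb_def by (rule norm_conj_exp_le[OF B])
  note ta = conj_exp_taylor[OF A s2, folded a_def ea_def] and tb = conj_exp_taylor[OF B s, folded b_def eb_def]
  define r1 where "r1 = ea X - X - (s / 2) *\<^sub>R a X - ((s / 2)\<^sup>2 / 2) *\<^sub>R a (a X)"
  define r2 where "r2 = eb X - X - s *\<^sub>R b X - (s\<^sup>2 / 2) *\<^sub>R b (b X)"
  define r3 where "r3 = eb (a X) - a X - s *\<^sub>R b (a X)"
  define r4 where "r4 = eb (a (a X)) - a (a X)"
  \<comment> \<open>\<open>Y\<close> and \<open>Z\<close> are the coefficients of \<open>s\<close>
    and \<open>s ^ 2\<close> in the expansion of the two inner flows.\<close>
  define Y where "Y = b X + (1 / 2) *\<^sub>R a X"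
  define Z where "Z = (1 / 2) *\<^sub>R b (b X) + (1 / 2) *\<^sub>R b (a X) + (1 / 8) *\<^sub>R a (a X)"
  define r5 where "r5 = ea Y - Y - (s / 2) *\<^sub>R a Y"
  define r6 where "r6 = ea Z - Z"
  define R where "R = eb r1 + r2 + (s / 2) *\<^sub>R r3 + (s\<^sup>2 / 8) *\<^sub>R r4"
  define r7 where "r7 = conj_exp s (A + B) X - X - s *\<^sub>R commutator (A + B) X
    - (s\<^sup>2 / 2) *\<^sub>R commutator (A + B) (commutator (A + B) X)"
  have eb: "eb (ea X) = X + s *\<^sub>R Y + s\<^sup>2 *\<^sub>R Z + R"
  proof -
    have "ea X = X + (s / 2) *\<^sub>R a X + ((s / 2)\<^sup>2 / 2) *\<^sub>R a (a X) + r1" by (simp add: r1_def)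
    then have "eb (ea X) = eb X + (s / 2) *\<^sub>R eb (a X) + ((s / 2)\<^sup>2 / 2) *\<^sub>R eb (a (a X)) + eb r1"
      by (simp only: lin)
    moreover have "eb X = X + s *\<^sub>R b X + (s\<^sup>2 / 2) *\<^sub>R b (b X) + r2" by (simp add: r2_def)
    moreover have "eb (a X) = a X + s *\<^sub>R b (a X) + r3" by (simp add: r3_def)
    moreover have "eb (a (a X)) = a (a X) + r4" by (simp add: r4_def)
    ultimately show ?thesis
      unfolding R_def Y_def Z_def by (simp add: algebra_simps power2_eq_square)
  qed
  have comm: "commutator (A + B) X = a X + b X" "commutator (A + B) (commutator (A + B) X) = a (a X) + a (b X) + b (a X) + b (b X)"
    "commutator (A + B) (commutator (A + B) (commutator (A + B) X)) =
       a (a (a X)) + a (a (b X)) + a (b (a X)) + a (b (b X)) + b (a (a X)) + b (a (b X)) + b (b (a X)) + b (b (b X))"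
    unfolding commutator_linear a_def b_def by (simp_all add: algebra_simps)
  have "strang s A B X = ea X + s *\<^sub>R ea Y + s\<^sup>2 *\<^sub>R ea Z + ea R"
    unfolding strang_def ea_def[symmetric] eb_def[symmetric] eb by (simp only: lin)
  also have "\<dots> = (X + (s / 2) *\<^sub>R a X + ((s / 2)\<^sup>2 / 2) *\<^sub>R a (a X) + r1) + s *\<^sub>R (Y + (s / 2) *\<^sub>R a Y + r5) + s\<^sup>2 *\<^sub>R (Z + r6) + ea R"
    by (simp add: r1_def r5_def r6_def)
  also have "\<dots> = X + s *\<^sub>R commutator (A + B) X + (s\<^sup>2 / 2) *\<^sub>R commutator (A + B) (commutator (A + B) X)
     + (r1 + s *\<^sub>R r5 + s\<^sup>2 *\<^sub>R r6 + ea R)"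
  proof -
    have e1: "s *\<^sub>R ((s / 2) *\<^sub>R a Y) = (s\<^sup>2 / 2) *\<^sub>R a (b X) + (s\<^sup>2 / 4) *\<^sub>R a (a X)"
      unfolding Y_def lin by (simp add: algebra_simps power2_eq_square)
    have e2: "s *\<^sub>R Y = s *\<^sub>R b X + (s / 2) *\<^sub>R a X" "s\<^sup>2 *\<^sub>R Z = (s\<^sup>2 / 2) *\<^sub>R b (b X) + (s\<^sup>2 / 2) *\<^sub>R b (a X) + (s\<^sup>2 / 8) *\<^sub>R a (a X)"
      unfolding Y_def Z_def by (simp_all add: algebra_simps)
    \<comment> \<open>The coefficient 1/2 of \<open>a (a X)\<close> arises as 1/8 + 1/4 + 1/8: outer
      flow, cross term, inner flow. The symmetry of the step shows in \<open>a (b X)\<close> and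
      \<open>b (a X)\<close> receiving the same coefficient 1/2.\<close>
    have e3: "(s\<^sup>2 / 2) *\<^sub>R commutator (A + B) (commutator (A + B) X) =
        ((s / 2)\<^sup>2 / 2) *\<^sub>R a (a X) + (s\<^sup>2 / 4) *\<^sub>R a (a X) + (s\<^sup>2 / 8) *\<^sub>R a (a X)
        + ((s\<^sup>2 / 2) *\<^sub>R a (b X) + (s\<^sup>2 / 2) *\<^sub>R b (a X) + (s\<^sup>2 / 2) *\<^sub>R b (b X))"
      unfolding scaleR_left_distrib[symmetric] comm(2) scaleR_add_right
      by (simp add: power2_eq_square)
    have e4: "s *\<^sub>R commutator (A + B) X = (s / 2) *\<^sub>R a X + (s / 2) *\<^sub>R a X + s *\<^sub>R b X"
      unfolding scaleR_left_distrib[symmetric] comm(1) scaleR_add_right by simp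
    show ?thesis unfolding e3 e4 unfolding scaleR_add_right e1 e2 by (simp only: add_ac)
  qed
  finally have "strang s A B X - conj_exp s (A + B) X = r1 + s *\<^sub>R r5 + s\<^sup>2 *\<^sub>R r6 + ea R - r7"
    by (simp add: r7_def)
  then have "norm (strang s A B X - conj_exp s (A + B) X)
    \<le> norm r1 + norm (s *\<^sub>R r5) + norm (s\<^sup>2 *\<^sub>R r6) + norm (ea R) + norm r7"
    by (simp only:) (intro order_trans[OF norm_triangle_ineq4] add_mono norm_triangle_mono order_refl)
  moreover have "norm r1 \<le> s ^ 3 / 48 * M"
  proof -
    have "norm r1 \<le> (s / 2) ^ 3 / 6 * norm (a (a (a X)))" unfolding r1_def by (rule ta(3))
    also have "\<dots> \<le> (s / 2) ^ 3 / 6 * M" using s3 by (intro mult_left_mono M') (auto simp: s)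
    finally show ?thesis by (simp add: power3_eq_cube)
  qed
  moreover have "norm r2 \<le> s ^ 3 / 6 * M"
    unfolding r2_def using s3 by (intro order_trans[OF tb(3)] mult_left_mono M') auto
  moreover have "norm ((s / 2) *\<^sub>R r3) \<le> s ^ 3 / 4 * M"
  proof -
    have "norm r3 \<le> s\<^sup>2 / 2 * M" unfolding r3_def
      using s3 by (intro order_trans[OF tb(2)] mult_left_mono M') auto
    from mult_left_mono[OF this s2] show ?thesis using s by (simp add: power3_eq_cube power2_eq_square mult_ac)
  qed
  moreover have "norm ((s\<^sup>2 / 8) *\<^sub>R r4) \<le> s ^ 3 / 8 * M"
  proof -
    have "norm r4 \<le> s * M" unfolding r4_def
      using s by (intro order_trans[OF tb(1)] mult_left_mono M') auto
    from mult_left_mono[OF this, of "s\<^sup>2 / 8"] show ?thesis using s by (simp add: power3_eq_cube power2_eq_square mult_ac)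
  qed
  moreover have "norm (s *\<^sub>R r5) \<le> s ^ 3 * 3 / 16 * M"
  proof -
    have "norm (a (a Y)) \<le> norm (a (a (b X))) + norm ((1 / 2) *\<^sub>R a (a (a X)))" unfolding Y_def lin
      by (rule norm_triangle_ineq)
    also have "\<dots> \<le> 3 / 2 * M" using M' by simp
    finally have "norm r5 \<le> (s / 2)\<^sup>2 / 2 * (3 / 2 * M)" unfolding r5_def
      using s3 by (intro order_trans[OF ta(2)] mult_left_mono) auto
    from mult_left_mono[OF this, of s] show ?thesis using s by (simp add: power3_eq_cube power2_eq_square mult_ac)
  qed
  moreover have "norm (s\<^sup>2 *\<^sub>R r6) \<le> s ^ 3 * 9 / 16 * M"
  proof -
    have "norm (a Z) \<le> norm ((1 / 2) *\<^sub>R a (b (b X))) + norm ((1 / 2) *\<^sub>R a (b (a X))) + norm ((1 / 8) *\<^sub>R a (a (a X)))"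
      unfolding Z_def lin by (intro norm_triangle_mono order_refl)
    also have "\<dots> \<le> 9 / 8 * M" using M' by simp
    finally have "norm r6 \<le> s / 2 * (9 / 8 * M)" unfolding r6_def
      using s by (intro order_trans[OF ta(1)] mult_left_mono) auto
    from mult_left_mono[OF this, of "s\<^sup>2"] show ?thesis using s by (simp add: power3_eq_cube power2_eq_square mult_ac)
  qed
  moreover have "norm (ea R) \<le> norm r1 + norm r2 + norm ((s / 2) *\<^sub>R r3) + norm ((s\<^sup>2 / 8) *\<^sub>R r4)"
  proof -
    have "norm R \<le> norm (eb r1) + norm r2 + norm ((s / 2) *\<^sub>R r3) + norm ((s\<^sup>2 / 8) *\<^sub>R r4)"
      unfolding R_def by (intro norm_triangle_mono order_refl)
    then show ?thesis using nea[of R] neb[of r1] by linarith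
  qed
  moreover have "norm r7 \<le> s ^ 3 / 6 * (8 * M)"
  proof -
    have "norm (commutator (A + B) (commutator (A + B) (commutator (A + B) X))) \<le>
       norm (a (a (a X))) + norm (a (a (b X))) + norm (a (b (a X))) + norm (a (b (b X))) + norm (b (a (a X)))
       + norm (b (a (b X))) + norm (b (b (a X))) + norm (b (b (b X)))"
      unfolding comm(3) by (intro norm_triangle_mono order_refl)
    also have "\<dots> \<le> 8 * M" using M' by linarith
    finally show ?thesis unfolding r7_def using s3
      by (intro order_trans[OF conj_exp_taylor(3)[OF AB s]] mult_left_mono) auto
  qed
  moreover have "0 \<le> s ^ 3 * M" using s3 order_trans[OF norm_ge_zero M'(1)] by simp
  \<comment> \<open>The eight contributions add up to 8/3 times \<open>w\<close>, which the constant
    3 rounds up.\<close>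
  moreover define w where "w = s ^ 3 * M"
  have "s ^ 3 / 48 * M = w / 48" "s ^ 3 / 6 * M = w / 6" "s ^ 3 / 4 * M = w / 4" "s ^ 3 / 8 * M = w / 8"
    "s ^ 3 * 3 / 16 * M = w * 3 / 16" "s ^ 3 * 9 / 16 * M = w * 9 / 16" "s ^ 3 / 6 * (8 * M) = w * 8 / 6"
    "3 * s ^ 3 * M = 3 * w"
    by (simp_all add: w_def)
  ultimately show ?thesis unfolding w_def[symmetric] by linarith
qed

section \<open>Difference operators and propagation of regularity\<close>

text \<open>The relation \<open>w j * u j = 1\<close> makes \<open>X \<mapsto> u j * X * w j\<close>
  multiplicative, and the norm bounds make it contractive. \<open>Nn\<close> stands for
  \<open>1 / (2 * pi * h)\<close>.\<close>

locale difference_calculus =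
  fixes Nn :: real and u w :: "'j::finite \<Rightarrow> 'm::{real_normed_algebra_1,banach}"
  assumes Nn: "1 \<le> Nn" and wu: "\<And>j. w j * u j = 1"
    and norm_u: "\<And>j. norm (u j) \<le> 1" and norm_w: "\<And>j. norm (w j) \<le> 1"
begin

definition D :: "'j \<Rightarrow> 'm \<Rightarrow> 'm" where
  "D j X = Nn *\<^sub>R (u j * X * w j - X)"

primrec sob :: "nat \<Rightarrow> 'm \<Rightarrow> real" where
  "sob 0 X = norm X"
| "sob (Suc k) X = sob k X + (\<Sum>j\<in>UNIV. sob k (D j X))"

text \<open>The first clause admits generators as large as \<open>Nn\<close>; the second says that
  commuting with them still costs only one difference. It is asked for arbitrary \<open>X\<close>,
  because an evolved observable is no longer known to be a quantization.\<close>

definition gen_bound :: "real \<Rightarrow> 'm \<Rightarrow> bool" where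
  "gen_bound \<kappa> K \<longleftrightarrow> norm K \<le> \<kappa> * Nn \<and> (\<forall>X. norm (commutator K X) \<le> \<kappa> * (\<Sum>j\<in>UNIV. norm (D j X)))"

text \<open>The Leibniz rule replaces \<open>K\<close> by its differences, which therefore have to
  obey the same bound with the same \<open>\<kappa>\<close>.\<close>

primrec gen :: "nat \<Rightarrow> real \<Rightarrow> 'm \<Rightarrow> bool" where
  "gen 0 \<kappa> K \<longleftrightarrow> gen_bound \<kappa> K"
| "gen (Suc k) \<kappa> K \<longleftrightarrow> gen_bound \<kappa> K \<and> (\<forall>j. gen k \<kappa> (D j K))"

definition J :: real where "J = real CARD('j)"

text \<open>Per order, the Leibniz rule yields three commutators for each of the \<open>J\<close>
  differences, and the undifferenced commutator adds one.\<close>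

definition C :: "nat \<Rightarrow> real" where "C k = (1 + 3 * J) ^ k"

text \<open>Chosen so that \<open>G k + C k * (J + 2) \<le> G (Suc k)\<close>, the recursion for the
  growth rate of \<open>sob k\<close> under the flow.\<close>

definition G :: "nat \<Rightarrow> real" where "G k = k * (J + 2) * (1 + 3 * J) ^ k"

lemma J_nonneg: "0 \<le> J"
  by (simp add: J_def)

lemma C_nonneg: "0 \<le> C k" and G_nonneg: "0 \<le> G k"
  using J_nonneg by (auto simp: C_def G_def)

lemma D_linear:
  "D j (X + Y) = D j X + D j Y" "D j (X - Y) = D j X - D j Y" "D j (r *\<^sub>R X) = r *\<^sub>R D j X"
  by (simp_all add: D_def algebra_simps)

lemma D_bounded: "norm (D j X) \<le> 2 * Nn * norm X"
proof -
  have "norm (u j * X * w j) \<le> 1 * norm X * 1"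
    by (intro order_trans[OF norm_mult_ineq] mult_mono norm_u norm_w) (auto intro: order_trans[OF norm_mult_ineq] mult_mono norm_u)
  then have "norm (u j * X * w j - X) \<le> 2 * norm X"
    using norm_triangle_ineq4[of "u j * X * w j" X] by simp
  then show ?thesis using Nn by (simp add: D_def)
qed

text \<open>A twisted Leibniz rule, since \<open>X \<mapsto> u j * X * w j\<close> is multiplicative.\<close>

lemma D_commutator:
  "D j (commutator K X) = commutator (D j K) X + commutator K (D j X) + (1 / Nn) *\<^sub>R commutator (D j K) (D j X)"
proof -
  define \<alpha> where "\<alpha> Y = u j * Y * w j" for Y
  have mult: "\<alpha> (Y * Z) = \<alpha> Y * \<alpha> Z" for Y Z
  proof -
    have "\<alpha> Y * \<alpha> Z = u j * Y * (w j * u j) * Z * w j" unfolding \<alpha>_def by (simp only: mult.assoc)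
    then show ?thesis by (simp add: wu \<alpha>_def mult.assoc)
  qed
  have \<alpha>: "\<alpha> Y = Y + (1 / Nn) *\<^sub>R D j Y" for Y
    using Nn by (simp add: D_def \<alpha>_def)
  have "\<alpha> (commutator K X) = \<alpha> K * \<alpha> X - \<alpha> X * \<alpha> K"
    unfolding commutator_def by (simp add: mult[symmetric]) (simp add: \<alpha>_def algebra_simps)
  also have "\<dots> = commutator K X + (1 / Nn) *\<^sub>R (commutator (D j K) X + commutator K (D j X) + (1 / Nn) *\<^sub>R commutator (D j K) (D j X))"
    unfolding \<alpha> commutator_def by (simp add: algebra_simps)
  finally have "Nn *\<^sub>R (\<alpha> (commutator K X) - commutator K X) = commutator (D j K) X + commutator K (D j X) + (1 / Nn) *\<^sub>R commutator (D j K) (D j X)"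
    using Nn by (simp only: add_diff_cancel_left') simp
  then show ?thesis by (simp add: D_def \<alpha>_def)
qed

section \<open>The difference norms and their behaviour under commutators and flows\<close>

lemma sob_nonneg: "0 \<le> sob k X"
  by (induction k arbitrary: X) (auto intro!: add_nonneg_nonneg sum_nonneg)

lemma sob_Suc: "sob k X \<le> sob (Suc k) X"
  by (simp add: sum_nonneg sob_nonneg)

lemma sob_mono: "k \<le> l \<Longrightarrow> sob k X \<le> sob l X"
  by (rule lift_Suc_mono_le[of "\<lambda>k. sob k X"]) (rule sob_Suc)

lemma norm_le_sob: "norm X \<le> sob k X"
  using sob_mono[of 0 k X] by simp

lemma sob_D: "sob k (D j X) \<le> sob (Suc k) X"
proof -
  have "sob k (D j X) \<le> (\<Sum>j\<in>UNIV. sob k (D j X))"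
    by (rule member_le_sum) (auto simp: sob_nonneg)
  then show ?thesis using sob_nonneg[of k X] by simp
qed

lemma sob_triangle: "sob k (X + Y) \<le> sob k X + sob k Y"
proof (induction k arbitrary: X Y)
  case (Suc k)
  have "(\<Sum>j\<in>UNIV. sob k (D j X + D j Y)) \<le> (\<Sum>j\<in>UNIV. sob k (D j X) + sob k (D j Y))"
    by (intro sum_mono Suc.IH)
  then show ?case using Suc.IH[of X Y] by (simp add: D_linear sum.distrib)
qed (simp add: norm_triangle_ineq)

lemma sob_scale: "sob k (r *\<^sub>R X) = \<bar>r\<bar> * sob k X"
  by (induction k arbitrary: X) (auto simp: D_linear sum_distrib_left algebra_simps)

text \<open>This constant depends on \<open>Nn\<close>. It is used only for second-order remainders,
  which disappear as the time step tends to zero.\<close>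

lemma sob_bounded: "\<exists>c\<ge>0. \<forall>X. sob k X \<le> c * norm X"
proof (induction k)
  case (Suc k)
  then obtain c where c: "c \<ge> 0" "\<And>X. sob k X \<le> c * norm X" by auto
  have "sob (Suc k) X \<le> (c + J * (c * (2 * Nn))) * norm X" for X
  proof -
    have "sob k (D j X) \<le> c * (2 * Nn * norm X)" for j
      by (rule order_trans[OF c(2)]) (intro mult_left_mono D_bounded c(1))
    then have "(\<Sum>j\<in>UNIV. sob k (D j X)) \<le> (\<Sum>j\<in>(UNIV::'j set). c * (2 * Nn * norm X))"
      by (intro sum_mono)
    then show ?thesis using c(2)[of X] by (simp add: J_def algebra_simps)
  qed
  then show ?case using c(1) Nn J_nonneg by (intro exI[of _ "c + J * (c * (2 * Nn))"]) auto
qed (auto intro: exI[of _ 1])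

lemma gen_Suc: "gen (Suc k) \<kappa> K \<Longrightarrow> gen k \<kappa> K"
  by (induction k arbitrary: K) auto

lemma gen_mono: "k \<le> l \<Longrightarrow> gen l \<kappa> K \<Longrightarrow> gen k \<kappa> K"
  by (induction l rule: dec_induct) (auto simp del: gen.simps dest: gen_Suc)

text \<open>Each difference of the commutator splits into three commutators, with the difference on
  \<open>K\<close>, on \<open>X\<close>, or on both; the factor \<open>1 / Nn\<close> of the last
  one is bounded by 1.\<close>

lemma sob_commutator:
  assumes "0 \<le> \<kappa>" and "gen k \<kappa> K"
  shows "sob k (commutator K X) \<le> C k * \<kappa> * sob (Suc k) X"
  using assms(2)
proof (induction k arbitrary: K X)
  case 0
  then have "norm (commutator K X) \<le> \<kappa> * (\<Sum>j\<in>UNIV. norm (D j X))"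
    by (simp add: gen_bound_def)
  also have "\<dots> \<le> \<kappa> * sob 1 X" using assms(1) by (intro mult_left_mono) auto
  finally show ?case by (simp add: C_def)
next
  case (Suc k)
  define B where "B = C k * \<kappa> * sob (Suc (Suc k)) X"
  have K: "gen k \<kappa> K" and DK: "\<And>j. gen k \<kappa> (D j K)"
    using Suc.prems gen_Suc[OF Suc.prems] by auto
  have le: "C k * \<kappa> * sob (Suc k) Y \<le> B" if "Y = X \<or> (\<exists>j. Y = D j X)" for Y
  proof -
    have "sob (Suc k) Y \<le> sob (Suc (Suc k)) X" using that sob_Suc[of "Suc k" X] sob_D[of "Suc k" _ X] by auto
    then show ?thesis unfolding B_def using assms(1) C_nonneg by (intro mult_left_mono) auto
  qed
  have "sob k (D j (commutator K X)) \<le> 3 * B" for j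
  proof -
    have "sob k (D j (commutator K X)) \<le> sob k (commutator (D j K) X) + sob k (commutator K (D j X))
        + sob k ((1 / Nn) *\<^sub>R commutator (D j K) (D j X))"
      unfolding D_commutator by (meson sob_triangle add_right_mono order_trans)
    also have "sob k ((1 / Nn) *\<^sub>R commutator (D j K) (D j X)) \<le> sob k (commutator (D j K) (D j X))"
      unfolding sob_scale using Nn by (intro mult_left_le_one_le sob_nonneg) auto
    also have "\<dots> \<le> B" by (rule order_trans[OF Suc.IH[OF DK] le]) auto
    also have "sob k (commutator (D j K) X) \<le> B" by (rule order_trans[OF Suc.IH[OF DK] le]) auto
    also have "sob k (commutator K (D j X)) \<le> B" by (rule order_trans[OF Suc.IH[OF K] le]) auto
    finally show ?thesis by simp
  qed
  then have "(\<Sum>j\<in>UNIV. sob k (D j (commutator K X))) \<le> (\<Sum>j\<in>(UNIV::'j set). 3 * B)"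
    by (intro sum_mono)
  moreover have "sob k (commutator K X) \<le> B"
    by (rule order_trans[OF Suc.IH[OF K] le]) auto
  ultimately have "sob (Suc k) (commutator K X) \<le> (1 + 3 * J) * B"
    by (simp add: J_def algebra_simps)
  then show ?case by (simp add: B_def C_def mult_ac del: sob.simps)
qed

text \<open>The factor \<open>1 / Nn\<close> buys back the difference that a commutator costs, since
  \<open>K\<close> has norm at most \<open>\<kappa> * Nn\<close>. This serves the last Leibniz term,
  in which \<open>X\<close> has already been differenced once.\<close>

lemma sob_commutator_div:
  assumes "0 \<le> \<kappa>" and "gen k \<kappa> K"
  shows "sob k ((1 / Nn) *\<^sub>R commutator K X) \<le> 2 * C k * \<kappa> * sob k X"
  using assms(2)
proof (induction k arbitrary: K X)
  case 0
  have "norm (commutator K X) \<le> 2 * norm K * norm X" by (rule norm_commutator_le)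
  also have "\<dots> \<le> 2 * (\<kappa> * Nn) * norm X"
    using 0 by (intro mult_right_mono mult_left_mono) (auto simp: gen_bound_def)
  finally have "norm (commutator K X) / Nn \<le> 2 * \<kappa> * norm X"
    using Nn by (simp add: field_simps)
  then show ?case using Nn by (simp add: C_def)
next
  case (Suc k)
  define B where "B = 2 * C k * \<kappa> * sob (Suc k) X"
  have K: "gen k \<kappa> K" and DK: "\<And>j. gen k \<kappa> (D j K)"
    using Suc.prems gen_Suc[OF Suc.prems] by auto
  have le: "2 * C k * \<kappa> * sob k Y \<le> B" if "Y = X \<or> (\<exists>j. Y = D j X)" for Y
  proof -
    have "sob k Y \<le> sob (Suc k) X" using that sob_Suc[of k X] sob_D[of k _ X] by auto
    then show ?thesis unfolding B_def using assms(1) C_nonneg by (intro mult_left_mono) auto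
  qed
  have "sob k (D j ((1 / Nn) *\<^sub>R commutator K X)) \<le> 3 * B" for j
  proof -
    have "sob k (D j ((1 / Nn) *\<^sub>R commutator K X)) \<le> sob k ((1 / Nn) *\<^sub>R commutator (D j K) X) + sob k ((1 / Nn) *\<^sub>R commutator K (D j X))
        + sob k ((1 / Nn) *\<^sub>R (1 / Nn) *\<^sub>R commutator (D j K) (D j X))"
      unfolding D_linear D_commutator scaleR_add_right by (meson sob_triangle add_right_mono order_trans)
    also have "sob k ((1 / Nn) *\<^sub>R (1 / Nn) *\<^sub>R commutator (D j K) (D j X)) \<le> sob k ((1 / Nn) *\<^sub>R commutator (D j K) (D j X))"
      unfolding sob_scale[of k "1 / Nn" "(1 / Nn) *\<^sub>R commutator (D j K) (D j X)"] using Nn by (intro mult_left_le_one_le sob_nonneg) auto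
    also have "\<dots> \<le> B" by (rule order_trans[OF Suc.IH[OF DK] le]) auto
    also have "sob k ((1 / Nn) *\<^sub>R commutator (D j K) X) \<le> B" by (rule order_trans[OF Suc.IH[OF DK] le]) auto
    also have "sob k ((1 / Nn) *\<^sub>R commutator K (D j X)) \<le> B" by (rule order_trans[OF Suc.IH[OF K] le]) auto
    finally show ?thesis by simp
  qed
  then have "(\<Sum>j\<in>UNIV. sob k (D j ((1 / Nn) *\<^sub>R commutator K X))) \<le> (\<Sum>j\<in>(UNIV::'j set). 3 * B)"
    by (intro sum_mono)
  moreover have "sob k ((1 / Nn) *\<^sub>R commutator K X) \<le> B"
    by (rule order_trans[OF Suc.IH[OF K] le]) auto
  ultimately have "sob (Suc k) ((1 / Nn) *\<^sub>R commutator K X) \<le> (1 + 3 * J) * B"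
    unfolding sob.simps(2)[of k "(1 / Nn) *\<^sub>R commutator K X"] by (simp add: J_def algebra_simps)
  then show ?case by (simp add: B_def C_def mult_ac del: sob.simps)
qed

text \<open>\<open>D j\<close> does not commute with the flow. To first order in
  \<open>\<delta>\<close> the defect consists of commutators with \<open>D j K\<close>, which are
  bounded uniformly; the second-order factor \<open>c\<close> is allowed to depend on
  \<open>Nn\<close> and \<open>K\<close>.\<close>

lemma sob_conj_exp_small:
  assumes "0 \<le> \<kappa>" and iso: "isometric_generator K" and "gen k \<kappa> K"
  shows "\<exists>c\<ge>0. \<forall>\<delta>\<ge>0. \<forall>X. sob k (conj_exp \<delta> K X) \<le> (1 + G k * \<kappa> * \<delta>) * sob k X + c * \<delta>\<^sup>2 * norm X"
  using assms(3)
proof (induction k)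
  case 0
  then show ?case using norm_conj_exp_le[OF iso] by (auto simp: G_def intro!: exI[of _ 0])
next
  case (Suc k)
  have K: "gen k \<kappa> K" and DK: "\<And>j. gen k \<kappa> (D j K)"
    using Suc.prems gen_Suc[OF Suc.prems] by auto
  from Suc.IH[OF K] obtain c where c: "c \<ge> 0"
    "\<And>\<delta> X. 0 \<le> \<delta> \<Longrightarrow> sob k (conj_exp \<delta> K X) \<le> (1 + G k * \<kappa> * \<delta>) * sob k X + c * \<delta>\<^sup>2 * norm X" by auto
  obtain c' where c': "c' \<ge> 0" "\<And>X. sob k X \<le> c' * norm X" using sob_bounded by blast
  define L where "L = 2 * (norm K)\<^sup>2"
  have L0: "0 \<le> L" by (simp add: L_def)
  have R: "norm (conj_exp \<delta> K X - X - \<delta> *\<^sub>R commutator K X) \<le> L * \<delta>\<^sup>2 * norm X" if "0 \<le> \<delta>" for \<delta> X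
  proof -
    have "norm (commutator K (commutator K X)) \<le> 2 * norm K * (2 * norm K * norm X)"
      by (rule order_trans[OF norm_commutator_le]) (intro mult_left_mono norm_commutator_le; simp)
    then have "\<delta>\<^sup>2 / 2 * norm (commutator K (commutator K X)) \<le> \<delta>\<^sup>2 / 2 * (2 * norm K * (2 * norm K * norm X))"
      by (intro mult_left_mono) auto
    also have "\<dots> = L * \<delta>\<^sup>2 * norm X" by (simp add: L_def power2_eq_square)
    finally show ?thesis using conj_exp_taylor(2)[OF iso that, of X] by linarith
  qed
  define c'' where "c'' = c + J * (c * (2 * Nn) + c' * (L * (2 * Nn) + 2 * Nn * L))"
  have c''0: "0 \<le> c''" unfolding c''_def using c(1) c'(1) J_nonneg Nn L0 by (intro add_nonneg_nonneg mult_nonneg_nonneg) auto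
  have "sob (Suc k) (conj_exp \<delta> K X) \<le> (1 + G (Suc k) * \<kappa> * \<delta>) * sob (Suc k) X + c'' * \<delta>\<^sup>2 * norm X"
    if \<delta>: "0 \<le> \<delta>" for \<delta> X
  proof -
    define S where "S = sob (Suc k) X"
    have each: "sob k (D j (conj_exp \<delta> K X)) \<le> (1 + G k * \<kappa> * \<delta>) * sob k (D j X) + \<delta> * (C k * \<kappa> * S)
        + \<delta> * (2 * C k * \<kappa> * sob k (D j X)) + (c * (2 * Nn) + c' * (L * (2 * Nn) + 2 * Nn * L)) * \<delta>\<^sup>2 * norm X" for j
    proof -
      \<comment> \<open>Difference of two second-order Taylor remainders: that of \<open>X\<close>
        after \<open>D j\<close>, and that of \<open>D j X\<close>. Hence it is of order
        \<open>\<delta> ^ 2\<close>.\<close>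
      define e where "e = D j (conj_exp \<delta> K X - X - \<delta> *\<^sub>R commutator K X)
         - (conj_exp \<delta> K (D j X) - D j X - \<delta> *\<^sub>R commutator K (D j X))"
      have "D j (conj_exp \<delta> K X) = conj_exp \<delta> K (D j X) + \<delta> *\<^sub>R commutator (D j K) X
         + \<delta> *\<^sub>R ((1 / Nn) *\<^sub>R commutator (D j K) (D j X)) + e"
        unfolding e_def D_linear D_commutator by (simp add: algebra_simps)
      then have "sob k (D j (conj_exp \<delta> K X)) \<le> sob k (conj_exp \<delta> K (D j X)) + sob k (\<delta> *\<^sub>R commutator (D j K) X)
         + sob k (\<delta> *\<^sub>R ((1 / Nn) *\<^sub>R commutator (D j K) (D j X))) + sob k e"
        by (simp only:) (meson sob_triangle add_right_mono order_trans)
      moreover have "sob k (\<delta> *\<^sub>R commutator (D j K) X) \<le> \<delta> * (C k * \<kappa> * S)"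
        unfolding sob_scale S_def abs_of_nonneg[OF \<delta>] by (intro mult_left_mono sob_commutator DK assms \<delta>)
      moreover have "sob k (\<delta> *\<^sub>R ((1 / Nn) *\<^sub>R commutator (D j K) (D j X))) \<le> \<delta> * (2 * C k * \<kappa> * sob k (D j X))"
        unfolding sob_scale[of k \<delta>] abs_of_nonneg[OF \<delta>] by (intro mult_left_mono sob_commutator_div DK assms \<delta>)
      moreover have "sob k (conj_exp \<delta> K (D j X)) \<le> (1 + G k * \<kappa> * \<delta>) * sob k (D j X) + c * (2 * Nn) * \<delta>\<^sup>2 * norm X"
      proof -
        have "c * \<delta>\<^sup>2 * norm (D j X) \<le> c * \<delta>\<^sup>2 * (2 * Nn * norm X)"
          by (intro mult_left_mono D_bounded) (simp add: c(1))
        then show ?thesis using c(2)[OF \<delta>, of "D j X"] by (simp add: mult_ac)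
      qed
      moreover have "sob k e \<le> c' * (L * (2 * Nn) + 2 * Nn * L) * \<delta>\<^sup>2 * norm X"
      proof -
        have "norm (D j (conj_exp \<delta> K X - X - \<delta> *\<^sub>R commutator K X)) \<le> 2 * Nn * (L * \<delta>\<^sup>2 * norm X)"
          using Nn by (intro order_trans[OF D_bounded] mult_left_mono R \<delta>) auto
        moreover have "norm (conj_exp \<delta> K (D j X) - D j X - \<delta> *\<^sub>R commutator K (D j X)) \<le> L * \<delta>\<^sup>2 * (2 * Nn * norm X)"
          using L0 by (intro order_trans[OF R[OF \<delta>]] mult_left_mono D_bounded) auto
        ultimately have "norm e \<le> 2 * Nn * (L * \<delta>\<^sup>2 * norm X) + L * \<delta>\<^sup>2 * (2 * Nn * norm X)"
          unfolding e_def using norm_triangle_ineq4 by (meson add_mono order_trans)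
        from mult_left_mono[OF this c'(1)] c'(2)[of e] show ?thesis by (simp add: algebra_simps)
      qed
      ultimately show ?thesis by (simp add: algebra_simps)
    qed
    have "(\<Sum>j\<in>UNIV. sob k (D j (conj_exp \<delta> K X))) \<le> (\<Sum>j\<in>UNIV. (1 + G k * \<kappa> * \<delta>) * sob k (D j X) + \<delta> * (C k * \<kappa> * S)
        + \<delta> * (2 * C k * \<kappa> * sob k (D j X)) + (c * (2 * Nn) + c' * (L * (2 * Nn) + 2 * Nn * L)) * \<delta>\<^sup>2 * norm X)"
      by (intro sum_mono each)
    also have "\<dots> = (1 + G k * \<kappa> * \<delta>) * (\<Sum>j\<in>UNIV. sob k (D j X)) + J * (\<delta> * (C k * \<kappa> * S))
       + \<delta> * (2 * C k * \<kappa> * (\<Sum>j\<in>UNIV. sob k (D j X))) + J * (c * (2 * Nn) + c' * (L * (2 * Nn) + 2 * Nn * L)) * \<delta>\<^sup>2 * norm X"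
      by (simp only: sum.distrib sum_distrib_left[symmetric] sum_constant J_def) (simp add: mult_ac)
    finally have 1: "sob (Suc k) (conj_exp \<delta> K X) \<le> (1 + G k * \<kappa> * \<delta>) * S + J * (\<delta> * (C k * \<kappa> * S))
       + \<delta> * (2 * C k * \<kappa> * (\<Sum>j\<in>UNIV. sob k (D j X))) + c'' * \<delta>\<^sup>2 * norm X"
      unfolding c''_def S_def using c(2)[OF \<delta>, of X] by (simp add: algebra_simps)
    have 2: "\<delta> * (2 * C k * \<kappa> * (\<Sum>j\<in>UNIV. sob k (D j X))) \<le> \<delta> * (2 * C k * \<kappa> * S)"
      unfolding S_def using assms(1) C_nonneg \<delta> sob_nonneg by (intro mult_left_mono) auto
    \<comment> \<open>Summed over \<open>j\<close>, the defect contributes \<open>J\<close> copies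
      of the bound with \<open>C k\<close>, and one with \<open>2 * C k\<close> because the sum of
      \<open>sob k (D j X)\<close> is itself at most \<open>S\<close>.\<close>
    have 3: "G k + C k * (J + 2) \<le> G (Suc k)"
    proof -
      have a: "(1 + 3 * J) ^ k \<le> (1 + 3 * J) ^ Suc k" using J_nonneg by (intro power_increasing) auto
      have "G k + C k * (J + 2) = Suc k * (J + 2) * (1 + 3 * J) ^ k" by (simp add: G_def C_def algebra_simps)
      also have "\<dots> \<le> G (Suc k)" unfolding G_def using J_nonneg by (intro mult_left_mono a) auto
      finally show ?thesis .
    qed
    have "(G k + C k * (J + 2)) * (\<kappa> * \<delta> * S) \<le> G (Suc k) * (\<kappa> * \<delta> * S)"
      using assms(1) \<delta> sob_nonneg[of "Suc k" X] by (intro mult_right_mono 3) (auto simp: S_def simp del: sob.simps)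
    with 1 2 show ?thesis unfolding S_def[symmetric] by (simp add: algebra_simps)
  qed
  with c''0 show ?case by blast
qed

text \<open>Splitting \<open>[0, t]\<close> into \<open>m\<close> steps and letting \<open>m\<close> tend to infinity removes the quadratic
  error term, whose constant depends on \<open>Nn\<close>.\<close>

lemma sob_conj_exp:
  assumes "0 \<le> \<kappa>" and iso: "isometric_generator K" and "gen k \<kappa> K" and t: "0 \<le> t"
  shows "sob k (conj_exp t K X) \<le> exp (G k * \<kappa> * t) * sob k X"
proof -
  obtain c where c: "c \<ge> 0"
    "\<And>\<delta> X. 0 \<le> \<delta> \<Longrightarrow> sob k (conj_exp \<delta> K X) \<le> (1 + G k * \<kappa> * \<delta>) * sob k X + c * \<delta>\<^sup>2 * norm X"
    using sob_conj_exp_small[OF assms(1-3)] by auto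
  have "sob k (conj_exp t K X) \<le> exp (G k * \<kappa> * t + c * t\<^sup>2 * inverse (real (Suc m))) * sob k X" for m
  proof -
    define \<delta> where "\<delta> = t / Suc m"
    have \<delta>: "0 \<le> \<delta>" using t by (simp add: \<delta>_def)
    define q where "q = G k * \<kappa> * \<delta> + c * \<delta>\<^sup>2"
    have q: "0 \<le> q" unfolding q_def using G_nonneg assms(1) \<delta> c(1) by simp
    have step: "sob k (conj_exp \<delta> K Y) \<le> exp q * sob k Y" for Y
    proof -
      have "c * \<delta>\<^sup>2 * norm Y \<le> c * \<delta>\<^sup>2 * sob k Y" using c(1) by (intro mult_left_mono norm_le_sob) auto
      then have "sob k (conj_exp \<delta> K Y) \<le> (1 + q) * sob k Y"
        using c(2)[OF \<delta>, of Y] by (simp add: q_def algebra_simps)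
      also have "\<dots> \<le> exp q * sob k Y" by (intro mult_right_mono exp_ge_add_one_self sob_nonneg)
      finally show ?thesis .
    qed
    have "sob k (conj_exp (real i * \<delta>) K X) \<le> exp (real i * q) * sob k X" for i
    proof (induction i)
      case (Suc i)
      have "sob k (conj_exp (real (Suc i) * \<delta>) K X) = sob k (conj_exp \<delta> K (conj_exp (real i * \<delta>) K X))"
        by (simp add: conj_exp_add algebra_simps)
      also have "\<dots> \<le> exp q * (exp (real i * q) * sob k X)"
        by (rule order_trans[OF step]) (intro mult_left_mono Suc.IH; simp)
      also have "\<dots> = exp (real (Suc i) * q) * sob k X" by (simp add: exp_add algebra_simps)
      finally show ?case .
    qed simp
    from this[of "Suc m"] have "sob k (conj_exp t K X) \<le> exp (real (Suc m) * q) * sob k X"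
      by (simp add: \<delta>_def)
    moreover have "real (Suc m) * q = G k * \<kappa> * t + c * t\<^sup>2 * inverse (real (Suc m))"
    proof -
      have "real (Suc m) * q = G k * \<kappa> * (real (Suc m) * \<delta>) + c * (real (Suc m) * \<delta> * \<delta>)"
        unfolding q_def by (simp add: algebra_simps power2_eq_square)
      then show ?thesis unfolding \<delta>_def by (simp add: power2_eq_square field_simps del: of_nat_Suc)
    qed
    ultimately show ?thesis by simp
  qed
  moreover have "(\<lambda>m. exp (G k * \<kappa> * t + c * t\<^sup>2 * inverse (real (Suc m))) * sob k X)
      \<longlonglongrightarrow> exp (G k * \<kappa> * t + c * t\<^sup>2 * 0) * sob k X"
    by (intro tendsto_intros LIMSEQ_inverse_real_of_nat)
  ultimately show ?thesis
    by (intro LIMSEQ_le_const) auto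
qed

text \<open>Telescoping along the exact trajectory: each local error is taken at
  \<open>conj_exp (real i * s) (A + B) X\<close>. Growth of \<open>sob 3\<close> thus has to be
  controlled only for the flow of \<open>A + B\<close>, and never for the splitting.\<close>

theorem strang_global_error:
  assumes \<kappa>: "0 \<le> \<kappa>" and iso: "isometric_generator A" "isometric_generator B" "isometric_generator (A + B)"
    and gen: "gen 3 \<kappa> A" "gen 3 \<kappa> B" "gen 3 \<kappa> (A + B)" and s: "0 \<le> s"
  shows "norm ((strang s A B ^^ n) X - conj_exp (real n * s) (A + B) X)
    \<le> real n * (3 * s ^ 3 * (C 3 * \<kappa>) ^ 3 * exp (G 3 * \<kappa> * (real n * s)) * sob 3 X)"
proof -
  have C1: "C i \<le> C 3" if "i \<le> 3" for i
    unfolding C_def using that J_nonneg by (intro power_increasing) auto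
  have comm: "sob i (commutator K Y) \<le> C 3 * \<kappa> * sob (Suc i) Y" if "K \<in> {A, B}" "i \<le> 3" for K i Y
  proof -
    have "gen i \<kappa> K" using that gen gen_mono by blast
    from sob_commutator[OF \<kappa> this, of Y] show ?thesis
      using mult_right_mono[OF mult_right_mono[OF C1[OF that(2)] \<kappa>] sob_nonneg[of "Suc i" Y]] by linarith
  qed
  have C0: "0 \<le> C 3 * \<kappa>" using \<kappa> C_nonneg by simp
  have local_err: "norm (strang s A B Y - conj_exp s (A + B) Y) \<le> 3 * s ^ 3 * ((C 3 * \<kappa>) ^ 3 * sob 3 Y)" for Y
  proof (rule strang_local_error[OF iso s])
    fix K L P assume *: "K \<in> {A, B}" "L \<in> {A, B}" "P \<in> {A, B}"
    \<comment> \<open>Each commutator consumes one order: the outermost is estimated in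
      \<open>sob 0\<close>, the innermost in \<open>sob 2\<close>, and this reaches
      \<open>sob 3 Y\<close>.\<close>
    have "norm (commutator K (commutator L (commutator P Y))) \<le> C 3 * \<kappa> * sob 1 (commutator L (commutator P Y))"
      using comm[OF *(1), of 0 "commutator L (commutator P Y)"] by (simp del: sob.simps(2))
    also have "\<dots> \<le> C 3 * \<kappa> * (C 3 * \<kappa> * (C 3 * \<kappa> * sob 3 Y))"
    proof (intro mult_left_mono C0)
      have "sob 1 (commutator L (commutator P Y)) \<le> C 3 * \<kappa> * sob 2 (commutator P Y)"
        using comm[OF *(2), of 1 "commutator P Y"] by (simp add: numeral_2_eq_2 del: sob.simps)
      also have "\<dots> \<le> C 3 * \<kappa> * (C 3 * \<kappa> * sob 3 Y)"
        using comm[OF *(3), of 2 Y] by (intro mult_left_mono C0) (simp add: numeral_3_eq_3 numeral_2_eq_2 del: sob.simps)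
      finally show "sob 1 (commutator L (commutator P Y)) \<le> C 3 * \<kappa> * (C 3 * \<kappa> * sob 3 Y)" .
    qed
    finally show "norm (commutator K (commutator L (commutator P Y))) \<le> (C 3 * \<kappa>) ^ 3 * sob 3 Y"
      by (simp add: power3_eq_cube mult_ac)
  qed
  have strang_norm: "norm (strang s A B Y) \<le> norm Y" for Y
    unfolding strang_def by (meson norm_conj_exp_le iso order_trans)
  have strang_diff: "strang s A B (Y - Z) = strang s A B Y - strang s A B Z" for Y Z
    unfolding strang_def by (simp add: conj_exp_linear)
  define T where "T = real n * s"
  define E where "E = 3 * s ^ 3 * (C 3 * \<kappa>) ^ 3 * exp (G 3 * \<kappa> * T) * sob 3 X"
  have "norm ((strang s A B ^^ i) X - conj_exp (real i * s) (A + B) X) \<le> real i * E" if "i \<le> n" for i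
    using that
  proof (induction i)
    case (Suc i)
    define Y where "Y = conj_exp (real i * s) (A + B) X"
    have "real i * s \<le> T" using Suc.prems s by (simp add: T_def mult_right_mono)
    then have e: "exp (G 3 * \<kappa> * (real i * s)) \<le> exp (G 3 * \<kappa> * T)"
      using G_nonneg \<kappa> by (simp add: mult_left_mono)
    have "sob 3 Y \<le> exp (G 3 * \<kappa> * (real i * s)) * sob 3 X"
      unfolding Y_def using s by (intro sob_conj_exp \<kappa> iso(3) gen(3)) simp
    also have "\<dots> \<le> exp (G 3 * \<kappa> * T) * sob 3 X"
      by (intro mult_right_mono e sob_nonneg)
    finally have "sob 3 Y \<le> exp (G 3 * \<kappa> * T) * sob 3 X" .
    then have "3 * s ^ 3 * ((C 3 * \<kappa>) ^ 3 * sob 3 Y) \<le> E"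
      unfolding E_def mult.assoc using s C0 by (intro mult_left_mono) auto
    then have 1: "norm (strang s A B Y - conj_exp s (A + B) Y) \<le> E"
      using local_err[of Y] by linarith
    have "(strang s A B ^^ Suc i) X - conj_exp (real (Suc i) * s) (A + B) X
        = strang s A B ((strang s A B ^^ i) X - Y) + (strang s A B Y - conj_exp s (A + B) Y)"
      by (simp add: strang_diff Y_def conj_exp_add algebra_simps)
    then have "norm ((strang s A B ^^ Suc i) X - conj_exp (real (Suc i) * s) (A + B) X)
        \<le> norm ((strang s A B ^^ i) X - Y) + norm (strang s A B Y - conj_exp s (A + B) Y)"
      by (simp only:) (meson norm_triangle_ineq strang_norm add_right_mono order_trans)
    also have "\<dots> \<le> real i * E + E" using Suc 1 by (simp add: Y_def)
    finally show ?case by (simp add: algebra_simps)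
  qed simp
  from this[of n] show ?thesis by (simp add: E_def T_def)
qed

text \<open>One factor of the conjugation cancels against \<open>u j\<close> on the right, or
  against \<open>w j\<close> on the left. A commutator with an elementary translation is therefore a
  difference up to a factor of norm at most 1, and the scale \<open>Nn\<close> matches.\<close>

lemma D_u_commutator: "Nn *\<^sub>R commutator (u j) X = D j X * u j"
  and D_w_commutator: "Nn *\<^sub>R commutator (w j) X = - (w j * D j X)"
proof -
  have "u j * X * w j * u j = u j * X" "w j * (u j * X * w j) = X * w j"
    using wu[of j] by (simp_all add: mult.assoc) (simp add: mult.assoc[symmetric])
  then show "Nn *\<^sub>R commutator (u j) X = D j X * u j" "Nn *\<^sub>R commutator (w j) X = - (w j * D j X)"
    by (simp_all add: commutator_def D_def algebra_simps)
qed

text \<open>The norm bound belongs to the predicate because it makes the constants additive under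
  products.\<close>

definition comm_bound :: "real \<Rightarrow> 'm \<Rightarrow> bool" where
  "comm_bound c V \<longleftrightarrow> norm V \<le> 1 \<and> (\<forall>X. Nn * norm (commutator V X) \<le> c * (\<Sum>j\<in>UNIV. norm (D j X)))"

lemma comm_bound_u: "comm_bound 1 (u j)" and comm_bound_w: "comm_bound 1 (w j)"
proof -
  have 1: "norm (D j X) \<le> (\<Sum>j\<in>UNIV. norm (D j X))" for X
    by (rule member_le_sum) auto
  have "Nn * norm (commutator (u j) X) \<le> norm (D j X) * norm (u j)" for X
    using Nn norm_mult_ineq[of "D j X" "u j"] unfolding D_u_commutator[symmetric] by simp
  moreover have "norm (D j X) * norm (u j) \<le> norm (D j X)" for X
    by (rule mult_right_le_one_le) (auto simp: norm_u)
  ultimately show "comm_bound 1 (u j)"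
    unfolding comm_bound_def using 1 norm_u by (metis mult_1 order_trans)
  have "Nn * norm (commutator (w j) X) \<le> norm (w j) * norm (D j X)" for X
    using Nn norm_mult_ineq[of "w j" "D j X"] arg_cong[OF D_w_commutator[of j X], of norm] by simp
  moreover have "norm (w j) * norm (D j X) \<le> norm (D j X)" for X
    by (rule mult_left_le_one_le) (auto simp: norm_w)
  ultimately show "comm_bound 1 (w j)"
    unfolding comm_bound_def using 1 norm_w by (metis mult_1 order_trans)
qed

lemma comm_bound_1: "comm_bound 0 1"
  by (simp add: comm_bound_def commutator_def)

lemma comm_bound_mult:
  assumes "comm_bound c V" and "comm_bound d W"
  shows "comm_bound (c + d) (V * W)"
proof -
  have "norm (V * W) \<le> 1"
    using assms norm_mult_ineq[of V W] mult_le_one[of "norm V" "norm W"]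
    by (auto simp: comm_bound_def)
  moreover have "Nn * norm (commutator (V * W) X) \<le> (c + d) * (\<Sum>j\<in>UNIV. norm (D j X))" for X
  proof -
    have "commutator (V * W) X = V * commutator W X + commutator V X * W"
      by (simp add: commutator_def algebra_simps)
    then have "norm (commutator (V * W) X) \<le> norm V * norm (commutator W X) + norm (commutator V X) * norm W"
      using norm_triangle_le norm_mult_ineq add_mono by (metis (no_types, lifting))
    also have "\<dots> \<le> norm (commutator W X) + norm (commutator V X)"
      using assms unfolding comm_bound_def by (intro add_mono mult_left_le_one_le mult_right_le_one_le) auto
    finally have "Nn * norm (commutator (V * W) X) \<le> Nn * norm (commutator W X) + Nn * norm (commutator V X)"
      using Nn by (simp add: distrib_left[symmetric])
    moreover have "Nn * norm (commutator W X) \<le> d * (\<Sum>j\<in>UNIV. norm (D j X))" "Nn * norm (commutator V X) \<le> c * (\<Sum>j\<in>UNIV. norm (D j X))"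
      using assms unfolding comm_bound_def by auto
    ultimately show ?thesis by (simp add: distrib_right)
  qed
  ultimately show ?thesis by (simp add: comm_bound_def)
qed

end

section \<open>Bounded operators on square-summable families\<close>

text \<open>Treated below as a real Hilbert space, the inner product being the real part of the
  usual one. Norms are unaffected, and complex scalars return as the operators
  \<open>cmul\<close>.\<close>

typedef 'i ell2 = "{f :: 'i \<Rightarrow> complex. (\<lambda>i. (cmod (f i))\<^sup>2) summable_on UNIV}"
  morphisms coeff Abs_ell2
  by (rule exI[of _ "\<lambda>_. 0"]) simp

setup_lifting type_definition_ell2

lemma square_summable_add:
  assumes "(\<lambda>i. (cmod (f i))\<^sup>2) summable_on UNIV" and "(\<lambda>i. (cmod (g i))\<^sup>2) summable_on UNIV"
  shows "(\<lambda>i. (cmod (f i + g i))\<^sup>2) summable_on UNIV"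
proof (rule summable_on_comparison_test)
  show "(\<lambda>i. 2 * (cmod (f i))\<^sup>2 + 2 * (cmod (g i))\<^sup>2) summable_on UNIV"
    by (intro summable_on_add summable_on_cmult_right assms)
  show "(cmod (f i + g i))\<^sup>2 \<le> 2 * (cmod (f i))\<^sup>2 + 2 * (cmod (g i))\<^sup>2" for i
  proof -
    have "(cmod (f i + g i))\<^sup>2 \<le> (cmod (f i) + cmod (g i))\<^sup>2"
      by (intro power_mono norm_triangle_ineq) auto
    then show ?thesis
      using sum_squares_bound[of "cmod (f i)" "cmod (g i)"] by (simp add: power2_sum)
  qed
qed simp

lemma square_summable_minus:
  assumes "(\<lambda>i. (cmod (f i))\<^sup>2) summable_on UNIV" and "(\<lambda>i. (cmod (g i))\<^sup>2) summable_on UNIV"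
  shows "(\<lambda>i. (cmod (f i - g i))\<^sup>2) summable_on UNIV"
  using square_summable_add[of f "\<lambda>i. - g i"] assms by simp

lemma square_summable_inner:
  assumes "(\<lambda>i. (cmod (f i))\<^sup>2) summable_on UNIV" and "(\<lambda>i. (cmod (g i))\<^sup>2) summable_on UNIV"
  shows "(\<lambda>i. f i \<bullet> g i) summable_on UNIV"
proof -
  have "(\<lambda>i. (cmod (f i))\<^sup>2 + (cmod (g i))\<^sup>2) summable_on UNIV"
    by (intro summable_on_add assms)
  then have "(\<lambda>i. norm (f i \<bullet> g i)) summable_on UNIV"
  proof (rule Infinite_Sum.abs_summable_on_comparison_test')
    fix i
    have "\<bar>f i \<bullet> g i\<bar> \<le> cmod (f i) * cmod (g i)" by (rule Cauchy_Schwarz_ineq2)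
    moreover have "0 \<le> cmod (f i) * cmod (g i)" by simp
    ultimately show "norm (f i \<bullet> g i) \<le> (cmod (f i))\<^sup>2 + (cmod (g i))\<^sup>2"
      using sum_squares_bound[of "cmod (f i)" "cmod (g i)"] unfolding real_norm_def by linarith
  qed
  then show ?thesis by (rule abs_summable_summable)
qed

instantiation ell2 :: (type) real_inner
begin

lift_definition zero_ell2 :: "'a ell2" is "\<lambda>_. 0" by simp
lift_definition plus_ell2 :: "'a ell2 \<Rightarrow> 'a ell2 \<Rightarrow> 'a ell2" is "\<lambda>f g i. f i + g i"
  by (rule square_summable_add)
lift_definition minus_ell2 :: "'a ell2 \<Rightarrow> 'a ell2 \<Rightarrow> 'a ell2" is "\<lambda>f g i. f i - g i"
  by (rule square_summable_minus)
lift_definition uminus_ell2 :: "'a ell2 \<Rightarrow> 'a ell2" is "\<lambda>f i. - f i" by simp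
lift_definition scaleR_ell2 :: "real \<Rightarrow> 'a ell2 \<Rightarrow> 'a ell2" is "\<lambda>r f i. r *\<^sub>R f i"
  by (simp add: power_mult_distrib summable_on_cmult_right)
lift_definition inner_ell2 :: "'a ell2 \<Rightarrow> 'a ell2 \<Rightarrow> real" is "\<lambda>f g. \<Sum>\<^sub>\<infinity>i. f i \<bullet> g i" .

definition "norm_ell2 (x :: 'a ell2) = sqrt (x \<bullet> x)"
definition "sgn_ell2 (x :: 'a ell2) = (inverse (norm x)) *\<^sub>R x"
definition "dist_ell2 (x :: 'a ell2) y = norm (x - y)"
definition "uniformity_ell2 = (INF e\<in>{0 <..}. principal {(x :: 'a ell2, y). dist x y < e})"
definition "open_ell2 U = (\<forall>x\<in>U. eventually (\<lambda>(x', y). x' = x \<longrightarrow> y \<in> U) (uniformity :: ('a ell2 \<times> 'a ell2) filter))"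

instance
proof
  fix x y z :: "'a ell2" and r s :: real and U :: "'a ell2 set"
  show "x + y + z = x + (y + z)" by transfer (simp add: add_ac)
  show "x + y = y + x" by transfer (simp add: add_ac)
  show "0 + x = x" by transfer simp
  show "- x + x = 0" by transfer simp
  show "x - y = x + - y" by transfer simp
  show "r *\<^sub>R (x + y) = r *\<^sub>R x + r *\<^sub>R y" by transfer (simp add: scaleR_right_distrib)
  show "(r + s) *\<^sub>R x = r *\<^sub>R x + s *\<^sub>R x" by transfer (simp add: scaleR_left_distrib)
  show "r *\<^sub>R s *\<^sub>R x = (r * s) *\<^sub>R x" by transfer simp
  show "1 *\<^sub>R x = x" by transfer simp
  show "sgn x = inverse (norm x) *\<^sub>R x" by (rule sgn_ell2_def)
  show "dist x y = norm (x - y)" by (rule dist_ell2_def)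
  show "uniformity = (INF e\<in>{0 <..}. principal {(x :: 'a ell2, y). dist x y < e})"
    by (rule uniformity_ell2_def)
  show "open U = (\<forall>x\<in>U. eventually (\<lambda>(x', y). x' = x \<longrightarrow> y \<in> U) uniformity)"
    by (rule open_ell2_def)
  show "norm x = sqrt (x \<bullet> x)" by (rule norm_ell2_def)
  show "x \<bullet> y = y \<bullet> x" by transfer (simp add: inner_commute)
  show "(x + y) \<bullet> z = x \<bullet> z + y \<bullet> z"
    by transfer (simp add: inner_add_left infsum_add square_summable_inner)
  show "(r *\<^sub>R x) \<bullet> y = r * (x \<bullet> y)"
    by transfer (simp add: infsum_cmult_right')
  show "0 \<le> x \<bullet> x" by transfer (simp add: infsum_nonneg)
  show "x \<bullet> x = 0 \<longleftrightarrow> x = 0"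
  proof transfer
    fix f :: "'a \<Rightarrow> complex" assume f: "(\<lambda>i. (cmod (f i))\<^sup>2) summable_on UNIV"
    show "(\<Sum>\<^sub>\<infinity>i. f i \<bullet> f i) = 0 \<longleftrightarrow> f = (\<lambda>_. 0)"
    proof
      assume 0: "(\<Sum>\<^sub>\<infinity>i. f i \<bullet> f i) = 0"
      have "(cmod (f i))\<^sup>2 \<le> 0" for i
        using finite_sum_le_infsum[OF f, of "{i}"] 0 by (simp add: power2_norm_eq_inner)
      then show "f = (\<lambda>_. 0)" by auto
    qed simp
  qed
qed

end

lemma coeff_simps [simp]:
  "coeff 0 i = 0" "coeff (x + y) i = coeff x i + coeff y i" "coeff (x - y) i = coeff x i - coeff y i"
  "coeff (- x) i = - coeff x i" "coeff (r *\<^sub>R x) i = r *\<^sub>R coeff x i"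
  by (transfer, simp)+

lemma summable_coeff: "(\<lambda>i. (cmod (coeff x i))\<^sup>2) summable_on UNIV"
  by transfer

lemma norm_ell2_power2: "(norm x)\<^sup>2 = (\<Sum>\<^sub>\<infinity>i. (cmod (coeff x i))\<^sup>2)"
  by (simp add: power2_norm_eq_inner inner_ell2.rep_eq)

lemma sum_coeff_le: "finite F \<Longrightarrow> (\<Sum>i\<in>F. (cmod (coeff x i))\<^sup>2) \<le> (norm x)\<^sup>2"
  unfolding norm_ell2_power2 by (rule finite_sum_le_infsum[OF summable_coeff]) auto

lemma norm_coeff_le: "cmod (coeff x i) \<le> norm x"
  using sum_coeff_le[of "{i}" x] by (simp add: power2_le_iff_abs_le)

lemma square_summableI:
  fixes f :: "'i \<Rightarrow> complex"
  assumes "\<And>F. finite F \<Longrightarrow> (\<Sum>i\<in>F. (cmod (f i))\<^sup>2) \<le> B"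
  shows "(\<lambda>i. (cmod (f i))\<^sup>2) summable_on UNIV"
  by (rule nonneg_bdd_above_summable_on) (auto intro!: bdd_aboveI[of _ B] assms)

lemma norm_ell2_leI:
  assumes "\<And>F. finite F \<Longrightarrow> (\<Sum>i\<in>F. (cmod (coeff x i))\<^sup>2) \<le> B\<^sup>2" and "0 \<le> B"
  shows "norm x \<le> B"
proof -
  have "(norm x)\<^sup>2 \<le> B\<^sup>2"
    unfolding norm_ell2_power2 by (rule infsum_le_finite_sums[OF summable_coeff]) (use assms in auto)
  then show ?thesis using assms(2) by (simp add: power2_le_iff_abs_le)
qed

lemma bounded_linear_coeff: "bounded_linear (\<lambda>x. coeff x i)"
  by (rule bounded_linear_intro[of _ 1]) (auto simp: norm_coeff_le)

text \<open>Coordinates converge one by one. The Cauchy bound is kept on finite sets of coordinates,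
  passed to the limit there, and only then extended to the whole family.\<close>

instance ell2 :: (type) banach
proof
  fix X :: "nat \<Rightarrow> 'a ell2"
  assume X: "Cauchy X"
  have "convergent (\<lambda>n. coeff (X n) i)" for i
    using bounded_linear.Cauchy[OF bounded_linear_coeff X] by (simp add: Cauchy_convergent_iff)
  then obtain f where f: "\<And>i. (\<lambda>n. coeff (X n) i) \<longlonglongrightarrow> f i"
    unfolding convergent_def by metis
  have *: "\<exists>M. \<forall>n\<ge>M. \<forall>F. finite F \<longrightarrow> (\<Sum>i\<in>F. (cmod (coeff (X n) i - f i))\<^sup>2) \<le> e\<^sup>2" if e: "0 < e" for e
  proof -
    obtain M where M: "\<And>m n. m \<ge> M \<Longrightarrow> n \<ge> M \<Longrightarrow> norm (X m - X n) < e"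
      using CauchyD[OF X e] by auto
    have "(\<Sum>i\<in>F. (cmod (coeff (X n) i - f i))\<^sup>2) \<le> e\<^sup>2" if "n \<ge> M" "finite F" for n F
    proof (rule LIMSEQ_le_const2)
      show "(\<lambda>m. \<Sum>i\<in>F. (cmod (coeff (X n) i - coeff (X m) i))\<^sup>2) \<longlonglongrightarrow> (\<Sum>i\<in>F. (cmod (coeff (X n) i - f i))\<^sup>2)"
        by (intro tendsto_intros f)
      have "(\<Sum>i\<in>F. (cmod (coeff (X n) i - coeff (X m) i))\<^sup>2) \<le> e\<^sup>2" if "m \<ge> M" for m
      proof -
        have "(norm (X n - X m))\<^sup>2 \<le> e\<^sup>2" using M[OF \<open>n \<ge> M\<close> that] by (intro power_mono) auto
        then show ?thesis using sum_coeff_le[OF \<open>finite F\<close>, of "X n - X m"] by simp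
      qed
      then show "\<exists>M. \<forall>m\<ge>M. (\<Sum>i\<in>F. (cmod (coeff (X n) i - coeff (X m) i))\<^sup>2) \<le> e\<^sup>2" by blast
    qed
    then show ?thesis by blast
  qed
  obtain M where M: "\<And>F. finite F \<Longrightarrow> (\<Sum>i\<in>F. (cmod (coeff (X M) i - f i))\<^sup>2) \<le> 1"
    using *[of 1] by auto
  have "(\<lambda>i. (cmod (coeff (X M) i - f i))\<^sup>2) summable_on UNIV"
    by (rule square_summableI[OF M])
  from square_summable_minus[OF summable_coeff this, of "X M"]
  have fs: "(\<lambda>i. (cmod (f i))\<^sup>2) summable_on UNIV" by simp
  define x where "x = Abs_ell2 f"
  have x: "coeff x i = f i" for i using fs by (simp add: x_def Abs_ell2_inverse)
  have "X \<longlonglongrightarrow> x"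
  proof (rule LIMSEQ_I)
    fix r :: real assume r: "0 < r"
    then obtain M where M: "\<And>n F. n \<ge> M \<Longrightarrow> finite F \<Longrightarrow> (\<Sum>i\<in>F. (cmod (coeff (X n) i - f i))\<^sup>2) \<le> (r / 2)\<^sup>2"
      using *[of "r / 2"] by auto
    have "norm (X n - x) \<le> r / 2" if "n \<ge> M" for n
      by (rule norm_ell2_leI) (use M[OF that] r in \<open>auto simp: x\<close>)
    then show "\<exists>no. \<forall>n\<ge>no. norm (X n - x) < r" using r by (intro exI[of _ M]) force
  qed
  then show "convergent X" by (auto simp: convergent_def)
qed

text \<open>Provides a nonzero vector, which is what \<open>norm 1 = 1\<close> requires of the
  operator algebra.\<close>

lift_definition single :: "'i \<Rightarrow> 'i ell2" is "\<lambda>i j. if j = i then 1 else 0"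
  proof (rule square_summableI[of _ 1])
  fix i :: 'i and F :: "'i set" assume F: "finite F"
  have "(\<Sum>j\<in>F. (cmod (if j = i then 1 else 0))\<^sup>2) = (\<Sum>j\<in>F. if j = i then 1 else 0)"
    by (rule sum.cong) auto
  then show "(\<Sum>j\<in>F. (cmod (if j = i then 1 else 0))\<^sup>2) \<le> 1"
    using F by (simp add: sum.delta)
qed

lifting_forget ell2.lifting

text \<open>A copy of the bounded linear maps on which composition is the ring multiplication, so
  that \<open>exp\<close> and the splitting estimates apply.\<close>

typedef 'i bop = "UNIV :: ('i ell2 \<Rightarrow>\<^sub>L 'i ell2) set"
  morphisms Rep_bop Abs_bop by simp

setup_lifting type_definition_bop

definition app :: "'i bop \<Rightarrow> 'i ell2 \<Rightarrow> 'i ell2" where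
  "app M = blinfun_apply (Rep_bop M)"

instantiation bop :: (type) real_normed_algebra_1
begin

lift_definition zero_bop :: "'a bop" is 0 .
lift_definition one_bop :: "'a bop" is id_blinfun .
lift_definition plus_bop :: "'a bop \<Rightarrow> 'a bop \<Rightarrow> 'a bop" is "(+)" .
lift_definition minus_bop :: "'a bop \<Rightarrow> 'a bop \<Rightarrow> 'a bop" is "(-)" .
lift_definition times_bop :: "'a bop \<Rightarrow> 'a bop \<Rightarrow> 'a bop" is "blinfun_compose" .
lift_definition uminus_bop :: "'a bop \<Rightarrow> 'a bop" is uminus .
lift_definition scaleR_bop :: "real \<Rightarrow> 'a bop \<Rightarrow> 'a bop" is "(*\<^sub>R)" .
lift_definition norm_bop :: "'a bop \<Rightarrow> real" is norm .

definition "sgn_bop (x :: 'a bop) = (inverse (norm x)) *\<^sub>R x"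
definition "dist_bop (x :: 'a bop) y = norm (x - y)"
definition "uniformity_bop = (INF e\<in>{0 <..}. principal {(x :: 'a bop, y). dist x y < e})"
definition "open_bop U = (\<forall>x\<in>U. eventually (\<lambda>(x', y). x' = x \<longrightarrow> y \<in> U) (uniformity :: ('a bop \<times> 'a bop) filter))"

instance
proof
  fix x y z :: "'a bop" and r s :: real and U :: "'a bop set"
  show "x + y + z = x + (y + z)" by transfer (simp add: add_ac)
  show "x + y = y + x" by transfer (simp add: add_ac)
  show "0 + x = x" by transfer simp
  show "- x + x = 0" by transfer simp
  show "x - y = x + - y" by transfer simp
  show "r *\<^sub>R (x + y) = r *\<^sub>R x + r *\<^sub>R y" by transfer (simp add: scaleR_right_distrib)
  show "(r + s) *\<^sub>R x = r *\<^sub>R x + s *\<^sub>R x" by transfer (simp add: scaleR_left_distrib)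
  show "r *\<^sub>R s *\<^sub>R x = (r * s) *\<^sub>R x" by transfer simp
  show "1 *\<^sub>R x = x" by transfer simp
  show "x * y * z = x * (y * z)" by transfer (rule blinfun_eqI, simp)
  show "(x + y) * z = x * z + y * z" by transfer (rule blinfun_eqI, simp add: blinfun.bilinear_simps)
  show "x * (y + z) = x * y + x * z" by transfer (rule blinfun_eqI, simp add: blinfun.bilinear_simps)
  show "r *\<^sub>R x * y = r *\<^sub>R (x * y)" by transfer (rule blinfun_eqI, simp add: blinfun.bilinear_simps)
  show "x * r *\<^sub>R y = r *\<^sub>R (x * y)" by transfer (rule blinfun_eqI, simp add: blinfun.bilinear_simps)
  show "1 * x = x" "x * 1 = x" by (transfer, rule blinfun_eqI, simp)+
  show "norm (x * y) \<le> norm x * norm y" by transfer (rule norm_blinfun_compose)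
  show "norm x = 0 \<longleftrightarrow> x = 0" by transfer simp
  show "norm (x + y) \<le> norm x + norm y" by transfer (rule norm_triangle_ineq)
  show "norm (r *\<^sub>R x) = \<bar>r\<bar> * norm x" by transfer simp
  show "sgn x = inverse (norm x) *\<^sub>R x" by (rule sgn_bop_def)
  show "dist x y = norm (x - y)" by (rule dist_bop_def)
  show "uniformity = (INF e\<in>{0 <..}. principal {(x :: 'a bop, y). dist x y < e})"
    by (rule uniformity_bop_def)
  show "open U = (\<forall>x\<in>U. eventually (\<lambda>(x', y). x' = x \<longrightarrow> y \<in> U) uniformity)"
    by (rule open_bop_def)
  have "coeff (single undefined) undefined \<noteq> coeff (0 :: 'a ell2) undefined" by (simp add: single.rep_eq)
  then have "single undefined \<noteq> (0 :: 'a ell2)" by metis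
  then have s: "norm (single undefined :: 'a ell2) \<noteq> 0" by simp
  show "norm (1 :: 'a bop) = 1"
  proof transfer
    have "norm (blinfun_apply id_blinfun (single undefined :: 'a ell2))
        \<le> norm (id_blinfun :: 'a ell2 \<Rightarrow>\<^sub>L 'a ell2) * norm (single undefined :: 'a ell2)"
      by (rule norm_blinfun)
    then have "1 \<le> norm (id_blinfun :: 'a ell2 \<Rightarrow>\<^sub>L 'a ell2)" using s by simp
    moreover have "norm (id_blinfun :: 'a ell2 \<Rightarrow>\<^sub>L 'a ell2) \<le> 1" by (rule norm_blinfun_bound) auto
    ultimately show "norm (id_blinfun :: 'a ell2 \<Rightarrow>\<^sub>L 'a ell2) = 1" by simp
  qed
  then show "(0 :: 'a bop) \<noteq> 1"
    by (metis norm_bop.rep_eq norm_zero zero_bop.rep_eq zero_neq_one)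
qed

end

instance bop :: (type) banach
proof
  fix X :: "nat \<Rightarrow> 'a bop"
  assume X: "Cauchy X"
  have "Cauchy (\<lambda>n. Rep_bop (X n))"
    using X unfolding Cauchy_def dist_bop_def dist_norm norm_bop.rep_eq minus_bop.rep_eq .
  then obtain L where L: "(\<lambda>n. Rep_bop (X n)) \<longlonglongrightarrow> L"
    by (auto simp: Cauchy_convergent_iff convergent_def)
  have "X \<longlonglongrightarrow> Abs_bop L"
    using L unfolding LIMSEQ_def dist_bop_def dist_norm norm_bop.rep_eq minus_bop.rep_eq
    by (simp add: Abs_bop_inverse)
  then show "convergent X" by (auto simp: convergent_def)
qed

lemma app_simps [simp]:
  "app (M + L) x = app M x + app L x" "app (M - L) x = app M x - app L x" "app (- M) x = - app M x"
  "app (r *\<^sub>R M) x = r *\<^sub>R app M x" "app (M * L) x = app M (app L x)" "app 1 x = x" "app 0 x = 0"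
  by (simp_all add: app_def plus_bop.rep_eq minus_bop.rep_eq uminus_bop.rep_eq scaleR_bop.rep_eq
      times_bop.rep_eq one_bop.rep_eq zero_bop.rep_eq blinfun.bilinear_simps)

lemma bop_eqI: "(\<And>x. app M x = app L x) \<Longrightarrow> M = L"
  by (metis app_def blinfun_eqI Rep_bop_inject)

lemma norm_app: "norm (app M x) \<le> norm M * norm x"
  by (simp add: app_def norm_bop.rep_eq norm_blinfun)

lemma bounded_linear_app_left: "bounded_linear (\<lambda>M. app M x)"
  by (rule bounded_linear_intro[of _ "norm x"]) (auto simp: norm_app mult.commute)

lemma app_Abs_bop: "bounded_linear f \<Longrightarrow> app (Abs_bop (Blinfun f)) x = f x"
  by (simp add: app_def Abs_bop_inverse bounded_linear_Blinfun_apply)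

lemma norm_bop_le: "0 \<le> b \<Longrightarrow> (\<And>x. norm (app M x) \<le> b * norm x) \<Longrightarrow> norm M \<le> b"
  by (simp add: app_def norm_bop.rep_eq norm_blinfun_bound)

text \<open>Comparing the exponential series term by term shows that the adjoint of
  \<open>exp L\<close> is \<open>exp (- L)\<close>, its inverse. Hence \<open>exp L\<close>
  preserves the inner product.\<close>

lemma isometric_generator_skew:
  fixes K :: "'i bop"
  assumes skew: "\<And>x y. app K x \<bullet> y = - (x \<bullet> app K y)"
  shows "isometric_generator K"
proof -
  have exp_skew: "app (exp L) x \<bullet> y = x \<bullet> app (exp (- L)) y"
    if L: "\<And>x y. app L x \<bullet> y = - (x \<bullet> app L y)" for L :: "'i bop" and x y
  proof -
    have p: "app (L ^ n) x \<bullet> y = x \<bullet> app ((- L) ^ n) y" for n x y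
    proof (induction n arbitrary: x)
      case (Suc n)
      show ?case unfolding power_Suc2[of L] power_Suc[of "- L"] by (simp add: Suc.IH L)
    qed simp
    have 1: "bounded_linear (\<lambda>M. app M x \<bullet> y)"
      by (intro bounded_linear_inner_left_comp bounded_linear_app_left)
    have 2: "bounded_linear (\<lambda>M. x \<bullet> app M y)"
      by (intro bounded_linear_inner_right_comp bounded_linear_app_left)
    have "(\<lambda>n. app (L ^ n /\<^sub>R fact n) x \<bullet> y) sums (app (exp L) x \<bullet> y)"
      by (rule bounded_linear.sums[OF 1 exp_converges])
    moreover have "(\<lambda>n. x \<bullet> app ((- L) ^ n /\<^sub>R fact n) y) sums (x \<bullet> app (exp (- L)) y)"
      by (rule bounded_linear.sums[OF 2 exp_converges])
    ultimately show ?thesis by (simp add: p sums_unique2)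
  qed
  show ?thesis unfolding isometric_generator_def
  proof (intro allI norm_bop_le)
    fix t :: real and x :: "'i ell2"
    define L where "L = t *\<^sub>R K"
    have L: "app L x \<bullet> y = - (x \<bullet> app L y)" for x y by (simp add: L_def skew)
    have "exp (- L) * exp L = 1" using exp_minus_inverse[of "- L"] by simp
    then have "app (exp (- L)) (app (exp L) x) = x" by (metis app_simps(5,6))
    then have "app (exp L) x \<bullet> app (exp L) x = x \<bullet> x" by (simp add: exp_skew[OF L])
    then show "norm (app (exp (t *\<^sub>R K)) x) \<le> 1 * norm x" by (simp add: norm_eq_sqrt_inner L_def)
  qed simp
qed

text \<open>Weighted composition operators comprise scalars, phases and cyclic shifts alike, so
  norms and adjoints are computed once for all of them.\<close>

definition wcomp :: "('i \<Rightarrow> complex) \<Rightarrow> ('i \<Rightarrow> 'i) \<Rightarrow> 'i bop" where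
  "wcomp p f = Abs_bop (Blinfun (\<lambda>x. Abs_ell2 (\<lambda>i. p i * coeff x (f i))))"

text \<open>Injectivity of \<open>f\<close> keeps any coefficient from being counted twice in a
  finite sum of squares.\<close>

lemma
  assumes f: "inj f" and p: "\<And>i. cmod (p i) \<le> B"
  shows coeff_wcomp: "coeff (app (wcomp p f) x) i = p i * coeff x (f i)"
    and norm_wcomp: "norm (wcomp p f) \<le> B"
proof -
  have B: "0 \<le> B" using p[of undefined] norm_ge_zero order_trans by blast
  have fin: "(\<Sum>i\<in>F. (cmod (p i * coeff x (f i)))\<^sup>2) \<le> (B * norm x)\<^sup>2" if "finite F" for F x
  proof -
    have "(\<Sum>i\<in>F. (cmod (p i * coeff x (f i)))\<^sup>2) \<le> (\<Sum>i\<in>F. B\<^sup>2 * (cmod (coeff x (f i)))\<^sup>2)"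
      unfolding norm_mult power_mult_distrib by (intro sum_mono mult_right_mono power_mono p) auto
    also have "\<dots> = B\<^sup>2 * (\<Sum>i\<in>f ` F. (cmod (coeff x i))\<^sup>2)"
      using f by (simp add: sum_distrib_left sum.reindex inj_on_def)
    also have "\<dots> \<le> B\<^sup>2 * (norm x)\<^sup>2" using that by (intro mult_left_mono sum_coeff_le) auto
    finally show ?thesis by (simp add: power_mult_distrib)
  qed
  have c: "coeff (Abs_ell2 (\<lambda>i. p i * coeff x (f i))) i = p i * coeff x (f i)" for x i
    using square_summableI[of "\<lambda>i. p i * coeff x (f i)", OF fin] by (simp add: Abs_ell2_inverse)
  have "bounded_linear (\<lambda>x. Abs_ell2 (\<lambda>i. p i * coeff x (f i)))"
  proof (rule bounded_linear_intro[of _ B])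
    show "norm (Abs_ell2 (\<lambda>i. p i * coeff x (f i))) \<le> norm x * B" for x
      by (rule norm_ell2_leI) (use fin[of _ x] B in \<open>auto simp: c mult.commute\<close>)
    show "Abs_ell2 (\<lambda>i. p i * coeff (x + y) (f i)) = Abs_ell2 (\<lambda>i. p i * coeff x (f i)) + Abs_ell2 (\<lambda>i. p i * coeff y (f i))"
      "Abs_ell2 (\<lambda>i. p i * coeff (r *\<^sub>R x) (f i)) = r *\<^sub>R Abs_ell2 (\<lambda>i. p i * coeff x (f i))" for r x y
      unfolding coeff_inject[symmetric] fun_eq_iff c unfolding coeff_simps c by (auto simp: algebra_simps)
  qed
  then have a: "app (wcomp p f) x = Abs_ell2 (\<lambda>i. p i * coeff x (f i))" for x
    unfolding wcomp_def by (rule app_Abs_bop)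
  show "coeff (app (wcomp p f) x) i = p i * coeff x (f i)" by (simp add: a c)
  show "norm (wcomp p f) \<le> B"
    by (intro norm_bop_le B norm_ell2_leI) (use fin B in \<open>auto simp: a c\<close>)
qed

text \<open>Reindexing the sum by the inverse map \<open>g\<close> carries the weight, conjugated,
  to the other argument.\<close>

lemma inner_wcomp:
  assumes gf: "\<And>i. g (f i) = i" and fg: "\<And>i. f (g i) = i" and p: "\<And>i. cmod (p i) \<le> B"
  shows "app (wcomp p f) x \<bullet> y = x \<bullet> app (wcomp (\<lambda>i. cnj (p (g i))) g) y"
proof -
  have f: "inj f" and g: "inj g" using gf fg by (metis injI)+
  have bij: "bij_betw g UNIV UNIV" using gf fg by (metis bij_betw_def g surj_def)
  have "app (wcomp p f) x \<bullet> y = (\<Sum>\<^sub>\<infinity>i. (p i * coeff x (f i)) \<bullet> coeff y i)"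
    by (simp add: inner_ell2.rep_eq coeff_wcomp[OF f p])
  also have "\<dots> = (\<Sum>\<^sub>\<infinity>i. (p (g i) * coeff x (f (g i))) \<bullet> coeff y (g i))"
    by (rule infsum_reindex_bij_betw[OF bij, symmetric])
  also have "\<dots> = (\<Sum>\<^sub>\<infinity>i. coeff x i \<bullet> (cnj (p (g i)) * coeff y (g i)))"
    by (rule infsum_cong) (simp add: fg inner_complex_def algebra_simps)
  also have "\<dots> = x \<bullet> app (wcomp (\<lambda>i. cnj (p (g i))) g) y"
    using coeff_wcomp[OF g, of "\<lambda>i. cnj (p (g i))" B] p by (simp add: inner_ell2.rep_eq)
  finally show ?thesis .
qed

section \<open>Weyl translations and their rapidly decaying combinations\<close>

text \<open>Chord length on the unit circle. It yields both the upper bound for differences of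
  phases and the lower bound behind the decay of Fourier coefficients.\<close>

lemma norm_cis_minus_1: "cmod (cis t - 1) = 2 * \<bar>sin (t / 2)\<bar>"
proof -
  have "cis t - 1 = cis (t / 2) * (cis (t / 2) - cis (- (t / 2)))"
    by (simp add: algebra_simps cis_mult)
  also have "cis (t / 2) - cis (- (t / 2)) = 2 * \<i> * sin (t / 2)"
    by (simp add: complex_eq_iff)
  finally show ?thesis by (simp add: norm_mult)
qed

lemma norm_cis_minus_1_le: "cmod (cis t - 1) \<le> \<bar>t\<bar>"
  using abs_sin_x_le_abs_x[of "t / 2"] by (simp add: norm_cis_minus_1)

lemma cis_int [simp]: "cis (2 * pi * of_int k) = 1"
  using cis_multiple_2pi[of "of_int k"] by simp

lemma infsum_bounded_linear:
  assumes "bounded_linear h" and "f summable_on A"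
  shows "(\<Sum>\<^sub>\<infinity>x\<in>A. h (f x)) = h (infsum f A)"
  by (rule infsumI) (rule has_sum_bounded_linear[OF assms(1) has_sum_infsum[OF assms(2)]])

text \<open>A frequency on the torus of dimension \<open>2 d\<close> is one vector over a sum type.
  Its first half is dual to \<open>x\<close> and produces phases, its second half is dual to
  \<open>\<xi>\<close> and produces shifts.\<close>

definition lpart :: "int^('d + 'd) \<Rightarrow> int^'d" where "lpart v = (\<chi> i. v $ Inl i)"
definition mpart :: "int^('d + 'd) \<Rightarrow> int^'d" where "mpart v = (\<chi> i. v $ Inr i)"

definition pairing :: "int^'d \<Rightarrow> int^'d \<Rightarrow> int" where
  "pairing l m = (\<Sum>i\<in>UNIV. l $ i * m $ i)"

definition l1 :: "int^'n \<Rightarrow> real" where "l1 v = (\<Sum>i\<in>UNIV. \<bar>of_int (v $ i)\<bar>)"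

text \<open>The grid is identified with residues modulo \<open>N\<close>; translation acts on the residue
  \<open>n mod N\<close> and keeps the block number \<open>n div N\<close>, so that it is a bijection of all of \<open>nat^'d\<close>.\<close>

definition shift :: "nat \<Rightarrow> int^'d \<Rightarrow> nat^'d \<Rightarrow> nat^'d" where
  "shift N m n = (\<chi> i. (n $ i div N) * N + nat ((int (n $ i) + m $ i) mod int N))"

definition phase :: "nat \<Rightarrow> int^'d \<Rightarrow> nat^'d \<Rightarrow> complex" where
  "phase N l n = cis (2 * pi * of_int (pairing l (\<chi> i. int (n $ i))) / N)"

definition cmul :: "complex \<Rightarrow> (nat^'d) bop" where
  "cmul z = wcomp (\<lambda>_. z) (\<lambda>n. n)"

text \<open>Weyl-Heisenberg translation in the ordering phase times shift; the half-phase that makes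
  it symmetric is supplied separately by \<open>twist\<close>.\<close>

definition trans_op :: "nat \<Rightarrow> int^('d + 'd) \<Rightarrow> (nat^'d) bop" where
  "trans_op N v = wcomp (phase N (lpart v)) (shift N (mpart v))"

section \<open>Algebra of phases and cyclic shifts\<close>

lemma parts [simp]:
  "lpart (v + v') = lpart v + lpart v'" "mpart (v + v') = mpart v + mpart v'"
  "lpart (- v) = - lpart v" "mpart (- v) = - mpart v" "lpart 0 = 0" "mpart 0 = 0"
  by (simp_all add: lpart_def mpart_def vec_eq_iff)

lemma pairing_simps [simp]:
  "pairing (l + l') m = pairing l m + pairing l' m" "pairing l (m + m') = pairing l m + pairing l m'"
  "pairing (- l) m = - pairing l m" "pairing l (- m) = - pairing l m" "pairing 0 m = 0" "pairing l 0 = 0"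
  by (simp_all add: pairing_def algebra_simps sum.distrib sum_negf)

text \<open>Up to a multiple of \<open>N\<close> a cyclic shift is ordinary addition. Phases and
  periodic lattice sums cannot see that multiple.\<close>

lemma shift_int:
  assumes "N \<ge> 1"
  shows "\<exists>q. (\<chi> i. int (shift N m n $ i)) = (\<chi> i. int (n $ i)) + m + (\<chi> i. int N * (q $ i))"
proof -
  have "\<exists>q. int (shift N m n $ i) = int (n $ i) + m $ i + int N * q" for i
  proof -
    have "int (shift N m n $ i) = int (n $ i div N) * int N + (int (n $ i) + m $ i) mod int N"
      using assms by (simp add: shift_def)
    also have "(int (n $ i) + m $ i) mod int N = int (n $ i) + m $ i - int N * ((int (n $ i) + m $ i) div int N)"
      by (simp add: minus_mult_div_eq_mod)
    finally show ?thesis by (intro exI[of _ "int (n $ i div N) - (int (n $ i) + m $ i) div int N"]) (simp add: algebra_simps)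
  qed
  then obtain q where "\<And>i. int (shift N m n $ i) = int (n $ i) + m $ i + int N * q i" by metis
  then show ?thesis by (intro exI[of _ "\<chi> i. q i"]) (simp add: vec_eq_iff)
qed

lemma shift_0 [simp]: "N \<ge> 1 \<Longrightarrow> shift N 0 n = n"
  by (simp add: shift_def vec_eq_iff nat_mod_as_int[symmetric] zmod_int[symmetric])

lemma shift_add:
  assumes "N \<ge> 1"
  shows "shift N m (shift N m' n) = shift N (m + m') n"
proof -
  have "(n $ i div N * N + nat ((int (n $ i) + m' $ i) mod int N)) div N = n $ i div N" for i
  proof -
    have "nat ((int (n $ i) + m' $ i) mod int N) < N"
      using assms by (simp add: nat_less_iff)
    then show ?thesis using assms by simp
  qed
  moreover have "(int (n $ i div N * N + nat ((int (n $ i) + m' $ i) mod int N)) + m $ i) mod int N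
      = (int (n $ i) + (m $ i + m' $ i)) mod int N" for i
  proof -
    have "int (n $ i div N * N + nat ((int (n $ i) + m' $ i) mod int N)) + m $ i
        = (int (n $ i) + m' $ i) mod int N + m $ i + int N * int (n $ i div N)"
      using assms by simp
    also have "\<dots> mod int N = ((int (n $ i) + m' $ i) mod int N + m $ i) mod int N"
      by (rule mod_mult_self2)
    also have "\<dots> = (int (n $ i) + m' $ i + m $ i) mod int N" by (rule mod_add_left_eq)
    finally show ?thesis by (simp add: add_ac)
  qed
  ultimately show ?thesis by (simp add: shift_def vec_eq_iff)
qed

lemma inj_shift: "N \<ge> 1 \<Longrightarrow> inj (shift N m)"
  by (rule injI) (metis shift_0 shift_add add.left_inverse)

lemma norm_phase [simp]: "cmod (phase N l n) = 1"
  by (simp add: phase_def)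

lemma phase_0 [simp]: "phase N 0 n = 1"
  by (simp add: phase_def)

lemma phase_add: "phase N (l + l') n = phase N l n * phase N l' n"
  by (simp add: phase_def cis_mult add_divide_distrib ring_distribs)

lemma phase_minus: "phase N (- l) n = cnj (phase N l n)"
  by (simp add: phase_def cis_cnj)

lemma phase_shift:
  assumes "N \<ge> 1"
  shows "phase N l (shift N m n) = phase N l n * cis (2 * pi * of_int (pairing l m) / N)"
proof -
  obtain q where q: "(\<chi> i. int (shift N m n $ i)) = (\<chi> i. int (n $ i)) + m + (\<chi> i. int N * (q $ i))"
    using shift_int[OF assms] by blast
  have "pairing l (\<chi> i. int N * (q $ i)) = int N * pairing l q"
    by (simp add: pairing_def sum_distrib_left mult_ac)
  then have "phase N l (shift N m n) = cis (2 * pi * of_int (pairing l (\<chi> i. int (n $ i))) / N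
      + 2 * pi * of_int (pairing l m) / N + 2 * pi * of_int (pairing l q))"
    unfolding phase_def q using assms by (simp add: add_divide_distrib ring_distribs mult.assoc)
  then show ?thesis by (simp add: cis_mult[symmetric] phase_def)
qed

lemma coeff_cmul [simp]: "coeff (app (cmul z) x) n = z * coeff x n"
  unfolding cmul_def by (rule coeff_wcomp[where B = "cmod z"]) auto

lemma norm_cmul: "norm (cmul z :: (nat^'d) bop) \<le> cmod z"
  unfolding cmul_def by (rule norm_wcomp) auto

lemma coeff_trans_op: "N \<ge> 1 \<Longrightarrow> coeff (app (trans_op N v) x) n = phase N (lpart v) n * coeff x (shift N (mpart v) n)"
  unfolding trans_op_def by (rule coeff_wcomp[OF inj_shift, where B = 1]) auto

lemma norm_trans_op: "N \<ge> 1 \<Longrightarrow> norm (trans_op N v) \<le> 1"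
  unfolding trans_op_def by (rule norm_wcomp[OF inj_shift]) auto

lemma bop_coeff_eqI: "(\<And>x n. coeff (app M x) n = coeff (app L x) n) \<Longrightarrow> M = L"
  by (intro bop_eqI) (simp add: coeff_inject[symmetric] fun_eq_iff)

lemma cmul_simps: "cmul (y + z) = cmul y + cmul z" "cmul (y - z) = cmul y - cmul z"
  "cmul (y * z) = cmul y * cmul z" "cmul (r *\<^sub>R z) = r *\<^sub>R cmul z" "cmul 1 = 1" "cmul 0 = 0" "cmul (- z) = - cmul z"
  by (auto intro!: bop_coeff_eqI simp: algebra_simps)

lemma cmul_trans_op: "N \<ge> 1 \<Longrightarrow> trans_op N v * cmul z = cmul z * trans_op N v"
  by (auto intro!: bop_coeff_eqI simp: coeff_trans_op)

lemma trans_op_0: "N \<ge> 1 \<Longrightarrow> trans_op N 0 = 1"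
  by (auto intro!: bop_coeff_eqI simp: coeff_trans_op)

text \<open>The phase of the right factor is evaluated at an index already shifted by the left one.
  This produces the cocycle of the Weyl commutation relation.\<close>

lemma trans_op_mult:
  "N \<ge> 1 \<Longrightarrow> trans_op N v * trans_op N v' =
    cmul (cis (2 * pi * of_int (pairing (lpart v') (mpart v)) / N)) * trans_op N (v + v')"
  by (auto intro!: bop_coeff_eqI simp: coeff_trans_op phase_shift phase_add shift_add add.commute)

text \<open>The adjoint is the opposite translation, up to the phase incurred by undoing shift and
  phase in the wrong order.\<close>

lemma inner_trans_op:
  assumes "N \<ge> 1"
  shows "app (cmul z * trans_op N v) x \<bullet> y =
    x \<bullet> app (cmul (cnj z * cis (2 * pi * of_int (pairing (lpart v) (mpart v)) / N)) * trans_op N (- v)) y"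
proof -
  have 1: "cmul z * trans_op N v = wcomp (\<lambda>n. z * phase N (lpart v) n) (shift N (mpart v))"
    using assms by (intro bop_coeff_eqI) (simp add: coeff_trans_op coeff_wcomp[OF inj_shift, where B = "cmod z"] norm_mult)
  have 2: "cmul (cnj z * cis (2 * pi * of_int (pairing (lpart v) (mpart v)) / N)) * trans_op N (- v)
     = wcomp (\<lambda>n. cnj (z * phase N (lpart v) (shift N (- mpart v) n))) (shift N (- mpart v))"
    using assms by (intro bop_coeff_eqI)
      (simp add: coeff_trans_op coeff_wcomp[OF inj_shift, where B = "cmod z"] norm_mult phase_shift phase_minus cis_cnj)
  show ?thesis unfolding 1 2
    by (rule inner_wcomp[where B = "cmod z"]) (use assms in \<open>auto simp: shift_add norm_mult\<close>)
qed

text \<open>Besides the elementary translations, the family contains multiplication by \<open>\<i>\<close>; since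
  \<open>bop\<close> consists of real-linear operators, a vanishing difference for \<open>None\<close> expresses
  complex linearity.\<close>

definition gu :: "nat \<Rightarrow> ('d + 'd) option \<Rightarrow> (nat^'d) bop" where
  "gu N j = (case j of None \<Rightarrow> cmul \<i> | Some j \<Rightarrow> trans_op N (axis j 1))"
definition gw :: "nat \<Rightarrow> ('d + 'd) option \<Rightarrow> (nat^'d) bop" where
  "gw N j = (case j of None \<Rightarrow> cmul (- \<i>) | Some j \<Rightarrow> trans_op N (- axis j 1))"

lemma parts_axis [simp]:
  "lpart (axis (Inl i) 1) = axis i 1" "mpart (axis (Inl i) 1) = 0"
  "lpart (axis (Inr i) 1) = 0" "mpart (axis (Inr i) 1) = axis i 1"
  by (simp_all add: lpart_def mpart_def axis_def vec_eq_iff)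

lemma pairing_axis_unit [simp]: "pairing (axis i 1) m = m $ i" "pairing l (axis i 1) = l $ i"
  by (simp_all add: pairing_def axis_def mult_delta_left mult_delta_right)

lemma pairing_axis: "pairing (lpart (axis j 1)) (mpart (axis j 1)) = 0"
  by (cases j) simp_all

text \<open>The bracket is the symplectic pairing of \<open>v\<close> with a unit vector, the
  exponent in the Weyl relation. For fixed integer \<open>s\<close>,
  \<open>real N * (cis (2 * pi * s / N) - 1)\<close> tends to \<open>2 * pi * \<i> * s\<close>, the
  Fourier multiplier of a derivative. Scalars commute with all terms of a quantization, whence 0 for
  \<open>None\<close>.\<close>

definition dcoeff :: "nat \<Rightarrow> ('d::finite + 'd) option \<Rightarrow> (int^('d + 'd) \<Rightarrow> complex) \<Rightarrow> int^('d + 'd) \<Rightarrow> complex" where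
  "dcoeff N j c v = (case j of None \<Rightarrow> 0 | Some j \<Rightarrow>
     real N * (cis (2 * pi * of_int (pairing (lpart v) (mpart (axis j 1)) - pairing (lpart (axis j 1)) (mpart v)) / N) - 1) * c v)"

text \<open>The rescaled phase difference is at most \<open>2 * pi * \<bar>s\<bar>\<close> for every
  \<open>N\<close>. This dictates the weight \<open>1 + 2 * pi * l1 v\<close>: one power of it
  absorbs one difference.\<close>

lemma norm_dcoeff:
  assumes "N \<ge> 1"
  shows "cmod (dcoeff N j c v) \<le> cmod (c v) * (1 + 2 * pi * l1 v)"
proof (cases j)
  case (Some j)
  define s where "s = pairing (lpart v) (mpart (axis j 1)) - pairing (lpart (axis j 1)) (mpart v)"
  have "\<bar>of_int s\<bar> \<le> l1 v"
  proof (cases j)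
    case (Inl i)
    have "\<bar>of_int s\<bar> = \<bar>real_of_int (v $ Inr i)\<bar>" by (simp add: s_def Inl) (simp add: mpart_def)
    also have "\<dots> \<le> l1 v" unfolding l1_def by (rule member_le_sum) auto
    finally show ?thesis .
  next
    case (Inr i)
    have "\<bar>of_int s\<bar> = \<bar>real_of_int (v $ Inl i)\<bar>" by (simp add: s_def Inr) (simp add: lpart_def)
    also have "\<dots> \<le> l1 v" unfolding l1_def by (rule member_le_sum) auto
    finally show ?thesis .
  qed
  then have "2 * pi * \<bar>of_int s\<bar> \<le> 1 + 2 * pi * l1 v"
    by (intro order_trans[OF mult_left_mono[of "\<bar>of_int s\<bar>" "l1 v" "2 * pi"]]) auto
  moreover have "N * cmod (cis (2 * pi * of_int s / N) - 1) \<le> 2 * pi * \<bar>of_int s\<bar>"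
  proof -
    have "N * cmod (cis (2 * pi * of_int s / N) - 1) \<le> N * \<bar>2 * pi * of_int s / N\<bar>"
      by (intro mult_left_mono norm_cis_minus_1_le) auto
    then show ?thesis using assms by (simp add: abs_mult)
  qed
  ultimately have "N * cmod (cis (2 * pi * of_int s / N) - 1) * cmod (c v) \<le> (1 + 2 * pi * l1 v) * cmod (c v)"
    by (intro mult_right_mono) auto
  then show ?thesis using assms unfolding dcoeff_def Some option.case s_def[symmetric]
    by (simp add: norm_mult mult_ac)
next
  case None
  have "0 \<le> l1 v" by (simp add: l1_def sum_nonneg)
  then show ?thesis by (simp add: dcoeff_def None)
qed

definition Op :: "nat \<Rightarrow> (int^('d + 'd) \<Rightarrow> complex) \<Rightarrow> (nat^'d::finite) bop" where
  "Op N c = (\<Sum>\<^sub>\<infinity>v. cmul (c v) * trans_op N v)"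

text \<open>A weighted Wiener norm of the symbol; it takes the place of a \<open>k\<close>-th
  derivative norm and does not depend on \<open>N\<close>.\<close>

definition wsum :: "nat \<Rightarrow> (int^'n \<Rightarrow> complex) \<Rightarrow> real" where
  "wsum k c = (\<Sum>\<^sub>\<infinity>v. cmod (c v) * (1 + 2 * pi * l1 v) ^ k)"

definition rapid :: "(int^'n \<Rightarrow> complex) \<Rightarrow> bool" where
  "rapid c \<longleftrightarrow> (\<forall>k. (\<lambda>v. cmod (c v) * (1 + 2 * pi * l1 v) ^ k) summable_on UNIV)"

section \<open>Rapidly decaying coefficients and convergence of the operator series\<close>

lemma l1_nonneg: "0 \<le> l1 v"
  by (simp add: l1_def sum_nonneg)

lemma weight_ge_1: "1 \<le> 1 + 2 * pi * l1 v"
  using l1_nonneg[of v] by simp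

lemma rapid_abs_summable:
  assumes "rapid c"
  shows "(\<lambda>v. cmod (c v)) summable_on UNIV"
  using assms[unfolded rapid_def, rule_format, of 0] by simp

lemma rapid_mono:
  assumes "rapid c" and "\<And>v. cmod (b v) \<le> cmod (c v) * (B * (1 + 2 * pi * l1 v) ^ r)"
  shows "rapid b"
  unfolding rapid_def
proof
  fix k
  have "(\<lambda>v. B * (cmod (c v) * (1 + 2 * pi * l1 v) ^ (r + k))) summable_on UNIV"
    using assms(1) unfolding rapid_def by (intro summable_on_cmult_right) auto
  then show "(\<lambda>v. cmod (b v) * (1 + 2 * pi * l1 v) ^ k) summable_on UNIV"
  proof (rule summable_on_comparison_test)
    fix v :: "int^'a"
    show "cmod (b v) * (1 + 2 * pi * l1 v) ^ k \<le> B * (cmod (c v) * (1 + 2 * pi * l1 v) ^ (r + k))"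
      using mult_right_mono[OF assms(2)[of v], of "(1 + 2 * pi * l1 v) ^ k"] weight_ge_1[of v]
      by (simp add: power_add mult_ac)
    show "0 \<le> cmod (b v) * (1 + 2 * pi * l1 v) ^ k" using weight_ge_1[of v] by simp
  qed
qed

lemma rapid_dcoeff: "N \<ge> 1 \<Longrightarrow> rapid c \<Longrightarrow> rapid (dcoeff N j c)"
  by (rule rapid_mono[of c _ 1 1]) (auto simp: norm_dcoeff)

lemma wsum_dcoeff:
  assumes "N \<ge> 1" and "rapid c"
  shows "wsum k (dcoeff N j c) \<le> wsum (Suc k) c"
  unfolding wsum_def
proof (rule infsum_mono)
  show "(\<lambda>v. cmod (dcoeff N j c v) * (1 + 2 * pi * l1 v) ^ k) summable_on UNIV"
    using rapid_dcoeff[OF assms] by (simp add: rapid_def)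
  show "(\<lambda>v. cmod (c v) * (1 + 2 * pi * l1 v) ^ Suc k) summable_on UNIV"
    using assms(2) unfolding rapid_def by blast
  show "cmod (dcoeff N j c v) * (1 + 2 * pi * l1 v) ^ k \<le> cmod (c v) * (1 + 2 * pi * l1 v) ^ Suc k" for v
    using mult_right_mono[OF norm_dcoeff[OF assms(1), of j c v], of "(1 + 2 * pi * l1 v) ^ k"] weight_ge_1[of v]
    by (simp add: mult_ac)
qed

lemma wsum_mono: "rapid c \<Longrightarrow> k \<le> l \<Longrightarrow> wsum k c \<le> wsum l c"
  unfolding wsum_def by (rule infsum_mono) (auto simp: rapid_def intro!: mult_left_mono power_increasing weight_ge_1)

lemma wsum_nonneg: "0 \<le> wsum k c"
  unfolding wsum_def by (intro infsum_nonneg mult_nonneg_nonneg zero_le_power norm_ge_zero order_trans[OF zero_le_one weight_ge_1])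

lemma norm_Op_term: "N \<ge> 1 \<Longrightarrow> norm (cmul z * trans_op N v) \<le> cmod z"
  using norm_mult_ineq[of "cmul z" "trans_op N v"] mult_mono[OF norm_cmul[of z] norm_trans_op[of N v]]
  by (auto intro: order_trans)

lemma summable_Op:
  assumes "N \<ge> 1" and "rapid c"
  shows "(\<lambda>v. norm (cmul (c v) * trans_op N v)) summable_on UNIV"
    and "(\<lambda>v. cmul (c v) * trans_op N v) summable_on UNIV"
proof -
  show "(\<lambda>v. norm (cmul (c v) * trans_op N v)) summable_on UNIV"
    by (rule Infinite_Sum.abs_summable_on_comparison_test'[OF rapid_abs_summable[OF assms(2)]])
      (rule norm_Op_term[OF assms(1)])
  then show "(\<lambda>v. cmul (c v) * trans_op N v) summable_on UNIV"
    by (rule abs_summable_summable)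
qed

lemma norm_infsum_le_infsum:
  fixes f :: "'a \<Rightarrow> 'b::banach"
  assumes "\<And>x. norm (f x) \<le> g x" and "g summable_on UNIV"
  shows "norm (infsum f UNIV) \<le> infsum g UNIV"
proof -
  have s: "(\<lambda>x. norm (f x)) summable_on UNIV"
    by (rule Infinite_Sum.abs_summable_on_comparison_test'[OF assms(2)]) (rule assms(1))
  have "norm (infsum f UNIV) \<le> (\<Sum>\<^sub>\<infinity>x. norm (f x))" by (rule norm_infsum_bound[OF s])
  also have "\<dots> \<le> infsum g UNIV" by (rule infsum_mono[OF s assms(2)]) (rule assms(1))
  finally show ?thesis .
qed

lemma norm_Op:
  assumes "N \<ge> 1" and "rapid c"
  shows "norm (Op N c) \<le> wsum 0 c"
  unfolding Op_def wsum_def using assms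
  by (intro norm_infsum_le_infsum) (auto simp: norm_Op_term rapid_abs_summable)

lemma Op_add:
  assumes "N \<ge> 1" and "rapid b" and "rapid c"
  shows "Op N (\<lambda>v. b v + c v) = Op N b + Op N c"
  unfolding Op_def using assms by (simp add: cmul_simps distrib_right infsum_add summable_Op)

lemma Op_scale:
  assumes "N \<ge> 1" and "rapid c"
  shows "Op N (\<lambda>v. z * c v) = cmul z * Op N c" and "cmul z * Op N c = Op N c * cmul z"
proof -
  have "cmul z * Op N c = (\<Sum>\<^sub>\<infinity>v. cmul z * (cmul (c v) * trans_op N v))"
    unfolding Op_def by (rule infsum_bounded_linear[OF bounded_linear_mult_right summable_Op(2)[OF assms], symmetric])
  then show 1: "Op N (\<lambda>v. z * c v) = cmul z * Op N c"
    by (simp add: Op_def cmul_simps mult.assoc)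
  have "Op N c * cmul z = (\<Sum>\<^sub>\<infinity>v. cmul (c v) * trans_op N v * cmul z)"
    unfolding Op_def by (rule infsum_bounded_linear[OF bounded_linear_mult_left summable_Op(2)[OF assms], symmetric])
  then show "cmul z * Op N c = Op N c * cmul z"
    unfolding 1[symmetric] by (simp add: Op_def cmul_simps mult.assoc cmul_trans_op[OF assms(1)])
      (simp add: mult.assoc[symmetric] cmul_simps(3)[symmetric] mult.commute)
qed

lemma coeff_Op:
  assumes "N \<ge> 1" and "rapid c"
  shows "coeff (app (Op N c) x) n = (\<Sum>\<^sub>\<infinity>v. c v * phase N (lpart v) n * coeff x (shift N (mpart v) n))"
proof -
  have bl: "bounded_linear (\<lambda>M. coeff (app M x) n)"
    by (rule bounded_linear_compose[OF bounded_linear_coeff bounded_linear_app_left])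
  show ?thesis unfolding Op_def
    by (subst infsum_bounded_linear[OF bl summable_Op(2)[OF assms], symmetric])
      (simp add: coeff_trans_op[OF assms(1)] mult.assoc)
qed

text \<open>The adjoint sends the term at \<open>v\<close> to a multiple of the translation by
  \<open>- v\<close>; the hypothesis on \<open>c\<close> makes it minus the term at
  \<open>- v\<close>, and the substitution of \<open>- v\<close> for \<open>v\<close>
  finishes.\<close>

lemma Op_skew:
  assumes N: "N \<ge> 1" and c: "rapid c"
    and skew: "\<And>v. c (- v) = - cnj (c v) * cis (2 * pi * of_int (pairing (lpart v) (mpart v)) / N)"
  shows "app (Op N c) x \<bullet> y = - (x \<bullet> app (Op N c) y)"
proof -
  have bl: "bounded_linear (\<lambda>M. app M x \<bullet> y)" "bounded_linear (\<lambda>M. x \<bullet> app M y)"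
    by (intro bounded_linear_inner_left_comp bounded_linear_inner_right_comp bounded_linear_app_left)+
  have "app (Op N c) x \<bullet> y = (\<Sum>\<^sub>\<infinity>v. app (cmul (c v) * trans_op N v) x \<bullet> y)"
    unfolding Op_def by (rule infsum_bounded_linear[OF bl(1) summable_Op(2)[OF N c], symmetric])
  also have "\<dots> = (\<Sum>\<^sub>\<infinity>v. - (x \<bullet> app (cmul (c (- v)) * trans_op N (- v)) y))"
  proof (rule infsum_cong)
    fix v
    have "cnj (c v) * cis (2 * pi * of_int (pairing (lpart v) (mpart v)) / N) = - c (- v)" by (simp add: skew)
    then show "app (cmul (c v) * trans_op N v) x \<bullet> y = - (x \<bullet> app (cmul (c (- v)) * trans_op N (- v)) y)"
      unfolding inner_trans_op[OF N] by (simp add: cmul_simps)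
  qed
  also have "\<dots> = (\<Sum>\<^sub>\<infinity>v. - (x \<bullet> app (cmul (c v) * trans_op N v) y))"
    by (rule infsum_reindex_bij_betw[of uminus UNIV UNIV]) (metis bij_betw_def inj_onI neg_equal_iff_equal surj_def minus_minus)
  also have "\<dots> = - (x \<bullet> app (Op N c) y)"
    unfolding Op_def infsum_uminus by (subst infsum_bounded_linear[OF bl(2) summable_Op(2)[OF N c], symmetric]) simp
  finally show ?thesis .
qed

text \<open>The parameter \<open>dim\<close> ties the type variable \<open>'d\<close> to the
  locale.\<close>

locale quantized =
  fixes N :: nat and dim :: "'d::finite itself"
  assumes N: "N \<ge> 1"

sublocale quantized \<subseteq> difference_calculus "real N" "gu N :: ('d + 'd) option \<Rightarrow> (nat^'d) bop" "gw N"
proof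
  show "1 \<le> real N" using N by simp
  fix j :: "('d + 'd) option"
  show "gw N j * gu N j = 1"
  proof (cases j)
    case None
    then show ?thesis by (auto intro!: bop_coeff_eqI simp: gu_def gw_def)
  next
    case (Some i)
    then show ?thesis by (simp add: gu_def gw_def trans_op_mult[OF N] pairing_axis trans_op_0[OF N] cmul_simps(5))
  qed
  show "norm (gu N j) \<le> 1" "norm (gw N j) \<le> 1"
    using norm_cmul[of \<i>] norm_cmul[of "- \<i>"] by (cases j; simp add: gu_def gw_def norm_trans_op[OF N])+
qed

section \<open>Quantizations within the difference calculus\<close>

context quantized
begin

abbreviation opN :: "(int^('d + 'd) \<Rightarrow> complex) \<Rightarrow> (nat^'d) bop" where "opN \<equiv> Op N"

text \<open>Translations are eigenvectors of conjugation by an elementary translation, because the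
  two cocycles combine to a scalar; \<open>dcoeff\<close> records the rescaled eigenvalue minus
  one.\<close>

lemma D_term: "D j (cmul (c v) * trans_op N v) = cmul (dcoeff N j c v) * trans_op N v"
proof (cases j)
  case None
  have "gu N j * (cmul (c v) * trans_op N v) * gw N j = cmul (\<i> * (c v * (- \<i>))) * trans_op N v"
    unfolding gu_def gw_def None option.case cmul_simps(3) mult.assoc cmul_trans_op[OF N] ..
  also have "\<i> * (c v * (- \<i>)) = c v" by (simp add: complex_eq_iff)
  finally have "gu N j * (cmul (c v) * trans_op N v) * gw N j = cmul (c v) * trans_op N v" .
  then show ?thesis by (simp add: D_def dcoeff_def None cmul_simps(6))
next
  case (Some j')
  define p where "p = cis (2 * pi * of_int (pairing (lpart v) (mpart (axis j' 1)) - pairing (lpart (axis j' 1)) (mpart v)) / N)"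
  have "gu N j * (cmul (c v) * trans_op N v) * gw N j = cmul (c v) * (trans_op N (axis j' 1) * trans_op N v * trans_op N (- axis j' 1))"
    unfolding gu_def gw_def Some option.case by (simp only: mult.assoc[symmetric] cmul_trans_op[OF N])
  also have "trans_op N (axis j' 1) * trans_op N v * trans_op N (- axis j' 1) = cmul p * trans_op N v"
    unfolding p_def trans_op_mult[OF N] mult.assoc
    by (simp add: mult.assoc[symmetric] cmul_simps(3)[symmetric] cis_mult pairing_axis ring_distribs add_divide_distrib diff_divide_distrib)
  finally have "gu N j * (cmul (c v) * trans_op N v) * gw N j = cmul (p * c v) * trans_op N v"
    by (simp add: mult.assoc[symmetric] cmul_simps(3)[symmetric] mult.commute)
  moreover have "dcoeff N j c v = real N *\<^sub>R (p * c v - c v)"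
    unfolding dcoeff_def Some option.case p_def[symmetric] by (simp add: scaleR_conv_of_real algebra_simps)
  ultimately show ?thesis
    unfolding D_def by (simp only: cmul_simps(2,4) left_diff_distrib mult_scaleR_left)
qed

lemma bounded_linear_D: "bounded_linear (D j)"
  by (rule bounded_linear_intro[of _ "2 * real N"]) (auto simp: D_linear mult.commute intro: D_bounded[THEN order_trans])

lemma D_Op:
  assumes "rapid c"
  shows "D j (opN c) = opN (dcoeff N j c)"
  unfolding Op_def
  by (subst infsum_bounded_linear[OF bounded_linear_D summable_Op(2)[OF N assms], symmetric])
    (simp only: D_term)

lemma sob_Op:
  assumes "rapid c"
  shows "sob k (opN c) \<le> (1 + J) ^ k * wsum k c"
  using assms
proof (induction k arbitrary: c)
  case (Suc k)
  define B where "B = (1 + J) ^ k * wsum (Suc k) c"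
  have J1: "0 \<le> (1 + J) ^ k" using J_nonneg by simp
  have "sob k (opN c) \<le> B"
    unfolding B_def by (rule order_trans[OF Suc.IH[OF Suc.prems]]) (intro mult_left_mono J1 wsum_mono Suc.prems, simp)
  moreover have "sob k (D j (opN c)) \<le> B" for j
    unfolding D_Op[OF Suc.prems] B_def
    by (rule order_trans[OF Suc.IH[OF rapid_dcoeff[OF N Suc.prems]]]) (intro mult_left_mono J1 wsum_dcoeff N Suc.prems)
  then have "(\<Sum>j\<in>UNIV. sob k (D j (opN c))) \<le> (\<Sum>j\<in>(UNIV :: ('d + 'd) option set). B)" by (intro sum_mono)
  ultimately have "sob (Suc k) (opN c) \<le> (1 + J) * B" by (simp add: J_def algebra_simps)
  then show ?case by (simp add: B_def mult_ac del: sob.simps)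
qed (simp add: norm_Op[OF N])

lemma comm_bound_trans_op: "comm_bound (l1 v) (trans_op N v)"
proof (induction "nat (\<Sum>i\<in>UNIV. \<bar>v $ i\<bar>)" arbitrary: v rule: less_induct)
  case less
  show ?case
  proof (cases "v = 0")
    case True
    then show ?thesis using comm_bound_1 by (simp add: trans_op_0[OF N] l1_def)
  next
    case False
    then obtain j where j: "v $ j \<noteq> 0" by (auto simp: vec_eq_iff)
    define s where "s = sgn (v $ j)"
    have s: "s = 1 \<or> s = - 1" "\<bar>v $ j - s\<bar> = \<bar>v $ j\<bar> - 1" using j by (auto simp: s_def sgn_if)
    define e where "e = (\<chi> i. if i = j then s else 0)"
    define v' where "v' = v - e"
    have e: "e = axis j 1 \<or> e = - axis j 1" using s(1) by (auto simp: e_def axis_def vec_eq_iff)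
    have ve: "\<bar>v' $ i\<bar> = \<bar>v $ i\<bar> - (if i = j then 1 else 0)" for i using s(2) by (simp add: v'_def e_def)
    have sum: "(\<Sum>i\<in>UNIV. \<bar>v' $ i\<bar>) = (\<Sum>i\<in>UNIV. \<bar>v $ i\<bar>) - 1"
      by (simp add: ve sum_subtractf)
    have "0 < (\<Sum>i\<in>UNIV. \<bar>v $ i\<bar>)" by (rule sum_pos2[of _ j]) (use j in auto)
    then have "comm_bound (l1 v') (trans_op N v')"
      by (intro less) (simp add: sum)
    moreover have "comm_bound 1 (trans_op N e)"
      using comm_bound_u[of "Some j"] comm_bound_w[of "Some j"] e by (auto simp: gu_def gw_def)
    ultimately have cb: "comm_bound (l1 v' + 1) (trans_op N v' * trans_op N e)"
      by (rule comm_bound_mult)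
    have l1: "l1 v' + 1 = l1 v"
      using arg_cong[OF sum, of real_of_int] by (simp add: l1_def)
    \<comment> \<open>The unit step is split off on the side where the cocycle is trivial. A scalar
      factor would matter here, since \<open>X\<close> need not commute with
      \<open>cmul\<close>.\<close>
    consider i where "j = Inl i" | i where "j = Inr i" by (cases j) auto
    then show ?thesis
    proof cases
      case (1 i)
      have "mpart e = 0" by (simp add: mpart_def e_def 1 vec_eq_iff)
      then have "trans_op N e * trans_op N v' = trans_op N v"
        by (simp add: trans_op_mult[OF N] cmul_simps v'_def)
      moreover have "comm_bound (1 + l1 v') (trans_op N e * trans_op N v')"
        using \<open>comm_bound 1 (trans_op N e)\<close> \<open>comm_bound (l1 v') (trans_op N v')\<close> by (rule comm_bound_mult)
      ultimately show ?thesis using l1 by (simp add: add.commute)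
    next
      case (2 i)
      have "lpart e = 0" by (simp add: lpart_def e_def 2 vec_eq_iff)
      then have "trans_op N v' * trans_op N e = trans_op N v"
        by (simp add: trans_op_mult[OF N] cmul_simps v'_def)
      then show ?thesis using cb l1 by simp
    qed
  qed
qed

text \<open>Real scalars commute with every \<open>X\<close>, so only the imaginary part
  contributes, through the difference for \<open>None\<close>.\<close>

lemma commutator_cmul: "real N * norm (commutator (cmul z) X) \<le> cmod z * (\<Sum>j\<in>UNIV. norm (D j X))"
proof -
  have "cmul z = cmul (Re z *\<^sub>R 1 + Im z *\<^sub>R \<i>)"
    by (rule arg_cong[of _ _ cmul]) (simp add: complex_eq_iff)
  also have "\<dots> = Re z *\<^sub>R 1 + Im z *\<^sub>R gu N (None :: ('d + 'd) option)"
    unfolding gu_def option.case cmul_simps(1,4,5) ..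
  finally have "cmul z = Re z *\<^sub>R 1 + Im z *\<^sub>R gu N (None :: ('d + 'd) option)" .
  then have "commutator (cmul z) X = Im z *\<^sub>R commutator (gu N (None :: ('d + 'd) option)) X"
    by (simp only:) (simp add: commutator_def algebra_simps)
  then have "real N * norm (commutator (cmul z) X) = \<bar>Im z\<bar> * (real N * norm (commutator (gu N None) X))"
    by simp
  also have "\<dots> \<le> cmod z * (1 * (\<Sum>j\<in>UNIV. norm (D j X)))"
    by (rule mult_mono) (use comm_bound_u[of None] in \<open>auto simp: comm_bound_def abs_Im_le_cmod\<close>)
  finally show ?thesis by simp
qed

text \<open>The scalar contributes 1 and the translation \<open>l1 v\<close>; enlarging the sum to
  \<open>1 + 2 * pi * l1 v\<close> reuses the weight of \<open>wsum\<close>.\<close>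

lemma commutator_Op_term:
  "real N * norm (commutator (cmul z * trans_op N v) X) \<le> cmod z * (1 + 2 * pi * l1 v) * (\<Sum>j\<in>UNIV. norm (D j X))"
proof -
  define S where "S = (\<Sum>j\<in>UNIV. norm (D j X))"
  have S: "0 \<le> S" by (simp add: S_def sum_nonneg)
  have cb: "real N * norm (commutator (trans_op N v) X) \<le> l1 v * S" "norm (trans_op N v) \<le> 1"
    using comm_bound_trans_op[of v] by (auto simp: comm_bound_def S_def)
  have "commutator (cmul z * trans_op N v) X = cmul z * commutator (trans_op N v) X + commutator (cmul z) X * trans_op N v"
    by (simp add: commutator_def algebra_simps)
  then have "norm (commutator (cmul z * trans_op N v) X) \<le> norm (cmul z :: (nat^'d) bop) * norm (commutator (trans_op N v) X)
      + norm (commutator (cmul z) X) * norm (trans_op N v)"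
    using norm_triangle_le norm_mult_ineq add_mono by (metis (no_types, lifting))
  also have "\<dots> \<le> cmod z * norm (commutator (trans_op N v) X) + norm (commutator (cmul z) X)"
    using cb by (intro add_mono mult_right_mono mult_right_le_one_le norm_cmul) auto
  finally have "real N * norm (commutator (cmul z * trans_op N v) X)
    \<le> cmod z * (real N * norm (commutator (trans_op N v) X)) + real N * norm (commutator (cmul z) X)"
    using N by (simp add: mult_left_mono distrib_left[symmetric] mult.left_commute)
  also have "\<dots> \<le> cmod z * (l1 v * S) + cmod z * S"
    using cb commutator_cmul[of z X] by (intro add_mono mult_left_mono) (auto simp: S_def)
  also have "\<dots> = cmod z * (1 + l1 v) * S" by (simp add: algebra_simps)
  also have "\<dots> \<le> cmod z * (1 + 2 * pi * l1 v) * S"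
  proof -
    have "1 * l1 v \<le> 2 * pi * l1 v" using pi_ge_two by (intro mult_right_mono l1_nonneg) auto
    then show ?thesis using S by (intro mult_right_mono mult_left_mono) auto
  qed
  finally show ?thesis by (simp add: S_def)
qed

text \<open>The factor \<open>real N\<close> in front of the quantization is offset by the
  \<open>real N\<close> built into \<open>D\<close>, so summation over the frequencies leaves a
  constant free of \<open>N\<close>.\<close>

lemma gen_bound_Op:
  assumes "rapid c"
  shows "gen_bound (wsum 1 c) (real N *\<^sub>R opN c)"
  unfolding gen_bound_def
proof (intro conjI allI)
  have "norm (opN c) \<le> wsum 1 c"
    by (rule order_trans[OF norm_Op[OF N assms]]) (rule wsum_mono[OF assms]; simp)
  then show "norm (real N *\<^sub>R opN c) \<le> wsum 1 c * real N"
    by (simp add: mult.commute mult_left_mono)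
  fix X :: "(nat^'d) bop"
  define S where "S = (\<Sum>j\<in>UNIV. norm (D j X))"
  have bl: "bounded_linear (\<lambda>K. real N *\<^sub>R commutator K X)"
    unfolding commutator_def
    by (intro bounded_linear_scaleR_right[THEN bounded_linear_compose] bounded_linear_sub bounded_linear_mult_left bounded_linear_mult_right)
  have "commutator (real N *\<^sub>R opN c) X = real N *\<^sub>R commutator (opN c) X"
    by (simp add: commutator_def algebra_simps)
  also have "\<dots> = (\<Sum>\<^sub>\<infinity>v. real N *\<^sub>R commutator (cmul (c v) * trans_op N v) X)"
    unfolding Op_def by (rule infsum_bounded_linear[OF bl summable_Op(2)[OF N assms], symmetric])
  also have "norm \<dots> \<le> (\<Sum>\<^sub>\<infinity>v. cmod (c v) * (1 + 2 * pi * l1 v) ^ 1 * S)"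
  proof (rule norm_infsum_le_infsum)
    show "norm (real N *\<^sub>R commutator (cmul (c v) * trans_op N v) X) \<le> cmod (c v) * (1 + 2 * pi * l1 v) ^ 1 * S" for v
      using commutator_Op_term[of "c v" v X] by (simp add: S_def)
    show "(\<lambda>v. cmod (c v) * (1 + 2 * pi * l1 v) ^ 1 * S) summable_on UNIV"
      using assms unfolding rapid_def by (intro summable_on_cmult_left) blast
  qed
  also have "\<dots> = wsum 1 c * S"
    unfolding wsum_def by (rule infsum_cmult_left')
  finally show "norm (commutator (real N *\<^sub>R opN c) X) \<le> wsum 1 c * (\<Sum>j\<in>UNIV. norm (D j X))"
    by (simp add: S_def)
qed

lemma gen_bound_weaken: "gen_bound \<kappa> K \<Longrightarrow> \<kappa> \<le> \<kappa>' \<Longrightarrow> gen_bound \<kappa>' K"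
  unfolding gen_bound_def
  by (auto intro!: order_trans[OF _ mult_right_mono[of \<kappa> \<kappa>']] sum_nonneg)

text \<open>The commutator bound takes one power of the weight and each difference of the generator
  another, hence \<open>Suc k\<close>.\<close>

lemma gen_Op:
  assumes "rapid c" and "wsum (Suc k) c \<le> \<kappa>"
  shows "gen k \<kappa> (real N *\<^sub>R opN c)"
  using assms
proof (induction k arbitrary: c)
  case 0
  then show ?case using gen_bound_weaken[OF gen_bound_Op] by simp
next
  case (Suc k)
  have "gen_bound \<kappa> (real N *\<^sub>R opN c)"
    using Suc.prems wsum_mono[OF Suc.prems(1), of 1 "Suc (Suc k)"]
    by (intro gen_bound_weaken[OF gen_bound_Op]) auto
  moreover have "gen k \<kappa> (D j (real N *\<^sub>R opN c))" for j
    unfolding D_linear D_Op[OF Suc.prems(1)]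
    using wsum_dcoeff[OF N Suc.prems(1), of "Suc k" j] Suc.prems
    by (intro Suc.IH rapid_dcoeff N) auto
  ultimately show ?case by simp
qed

end

section \<open>Fourier series of smooth periodic functions\<close>

lemma smooth_has_derivative:
  assumes "smooth f"
  shows "(directional_derivs vs f has_derivative (\<lambda>h. directional_derivs (h # vs) f x)) (at x)"
proof -
  have "directional_derivs vs f differentiable (at x)"
    using assms by (auto simp: smooth_def differentiable_on_def)
  then show ?thesis by (simp add: frechet_derivative_works[symmetric])
qed

lemma directional_derivs_Cons_eq:
  assumes "\<And>x. (directional_derivs vs f has_derivative f' x) (at x)"
  shows "directional_derivs (v # vs) f = (\<lambda>x. f' x v)"
  using frechet_derivative_at[OF assms] by (simp add: fun_eq_iff)

lemma directional_derivs_append: "directional_derivs (vs @ ws) f = directional_derivs vs (directional_derivs ws f)"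
  by (induction vs) auto

lemma class_directional_derivs:
  assumes "P f"
    and step: "\<And>f. P f \<Longrightarrow> \<exists>f'. (\<forall>x. (f has_derivative f' x) (at x)) \<and> (\<forall>v. P (\<lambda>x. f' x v))"
  shows "P (directional_derivs vs f)"
proof (induction vs)
  case (Cons v vs)
  from step[OF Cons] obtain f' where f': "\<And>x. (directional_derivs vs f has_derivative f' x) (at x)" "\<And>v. P (\<lambda>x. f' x v)"
    by blast
  show ?case using f'(2) directional_derivs_Cons_eq[OF f'(1)] by simp
qed (simp add: assms(1))

text \<open>Closure of a class under directional derivatives replaces any formula for iterated
  derivatives. A proof of smoothness then amounts to choosing a suitable class
  \<open>P\<close>.\<close>

lemma smooth_coinduct:
  assumes "P f"
    and step: "\<And>f. P f \<Longrightarrow> \<exists>f'. (\<forall>x. (f has_derivative f' x) (at x)) \<and> (\<forall>v. P (\<lambda>x. f' x v))"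
  shows "smooth f"
  unfolding smooth_def differentiable_on_def
proof (intro allI ballI)
  fix vs x
  have "P (directional_derivs vs f)" using class_directional_derivs[of P, OF assms] .
  from step[OF this] show "directional_derivs vs f differentiable at x within UNIV"
    unfolding differentiable_def by auto
qed

lemma smooth_directional_derivs: "smooth f \<Longrightarrow> smooth (directional_derivs vs f)"
  unfolding smooth_def by (metis directional_derivs_append)

lemma directional_derivs_translate:
  assumes "smooth f"
  shows "directional_derivs vs (\<lambda>x. f (x + a)) = (\<lambda>x. directional_derivs vs f (x + a))"
proof (induction vs)
  case (Cons v vs)
  have "((\<lambda>x. directional_derivs vs f (x + a)) has_derivative (\<lambda>h. directional_derivs (h # vs) f (x + a))) (at x)" for x
  proof -
    have "((\<lambda>x. x + a) has_derivative (\<lambda>h. h)) (at x)"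
      by (auto intro!: derivative_eq_intros)
    from has_derivative_compose[OF this smooth_has_derivative[OF assms, of vs "x + a"]]
    show ?thesis by simp
  qed
  with Cons show ?case by (intro directional_derivs_Cons_eq) simp
qed simp

lemma directional_derivs_diff:
  assumes "smooth f" and "smooth g"
  shows "directional_derivs vs (\<lambda>x. f x - g x) = (\<lambda>x. directional_derivs vs f x - directional_derivs vs g x)"
proof (induction vs)
  case (Cons v vs)
  have "((\<lambda>x. directional_derivs vs f x - directional_derivs vs g x) has_derivative
      (\<lambda>h. directional_derivs (h # vs) f x - directional_derivs (h # vs) g x)) (at x)" for x
    by (intro has_derivative_diff smooth_has_derivative assms)
  with Cons show ?case by (intro directional_derivs_Cons_eq) simp
qed simp

lemma smooth_translate: "smooth f \<Longrightarrow> smooth (\<lambda>x. f (x + a))"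
proof (rule smooth_coinduct[where P = "\<lambda>g. \<exists>f. smooth f \<and> g = (\<lambda>x. f (x + a))"])
  fix g assume "\<exists>f. smooth f \<and> g = (\<lambda>x. f (x + a))"
  then obtain f where f: "smooth f" "g = (\<lambda>x. f (x + a))" by blast
  have "(g has_derivative (\<lambda>h. directional_derivs [h] f (x + a))) (at x)" for x
  proof -
    have "((\<lambda>x. x + a) has_derivative (\<lambda>h. h)) (at x)"
      by (auto intro!: derivative_eq_intros)
    from has_derivative_compose[OF this smooth_has_derivative[OF f(1), of "[]" "x + a"]]
    show ?thesis by (simp add: f(2))
  qed
  then show "\<exists>f'. (\<forall>x. (g has_derivative f' x) (at x)) \<and> (\<forall>v. \<exists>f. smooth f \<and> (\<lambda>x. f' x v) = (\<lambda>x. f (x + a)))"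
    using smooth_directional_derivs[OF f(1)]
    by (intro exI[of _ "\<lambda>x h. directional_derivs [h] f (x + a)"]) blast
qed blast

lemma smooth_diff: "smooth f \<Longrightarrow> smooth g \<Longrightarrow> smooth (\<lambda>x. f x - g x)"
  unfolding smooth_def[of "\<lambda>x. f x - g x"]
  by (auto simp: directional_derivs_diff smooth_def intro: differentiable_on_diff)

lemma onorm_scaleR_right_le: "onorm (\<lambda>h. h *\<^sub>R w) \<le> norm w"
  by (rule onorm_le) (simp add: mult.commute)

lemma smooth_has_vector_derivative:
  assumes "smooth u"
  shows "((\<lambda>s. u (x + s *\<^sub>R v)) has_vector_derivative directional_derivs [v] u (x + s *\<^sub>R v)) (at s)"
proof -
  have "((\<lambda>s. x + s *\<^sub>R v) has_derivative (\<lambda>h. h *\<^sub>R v)) (at s)"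
    by (auto intro!: derivative_eq_intros)
  from has_derivative_compose[OF this smooth_has_derivative[OF assms, of "[]" "x + s *\<^sub>R v"]]
  have "((\<lambda>s. u (x + s *\<^sub>R v)) has_derivative (\<lambda>h. directional_derivs [h *\<^sub>R v] u (x + s *\<^sub>R v))) (at s)" by simp
  moreover have "directional_derivs [h *\<^sub>R v] u y = h *\<^sub>R directional_derivs [v] u y" for h y
    using has_derivative_bounded_linear[OF smooth_has_derivative[OF assms, of "[]" y], THEN bounded_linear.linear, THEN linear_cmul, of h v] .
  ultimately show ?thesis by (simp add: has_vector_derivative_def del: directional_derivs.simps)
qed

lemma directional_derivs_increment_bound:
  fixes f :: "'a::euclidean_space \<Rightarrow> complex"
  assumes "smooth f" and "\<And>x. cmod (directional_derivs [v] f x) \<le> C" and "0 \<le> t"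
  shows "cmod (f (x + t *\<^sub>R v) - f x) \<le> t * C"
proof -
  have "norm (f (x + t *\<^sub>R v) - f (x + 0 *\<^sub>R v)) \<le> C * norm (t - 0)"
    by (intro differentiable_bound[of "{0..t}" _ "\<lambda>s h. h *\<^sub>R directional_derivs [v] f (x + s *\<^sub>R v)"])
      (use assms smooth_has_vector_derivative[OF assms(1), of x v] in
        \<open>auto simp del: directional_derivs.simps simp: has_vector_derivative_def
        intro: has_derivative_at_withinI order_trans[OF onorm_scaleR_right_le]\<close>)
  then show ?thesis using assms(3) by (simp add: mult.commute)
qed

definition increment :: "'a::euclidean_space \<Rightarrow> ('a \<Rightarrow> complex) \<Rightarrow> 'a \<Rightarrow> complex" where
  "increment a f = (\<lambda>x. f (x + a) - f x)"

lemma smooth_increment: "smooth f \<Longrightarrow> smooth (increment a f)"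
  unfolding increment_def by (intro smooth_diff smooth_translate)

text \<open>Each increment trades one derivative for a factor \<open>t\<close>; the remaining
  derivatives pass through it, since differentiation commutes with translation.\<close>

lemma iterated_increment_bound:
  assumes "smooth f" and "\<And>x. cmod (directional_derivs (replicate R v) f x) \<le> C" and "0 \<le> t"
  shows "cmod ((increment (t *\<^sub>R v) ^^ R) f x) \<le> t ^ R * C"
  using assms(1,2)
proof (induction R arbitrary: f C)
  case (Suc R)
  have "cmod (directional_derivs (replicate R v) (increment (t *\<^sub>R v) f) x) \<le> t * C" for x
  proof -
    have "directional_derivs (replicate R v) (increment (t *\<^sub>R v) f) x
      = directional_derivs (replicate R v) f (x + t *\<^sub>R v) - directional_derivs (replicate R v) f x"
      unfolding increment_def
      by (simp add: directional_derivs_diff directional_derivs_translate smooth_translate Suc.prems(1))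
    also have "cmod \<dots> \<le> t * C"
      using Suc.prems(2) assms(3)
      by (intro directional_derivs_increment_bound smooth_directional_derivs Suc.prems(1)) simp_all
    finally show ?thesis .
  qed
  then have "cmod ((increment (t *\<^sub>R v) ^^ R) (increment (t *\<^sub>R v) f) x) \<le> t ^ R * (t * C)"
    by (intro Suc.IH smooth_increment Suc.prems(1))
  then show ?case by (simp add: funpow_Suc_right mult_ac del: funpow.simps)
qed simp

definition mode :: "int^'n \<Rightarrow> real^'n \<Rightarrow> complex" where
  "mode k z = cis (2 * pi * (int_vec k \<bullet> z))"

definition periodic :: "(real^'n \<Rightarrow> complex) \<Rightarrow> bool" where
  "periodic f \<longleftrightarrow> (\<forall>z k. f (z + int_vec k) = f z)"

definition lattice_box :: "int set \<Rightarrow> (int^'n) set" where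
  "lattice_box S = {k. \<forall>i. k $ i \<in> S}"

definition node :: "nat \<Rightarrow> int^'n \<Rightarrow> real^'n" where
  "node M j = (1 / real M) *\<^sub>R int_vec j"

text \<open>Riemann sums take the place of coefficient integrals. Estimates become finite summation
  by parts, inversion at the nodes is exact, and the true coefficients are obtained as
  limits.\<close>

definition dft :: "nat \<Rightarrow> (real^'n \<Rightarrow> complex) \<Rightarrow> int^'n \<Rightarrow> complex" where
  "dft M f k = (\<Sum>j\<in>lattice_box {0..<int M}. f (node M j) * cnj (mode k (node M j))) / real M ^ CARD('n)"

section \<open>The discrete Fourier transform on a periodic grid of nodes\<close>

lemma lattice_box_eq_image: "lattice_box S = (\<lambda>g. \<chi> i. g i) ` (PiE UNIV (\<lambda>_. S))"
proof (intro set_eqI iffI)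
  fix k :: "int^'n" assume "k \<in> lattice_box S"
  then have "(\<lambda>i. k $ i) \<in> PiE UNIV (\<lambda>_. S)" by (auto simp: lattice_box_def)
  moreover have "k = (\<chi> i. k $ i)" by simp
  ultimately show "k \<in> (\<lambda>g. \<chi> i. g i) ` (PiE UNIV (\<lambda>_. S))" by blast
qed (auto simp: lattice_box_def)

lemma finite_lattice_box: "finite S \<Longrightarrow> finite (lattice_box S)"
  unfolding lattice_box_eq_image by (intro finite_imageI finite_PiE) auto

lemma sum_box_prod:
  fixes g :: "'n::finite \<Rightarrow> int \<Rightarrow> 'b::comm_semiring_1"
  assumes "finite S"
  shows "(\<Sum>k\<in>lattice_box S. \<Prod>i\<in>UNIV. g i (k $ i)) = (\<Prod>i\<in>UNIV. \<Sum>s\<in>S. g i s)"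
proof -
  have "inj_on (\<lambda>h. \<chi> i. h i :: int^'n) (PiE UNIV (\<lambda>_. S))"
    by (auto simp: inj_on_def vec_eq_iff)
  then show ?thesis
    unfolding lattice_box_eq_image using assms by (simp add: sum.reindex prod_sum_PiE)
qed

lemma card_lattice_box: "finite S \<Longrightarrow> card (lattice_box S :: (int^'n) set) = card S ^ CARD('n)"
  using sum_box_prod[of S "\<lambda>(_ :: 'n) _. 1 :: nat"] by simp

lemma int_vec_add [simp]: "int_vec (j + k) = int_vec j + int_vec k"
  "int_vec (j - k) = int_vec j - int_vec k" "int_vec (- k) = - int_vec k"
  "int_vec (0 :: int^'d) = 0"
  by (simp_all add: int_vec_def vec_eq_iff)

lemma node_add: "node M (j + k) = node M j + node M k"
  by (simp add: node_def scaleR_add_right)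

lemma mode_add: "mode k (y + z) = mode k y * mode k z" "mode (j + k) z = mode j z * mode k z"
  by (simp_all add: mode_def cis_mult inner_add_left inner_add_right ring_distribs)

lemma mode_minus: "mode k (- z) = cnj (mode k z)" "mode (- k) z = cnj (mode k z)"
  by (simp_all add: mode_def cis_cnj)

lemma norm_mode [simp]: "cmod (mode k z) = 1"
  by (simp add: mode_def)

lemma inner_int_vec: "int_vec k \<bullet> z = (\<Sum>i\<in>UNIV. of_int (k $ i) * z $ i)"
  by (simp add: inner_vec_def int_vec_def)

lemma periodic_mode: "periodic (mode k)"
proof -
  have "mode k (z + int_vec m) = mode k z" for z m
  proof -
    have "int_vec k \<bullet> int_vec m = real_of_int (\<Sum>i\<in>UNIV. k $ i * m $ i)"
      by (simp add: inner_int_vec) (simp add: int_vec_def)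
    then have "mode k (int_vec m) = 1" unfolding mode_def by (simp only: cis_int)
    then show ?thesis by (simp add: mode_add)
  qed
  then show ?thesis by (simp add: periodic_def)
qed

text \<open>The box is a full system of residues modulo \<open>M\<close>, and adding
  \<open>m\<close> permutes the residues.\<close>

lemma sum_box_shift:
  fixes F :: "int^'n \<Rightarrow> complex"
  assumes M: "M \<ge> 1" and F: "\<And>j q. F (j + (\<chi> i. int M * q $ i)) = F j"
  shows "(\<Sum>j\<in>lattice_box {0..<int M}. F (j + m)) = (\<Sum>j\<in>lattice_box {0..<int M}. F j)"
proof -
  have mod: "F (\<chi> i. j $ i mod int M) = F j" for j
  proof -
    have "j = (\<chi> i. j $ i mod int M) + (\<chi> i. int M * (\<chi> i. j $ i div int M) $ i)"
      by (simp add: vec_eq_iff)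
    then show ?thesis using F by metis
  qed
  show ?thesis
    by (rule sum.reindex_bij_witness[of _ "\<lambda>j. \<chi> i. (j $ i - m $ i) mod int M" "\<lambda>j. \<chi> i. (j $ i + m $ i) mod int M"])
      (use M mod[of "_ + m"] in \<open>auto simp: lattice_box_def vec_eq_iff mod_simps\<close>)
qed

lemma node_period: "M \<ge> 1 \<Longrightarrow> node M (j + (\<chi> i. int M * q $ i)) = node M j + int_vec q"
  by (simp add: node_def int_vec_def vec_eq_iff field_simps)

text \<open>Summation by parts: translation by a node permutes the nodes modulo periods, so
  increments act on the transform as multipliers.\<close>

lemma dft_increment:
  assumes M: "M \<ge> 1" and f: "periodic f"
  shows "dft M (increment (node M m) f) k = (mode k (node M m) - 1) * dft M f k"
proof -
  define F where "F j = f (node M j) * cnj (mode k (node M j))" for j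
  have F: "F (j + (\<chi> i. int M * q $ i)) = F j" for j q
    using f periodic_mode[of k] by (simp add: F_def node_period[OF M] periodic_def)
  have "f (node M j + node M m) * cnj (mode k (node M j)) = mode k (node M m) * F (j + m)" for j
  proof -
    have "mode k (node M m) * cnj (mode k (node M m)) = 1"
      by (simp add: complex_norm_square[symmetric])
    then show ?thesis by (simp add: F_def node_add mode_add)
  qed
  then have "(\<Sum>j\<in>lattice_box {0..<int M}. increment (node M m) f (node M j) * cnj (mode k (node M j)))
      = mode k (node M m) * (\<Sum>j\<in>lattice_box {0..<int M}. F (j + m)) - (\<Sum>j\<in>lattice_box {0..<int M}. F j)"
    unfolding increment_def by (simp add: left_diff_distrib sum_subtractf sum_distrib_left F_def[symmetric])
  also have "\<dots> = (mode k (node M m) - 1) * (\<Sum>j\<in>lattice_box {0..<int M}. F j)"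
    unfolding sum_box_shift[OF M F] by (simp add: left_diff_distrib)
  finally show ?thesis by (simp add: dft_def F_def)
qed

lemma periodic_increment: "periodic f \<Longrightarrow> periodic (increment a f)"
  unfolding periodic_def increment_def by (metis add.commute add.left_commute)

lemma dft_iterated_increment:
  assumes M: "M \<ge> 1" and f: "periodic f"
  shows "dft M ((increment (node M m) ^^ R) f) k = (mode k (node M m) - 1) ^ R * dft M f k"
proof -
  have "periodic ((increment (node M m) ^^ R) f)" for R
    by (induction R) (auto simp: f periodic_increment)
  then show ?thesis
    by (induction R) (simp_all add: dft_increment[OF M])
qed

lemma norm_dft_le:
  fixes f :: "real^'n \<Rightarrow> complex"
  assumes M: "M \<ge> 1" and "\<And>z. cmod (f z) \<le> B"
  shows "cmod (dft M f k) \<le> B"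
proof -
  have "cmod (\<Sum>j\<in>lattice_box {0..<int M}. f (node M j) * cnj (mode k (node M j))) \<le> (\<Sum>j\<in>(lattice_box {0..<int M} :: (int^'n) set). B)"
    by (rule sum_norm_le) (simp add: norm_mult assms(2))
  also have "\<dots> = real M ^ CARD('n) * B" by (simp add: card_lattice_box)
  finally show ?thesis using M by (simp add: dft_def norm_divide norm_power divide_le_eq mult.commute)
qed

text \<open>A crude form of Jordan's inequality: the mean value theorem with
  \<open>cos z \<ge> 1 / 2\<close> up to \<open>pi / 3\<close>, and beyond it
  \<open>sin x \<ge> 1 / 2\<close> together with \<open>x \<le> 2\<close>.\<close>

lemma sin_ge_quarter: "0 \<le> x \<Longrightarrow> x \<le> pi / 2 \<Longrightarrow> x / 4 \<le> sin x" for x :: real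
proof (cases "x \<le> pi / 3")
  case True
  assume x: "0 \<le> x"
  show ?thesis
  proof (cases "x = 0")
    case False
    with x have x0: "0 < x" by simp
    obtain z where z: "0 < z" "z < x" "sin x - sin 0 = (x - 0) * cos z"
      using MVT2[OF x0, of sin cos] DERIV_sin by blast
    have "cos (pi / 3) \<le> cos z" using z True by (intro cos_monotone_0_pi_le) auto
    then have "1 / 2 \<le> cos z" by (simp add: cos_60)
    then have "x * (1 / 2) \<le> x * cos z" using x0 by (intro mult_left_mono) auto
    then show ?thesis using z(3) x0 by simp
  qed simp
next
  case False
  assume x: "x \<le> pi / 2"
  have "sin (pi / 6) \<le> sin x" using False x pi_gt_zero by (intro sin_monotone_2pi_le) auto
  moreover have "x \<le> 2" using x pi_less_4 by simp
  ultimately show ?thesis by (simp add: sin_30)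
qed

text \<open>While \<open>2 * \<bar>k $ i\<bar> \<le> M\<close> the phase stays within half a turn,
  where chord and arc are comparable. For this reason frequencies are taken from the symmetric range
  \<open>- p..p\<close> with \<open>M = 2 * p + 1\<close>.\<close>

lemma norm_mode_node_axis:
  assumes M: "M \<ge> 1" and k: "2 * \<bar>k $ i\<bar> \<le> int M"
  shows "\<bar>real_of_int (k $ i)\<bar> / M \<le> cmod (mode k (node M (axis i 1)) - 1)"
proof -
  define x where "x = pi * \<bar>real_of_int (k $ i)\<bar> / M"
  have "int_vec k \<bullet> node M (axis i 1) = real_of_int (k $ i) / M"
    unfolding inner_int_vec by (simp add: node_def int_vec_def axis_def if_distrib cong: if_cong)
  then have "cmod (mode k (node M (axis i 1)) - 1) = 2 * \<bar>sin (pi * real_of_int (k $ i) / M)\<bar>"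
    by (simp add: mode_def norm_cis_minus_1)
  also have "\<bar>sin (pi * real_of_int (k $ i) / M)\<bar> = \<bar>sin x\<bar>"
    by (cases "k $ i \<ge> 0") (simp_all add: x_def)
  finally have 1: "cmod (mode k (node M (axis i 1)) - 1) = 2 * \<bar>sin x\<bar>" .
  have "2 * \<bar>real_of_int (k $ i)\<bar> \<le> real M" using k by linarith
  then have "x \<le> pi / 2" using M by (simp add: x_def field_simps)
  moreover have x0: "0 \<le> x" by (simp add: x_def)
  ultimately have "x / 2 \<le> 2 * \<bar>sin x\<bar>" using sin_ge_quarter[of x] by linarith
  moreover have "2 * (\<bar>real_of_int (k $ i)\<bar> / M) \<le> x"
    unfolding x_def using pi_ge_two mult_right_mono[of 2 pi "\<bar>real_of_int (k $ i)\<bar> / M"] by simp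
  ultimately show ?thesis using 1 by linarith
qed

text \<open>The range is a full period, so multiplication by \<open>z 1\<close> permutes the
  summands; unless \<open>z 1 = 1\<close>, the sum must vanish.\<close>

lemma sum_root_of_unity:
  fixes d :: int and p :: nat
  defines "M \<equiv> 2 * int p + 1"
  shows "(\<Sum>s = - int p..int p. cis (2 * pi * (of_int s * of_int d / of_int M))) = (if M dvd d then of_int M else 0)"
proof -
  define z where "z s = cis (2 * pi * (of_int s * of_int d / of_int M))" for s :: int
  have M0: "M > 0" by (simp add: M_def)
  have z_add: "z (s + t) = z s * z t" for s t
    by (simp add: z_def cis_mult ring_distribs add_divide_distrib)
  show ?thesis
  proof (cases "M dvd d")
    case True
    then obtain q where q: "d = M * q" by blast
    have "z s = 1" for s
    proof -
      have "of_int s * of_int d / of_int M = real_of_int (s * q)" using M0 by (simp add: q)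
      then show ?thesis unfolding z_def by (simp only: cis_int)
    qed
    then show ?thesis unfolding z_def[symmetric] using True by (simp add: M_def)
  next
    case False
    have "z M = 1"
    proof -
      have "of_int M * of_int d / of_int M = real_of_int d" using M0 by simp
      then show ?thesis unfolding z_def by (simp only: cis_int)
    qed
    then have per: "z (int p + 1) = z (- int p)"
      using z_add[of "- int p" M] by (simp add: M_def)
    have "z 1 \<noteq> 1"
    proof
      assume "z 1 = 1"
      then obtain n :: int where "2 * pi * (of_int d / of_int M) = of_int n * (2 * pi)"
        by (auto simp: z_def cis_eq_1_iff)
      then have "of_int d = real_of_int (n * M)" using M0 by (simp add: field_simps)
      then have "d = n * M" by (simp only: of_int_eq_iff)
      with False show False by simp
    qed
    define S where "S = (\<Sum>s = - int p..int p. z s)"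
    have "z 1 * S = (\<Sum>s = - int p..int p. z (s + 1))"
      by (simp add: S_def sum_distrib_left z_add mult.commute)
    also have "\<dots> = (\<Sum>s = - int p + 1..int p + 1. z s)"
      by (rule sum.reindex_bij_witness[of _ "\<lambda>s. s - 1" "\<lambda>s. s + 1"]) auto
    also have "\<dots> = S"
    proof -
      have "{- int p + 1..int p + 1} = insert (int p + 1) {- int p + 1..int p}" by auto
      moreover have "{- int p..int p} = insert (- int p) {- int p + 1..int p}" by auto
      ultimately show ?thesis by (simp add: S_def per)
    qed
    finally have "(z 1 - 1) * S = 0" by (simp add: left_diff_distrib)
    with \<open>z 1 \<noteq> 1\<close> show ?thesis unfolding z_def[symmetric] using False by (simp add: S_def)
  qed
qed

lemma cis_sum: "cis (\<Sum>i\<in>A. f i) = (\<Prod>i\<in>A. cis (f i))"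
  by (induction A rule: infinite_finite_induct) (simp_all add: cis_mult[symmetric])

text \<open>Trigonometric interpolation is exact at the nodes by orthogonality of the modes; no
  convergence is involved yet. An arbitrary \<open>j\<close> is first reduced to its residue
  \<open>j'\<close> in the box.\<close>

lemma dft_inversion:
  fixes f :: "real^'n \<Rightarrow> complex" and p :: nat
  defines "M \<equiv> 2 * p + 1"
  assumes f: "periodic f"
  shows "(\<Sum>k\<in>lattice_box {- int p..int p}. dft M f k * mode k (node M j)) = f (node M j)"
proof -
  have M1: "M \<ge> 1" by (simp add: M_def)
  have Mi: "int M = 2 * int p + 1" by (simp add: M_def)
  have orth: "(\<Sum>k\<in>lattice_box {- int p..int p}. mode k (node M m)) = (if \<forall>i. int M dvd m $ i then real M ^ CARD('n) else 0)" for m :: "int^'n"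
  proof -
    have "mode k (node M m) = (\<Prod>i\<in>UNIV. cis (2 * pi * (of_int (k $ i) * of_int (m $ i) / of_int (2 * int p + 1))))" for k
      unfolding mode_def inner_int_vec cis_sum[symmetric] sum_distrib_left
      by (simp add: node_def int_vec_def M_def add.commute)
    then have "(\<Sum>k\<in>lattice_box {- int p..int p}. mode k (node M m)) = (\<Prod>i\<in>UNIV. if int M dvd m $ i then of_int (int M) else 0)"
      using sum_box_prod[of "{- int p..int p}" "\<lambda>i s. cis (2 * pi * (of_int s * of_int (m $ i) / of_int (2 * int p + 1)))"]
      by (simp only: finite_atLeastAtMost_int sum_root_of_unity Mi True_implies_equals)
    also have "\<dots> = (if \<forall>i. int M dvd m $ i then real M ^ CARD('n) else 0)"
    proof (cases "\<forall>i. int M dvd m $ i")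
      case False
      then obtain i where "\<not> int M dvd m $ i" by blast
      then have "(\<Prod>i\<in>UNIV. if int M dvd m $ i then of_int (int M) else (0 :: complex)) = 0"
        by (intro prod_zero) auto
      then show ?thesis using False by simp
    qed simp
    finally show ?thesis .
  qed
  define j' where "j' = (\<chi> i. j $ i mod int M)"
  have j': "j' \<in> lattice_box {0..<int M}" using M1 by (auto simp: j'_def lattice_box_def)
  have "(\<Sum>k\<in>lattice_box {- int p..int p}. (\<Sum>l\<in>lattice_box {0..<int M}. f (node M l) * cnj (mode k (node M l))) * mode k (node M j))
      = (\<Sum>l\<in>lattice_box {0..<int M}. f (node M l) * (\<Sum>k\<in>lattice_box {- int p..int p}. mode k (node M (j - l))))"
  proof -
    have "node M (j - l) = node M j + - node M l" for l :: "int^'n"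
      by (simp add: node_def scaleR_diff_right)
    then have "mode k (node M (j - l)) = mode k (node M j) * cnj (mode k (node M l))" for k l :: "int^'n"
      by (simp only: mode_add(1) mode_minus)
    then show ?thesis
      unfolding sum_distrib_left sum_distrib_right by (subst sum.swap) (simp add: mult_ac)
  qed
  also have "\<dots> = (\<Sum>l\<in>lattice_box {0..<int M}. if l = j' then f (node M l) * real M ^ CARD('n) else 0)"
  proof (rule sum.cong)
    fix l :: "int^'n" assume l: "l \<in> lattice_box {0..<int M}"
    have "(\<forall>i. int M dvd (j - l) $ i) \<longleftrightarrow> l = j'"
    proof -
      have "int M dvd (j - l) $ i \<longleftrightarrow> l $ i = j $ i mod int M" for i
      proof -
        have "l $ i mod int M = l $ i" using l by (auto simp: lattice_box_def)
        then show ?thesis by (metis mod_eq_dvd_iff vector_minus_component)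
      qed
      then show ?thesis by (simp add: vec_eq_iff j'_def)
    qed
    then show "f (node M l) * (\<Sum>k\<in>lattice_box {- int p..int p}. mode k (node M (j - l))) = (if l = j' then f (node M l) * real M ^ CARD('n) else 0)"
      by (simp add: orth)
  qed simp
  also have "\<dots> = f (node M j') * real M ^ CARD('n)" using j' by (simp add: finite_lattice_box)
  also have "f (node M j') = f (node M j)"
  proof -
    have "j = j' + (\<chi> i. int M * (\<chi> i. j $ i div int M) $ i)" by (simp add: vec_eq_iff j'_def)
    then have "node M j = node M j' + int_vec (\<chi> i. j $ i div int M)" using node_period[OF M1] by metis
    then show ?thesis using f by (simp add: periodic_def)
  qed
  finally show ?thesis using M1
    by (simp add: dft_def sum_divide_distrib[symmetric] nonzero_divide_eq_eq times_divide_eq_left)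
qed

section \<open>Decay of the discrete coefficients, uniform in the mesh\<close>

lemma smooth_continuous: "smooth f \<Longrightarrow> continuous_on UNIV f"
  using smooth_has_derivative[of f "[]"]
  by (auto intro!: continuous_at_imp_continuous_on has_derivative_continuous simp del: directional_derivs.simps(2))

lemma periodic_directional_derivs:
  assumes "smooth f" and "periodic f"
  shows "periodic (directional_derivs vs f)"
proof -
  have "(\<lambda>x. f (x + int_vec k)) = f" for k
    using assms(2) by (simp add: periodic_def fun_eq_iff)
  then show ?thesis
    unfolding periodic_def using directional_derivs_translate[OF assms(1), of vs] by metis
qed

lemma periodic_bounded:
  fixes f :: "real^'n \<Rightarrow> complex"
  assumes "continuous_on UNIV f" and "periodic f"
  obtains C where "0 \<le> C" "\<And>z. cmod (f z) \<le> C"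
proof -
  have "compact (f ` cbox 0 1)"
    by (intro compact_continuous_image continuous_on_subset[OF assms(1)]) auto
  then obtain C where C: "\<And>z. z \<in> cbox 0 1 \<Longrightarrow> cmod (f z) \<le> C"
    using compact_imp_bounded bounded_iff by (metis image_eqI)
  have "cmod (f z) \<le> C" for z
  proof -
    define k where "k = (\<chi> i. \<lfloor>z $ i\<rfloor>)"
    have "z - int_vec k \<in> cbox 0 1"
      unfolding mem_box_cart by (auto simp: k_def int_vec_def) linarith
    moreover have "f (z - int_vec k) = f z"
      using assms(2) unfolding periodic_def by (metis diff_add_cancel)
    ultimately show ?thesis using C by metis
  qed
  then show ?thesis using that[of C] norm_ge_zero order_trans by blast
qed

text \<open>\<open>R\<close> increments of step \<open>1 / M\<close> gain \<open>(1 / M) ^ R\<close>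
  on the function, and their multiplier is at least \<open>(\<bar>k $ i\<bar> / M) ^ R\<close>. The
  powers of \<open>M\<close> cancel, so \<open>C\<close> is uniform in \<open>M\<close>.\<close>

lemma dft_decay_coordinate:
  fixes f :: "real^'n \<Rightarrow> complex"
  assumes "smooth f" and "periodic f"
  shows "\<exists>C\<ge>0. \<forall>M\<ge>1. \<forall>k. 2 * \<bar>k $ i\<bar> \<le> int M \<longrightarrow> cmod (dft M f k) * \<bar>real_of_int (k $ i)\<bar> ^ R \<le> C"
proof -
  define v :: "real^'n" where "v = int_vec (axis i 1)"
  obtain C where C: "0 \<le> C" "\<And>z. cmod (directional_derivs (replicate R v) f z) \<le> C"
    using periodic_bounded[of "directional_derivs (replicate R v) f"]
      smooth_continuous smooth_directional_derivs periodic_directional_derivs assms by metis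
  have "cmod (dft M f k) * \<bar>real_of_int (k $ i)\<bar> ^ R \<le> C" if M: "M \<ge> 1" and k: "2 * \<bar>k $ i\<bar> \<le> int M" for M k
  proof -
    define q where "q = cmod (mode k (node M (axis i 1)) - 1)"
    have "cmod ((increment (node M (axis i 1)) ^^ R) f z) \<le> (1 / M) ^ R * C" for z
      using iterated_increment_bound[OF assms(1) C(2), of "1 / M" z] by (simp add: node_def v_def)
    then have "cmod (dft M ((increment (node M (axis i 1)) ^^ R) f) k) \<le> (1 / M) ^ R * C"
      by (rule norm_dft_le[OF M])
    then have "q ^ R * cmod (dft M f k) \<le> (1 / M) ^ R * C"
      by (simp add: dft_iterated_increment[OF M assms(2)] norm_mult norm_power q_def)
    moreover have "(\<bar>real_of_int (k $ i)\<bar> / M) ^ R \<le> q ^ R"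
      unfolding q_def by (intro power_mono norm_mode_node_axis M k) auto
    ultimately have "(\<bar>real_of_int (k $ i)\<bar> / M) ^ R * cmod (dft M f k) \<le> (1 / M) ^ R * C"
      by (meson mult_right_mono norm_ge_zero order_trans)
    then show ?thesis using M by (simp add: power_divide divide_le_cancel mult.commute)
  qed
  then show ?thesis using C(1) by blast
qed

lemma dft_decay:
  fixes f :: "real^'n \<Rightarrow> complex"
  assumes "smooth f" and "periodic f"
  shows "\<exists>C. \<forall>p k. k \<in> lattice_box {- int p..int p} \<longrightarrow>
    cmod (dft (2 * p + 1) f k) * (1 + 2 * pi * l1 k) ^ R \<le> C"
proof -
  obtain C0 where C0: "0 \<le> C0" "\<And>z. cmod (f z) \<le> C0"
    using periodic_bounded smooth_continuous assms by metis
  obtain C where C: "\<And>i. 0 \<le> C i" "\<And>i M k. M \<ge> 1 \<Longrightarrow> 2 * \<bar>k $ i\<bar> \<le> int M \<Longrightarrow> cmod (dft M f k) * \<bar>real_of_int (k $ i)\<bar> ^ R \<le> C i"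
    using dft_decay_coordinate[OF assms, of _ R] by metis
  \<comment> \<open>The largest coordinate \<open>i\<close> of \<open>k\<close> controls
    \<open>l1 k\<close> up to the factor \<open>CARD('n)\<close>, and 8 bounds
    \<open>2 * pi\<close>. \<open>C0\<close> is needed beside the \<open>C i\<close> because a power
    of that coordinate gives nothing at \<open>k = 0\<close>.\<close>
  define B where "B = (1 + 8 * CARD('n)) ^ R * (C0 + (\<Sum>i\<in>UNIV. C i))"
  have "cmod (dft (2 * p + 1) f k) * (1 + 2 * pi * l1 k) ^ R \<le> B" if k: "k \<in> lattice_box {- int p..int p}" for p k
  proof -
    define a where "a = cmod (dft (2 * p + 1) f k)"
    have a0: "0 \<le> a" "a \<le> C0" unfolding a_def using C0 by (auto intro!: norm_dft_le)
    obtain i where i: "\<And>j. \<bar>k $ j\<bar> \<le> \<bar>k $ i\<bar>"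
    proof -
      have "Max (range (\<lambda>j. \<bar>k $ j\<bar>)) \<in> range (\<lambda>j. \<bar>k $ j\<bar>)" by (rule Max_in) auto
      then obtain i where "Max (range (\<lambda>j. \<bar>k $ j\<bar>)) = \<bar>k $ i\<bar>" by (rule rangeE)
      then show ?thesis using that[of i] by (metis Max_ge finite finite_imageI rangeI)
    qed
    define m where "m = \<bar>real_of_int (k $ i)\<bar>"
    have "\<bar>k $ i\<bar> = 0 \<or> 1 \<le> \<bar>k $ i\<bar>" by linarith
    then have m: "m = 0 \<or> 1 \<le> m" unfolding m_def by (metis of_int_0 of_int_1_le_iff of_int_abs)
    have "l1 k \<le> (\<Sum>j\<in>(UNIV::'n set). m)"
      unfolding l1_def m_def by (intro sum_mono) (use i in \<open>metis of_int_abs of_int_le_iff\<close>)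
    then have "l1 k \<le> CARD('n) * m" by simp
    then have "2 * pi * l1 k \<le> 8 * (CARD('n) * m)"
      using pi_less_4 l1_nonneg[of k] by (intro mult_mono) auto
    then have w: "1 + 2 * pi * l1 k \<le> 1 + 8 * CARD('n) * m" by simp
    have "(1 + 2 * pi * l1 k) ^ R \<le> (1 + 8 * CARD('n)) ^ R * (1 + m ^ R)"
    proof (cases "m = 0")
      case True
      then have "(1 + 2 * pi * l1 k) ^ R \<le> 1 ^ R" using w l1_nonneg[of k] by (intro power_mono) auto
      also have "\<dots> \<le> (1 + 8 * CARD('n)) ^ R * (1 + m ^ R)"
        using m by (simp add: m_def) (metis add_increasing2 mult_ge1_I one_le_power le_add_same_cancel1 mult_nonneg_nonneg of_nat_0_le_iff zero_le_numeral zero_le_power abs_ge_zero order_refl)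
      finally show ?thesis .
    next
      case False
      with m have m1: "1 \<le> m" by simp
      have "(1 + 2 * pi * l1 k) ^ R \<le> ((1 + 8 * CARD('n)) * m) ^ R"
        using w m1 l1_nonneg[of k] by (intro power_mono) (auto simp: algebra_simps)
      also have "\<dots> \<le> (1 + 8 * CARD('n)) ^ R * (1 + m ^ R)" by (simp add: power_mult_distrib)
      finally show ?thesis .
    qed
    then have "a * (1 + 2 * pi * l1 k) ^ R \<le> a * ((1 + 8 * CARD('n)) ^ R * (1 + m ^ R))"
      by (intro mult_left_mono a0)
    also have "\<dots> = (1 + 8 * CARD('n)) ^ R * (a + a * m ^ R)" by (simp add: algebra_simps)
    also have "\<dots> \<le> B" unfolding B_def
    proof (intro mult_left_mono add_mono a0)
      have "2 * \<bar>k $ i\<bar> \<le> int (2 * p + 1)" using k by (auto simp: lattice_box_def abs_le_iff) (metis abs_le_iff add.commute add_increasing mult_le_mono2 minus_le_iff mult_left_mono zero_le_numeral zero_le_one)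
      then have "a * m ^ R \<le> C i" unfolding a_def m_def by (intro C(2)) auto
      also have "\<dots> \<le> (\<Sum>i\<in>UNIV. C i)" by (rule member_le_sum) (auto simp: C(1))
      finally show "a * m ^ R \<le> (\<Sum>i\<in>UNIV. C i)" .
    qed simp
    finally show ?thesis by (simp add: a_def)
  qed
  then show ?thesis by blast
qed

section \<open>Lattice sums and passage to the limit\<close>

lemma summable_int_inverse_square: "(\<lambda>s::int. 1 / (1 + (real_of_int s)\<^sup>2)) summable_on UNIV"
proof -
  have s: "(\<lambda>n. 1 / (1 + (real n)\<^sup>2)) summable_on UNIV"
  proof (rule summable_on_comparison_test)
    have "summable (\<lambda>n. 2 * (1 / (real (Suc n))\<^sup>2))"
      by (intro summable_mult) (use inverse_squares_sums in \<open>auto simp: sums_iff\<close>)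
    then show "(\<lambda>n. 2 * (1 / (real (Suc n))\<^sup>2)) summable_on UNIV"
      by (subst summable_on_UNIV_nonneg_real_iff) auto
    fix n :: nat
    have "(real (Suc n))\<^sup>2 \<le> 2 * (1 + (real n)\<^sup>2)"
      using sum_squares_bound[of "real n" 1] by (simp add: power2_eq_square algebra_simps)
    then show "1 / (1 + (real n)\<^sup>2) \<le> 2 * (1 / (real (Suc n))\<^sup>2)"
      by (simp add: divide_simps add_pos_nonneg del: of_nat_Suc)
  qed simp
  have "(\<lambda>s::int. 1 / (1 + (real_of_int s)\<^sup>2)) summable_on (int ` UNIV)"
    using s by (subst summable_on_reindex) (auto simp: o_def)
  moreover have "(\<lambda>s::int. 1 / (1 + (real_of_int s)\<^sup>2)) summable_on ((\<lambda>n. - int n) ` UNIV)"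
    using s by (subst summable_on_reindex) (auto simp: o_def inj_def)
  moreover have "(UNIV :: int set) = int ` UNIV \<union> (\<lambda>n. - int n) ` UNIV"
  proof -
    have "s \<in> int ` UNIV \<union> (\<lambda>n. - int n) ` UNIV" for s
    proof (cases "0 \<le> s")
      case True
      then show ?thesis by (metis UnI1 nat_0_le rangeI)
    next
      case False
      then have "s = - int (nat (- s))" by simp
      then show ?thesis by blast
    qed
    then show ?thesis by blast
  qed
  ultimately show ?thesis by (metis summable_on_union)
qed

text \<open>Every coordinate satisfies \<open>1 + (k $ i)^2 \<le> (1 + 2 * pi * l1 k)^2\<close>.
  Multiplying over the coordinates gives the exponent \<open>2 * CARD('n)\<close> and a comparison
  with a product of one-dimensional sums.\<close>

lemma summable_weight: "(\<lambda>k::int^'n. 1 / (1 + 2 * pi * l1 k) ^ (2 * CARD('n))) summable_on UNIV"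
proof (rule nonneg_bdd_above_summable_on)
  define S where "S = (\<Sum>\<^sub>\<infinity>s::int. 1 / (1 + (real_of_int s)\<^sup>2))"
  show "bdd_above (sum (\<lambda>k::int^'n. 1 / (1 + 2 * pi * l1 k) ^ (2 * CARD('n))) ` {F. F \<subseteq> UNIV \<and> finite F})"
  proof (rule bdd_aboveI2)
    fix F :: "(int^'n) set" assume "F \<in> {F. F \<subseteq> UNIV \<and> finite F}"
    then have F: "finite F" by simp
    define T where "T = (\<Union>i. (\<lambda>k. k $ i) ` F)"
    have T: "finite T" "F \<subseteq> lattice_box T" using F by (auto simp: T_def lattice_box_def)
    have "(\<Sum>k\<in>F. 1 / (1 + 2 * pi * l1 k) ^ (2 * CARD('n))) \<le> (\<Sum>k\<in>(lattice_box T :: (int^'n) set). 1 / (1 + 2 * pi * l1 k) ^ (2 * CARD('n)))"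
    proof (rule sum_mono2)
      show "0 \<le> 1 / (1 + 2 * pi * l1 k) ^ (2 * CARD('n))" for k :: "int^'n"
        using weight_ge_1[of k] by simp
    qed (use T finite_lattice_box in auto)
    also have "\<dots> \<le> (\<Sum>k\<in>(lattice_box T :: (int^'n) set). \<Prod>i\<in>UNIV. 1 / (1 + (real_of_int (k $ i))\<^sup>2))"
    proof (rule sum_mono)
      fix k :: "int^'n"
      have "1 + (real_of_int (k $ i))\<^sup>2 \<le> (1 + 2 * pi * l1 k)\<^sup>2" for i
      proof -
        have a: "\<bar>real_of_int (k $ i)\<bar> \<le> l1 k" unfolding l1_def by (rule member_le_sum) auto
        have "1 * l1 k \<le> 2 * pi * l1 k" using pi_ge_two by (intro mult_right_mono l1_nonneg) auto
        with a have b: "\<bar>real_of_int (k $ i)\<bar> \<le> 2 * pi * l1 k" by linarith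
        then have "\<bar>real_of_int (k $ i)\<bar>\<^sup>2 \<le> (2 * pi * l1 k)\<^sup>2" by (intro power_mono) auto
        moreover have "0 \<le> 2 * pi * l1 k" using l1_nonneg[of k] by simp
        ultimately show ?thesis by (simp add: power2_sum)
      qed
      then have "(\<Prod>i\<in>(UNIV::'n set). 1 + (real_of_int (k $ i))\<^sup>2) \<le> (\<Prod>i\<in>(UNIV::'n set). (1 + 2 * pi * l1 k)\<^sup>2)"
        by (intro prod_mono) (auto intro: add_nonneg_nonneg)
      then have "(\<Prod>i\<in>(UNIV::'n set). 1 + (real_of_int (k $ i))\<^sup>2) \<le> (1 + 2 * pi * l1 k) ^ (2 * CARD('n))"
        by (simp add: power_mult)
      moreover have "0 < (\<Prod>i\<in>(UNIV::'n set). 1 + (real_of_int (k $ i))\<^sup>2)"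
        by (intro prod_pos) (auto intro: add_pos_nonneg)
      ultimately show "1 / (1 + 2 * pi * l1 k) ^ (2 * CARD('n)) \<le> (\<Prod>i\<in>UNIV. 1 / (1 + (real_of_int (k $ i))\<^sup>2))"
        by (simp add: prod_dividef frac_le)
    qed
    also have "\<dots> = (\<Prod>i\<in>(UNIV::'n set). \<Sum>s\<in>T. 1 / (1 + (real_of_int s)\<^sup>2))"
      by (rule sum_box_prod[OF T(1)])
    also have "\<dots> \<le> (\<Prod>i\<in>(UNIV::'n set). S)"
      unfolding S_def using T(1)
      by (intro prod_mono conjI sum_nonneg finite_sum_le_infsum summable_int_inverse_square) auto
    finally show "(\<Sum>k\<in>F. 1 / (1 + 2 * pi * l1 k) ^ (2 * CARD('n))) \<le> S ^ CARD('n)" by simp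
  qed
  show "0 \<le> 1 / (1 + 2 * pi * l1 k) ^ (2 * CARD('n))" for k :: "int^'n"
    using weight_ge_1[of k] by simp
qed

lemma rapidI:
  fixes c :: "int^'n \<Rightarrow> complex"
  assumes "\<And>R. \<exists>C. \<forall>k. cmod (c k) * (1 + 2 * pi * l1 k) ^ R \<le> C"
  shows "rapid c"
  unfolding rapid_def
proof
  fix R
  define w where "w k = 1 + 2 * pi * l1 k" for k :: "int^'n"
  have w: "1 \<le> w k" for k unfolding w_def by (rule weight_ge_1)
  obtain C where C: "\<And>k. cmod (c k) * w k ^ (R + 2 * CARD('n)) \<le> C"
    using assms[of "R + 2 * CARD('n)"] unfolding w_def by blast
  have "(\<lambda>k. C * (1 / w k ^ (2 * CARD('n)))) summable_on UNIV"
    unfolding w_def by (intro summable_on_cmult_right summable_weight)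
  then show "(\<lambda>k. cmod (c k) * (1 + 2 * pi * l1 k) ^ R) summable_on UNIV"
    unfolding w_def[symmetric]
  proof (rule summable_on_comparison_test)
    fix k
    have "0 < w k ^ (2 * CARD('n))" using w[of k] by simp
    then show "cmod (c k) * w k ^ R \<le> C * (1 / w k ^ (2 * CARD('n)))"
      using C[of k] by (simp add: power_add pos_le_divide_eq mult_ac)
    show "0 \<le> cmod (c k) * w k ^ R" using w[of k] by simp
  qed
qed

text \<open>Dominated convergence for the counting measure.\<close>

lemma tendsto_infsum_dominated:
  fixes f :: "nat \<Rightarrow> 'a \<Rightarrow> complex"
  assumes "g summable_on UNIV" and "\<And>n x. cmod (f n x) \<le> g x" and "\<And>x. (\<lambda>n. f n x) \<longlonglongrightarrow> f' x"
  shows "(\<lambda>n. \<Sum>\<^sub>\<infinity>x. f n x) \<longlonglongrightarrow> (\<Sum>\<^sub>\<infinity>x. f' x)"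
proof -
  have g0: "0 \<le> g x" for x using assms(2)[of 0 x] norm_ge_zero order_trans by blast
  have f': "cmod (f' x) \<le> g x" for x
    by (rule LIMSEQ_le_const2[OF tendsto_norm[OF assms(3)]]) (use assms(2) in auto)
  have conv: "Infinite_Set_Sum.abs_summable_on h UNIV \<and> infsum h UNIV = (\<integral>x. h x \<partial>count_space UNIV)" if "\<And>x. cmod (h x) \<le> g x" for h :: "'a \<Rightarrow> complex"
  proof -
    have "(\<lambda>x. norm (h x)) summable_on UNIV"
      by (rule Infinite_Sum.abs_summable_on_comparison_test'[OF assms(1) that])
    then have "Infinite_Set_Sum.abs_summable_on h UNIV" by (simp add: abs_summable_equivalent)
    then show ?thesis using infsetsum_infsum[of h UNIV] by (simp add: infsetsum_def)
  qed
  have "integrable (count_space UNIV) g"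
  proof -
    have "Infinite_Set_Sum.abs_summable_on g UNIV"
      using assms(1) g0 by (simp add: abs_summable_equivalent[symmetric])
    then show ?thesis by (simp add: abs_summable_on_def)
  qed
  then have "(\<lambda>n. \<integral>x. f n x \<partial>count_space UNIV) \<longlonglongrightarrow> (\<integral>x. f' x \<partial>count_space UNIV)"
    by (intro integral_dominated_convergence[where w = g]) (auto simp: assms AE_count_space)
  then show ?thesis using conv[OF assms(2)] conv[OF f'] by simp
qed

text \<open>The coefficients \<open>b p k\<close> are bounded uniformly in \<open>p\<close>, so a
  subsequence converges for every \<open>k\<close>. At nodes \<open>zp p\<close> tending to
  \<open>z\<close> the interpolation identity is exact, and it passes to the limit by dominated
  convergence.\<close>

theorem fourier_series:
  fixes f :: "real^'n \<Rightarrow> complex"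
  assumes f: "smooth f" "periodic f"
  shows "\<exists>c. rapid c \<and> (\<forall>z. f z = (\<Sum>\<^sub>\<infinity>k. c k * mode k z))"
proof -
  define w where "w k = 1 + 2 * pi * l1 k" for k :: "int^'n"
  have w: "1 \<le> w k" for k unfolding w_def by (rule weight_ge_1)
  define b where "b p k = (if k \<in> lattice_box {- int p..int p} then dft (2 * p + 1) f k else 0)" for p k
  obtain C where C: "\<And>R p k. k \<in> lattice_box {- int p..int p} \<Longrightarrow> cmod (dft (2 * p + 1) f k) * w k ^ R \<le> C R"
    using dft_decay[OF f] unfolding w_def by metis
  have C0: "0 \<le> C R" for R
  proof -
    have "(0 :: int^'n) \<in> lattice_box {- int 0..int 0}" by (simp add: lattice_box_def)
    moreover have "0 \<le> cmod (dft (2 * 0 + 1) f 0) * w 0 ^ R" using w[of 0] by simp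
    ultimately show ?thesis using C[of 0 0 R] by linarith
  qed
  have b: "cmod (b p k) * w k ^ R \<le> C R" for p k R
    using C C0 by (simp add: b_def)
  \<comment> \<open>Tychonoff. The index set \<open>int^'n\<close> is countable, so the product is
    metrizable and compactness yields a convergent subsequence.\<close>
  have "compact (PiE UNIV (\<lambda>_. cball 0 (C 0)) :: (int^'n \<Rightarrow> complex) set)"
    using compactin_PiE[of "\<lambda>_ :: int^'n. euclidean" UNIV "\<lambda>_. cball (0 :: complex) (C 0)"]
    by (simp add: euclidean_product_topology)
  moreover have "b p \<in> PiE UNIV (\<lambda>_. cball 0 (C 0))" for p
    using b[of p _ 0] by auto
  ultimately obtain c r where r: "strict_mono r" and lim: "(b \<circ> r) \<longlonglongrightarrow> c"
    unfolding compact_eq_seq_compact_metric seq_compact_def by blast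
  have bc: "(\<lambda>p. b (r p) k) \<longlonglongrightarrow> c k" for k
  proof -
    have "isCont (\<lambda>x. x k) c"
      by (metis continuous_on_product_coordinates continuous_on_eq_continuous_at open_UNIV UNIV_I)
    from isCont_tendsto_compose[OF this lim] show ?thesis by (simp add: o_def)
  qed
  have cw: "cmod (c k) * w k ^ R \<le> C R" for k R
    by (rule LIMSEQ_le_const2[OF tendsto_mult_right[OF tendsto_norm[OF bc]]]) (use b in auto)
  have "rapid c" using cw unfolding w_def by (intro rapidI) blast
  moreover have "f z = (\<Sum>\<^sub>\<infinity>k. c k * mode k z)" for z
  proof -
    define M where "M p = 2 * r p + 1" for p
    define j where "j p = (\<chi> i. \<lfloor>real (M p) * z $ i\<rfloor>)" for p
    define zp where "zp p = node (M p) (j p)" for p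
    have M0: "0 < real (M p)" for p by (simp add: M_def)
    have Minf: "filterlim (\<lambda>p. real (M p)) at_top sequentially"
      unfolding M_def
      by (rule filterlim_compose[OF filterlim_real_sequentially filterlim_at_top_mono[OF filterlim_subseq[OF r]]]) auto
    have zp: "zp \<longlonglongrightarrow> z"
    proof (rule vec_tendstoI)
      fix i
      have zi: "zp p $ i = \<lfloor>real (M p) * z $ i\<rfloor> / M p" for p
        by (simp add: zp_def node_def j_def int_vec_def)
      show "(\<lambda>p. zp p $ i) \<longlonglongrightarrow> z $ i"
      proof (rule tendsto_sandwich)
        show "\<forall>\<^sub>F p in sequentially. z $ i - 1 / M p \<le> zp p $ i"
        proof (intro always_eventually allI)
          fix p
          have "real (M p) * z $ i - 1 \<le> \<lfloor>real (M p) * z $ i\<rfloor>" by linarith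
          then have "(real (M p) * z $ i - 1) / M p \<le> \<lfloor>real (M p) * z $ i\<rfloor> / M p"
            by (rule divide_right_mono) simp
          then show "z $ i - 1 / M p \<le> zp p $ i" unfolding zi using M0[of p] by (simp add: diff_divide_distrib)
        qed
        show "\<forall>\<^sub>F p in sequentially. zp p $ i \<le> z $ i"
        proof (intro always_eventually allI)
          fix p
          have "\<lfloor>real (M p) * z $ i\<rfloor> \<le> real (M p) * z $ i" by linarith
          then show "zp p $ i \<le> z $ i" unfolding zi using M0[of p] by (simp add: field_simps)
        qed
        have "(\<lambda>p. 1 / M p) \<longlonglongrightarrow> 0"
          using tendsto_inverse_0_at_top[OF Minf] by (simp add: inverse_eq_divide)
        from tendsto_diff[OF tendsto_const this, of "z $ i"] show "(\<lambda>p. z $ i - 1 / M p) \<longlonglongrightarrow> z $ i" by simp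
      qed simp
    qed
    have "(\<Sum>\<^sub>\<infinity>k. b (r p) k * mode k (zp p)) = f (zp p)" for p
    proof -
      have "(\<Sum>\<^sub>\<infinity>k. b (r p) k * mode k (zp p)) = (\<Sum>\<^sub>\<infinity>k\<in>lattice_box {- int (r p)..int (r p)}. dft (M p) f k * mode k (zp p))"
        by (rule infsum_cong_neutral) (auto simp: b_def M_def)
      also have "\<dots> = (\<Sum>k\<in>lattice_box {- int (r p)..int (r p)}. dft (M p) f k * mode k (zp p))"
        by (simp add: finite_lattice_box)
      also have "\<dots> = f (zp p)" unfolding zp_def M_def by (rule dft_inversion[OF f(2)])
      finally show ?thesis .
    qed
    moreover have "(\<lambda>p. \<Sum>\<^sub>\<infinity>k. b (r p) k * mode k (zp p)) \<longlonglongrightarrow> (\<Sum>\<^sub>\<infinity>k. c k * mode k z)"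
    proof (rule tendsto_infsum_dominated)
      show "(\<lambda>k. C (2 * CARD('n)) * (1 / w k ^ (2 * CARD('n)))) summable_on UNIV"
        unfolding w_def by (intro summable_on_cmult_right summable_weight)
      show "cmod (b (r p) k * mode k (zp p)) \<le> C (2 * CARD('n)) * (1 / w k ^ (2 * CARD('n)))" for p k
      proof -
        have "0 < w k ^ (2 * CARD('n))" using w[of k] by simp
        then show ?thesis using b[of "r p" k "2 * CARD('n)"] by (simp add: norm_mult pos_le_divide_eq)
      qed
      show "(\<lambda>p. b (r p) k * mode k (zp p)) \<longlonglongrightarrow> c k * mode k z" for k
      proof (rule tendsto_mult[OF bc])
        have "isCont (mode k) z" unfolding mode_def cis_conv_exp by (intro continuous_intros)
        from isCont_tendsto_compose[OF this zp] show "(\<lambda>p. mode k (zp p)) \<longlonglongrightarrow> mode k z" .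
      qed
    qed
    moreover have "(\<lambda>p. f (zp p)) \<longlonglongrightarrow> f z"
      using smooth_continuous[OF f(1)] by (intro isCont_tendsto_compose[OF _ zp]) (simp add: continuous_on_eq_continuous_at)
    ultimately show ?thesis by (simp add: LIMSEQ_unique)
  qed
  ultimately show ?thesis by blast
qed

section \<open>Schwartz functions and Fourier inversion\<close>

lemma measurable_cis [measurable]: "cis \<in> borel_measurable borel"
  unfolding cis_conv_exp by measurable

lemma schwartz_smooth: "schwartz f \<Longrightarrow> smooth f"
  by (simp add: schwartz_def)

lemma add_one_power_le:
  fixes t :: real
  assumes "0 \<le> t"
  shows "(1 + t) ^ k \<le> 2 ^ k * (1 + t ^ k)"
proof -
  have "(1 + t) ^ k \<le> (2 * max 1 t) ^ k" using assms by (intro power_mono) auto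
  also have "\<dots> = 2 ^ k * max 1 t ^ k" by (simp add: power_mult_distrib)
  also have "max 1 t ^ k \<le> 1 + t ^ k" using assms by (auto simp: max_def)
  finally show ?thesis by simp
qed

lemma schwartz_bound:
  assumes "schwartz f"
  obtains C where "0 \<le> C" "\<And>x. (1 + norm x) ^ k * norm (directional_derivs vs f x) \<le> C"
proof -
  obtain C0 where C0: "\<And>x. norm x ^ 0 * norm (directional_derivs vs f x) \<le> C0"
    using assms unfolding schwartz_def by blast
  obtain C1 where C1: "\<And>x. norm x ^ k * norm (directional_derivs vs f x) \<le> C1"
    using assms unfolding schwartz_def by blast
  have "(1 + norm x) ^ k * norm (directional_derivs vs f x) \<le> 2 ^ k * (C0 + C1)" for x
  proof -
    have "(1 + norm x) ^ k * norm (directional_derivs vs f x) \<le> 2 ^ k * (1 + norm x ^ k) * norm (directional_derivs vs f x)"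
      by (intro mult_right_mono add_one_power_le) auto
    also have "\<dots> = 2 ^ k * (norm x ^ 0 * norm (directional_derivs vs f x) + norm x ^ k * norm (directional_derivs vs f x))"
      by (simp add: algebra_simps)
    also have "\<dots> \<le> 2 ^ k * (C0 + C1)" by (intro mult_left_mono add_mono C0 C1) auto
    finally show ?thesis .
  qed
  moreover from this[of 0] have "0 \<le> 2 ^ k * (C0 + C1)"
    by (rule order_trans[rotated]) auto
  ultimately show ?thesis using that by blast
qed

lemma schwartz_directional_derivs: "schwartz f \<Longrightarrow> schwartz (directional_derivs vs f)"
  unfolding schwartz_def
  by (auto intro: smooth_directional_derivs simp: directional_derivs_append[symmetric])

lemma schwartz_coinduct:
  assumes "P f"
    and step: "\<And>f. P f \<Longrightarrow> \<exists>f'. (\<forall>x. (f has_derivative f' x) (at x)) \<and> (\<forall>v. P (\<lambda>x. f' x v))"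
    and bound: "\<And>f k. P f \<Longrightarrow> \<exists>C. \<forall>x. norm x ^ k * cmod (f x) \<le> C"
  shows "schwartz f"
  unfolding schwartz_def
  using smooth_coinduct[of P, OF assms(1) step] class_directional_derivs[of P, OF assms(1) step] bound
  by blast

text \<open>Peetre's inequality; it transfers decay from a function to its translates.\<close>

lemma norm_shift_weight:
  fixes x a :: "'a::real_normed_vector"
  shows "(1 + norm x) ^ k \<le> (1 + norm a) ^ k * (1 + norm (x + a)) ^ k"
proof -
  have "norm x \<le> norm (x + a) + norm a" using norm_triangle_ineq4[of "x + a" a] by simp
  then have "1 + norm x \<le> (1 + norm a) * (1 + norm (x + a))"
  proof -
    have "0 \<le> norm a * norm (x + a)" by simp
    moreover have "(1 + norm a) * (1 + norm (x + a)) = 1 + norm a + norm (x + a) + norm a * norm (x + a)"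
      by (simp add: algebra_simps)
    ultimately show ?thesis using \<open>norm x \<le> norm (x + a) + norm a\<close> by linarith
  qed
  then have "(1 + norm x) ^ k \<le> ((1 + norm a) * (1 + norm (x + a))) ^ k" by (intro power_mono) auto
  then show ?thesis by (simp add: power_mult_distrib)
qed

text \<open>\<open>lborel\<close> is the image of a product measure over \<open>Basis\<close>, so
  the integral of a product of one-variable functions factors. Used for the integrable weight and
  for Gaussians.\<close>

lemma
  fixes g :: "'a::euclidean_space \<Rightarrow> real \<Rightarrow> 'b::{real_normed_field,banach,second_countable_topology}"
  assumes g: "\<And>b. b \<in> Basis \<Longrightarrow> integrable lborel (g b)"
  shows integrable_lborel_prod: "integrable lborel (\<lambda>x::'a. \<Prod>b\<in>Basis. g b (x \<bullet> b))"
    and integral_lborel_prod: "(LINT x|lborel. (\<Prod>b\<in>Basis. g b (x \<bullet> b))) = (\<Prod>b\<in>Basis. (LINT x|lborel. g b x))"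
proof -
  interpret product_sigma_finite "\<lambda>_::'a. lborel :: real measure" ..
  have [measurable]: "b \<in> Basis \<Longrightarrow> g b \<in> borel_measurable borel" for b
    using g[of b] by (auto dest: borel_measurable_integrable)
  have m: "(\<lambda>f. \<Sum>b\<in>Basis. f b *\<^sub>R b) \<in> measurable (\<Pi>\<^sub>M b\<in>Basis. lborel) (borel :: 'a measure)"
    by measurable
  have m2: "(\<lambda>x::'a. \<Prod>b\<in>Basis. g b (x \<bullet> b)) \<in> borel_measurable borel"
    by measurable
  have e: "(\<Prod>b\<in>Basis. g b ((\<Sum>c\<in>Basis. f c *\<^sub>R c) \<bullet> b)) = (\<Prod>b\<in>Basis. g b (f b))" for f :: "'a \<Rightarrow> real"
    by (intro prod.cong refl) simp
  show "integrable lborel (\<lambda>x::'a. \<Prod>b\<in>Basis. g b (x \<bullet> b))"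
    unfolding lborel_eq[where 'a = 'a] integrable_distr_eq[OF m m2] e
    by (rule product_integrable_prod) (auto intro: g)
  show "(LINT x|lborel. (\<Prod>b\<in>Basis. g b (x \<bullet> b))) = (\<Prod>b\<in>Basis. (LINT x|lborel. g b x))"
    unfolding lborel_eq[where 'a = 'a] integral_distr[OF m m2] e
    by (rule product_integral_prod) (auto intro: g)
qed

lemma integrable_weight: "integrable lborel (\<lambda>x::'a::euclidean_space. 1 / (1 + norm x) ^ (2 * DIM('a)))"
proof (rule Bochner_Integration.integrable_bound)
  have "integrable lborel (\<lambda>x::real. inverse (1 + x\<^sup>2))"
    using integrable_inverse_1_plus_square by (simp add: set_integrable_def einterval_def)
  then show "integrable lborel (\<lambda>x::'a. \<Prod>b\<in>Basis. inverse (1 + (x \<bullet> b)\<^sup>2))"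
    by (intro integrable_lborel_prod)
  show "AE x in (lborel :: 'a measure). norm (1 / (1 + norm x) ^ (2 * DIM('a))) \<le> norm (\<Prod>b\<in>Basis. inverse (1 + (x \<bullet> b)\<^sup>2))"
  proof (rule AE_I2)
    fix x :: 'a
    have "1 + (x \<bullet> b)\<^sup>2 \<le> (1 + norm x)\<^sup>2" if "b \<in> Basis" for b
    proof -
      have "\<bar>x \<bullet> b\<bar>\<^sup>2 \<le> (norm x)\<^sup>2" using that by (intro power_mono Basis_le_norm) auto
      moreover have "(1 + norm x)\<^sup>2 = 1 + (norm x)\<^sup>2 + 2 * norm x" by (simp add: power2_sum)
      ultimately show ?thesis using norm_ge_zero[of x] unfolding power2_abs by linarith
    qed
    then have "(\<Prod>b\<in>(Basis :: 'a set). 1 + (x \<bullet> b)\<^sup>2) \<le> (\<Prod>b\<in>(Basis :: 'a set). (1 + norm x)\<^sup>2)"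
      by (intro prod_mono) (auto intro: add_nonneg_nonneg)
    then have le: "(\<Prod>b\<in>(Basis :: 'a set). 1 + (x \<bullet> b)\<^sup>2) \<le> (1 + norm x) ^ (2 * DIM('a))"
      by (simp add: power_mult)
    have pos: "0 < (\<Prod>b\<in>(Basis :: 'a set). 1 + (x \<bullet> b)\<^sup>2)"
      by (intro prod_pos) (auto intro: add_pos_nonneg)
    have "1 / (1 + norm x) ^ (2 * DIM('a)) \<le> 1 / (\<Prod>b\<in>(Basis :: 'a set). 1 + (x \<bullet> b)\<^sup>2)"
      using le pos by (intro frac_le) auto
    also have "\<dots> = (\<Prod>b\<in>Basis. inverse (1 + (x \<bullet> b)\<^sup>2))"
      by (simp add: inverse_eq_divide prod_dividef)
    finally have l: "1 / (1 + norm x) ^ (2 * DIM('a)) \<le> (\<Prod>b\<in>Basis. inverse (1 + (x \<bullet> b)\<^sup>2))" .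
    moreover have "0 \<le> 1 / (1 + norm x) ^ (2 * DIM('a))" by simp
    ultimately show "norm (1 / (1 + norm x) ^ (2 * DIM('a))) \<le> norm (\<Prod>b\<in>Basis. inverse (1 + (x \<bullet> b)\<^sup>2))"
      unfolding real_norm_def by linarith
  qed
qed measurable

lemma integrable_of_weight_bound:
  fixes f :: "'a::euclidean_space \<Rightarrow> complex"
  assumes [measurable]: "f \<in> borel_measurable borel" and "\<And>x. (1 + norm x) ^ (2 * DIM('a)) * cmod (f x) \<le> C"
  shows "integrable lborel f"
proof (rule Bochner_Integration.integrable_bound)
  show "integrable lborel (\<lambda>x::'a. C * (1 / (1 + norm x) ^ (2 * DIM('a))))"
    by (intro integrable_mult_right integrable_weight)
  show "AE x in lborel. norm (f x) \<le> norm (C * (1 / (1 + norm x) ^ (2 * DIM('a))))"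
  proof (rule AE_I2)
    fix x :: 'a
    have "0 < (1 + norm x) ^ (2 * DIM('a))" by (intro zero_less_power add_pos_nonneg) auto
    then have "norm (f x) \<le> C * (1 / (1 + norm x) ^ (2 * DIM('a)))"
      using assms(2)[of x] by (simp add: pos_le_divide_eq mult.commute)
    then show "norm (f x) \<le> norm (C * (1 / (1 + norm x) ^ (2 * DIM('a))))"
      by (metis abs_ge_self order_trans real_norm_def)
  qed
qed measurable

lemma schwartz_measurable: "schwartz f \<Longrightarrow> f \<in> borel_measurable borel"
  by (intro borel_measurable_continuous_onI smooth_continuous schwartz_smooth)

lemma schwartz_integrable:
  fixes f :: "'a::euclidean_space \<Rightarrow> complex"
  assumes "schwartz f"
  shows "integrable lborel f"
proof -
  obtain C where "\<And>x. (1 + norm x) ^ (2 * DIM('a)) * cmod (directional_derivs [] f x) \<le> C"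
    using schwartz_bound[OF assms] by metis
  then show ?thesis by (intro integrable_of_weight_bound schwartz_measurable assms) auto
qed

lemma integral_affine:
  fixes f :: "'a::euclidean_space \<Rightarrow> complex"
  assumes c: "c \<noteq> 0" and [measurable]: "f \<in> borel_measurable borel"
  shows "(LINT x|lborel. f x) = \<bar>c\<bar> ^ DIM('a) *\<^sub>R (LINT x|lborel. f (t + c *\<^sub>R x))"
proof -
  have m: "(\<lambda>x. t + c *\<^sub>R x) \<in> measurable lborel (borel :: 'a measure)" by measurable
  have "(LINT x|lborel. f x) = (LINT x|density (distr lborel borel (\<lambda>x. t + c *\<^sub>R x)) (\<lambda>_. \<bar>c\<bar> ^ DIM('a)). f x)"
    using lborel_affine[OF c, of t] by simp
  also have "\<dots> = (LINT x|distr lborel borel (\<lambda>x. t + c *\<^sub>R x). \<bar>c\<bar> ^ DIM('a) *\<^sub>R f x)"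
    by (rule integral_density) auto
  also have "\<dots> = (LINT x|lborel. \<bar>c\<bar> ^ DIM('a) *\<^sub>R f (t + c *\<^sub>R x))"
    by (rule integral_distr[OF m]) measurable
  finally show ?thesis by simp
qed

lemma integral_translate:
  fixes f :: "'a::euclidean_space \<Rightarrow> complex"
  assumes "f \<in> borel_measurable borel"
  shows "(LINT x|lborel. f (x + t)) = (LINT x|lborel. f x)"
  using integral_affine[of 1 f t, OF _ assms] by (simp add: add.commute)

text \<open>Unnormalized and with a free scale \<open>r\<close>, which becomes
  \<open>1 / h = 2 * pi * N\<close> in the Weyl formula.\<close>

definition FT :: "real \<Rightarrow> ('a::euclidean_space \<Rightarrow> complex) \<Rightarrow> 'a \<Rightarrow> complex" where
  "FT r u \<xi> = (LINT y|lborel. cis (- r * (y \<bullet> \<xi>)) * u y)"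

section \<open>The scaled Fourier transform of Schwartz functions\<close>

lemma integrable_cis_mult:
  fixes u :: "'a::euclidean_space \<Rightarrow> complex"
  assumes u: "integrable lborel u" and [measurable]: "p \<in> borel_measurable borel"
  shows "integrable lborel (\<lambda>y. cis (p y) * u y)"
proof -
  have [measurable]: "u \<in> borel_measurable borel" using u by (auto dest: borel_measurable_integrable)
  show ?thesis by (rule Bochner_Integration.integrable_bound[OF u]) (auto simp: norm_mult)
qed

lemma norm_FT_le:
  assumes "integrable lborel u"
  shows "cmod (FT r u \<xi>) \<le> (LINT y|lborel. cmod (u y))"
  unfolding FT_def
  by (rule order_trans[OF integral_norm_bound]) (simp add: norm_mult)

lemma FT_measurable [measurable]:
  assumes [measurable]: "u \<in> borel_measurable borel"
  shows "FT r u \<in> borel_measurable borel"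
  unfolding FT_def by measurable

lemma vector_derivative_quotient:
  fixes f :: "real \<Rightarrow> 'b::real_normed_vector"
  assumes "(f has_vector_derivative d) (at 0)"
  shows "((\<lambda>s. (f s - f 0) /\<^sub>R s) \<longlongrightarrow> d) (at 0)"
proof -
  have "((\<lambda>s. (1 / norm s) *\<^sub>R (f s - (f 0 + s *\<^sub>R d))) \<longlongrightarrow> 0) (at 0)"
    using assms unfolding has_vector_derivative_def has_derivative_at2 by simp
  then have "((\<lambda>s. norm ((1 / norm s) *\<^sub>R (f s - (f 0 + s *\<^sub>R d)))) \<longlongrightarrow> 0) (at 0)"
    by (rule tendsto_norm_zero)
  moreover have "\<forall>\<^sub>F s in at 0. norm ((1 / norm s) *\<^sub>R (f s - (f 0 + s *\<^sub>R d))) = norm ((f s - f 0) /\<^sub>R s - d)"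
    unfolding eventually_at_filter
  proof (intro always_eventually allI impI)
    fix s :: real assume "s \<noteq> 0"
    then have "(f s - f 0) /\<^sub>R s - d = (f s - (f 0 + s *\<^sub>R d)) /\<^sub>R s" by (simp add: algebra_simps)
    then show "norm ((1 / norm s) *\<^sub>R (f s - (f 0 + s *\<^sub>R d))) = norm ((f s - f 0) /\<^sub>R s - d)"
      by (simp add: inverse_eq_divide)
  qed
  ultimately have "((\<lambda>s. norm ((f s - f 0) /\<^sub>R s - d)) \<longlongrightarrow> 0) (at 0)"
    by (rule Lim_transform_eventually)
  then show ?thesis by (simp add: tendsto_norm_zero_iff LIM_zero_iff)
qed

text \<open>Integration by parts: translation invariance of the integral, differentiated at \<open>0\<close>.\<close>

lemma FT_derivative:
  fixes u :: "'a::euclidean_space \<Rightarrow> complex"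
  assumes u: "schwartz u"
  shows "FT r (directional_derivs [v] u) \<xi> = \<i> * (r * (v \<bullet> \<xi>)) * FT r u \<xi>"
proof -
  define t where "t n = inverse (real (Suc n))" for n
  have t: "0 < t n" "t n \<le> 1" for n by (auto simp: t_def divide_simps)
  have t0: "t \<longlonglongrightarrow> 0" unfolding t_def by (rule LIMSEQ_inverse_real_of_nat)
  define K where "K = 2 * DIM('a)"
  define w where "w x = (1 + norm x) ^ K" for x :: 'a
  have w0: "0 < w x" for x unfolding w_def by (intro zero_less_power add_pos_nonneg) auto
  obtain C where C: "0 \<le> C" "\<And>x. w x * cmod (directional_derivs [v] u x) \<le> C"
    using schwartz_bound[OF u, of K "[v]"] unfolding w_def by blast
  have [measurable]: "u \<in> borel_measurable borel" "directional_derivs [v] u \<in> borel_measurable borel"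
    using schwartz_measurable schwartz_directional_derivs u by blast+
  define q where "q n y = (1 / t n) *\<^sub>R (u (y + t n *\<^sub>R v) - u y)" for n y
  have [measurable]: "q n \<in> borel_measurable borel" for n unfolding q_def by measurable
  define c where "c y = cis (- r * (y \<bullet> \<xi>))" for y
  have [measurable]: "c \<in> borel_measurable borel" unfolding c_def by measurable
  have FTc: "FT r f \<xi> = (LINT y|lborel. c y * f y)" for f by (simp add: FT_def c_def)
  have "(\<lambda>n. LINT y|lborel. c y * q n y) \<longlonglongrightarrow> (LINT y|lborel. c y * directional_derivs [v] u y)"
  proof (rule integral_dominated_convergence)
    show "integrable lborel (\<lambda>y :: 'a. C * (1 + norm v) ^ K * (1 / (1 + norm y) ^ (2 * DIM('a))))"
      by (intro integrable_mult_right integrable_weight)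
    show "AE y in lborel. (\<lambda>n. c y * q n y) \<longlonglongrightarrow> c y * directional_derivs [v] u y"
    proof (intro AE_I2 tendsto_mult_left)
      fix y
      have "((\<lambda>s. u (y + s *\<^sub>R v)) has_vector_derivative directional_derivs [v] u (y + 0 *\<^sub>R v)) (at 0)"
        by (rule smooth_has_vector_derivative[OF schwartz_smooth[OF u]])
      from vector_derivative_quotient[OF this]
      have "((\<lambda>s. (u (y + s *\<^sub>R v) - u y) /\<^sub>R s) \<longlongrightarrow> directional_derivs [v] u y) (at 0)" by (simp del: directional_derivs.simps)
      moreover have "filterlim t (at 0) sequentially"
        using t0 t(1) by (auto simp: filterlim_at less_imp_neq[symmetric] intro!: always_eventually)
      ultimately show "(\<lambda>n. q n y) \<longlonglongrightarrow> directional_derivs [v] u y"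
        unfolding q_def using filterlim_compose by (fastforce simp: inverse_eq_divide)
    qed
    show "AE y in lborel. norm (c y * q n y) \<le> C * (1 + norm v) ^ K * (1 / (1 + norm y) ^ (2 * DIM('a)))" for n
    proof (rule AE_I2)
      fix y
      have "cmod (u (y + t n *\<^sub>R v) - u (y + 0 *\<^sub>R v)) \<le> (C * (1 + norm v) ^ K / w y) * norm (t n - 0)"
      proof (rule differentiable_bound[of "{0..t n}" _ "\<lambda>s h. h *\<^sub>R directional_derivs [v] u (y + s *\<^sub>R v)"])
        fix s assume s: "s \<in> {0..t n}"
        show "((\<lambda>s. u (y + s *\<^sub>R v)) has_derivative (\<lambda>h. h *\<^sub>R directional_derivs [v] u (y + s *\<^sub>R v))) (at s within {0..t n})"
          using smooth_has_vector_derivative[OF schwartz_smooth[OF u], of y v s]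
          unfolding has_vector_derivative_def by (rule has_derivative_at_withinI)
        \<comment> \<open>The steps \<open>t n\<close> are at most 1, so Peetre's inequality gives
          one integrable majorant valid for all \<open>n\<close>.\<close>
        have "norm (s *\<^sub>R v) \<le> norm v" using s t(2)[of n] by (simp add: mult_left_le_one_le)
        then have "(1 + norm (s *\<^sub>R v)) ^ K \<le> (1 + norm v) ^ K" by (intro power_mono) auto
        then have "w y \<le> (1 + norm v) ^ K * w (y + s *\<^sub>R v)"
          unfolding w_def using norm_shift_weight[of y K "s *\<^sub>R v"]
          by (meson mult_right_mono order_trans zero_le_power add_nonneg_nonneg norm_ge_zero zero_le_one)
        then have "w y * cmod (directional_derivs [v] u (y + s *\<^sub>R v)) \<le> (1 + norm v) ^ K * w (y + s *\<^sub>R v) * cmod (directional_derivs [v] u (y + s *\<^sub>R v))"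
          by (intro mult_right_mono) auto
        also have "\<dots> \<le> (1 + norm v) ^ K * C"
          unfolding mult.assoc by (intro mult_left_mono C(2)) auto
        finally have "cmod (directional_derivs [v] u (y + s *\<^sub>R v)) \<le> C * (1 + norm v) ^ K / w y"
          using w0[of y] by (simp add: pos_le_divide_eq mult.commute)
        then show "onorm (\<lambda>h. h *\<^sub>R directional_derivs [v] u (y + s *\<^sub>R v)) \<le> C * (1 + norm v) ^ K / w y"
          by (rule order_trans[OF onorm_scaleR_right_le])
      qed (use t(1)[of n] in auto)
      then have "cmod (q n y) \<le> C * (1 + norm v) ^ K / w y"
      proof -
        have "cmod (q n y) = cmod (u (y + t n *\<^sub>R v) - u (y + 0 *\<^sub>R v)) / t n"
          using t(1)[of n] by (simp add: q_def)
        then show ?thesis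
          using \<open>cmod (u (y + t n *\<^sub>R v) - u (y + 0 *\<^sub>R v)) \<le> _\<close> t(1)[of n]
          by (simp only: pos_divide_le_eq) simp
      qed
      then show "norm (c y * q n y) \<le> C * (1 + norm v) ^ K * (1 / (1 + norm y) ^ (2 * DIM('a)))"
        by (simp add: norm_mult c_def w_def K_def)
    qed
  qed measurable
  \<comment> \<open>Translating the integration variable moves the increment from \<open>u\<close>
    onto the phase, where it is an explicit difference quotient of \<open>cis\<close>.\<close>
  moreover have eq: "(LINT y|lborel. c y * q n y) = ((cis (r * t n * (v \<bullet> \<xi>)) - 1) / t n) * FT r u \<xi>" for n
  proof -
    have i1: "integrable lborel (\<lambda>y. c y * u y)"
      unfolding c_def by (intro integrable_cis_mult schwartz_integrable u) measurable
    have c: "c y = cis (r * t n * (v \<bullet> \<xi>)) * c (y + t n *\<^sub>R v)" for y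
      by (simp add: c_def cis_mult inner_add_left algebra_simps)
    have "(LINT y|lborel. c y * u (y + t n *\<^sub>R v))
        = (LINT y|lborel. cis (r * t n * (v \<bullet> \<xi>)) * (c (y + t n *\<^sub>R v) * u (y + t n *\<^sub>R v)))"
      by (subst c) (simp only: mult.assoc)
    also have "\<dots> = cis (r * t n * (v \<bullet> \<xi>)) * (LINT y|lborel. c (y + t n *\<^sub>R v) * u (y + t n *\<^sub>R v))"
      by (rule integral_mult_right_zero)
    also have "(LINT y|lborel. c (y + t n *\<^sub>R v) * u (y + t n *\<^sub>R v)) = (LINT y|lborel. c y * u y)"
      by (rule integral_translate[of "\<lambda>y. c y * u y"]) measurable
    finally have 1: "(LINT y|lborel. c y * u (y + t n *\<^sub>R v)) = cis (r * t n * (v \<bullet> \<xi>)) * (LINT y|lborel. c y * u y)" .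
    have i2: "integrable lborel (\<lambda>y. c y * u (y + t n *\<^sub>R v))"
    proof -
      obtain B where B: "0 \<le> B" "\<And>x. (1 + norm x) ^ (2 * DIM('a)) * cmod (directional_derivs [] u x) \<le> B"
        using schwartz_bound[OF u] by metis
      have "integrable lborel (\<lambda>y. u (t n *\<^sub>R v + 1 *\<^sub>R y))"
      proof (rule integrable_of_weight_bound)
        show "(1 + norm y) ^ (2 * DIM('a)) * cmod (u (t n *\<^sub>R v + 1 *\<^sub>R y)) \<le> (1 + norm (t n *\<^sub>R v)) ^ (2 * DIM('a)) * B" for y
        proof -
          have "(1 + norm y) ^ (2 * DIM('a)) * cmod (u (y + t n *\<^sub>R v)) \<le> (1 + norm (t n *\<^sub>R v)) ^ (2 * DIM('a)) * (1 + norm (y + t n *\<^sub>R v)) ^ (2 * DIM('a)) * cmod (u (y + t n *\<^sub>R v))"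
            by (intro mult_right_mono norm_shift_weight) auto
          also have "\<dots> \<le> (1 + norm (t n *\<^sub>R v)) ^ (2 * DIM('a)) * B"
            using B(2)[of "y + t n *\<^sub>R v"] unfolding mult.assoc by (intro mult_left_mono) auto
          finally show ?thesis by (simp add: add.commute)
        qed
      qed measurable
      then have "integrable lborel (\<lambda>y. u (y + t n *\<^sub>R v))" by (simp add: add.commute)
      then show ?thesis unfolding c_def by (intro integrable_cis_mult) measurable
    qed
    have "(LINT y|lborel. c y * q n y) = (LINT y|lborel. (1 / t n) *\<^sub>R (c y * u (y + t n *\<^sub>R v) - c y * u y))"
      by (rule Bochner_Integration.integral_cong) (auto simp: q_def algebra_simps)
    also have "\<dots> = (1 / t n) *\<^sub>R (cis (r * t n * (v \<bullet> \<xi>)) * (LINT y|lborel. c y * u y) - (LINT y|lborel. c y * u y))"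
      using i1 i2 by (simp add: 1)
    finally show ?thesis
      unfolding FTc by (simp add: scaleR_conv_of_real left_diff_distrib diff_divide_distrib)
  qed
  moreover have "(\<lambda>n. ((cis (r * t n * (v \<bullet> \<xi>)) - 1) / t n) * FT r u \<xi>) \<longlonglongrightarrow> \<i> * (r * (v \<bullet> \<xi>)) * FT r u \<xi>"
  proof (rule tendsto_mult_right)
    define a where "a = r * (v \<bullet> \<xi>)"
    have "((\<lambda>s. exp (s * (\<i> * a))) has_field_derivative \<i> * a) (at 0)"
      by (auto intro!: derivative_eq_intros)
    then have "((\<lambda>h. (exp (h * (\<i> * a)) - 1) / h) \<longlongrightarrow> \<i> * a) (at 0)"
      by (simp add: has_field_derivative_iff)
    moreover have "filterlim (\<lambda>n. complex_of_real (t n)) (at 0) sequentially"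
      using tendsto_of_real[OF t0, where 'a = complex] t(1)
      by (auto simp: filterlim_at less_imp_neq[symmetric] intro!: always_eventually)
    ultimately have "(\<lambda>n. (exp (t n * (\<i> * a)) - 1) / t n) \<longlonglongrightarrow> \<i> * a"
      by (rule filterlim_compose)
    then show "(\<lambda>n. (cis (r * t n * (v \<bullet> \<xi>)) - 1) / t n) \<longlonglongrightarrow> \<i> * complex_of_real (r * (v \<bullet> \<xi>))"
      by (simp add: cis_conv_exp a_def mult_ac)
  qed
  ultimately have "(LINT y|lborel. c y * directional_derivs [v] u y) = \<i> * (r * (v \<bullet> \<xi>)) * FT r u \<xi>"
    unfolding eq by (intro LIMSEQ_unique)
  then show ?thesis unfolding FTc[of "directional_derivs [v] u"] .
qed

text \<open>\<open>K\<close> derivatives along a basis vector \<open>b\<close> bound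
  \<open>\<bar>\<xi> \<bullet> b\<bar> ^ K\<close> times the transform. At each \<open>\<xi>\<close>
  the largest coordinate controls the norm, and \<open>K = 2 * DIM('a)\<close> makes the weight
  integrable.\<close>

lemma FT_integrable:
  fixes u :: "'a::euclidean_space \<Rightarrow> complex"
  assumes u: "schwartz u" and l: "0 < r"
  shows "integrable lborel (FT r u)"
proof -
  define K where "K = 2 * DIM('a)"
  have it: "FT r (directional_derivs (replicate k b) u) \<xi> = (\<i> * (r * (b \<bullet> \<xi>))) ^ k * FT r u \<xi>" for k b \<xi>
  proof (induction k)
    case (Suc k)
    have "directional_derivs (replicate (Suc k) b) u = directional_derivs [b] (directional_derivs (replicate k b) u)"
      by simp
    then have "FT r (directional_derivs (replicate (Suc k) b) u) \<xi> = \<i> * (r * (b \<bullet> \<xi>)) * FT r (directional_derivs (replicate k b) u) \<xi>"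
      using FT_derivative[OF schwartz_directional_derivs[OF u]] by metis
    then show ?case by (simp add: Suc del: directional_derivs.simps replicate.simps)
  qed simp
  define B where "B b = (LINT y|lborel. cmod (directional_derivs (replicate K b) u y))" for b
  have B: "r ^ K * \<bar>\<xi> \<bullet> b\<bar> ^ K * cmod (FT r u \<xi>) \<le> B b" for b \<xi>
  proof -
    have "r ^ K * \<bar>\<xi> \<bullet> b\<bar> ^ K * cmod (FT r u \<xi>) = cmod (FT r (directional_derivs (replicate K b) u) \<xi>)"
      using l by (simp add: it norm_mult norm_power power_mult_distrib inner_commute abs_mult)
    also have "\<dots> \<le> B b"
      unfolding B_def by (intro norm_FT_le schwartz_integrable schwartz_directional_derivs u)
    finally show ?thesis .
  qed
  have B0: "0 \<le> B b" for b unfolding B_def by (simp add: integral_nonneg_AE)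
  define A where "A = (LINT y|lborel. cmod (u y))"
  have A: "cmod (FT r u \<xi>) \<le> A" for \<xi> unfolding A_def by (intro norm_FT_le schwartz_integrable u)
  have "(1 + norm \<xi>) ^ K * cmod (FT r u \<xi>) \<le> 2 ^ K * (A + DIM('a) ^ K * ((\<Sum>b\<in>Basis. B b) / r ^ K))" for \<xi>
  proof -
    define m where "m = Max ((\<lambda>b. \<bar>\<xi> \<bullet> b\<bar>) ` Basis)"
    have "m \<in> (\<lambda>b. \<bar>\<xi> \<bullet> b\<bar>) ` Basis" unfolding m_def by (rule Max_in) auto
    then obtain b where b: "b \<in> Basis" "m = \<bar>\<xi> \<bullet> b\<bar>" by (rule imageE)
    have "norm \<xi> \<le> (\<Sum>b\<in>Basis. \<bar>\<xi> \<bullet> b\<bar>)" by (rule norm_le_l1)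
    also have "\<dots> \<le> (\<Sum>b\<in>(Basis :: 'a set). m)" unfolding m_def by (intro sum_mono Max_ge) auto
    finally have n: "norm \<xi> \<le> DIM('a) * m" by simp
    have "norm \<xi> ^ K * cmod (FT r u \<xi>) \<le> (DIM('a) * m) ^ K * cmod (FT r u \<xi>)"
      by (intro mult_right_mono power_mono n) auto
    also have "\<dots> = DIM('a) ^ K * (m ^ K * cmod (FT r u \<xi>))" by (simp add: power_mult_distrib)
    also have "m ^ K * cmod (FT r u \<xi>) \<le> B b / r ^ K"
      using B[of \<xi> b] l by (simp add: b(2) pos_le_divide_eq mult_ac)
    also have "B b / r ^ K \<le> (\<Sum>b\<in>Basis. B b) / r ^ K"
      using l by (intro divide_right_mono member_le_sum b(1)) (auto simp: B0)
    finally have 1: "norm \<xi> ^ K * cmod (FT r u \<xi>) \<le> DIM('a) ^ K * ((\<Sum>b\<in>Basis. B b) / r ^ K)"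
      by (simp add: mult_left_mono)
    have "(1 + norm \<xi>) ^ K * cmod (FT r u \<xi>) \<le> 2 ^ K * (1 + norm \<xi> ^ K) * cmod (FT r u \<xi>)"
      by (intro mult_right_mono add_one_power_le) auto
    also have "\<dots> = 2 ^ K * (cmod (FT r u \<xi>) + norm \<xi> ^ K * cmod (FT r u \<xi>))" by (simp add: algebra_simps)
    also have "\<dots> \<le> 2 ^ K * (A + DIM('a) ^ K * ((\<Sum>b\<in>Basis. B b) / r ^ K))"
      by (intro mult_left_mono add_mono A 1) auto
    finally show ?thesis .
  qed
  then show ?thesis
    unfolding K_def by (intro integrable_of_weight_bound FT_measurable schwartz_measurable u)
qed

lemma integrable_affine:
  fixes f :: "'a::euclidean_space \<Rightarrow> 'b::{banach, second_countable_topology}"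
  assumes c: "c \<noteq> 0" and f: "integrable lborel f"
  shows "integrable lborel (\<lambda>x. f (t + c *\<^sub>R x))"
proof -
  have [measurable]: "f \<in> borel_measurable borel" using f by (auto dest: borel_measurable_integrable)
  have m: "(\<lambda>x. t + c *\<^sub>R x) \<in> measurable lborel (borel :: 'a measure)" by measurable
  have "integrable (density (distr lborel borel (\<lambda>x. t + c *\<^sub>R x)) (\<lambda>_. \<bar>c\<bar> ^ DIM('a))) f"
    using f lborel_affine[OF c, of t] by simp
  then have "integrable (distr lborel borel (\<lambda>x. t + c *\<^sub>R x)) (\<lambda>x. \<bar>c\<bar> ^ DIM('a) *\<^sub>R f x)"
    by (subst (asm) integrable_density) auto
  then have "integrable lborel (\<lambda>x. \<bar>c\<bar> ^ DIM('a) *\<^sub>R f (t + c *\<^sub>R x))"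
    by (subst (asm) integrable_distr_eq[OF m]) auto
  then have "integrable lborel (\<lambda>x. inverse (\<bar>c\<bar> ^ DIM('a)) *\<^sub>R \<bar>c\<bar> ^ DIM('a) *\<^sub>R f (t + c *\<^sub>R x))"
    by (rule integrable_scaleR_right)
  then show ?thesis using c by simp
qed

definition gauss :: "'a::euclidean_space \<Rightarrow> real" where
  "gauss x = (\<Prod>b\<in>Basis. std_normal_density (x \<bullet> b))"

section \<open>Gaussians and Fourier inversion\<close>

lemma gauss_eq: "gauss (x :: 'a::euclidean_space) = exp (- (norm x)\<^sup>2 / 2) / sqrt (2 * pi) ^ DIM('a)"
proof -
  have "gauss x = (\<Prod>b\<in>(Basis :: 'a set). 1 / sqrt (2 * pi)) * (\<Prod>b\<in>Basis. exp (- (x \<bullet> b)\<^sup>2 / 2))"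
    unfolding gauss_def std_normal_density_def prod.distrib[symmetric] by simp
  also have "(\<Prod>b\<in>Basis. exp (- (x \<bullet> b)\<^sup>2 / 2)) = exp (\<Sum>b\<in>Basis. - (x \<bullet> b)\<^sup>2 / 2)"
    by (simp add: exp_sum)
  also have "(\<Sum>b\<in>Basis. - (x \<bullet> b)\<^sup>2 / 2) = - (norm x)\<^sup>2 / 2"
    unfolding norm_eq_sqrt_inner euclidean_inner[of x x]
    by (simp add: sum_nonneg sum_negf sum_divide_distrib[symmetric] power2_eq_square)
  finally show ?thesis by (simp add: power_divide)
qed

lemma gauss_measurable [measurable]: "gauss \<in> borel_measurable borel"
  unfolding gauss_def by measurable

lemma gauss_bounds: "0 \<le> gauss x" "gauss (x :: 'a::euclidean_space) \<le> gauss (0 :: 'a)"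
  by (auto simp: gauss_eq divide_right_mono)

lemma integrable_gauss: "integrable lborel (gauss :: 'a::euclidean_space \<Rightarrow> real)"
  unfolding gauss_def by (intro integrable_lborel_prod integrable_normal_density) simp

lemma integral_gauss: "(LINT x|lborel. gauss (x :: 'a::euclidean_space)) = 1"
  unfolding gauss_def
  by (subst integral_lborel_prod) (simp_all add: integrable_normal_density integral_normal_density)

text \<open>The integral factors over \<open>Basis\<close> into values of the characteristic
  function of the standard normal distribution.\<close>

lemma integral_cis_gauss:
  fixes t :: "'a::euclidean_space"
  shows "(LINT x|lborel. cis (t \<bullet> x) * gauss x) = exp (- (norm t)\<^sup>2 / 2)"
proof -
  define g where "g b s = cis ((t \<bullet> b) * s) * complex_of_real (std_normal_density s)" for b :: 'a and s
  have g: "integrable lborel (g b)" for b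
    unfolding g_def by (intro integrable_cis_mult integrable_of_real integrable_normal_density) (simp, measurable)
  have "(LINT s|lborel. g b s) = exp (- (t \<bullet> b)\<^sup>2 / 2)" for b
  proof -
    have "(LINT s|lborel. g b s) = (LINT s|lborel. std_normal_density s *\<^sub>R iexp ((t \<bullet> b) * s))"
      by (simp add: g_def cis_conv_exp scaleR_conv_of_real mult_ac)
    also have "\<dots> = char std_normal_distribution (t \<bullet> b)"
      unfolding char_def by (subst integral_density) (auto simp: normal_density_nonneg)
    finally show ?thesis by (simp add: char_std_normal_distribution)
  qed
  moreover have "cis (t \<bullet> x) * gauss x = (\<Prod>b\<in>Basis. g b (x \<bullet> b))" for x
  proof -
    have "cis (t \<bullet> x) = (\<Prod>b\<in>Basis. cis ((t \<bullet> b) * (x \<bullet> b)))"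
      unfolding euclidean_inner[of t x] cis_sum ..
    then show ?thesis by (simp add: g_def gauss_def prod.distrib)
  qed
  ultimately have "(LINT x|lborel. cis (t \<bullet> x) * gauss x) = (\<Prod>b\<in>Basis. complex_of_real (exp (- (t \<bullet> b)\<^sup>2 / 2)))"
    using integral_lborel_prod[where g = g] g by simp
  also have "\<dots> = exp (\<Sum>b\<in>Basis. - (t \<bullet> b)\<^sup>2 / 2)"
    by (simp add: exp_sum)
  also have "(\<Sum>b\<in>Basis. - (t \<bullet> b)\<^sup>2 / 2) = - (norm t)\<^sup>2 / 2"
    unfolding norm_eq_sqrt_inner euclidean_inner[of t t]
    by (simp add: sum_nonneg sum_negf sum_divide_distrib[symmetric] power2_eq_square)
  finally show ?thesis .
qed

text \<open>A Gaussian cutoff \<open>gauss (e n *\<^sub>R \<xi>)\<close> makes the double integral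
  absolutely convergent. After exchanging the order, its transform is an approximate identity at
  \<open>x\<close>; \<open>e n\<close> then tends to zero on both sides.\<close>

theorem fourier_inversion:
  fixes u :: "'a::euclidean_space \<Rightarrow> complex"
  assumes u: "schwartz u" and r: "0 < r"
  shows "(LINT \<xi>|lborel. cis (r * (x \<bullet> \<xi>)) * FT r u \<xi>) = (2 * pi / r) ^ DIM('a) *\<^sub>R u x"
proof -
  define D where "D = DIM('a)"
  define c where "c = sqrt (2 * pi) ^ D"
  have c0: "0 < c" by (simp add: c_def)
  define e where "e n = inverse (real (Suc n))" for n
  have e: "0 < e n" "e n \<le> 1" for n by (auto simp: e_def divide_simps)
  have e0: "e \<longlonglongrightarrow> 0" unfolding e_def by (rule LIMSEQ_inverse_real_of_nat)
  have [measurable]: "u \<in> borel_measurable borel" by (rule schwartz_measurable[OF u])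
  have iu: "integrable lborel u" by (rule schwartz_integrable[OF u])
  have gcont: "isCont (gauss :: 'a \<Rightarrow> real) y" for y
  proof -
    have "gauss = (\<lambda>x :: 'a. exp (- (norm x)\<^sup>2 / 2) / sqrt (2 * pi) ^ DIM('a))" using gauss_eq by blast
    show ?thesis unfolding \<open>gauss = _\<close> by (intro continuous_intros) auto
  qed
  define I where "I n = (LINT \<xi>|lborel. cis (r * (x \<bullet> \<xi>)) * FT r u \<xi> * gauss (e n *\<^sub>R \<xi>))" for n
  have lim1: "I \<longlonglongrightarrow> (LINT \<xi>|lborel. cis (r * (x \<bullet> \<xi>)) * FT r u \<xi> * gauss (0 :: 'a))"
    unfolding I_def
  proof (rule integral_dominated_convergence)
    show "integrable lborel (\<lambda>\<xi>. cmod (FT r u \<xi>) * gauss (0 :: 'a))"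
      by (intro integrable_mult_left integrable_norm FT_integrable u r)
    show "AE \<xi> in lborel. (\<lambda>n. cis (r * (x \<bullet> \<xi>)) * FT r u \<xi> * gauss (e n *\<^sub>R \<xi>)) \<longlonglongrightarrow> cis (r * (x \<bullet> \<xi>)) * FT r u \<xi> * gauss (0 :: 'a)"
    proof (intro AE_I2 tendsto_mult_left tendsto_of_real)
      fix \<xi> :: 'a
      have "(\<lambda>n. e n *\<^sub>R \<xi>) \<longlonglongrightarrow> 0 *\<^sub>R \<xi>" by (intro tendsto_intros e0)
      then have "(\<lambda>n. e n *\<^sub>R \<xi>) \<longlonglongrightarrow> 0" by simp
      from isCont_tendsto_compose[OF gcont this] show "(\<lambda>n. gauss (e n *\<^sub>R \<xi>)) \<longlonglongrightarrow> gauss (0 :: 'a)" .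
    qed
    show "AE \<xi> in lborel. norm (cis (r * (x \<bullet> \<xi>)) * FT r u \<xi> * gauss (e n *\<^sub>R \<xi>)) \<le> cmod (FT r u \<xi>) * gauss (0 :: 'a)" for n
      by (rule AE_I2) (auto simp: norm_mult gauss_bounds intro!: mult_left_mono)
  qed measurable
  have I: "I n = (c / r ^ D) *\<^sub>R (LINT w|lborel. u (x + (e n / r) *\<^sub>R w) * gauss w)" for n
  proof -
    define F where "F \<xi> y = cis (r * ((x - y) \<bullet> \<xi>)) * (u y * complex_of_real (gauss (e n *\<^sub>R \<xi>)))" for \<xi> y :: 'a
    have [measurable]: "(\<lambda>(\<xi>, y). F \<xi> y) \<in> borel_measurable (lborel \<Otimes>\<^sub>M lborel)"
      unfolding F_def by measurable
    have ig: "integrable lborel (\<lambda>\<xi> :: 'a. gauss (e n *\<^sub>R \<xi>))"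
      using integrable_affine[of "e n" gauss 0] e(1)[of n] integrable_gauss by simp
    have nF: "norm (F \<xi> y) = gauss (e n *\<^sub>R \<xi>) * cmod (u y)" for \<xi> y
      by (simp add: F_def norm_mult gauss_bounds)
    have "integrable (lborel \<Otimes>\<^sub>M lborel) (case_prod F)"
    proof (rule lborel_pair.Fubini_integrable)
      show "case_prod F \<in> borel_measurable (lborel \<Otimes>\<^sub>M lborel)" by measurable
      show "integrable lborel (\<lambda>\<xi>. LINT y|lborel. norm (case (\<xi>, y) of (\<xi>, y) \<Rightarrow> F \<xi> y))"
        using ig by (simp add: nF)
      show "AE \<xi> in lborel. integrable lborel (\<lambda>y. case (\<xi>, y) of (\<xi>, y) \<Rightarrow> F \<xi> y)"
        unfolding F_def prod.case using iu
        by (intro AE_I2 integrable_cis_mult integrable_mult_left) auto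
    qed
    then have swap: "(LINT y|lborel. LINT \<xi>|lborel. F \<xi> y) = (LINT \<xi>|lborel. LINT y|lborel. F \<xi> y)"
      by (rule lborel_pair.Fubini_integral)
    have "I n = (LINT \<xi>|lborel. LINT y|lborel. F \<xi> y)"
      unfolding I_def
    proof (rule Bochner_Integration.integral_cong[OF refl])
      fix \<xi> :: 'a
      have F: "F \<xi> y = cis (r * (x \<bullet> \<xi>)) * complex_of_real (gauss (e n *\<^sub>R \<xi>)) * (cis (- r * (y \<bullet> \<xi>)) * u y)" for y
      proof -
        have "cis (r * ((x - y) \<bullet> \<xi>)) = cis (r * (x \<bullet> \<xi>)) * cis (- r * (y \<bullet> \<xi>))"
          by (simp add: cis_mult inner_diff_left algebra_simps)
        then show ?thesis by (simp add: F_def mult_ac)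
      qed
      show "cis (r * (x \<bullet> \<xi>)) * FT r u \<xi> * gauss (e n *\<^sub>R \<xi>) = (LINT y|lborel. F \<xi> y)"
        unfolding F integral_mult_right_zero FT_def by (simp add: mult_ac)
    qed
    also have "\<dots> = (LINT y|lborel. LINT \<xi>|lborel. F \<xi> y)" by (rule swap[symmetric])
    also have "\<dots> = (LINT y|lborel. u y * ((c / e n ^ D) * gauss ((r / e n) *\<^sub>R (x - y))))"
    proof (rule Bochner_Integration.integral_cong[OF refl])
      fix y :: 'a
      have "(LINT \<xi>|lborel. F \<xi> y) = u y * (LINT \<xi>|lborel. cis (r * ((x - y) \<bullet> \<xi>)) * gauss (e n *\<^sub>R \<xi>))"
        unfolding integral_mult_right_zero[symmetric] F_def by (simp add: mult_ac)
      also have "(LINT \<xi>|lborel. cis (r * ((x - y) \<bullet> \<xi>)) * gauss (e n *\<^sub>R \<xi>))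
         = \<bar>1 / e n\<bar> ^ DIM('a) *\<^sub>R (LINT s|lborel. cis (((r / e n) *\<^sub>R (x - y)) \<bullet> s) * gauss s)"
        using e(1)[of n] integral_affine[of "1 / e n" "\<lambda>\<xi>. cis (r * ((x - y) \<bullet> \<xi>)) * gauss (e n *\<^sub>R \<xi>)" 0]
        by simp
      also have "\<dots> = (1 / e n ^ D) *\<^sub>R exp (- (norm ((r / e n) *\<^sub>R (x - y)))\<^sup>2 / 2)"
        unfolding integral_cis_gauss D_def using e(1)[of n] by (simp add: power_divide scaleR_conv_of_real)
      also have "exp (- (norm ((r / e n) *\<^sub>R (x - y)))\<^sup>2 / 2) = c * gauss ((r / e n) *\<^sub>R (x - y))"
        using c0 by (simp add: gauss_eq c_def D_def)
      finally show "(LINT \<xi>|lborel. F \<xi> y) = u y * ((c / e n ^ D) * gauss ((r / e n) *\<^sub>R (x - y)))"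
        by (simp add: scaleR_conv_of_real)
    qed
    \<comment> \<open>The substitution \<open>y = x + (e n / r) w\<close> fixes the Gaussian and
      concentrates \<open>u\<close> at \<open>x\<close>.\<close>
    also have "\<dots> = \<bar>e n / r\<bar> ^ DIM('a) *\<^sub>R (LINT w|lborel. u (x + (e n / r) *\<^sub>R w) * ((c / e n ^ D) * gauss ((r / e n) *\<^sub>R (x - (x + (e n / r) *\<^sub>R w)))))"
      using e(1)[of n] r by (intro integral_affine) (simp, measurable)
    also have "\<dots> = \<bar>e n / r\<bar> ^ DIM('a) *\<^sub>R (LINT w|lborel. (c / e n ^ D) * (u (x + (e n / r) *\<^sub>R w) * gauss w))"
    proof -
      have "gauss ((r / e n) *\<^sub>R (x - (x + (e n / r) *\<^sub>R w))) = gauss w" for w :: 'a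
        using e(1)[of n] r by (simp add: gauss_eq)
      then show ?thesis by (simp add: mult_ac)
    qed
    also have "\<dots> = (c / r ^ D) *\<^sub>R (LINT w|lborel. u (x + (e n / r) *\<^sub>R w) * gauss w)"
      unfolding integral_mult_right_zero using e(1)[of n] r by (simp add: D_def power_divide scaleR_conv_of_real)
    finally show ?thesis .
  qed
  obtain B where B: "\<And>y. (1 + norm y) ^ 0 * cmod (directional_derivs [] u y) \<le> B"
    using schwartz_bound[OF u] by metis
  have lim2: "(\<lambda>n. LINT w|lborel. u (x + (e n / r) *\<^sub>R w) * gauss w) \<longlonglongrightarrow> (LINT w|lborel. u x * gauss (w :: 'a))"
  proof (rule integral_dominated_convergence)
    show "integrable lborel (\<lambda>w. B * gauss (w :: 'a))" by (intro integrable_mult_right integrable_gauss)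
    show "AE w in lborel. (\<lambda>n. u (x + (e n / r) *\<^sub>R w) * gauss w) \<longlonglongrightarrow> u x * gauss (w :: 'a)"
    proof (intro AE_I2 tendsto_mult_right)
      fix w :: 'a
      have "(\<lambda>n. x + (e n / r) *\<^sub>R w) \<longlonglongrightarrow> x + (0 / r) *\<^sub>R w" using r by (intro tendsto_intros e0) auto
      then have l: "(\<lambda>n. x + (e n / r) *\<^sub>R w) \<longlonglongrightarrow> x" by simp
      have "isCont u x" using smooth_continuous[OF schwartz_smooth[OF u]] by (simp add: continuous_on_eq_continuous_at)
      from isCont_tendsto_compose[OF this l] show "(\<lambda>n. u (x + (e n / r) *\<^sub>R w)) \<longlonglongrightarrow> u x" .
    qed
    show "AE w in lborel. norm (u (x + (e n / r) *\<^sub>R w) * gauss w) \<le> B * gauss (w :: 'a)" for n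
      using B by (intro AE_I2) (auto simp: norm_mult gauss_bounds intro!: mult_right_mono)
  qed measurable
  have "(LINT w|lborel. u x * complex_of_real (gauss (w :: 'a))) = u x * complex_of_real (LINT w|lborel. gauss (w :: 'a))"
    by (simp add: integral_mult_right_zero)
  then have "I \<longlonglongrightarrow> (c / r ^ D) *\<^sub>R u x"
    unfolding I using tendsto_scaleR[OF tendsto_const lim2, of "c / r ^ D"] by (simp add: integral_gauss)
  with lim1 have "(LINT \<xi>|lborel. cis (r * (x \<bullet> \<xi>)) * FT r u \<xi> * gauss (0 :: 'a)) = (c / r ^ D) *\<^sub>R u x"
    by (rule LIMSEQ_unique)
  then have "(LINT \<xi>|lborel. cis (r * (x \<bullet> \<xi>)) * FT r u \<xi>) * complex_of_real (1 / c) = (c / r ^ D) *\<^sub>R u x"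
    by (simp only: integral_mult_left_zero) (simp add: gauss_eq c_def D_def)
  then have "(LINT \<xi>|lborel. cis (r * (x \<bullet> \<xi>)) * FT r u \<xi>) = complex_of_real (c * (c / r ^ D)) * u x"
    using c0 by (simp add: scaleR_conv_of_real field_simps)
  \<comment> \<open>One factor \<open>c\<close> comes from the transform of the Gaussian, the other
    from \<open>gauss 0 = 1 / c\<close>.\<close>
  also have "c * (c / r ^ D) = (2 * pi / r) ^ D"
  proof -
    have "c * c = (sqrt (2 * pi) * sqrt (2 * pi)) ^ D" by (simp only: c_def power_mult_distrib)
    also have "sqrt (2 * pi) * sqrt (2 * pi) = 2 * pi" by simp
    finally show ?thesis by (simp add: power_divide)
  qed
  finally show ?thesis by (simp add: scaleR_conv_of_real D_def)
qed

section \<open>Weyl quantization of a Fourier series\<close>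

text \<open>The remainder quotient of each term tends to 0 and is bounded by \<open>2 * B v\<close>,
  once by the mean value inequality and once by the derivative bound. Dominated convergence along
  sequences then treats the sum.\<close>

lemma has_derivative_infsum:
  fixes f :: "'i \<Rightarrow> 'a::euclidean_space \<Rightarrow> complex"
  assumes f: "\<And>v x. (f v has_derivative f' v x) (at x)"
    and A: "\<And>v x. cmod (f v x) \<le> A v" "A summable_on UNIV"
    and B: "\<And>v x h. cmod (f' v x h) \<le> B v * norm h" "B summable_on UNIV"
  shows "((\<lambda>x. \<Sum>\<^sub>\<infinity>v. f v x) has_derivative (\<lambda>h. \<Sum>\<^sub>\<infinity>v. f' v x h)) (at x)"
  unfolding has_derivative_at2
proof
  have B0: "0 \<le> B v" for v
  proof -
    obtain b :: 'a where b: "b \<in> Basis" using nonempty_Basis by blast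
    have "cmod (f' v x b) \<le> B v" using B(1)[of v x b] b by simp
    then show ?thesis using norm_ge_zero order_trans by blast
  qed
  have sf: "(\<lambda>v. f v y) summable_on UNIV" for y
    by (rule abs_summable_summable[OF Infinite_Sum.abs_summable_on_comparison_test'[OF A(2) A(1)]])
  have sf': "(\<lambda>v. f' v x h) summable_on UNIV" for h
    by (rule abs_summable_summable[OF Infinite_Sum.abs_summable_on_comparison_test'[of "\<lambda>v. B v * norm h"]])
      (use B in \<open>auto intro: summable_on_cmult_left\<close>)
  have lin: "linear (f' v x)" for v using f by (rule has_derivative_linear)
  show bl: "bounded_linear (\<lambda>h. \<Sum>\<^sub>\<infinity>v. f' v x h)"
  proof (rule bounded_linear_intro[of _ "\<Sum>\<^sub>\<infinity>v. B v"])
    show "(\<Sum>\<^sub>\<infinity>v. f' v x (h + k)) = (\<Sum>\<^sub>\<infinity>v. f' v x h) + (\<Sum>\<^sub>\<infinity>v. f' v x k)" for h k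
      by (simp add: linear_add[OF lin] infsum_add sf')
    show "(\<Sum>\<^sub>\<infinity>v. f' v x (r *\<^sub>R h)) = r *\<^sub>R (\<Sum>\<^sub>\<infinity>v. f' v x h)" for r h
      by (simp add: linear_cmul[OF lin] infsum_scaleR_right)
    show "norm (\<Sum>\<^sub>\<infinity>v. f' v x h) \<le> norm h * (\<Sum>\<^sub>\<infinity>v. B v)" for h
    proof -
      have "norm (\<Sum>\<^sub>\<infinity>v. f' v x h) \<le> (\<Sum>\<^sub>\<infinity>v. B v * norm h)"
        using B by (intro norm_infsum_le_infsum summable_on_cmult_left) auto
      also have "\<dots> = (\<Sum>\<^sub>\<infinity>v. B v) * norm h" by (rule infsum_cmult_left')
      finally show ?thesis by (simp add: mult.commute)
    qed
  qed
  define r where "r v y = (1 / norm (y - x)) *\<^sub>R (f v y - (f v x + f' v x (y - x)))" for v y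
  have lip: "cmod (f v y - f v x) \<le> B v * norm (y - x)" for v y
    by (rule differentiable_bound[of UNIV _ "f' v"]) (use f B(1) in \<open>auto intro: onorm_le\<close>)
  have r: "cmod (r v y) \<le> 2 * B v" for v y
  proof (cases "y = x")
    case False
    then have n: "0 < norm (y - x)" by simp
    have "cmod (f v y - (f v x + f' v x (y - x))) \<le> cmod (f v y - f v x) + cmod (f' v x (y - x))"
      using norm_triangle_ineq4[of "f v y - f v x" "f' v x (y - x)"] by (simp add: algebra_simps)
    also have "\<dots> \<le> 2 * B v * norm (y - x)" using lip[of v y] B(1)[of v x "y - x"] by simp
    finally show ?thesis using n by (simp add: r_def pos_divide_le_eq)
  qed (simp add: r_def B0)
  have lim: "(\<lambda>n. \<Sum>\<^sub>\<infinity>v. r v (X n)) \<longlonglongrightarrow> (\<Sum>\<^sub>\<infinity>v :: 'i. 0)" if X: "\<And>n. X n \<noteq> x" "X \<longlonglongrightarrow> x" for X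
  proof (rule tendsto_infsum_dominated[of "\<lambda>v. 2 * B v"])
    show "(\<lambda>v. 2 * B v) summable_on UNIV" by (intro summable_on_cmult_right B)
    show "cmod (r v (X n)) \<le> 2 * B v" for n v by (rule r)
    show "(\<lambda>n. r v (X n)) \<longlonglongrightarrow> 0" for v
    proof -
      have "(r v \<longlongrightarrow> 0) (at x)" using f[of v x] unfolding has_derivative_at2 r_def by blast
      then show ?thesis using X unfolding tendsto_at_iff_sequentially by (auto simp: o_def)
    qed
  qed
  have sum: "(\<Sum>\<^sub>\<infinity>v. r v y) = (1 / norm (y - x)) *\<^sub>R ((\<Sum>\<^sub>\<infinity>v. f v y) - ((\<Sum>\<^sub>\<infinity>v. f v x) + (\<Sum>\<^sub>\<infinity>v. f' v x (y - x))))" for y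
  proof -
    have "((\<lambda>v. f v x + f' v x (y - x)) has_sum ((\<Sum>\<^sub>\<infinity>v. f v x) + (\<Sum>\<^sub>\<infinity>v. f' v x (y - x)))) UNIV"
      by (intro has_sum_add has_sum_infsum sf sf')
    then have "((\<lambda>v. - (f v x + f' v x (y - x))) has_sum - ((\<Sum>\<^sub>\<infinity>v. f v x) + (\<Sum>\<^sub>\<infinity>v. f' v x (y - x)))) UNIV"
      by (subst has_sum_uminus) (simp only: minus_minus)
    from has_sum_add[OF has_sum_infsum[OF sf[of y]] this]
    have "((\<lambda>v. f v y - (f v x + f' v x (y - x))) has_sum
        ((\<Sum>\<^sub>\<infinity>v. f v y) - ((\<Sum>\<^sub>\<infinity>v. f v x) + (\<Sum>\<^sub>\<infinity>v. f' v x (y - x))))) UNIV"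
      by (simp only: diff_conv_add_uminus)
    from infsumI[OF has_sum_scaleR[OF this]] show ?thesis by (simp add: r_def)
  qed
  show "((\<lambda>y. (1 / norm (y - x)) *\<^sub>R ((\<Sum>\<^sub>\<infinity>v. f v y) - ((\<Sum>\<^sub>\<infinity>v. f v x) + (\<Sum>\<^sub>\<infinity>v. f' v x (y - x))))) \<longlongrightarrow> 0) (at x)"
    unfolding sum[symmetric] tendsto_at_iff_sequentially using lim by (simp add: o_def)
qed

section \<open>Exchange of series and integrals\<close>

lemma infsum_eq_integral:
  fixes h :: "'a \<Rightarrow> complex"
  assumes "(\<lambda>x. cmod (h x)) summable_on UNIV"
  shows "infsum h UNIV = (\<integral>x. h x \<partial>count_space UNIV)" and "integrable (count_space UNIV) h"
proof -
  have "Infinite_Set_Sum.abs_summable_on h UNIV" using assms by (simp add: abs_summable_equivalent)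
  then show "infsum h UNIV = (\<integral>x. h x \<partial>count_space UNIV)" "integrable (count_space UNIV) h"
    using infsetsum_infsum[of h UNIV] by (simp_all add: infsetsum_def abs_summable_on_def)
qed

text \<open>Fubini for the product of the counting measure and \<open>lborel\<close>.\<close>

lemma
  fixes f :: "'i::countable \<Rightarrow> 'a::euclidean_space \<Rightarrow> complex"
  assumes f: "\<And>v. integrable lborel (f v)"
    and B: "\<And>v. (LINT x|lborel. cmod (f v x)) \<le> B v" "B summable_on UNIV"
    and s: "\<And>x. (\<lambda>v. cmod (f v x)) summable_on UNIV"
  shows integral_infsum: "(LINT x|lborel. (\<Sum>\<^sub>\<infinity>v. f v x)) = (\<Sum>\<^sub>\<infinity>v. (LINT x|lborel. f v x))"
proof -
  interpret C: sigma_finite_measure "count_space (UNIV :: 'i set)"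
    by (rule sigma_finite_measure_count_space)
  interpret P: pair_sigma_finite "count_space (UNIV :: 'i set)" "lborel :: 'a measure" ..
  have [measurable]: "f v \<in> borel_measurable borel" for v using f[of v] by (auto dest: borel_measurable_integrable)
  have sB: "(\<lambda>v. cmod (LINT x|lborel. cmod (f v x))) summable_on UNIV"
    by (rule Infinite_Sum.abs_summable_on_comparison_test'[OF B(2)]) (use B(1) in \<open>simp add: integral_nonneg_AE\<close>)
  have "integrable (count_space UNIV \<Otimes>\<^sub>M lborel) (\<lambda>(v, x). f v x)"
  proof (rule P.Fubini_integrable)
    show "(\<lambda>(v, x). f v x) \<in> borel_measurable (count_space UNIV \<Otimes>\<^sub>M lborel)"
      by (rule measurable_pair_measure_countable1) auto
    have "integrable (count_space UNIV) (\<lambda>v. complex_of_real (LINT x|lborel. cmod (f v x)))"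
      using sB by (intro infsum_eq_integral(2)) simp
    then show "integrable (count_space UNIV) (\<lambda>v. LINT x|lborel. norm (case (v, x) of (v, x) \<Rightarrow> f v x))"
      by (simp add: complex_of_real_integrable_eq)
    show "AE v in count_space UNIV. integrable lborel (\<lambda>x. case (v, x) of (v, x) \<Rightarrow> f v x)"
      using f by (simp add: AE_count_space)
  qed
  from P.Fubini_integral[OF this]
  have "(LINT x|lborel. LINT v|count_space UNIV. f v x) = (LINT v|count_space UNIV. LINT x|lborel. f v x)" .
  moreover have s2: "(\<lambda>v. cmod (LINT x|lborel. f v x)) summable_on UNIV"
    by (rule Infinite_Sum.abs_summable_on_comparison_test'[OF B(2)]) (use B(1) integral_norm_bound order_trans in blast)
  ultimately show ?thesis unfolding infsum_eq_integral(1)[OF s] by (simp only: infsum_eq_integral(1)[OF s2])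
qed

lemma directional_derivative_linear_bound:
  assumes "schwartz \<phi>"
  obtains C where "0 \<le> C" "\<And>h x. cmod (directional_derivs [h] \<phi> x) \<le> C * norm h"
proof -
  have "\<exists>C\<ge>0. \<forall>x. (1 + norm x) ^ 0 * cmod (directional_derivs [b] \<phi> x) \<le> C" for b
    using schwartz_bound[OF assms] by metis
  then obtain C where C: "\<And>b. 0 \<le> C b" "\<And>b x. cmod (directional_derivs [b] \<phi> x) \<le> C b"
    by simp metis
  have "cmod (directional_derivs [h] \<phi> x) \<le> (\<Sum>b\<in>Basis. C b) * norm h" for h x
  proof -
    have lin: "linear (\<lambda>h. directional_derivs [h] \<phi> x)"
      using smooth_has_derivative[OF schwartz_smooth[OF assms], of "[]" x] has_derivative_linear by auto
    have "directional_derivs [h] \<phi> x = directional_derivs [\<Sum>b\<in>Basis. (h \<bullet> b) *\<^sub>R b] \<phi> x"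
      by (simp only: euclidean_representation)
    also have "\<dots> = (\<Sum>b\<in>Basis. (h \<bullet> b) *\<^sub>R directional_derivs [b] \<phi> x)"
      unfolding linear_sum[OF lin] linear_cmul[OF lin] ..
    also have "cmod \<dots> \<le> (\<Sum>b\<in>Basis. norm h * C b)"
    proof (rule sum_norm_le)
      fix b :: 'a assume "b \<in> Basis"
      then show "cmod ((h \<bullet> b) *\<^sub>R directional_derivs [b] \<phi> x) \<le> norm h * C b"
        using C unfolding norm_scaleR by (intro mult_mono Basis_le_norm) auto
    qed
    finally show ?thesis by (simp add: sum_distrib_left mult.commute)
  qed
  then show ?thesis using that[of "\<Sum>b\<in>Basis. C b"] C(1) by (simp add: sum_nonneg)
qed

text \<open>The shape that Weyl quantization of a Fourier series takes: modulations by
  \<open>lam v\<close> of translates by \<open>mu v\<close>.\<close>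

definition msum :: "(int^'n \<Rightarrow> 'a) \<Rightarrow> (int^'n \<Rightarrow> 'a) \<Rightarrow> (int^'n \<Rightarrow> complex) \<Rightarrow> ('a \<Rightarrow> complex) \<Rightarrow> 'a::euclidean_space \<Rightarrow> complex" where
  "msum lam mu c \<phi> x = (\<Sum>\<^sub>\<infinity>v. c v * cis (lam v \<bullet> x) * \<phi> (x + mu v))"

text \<open>A derivative of an \<open>msum\<close> is the sum of two, one with coefficients
  multiplied by \<open>lam v\<close> and one with \<open>\<phi>\<close> differentiated. Closing
  under addition gives a class stable under differentiation.\<close>

inductive msums for lam mu where
  base: "rapid c \<Longrightarrow> schwartz \<phi> \<Longrightarrow> msums lam mu (msum lam mu c \<phi>)"
| add: "msums lam mu f \<Longrightarrow> msums lam mu g \<Longrightarrow> msums lam mu (\<lambda>x. f x + g x)"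

locale modulated_sums =
  fixes lam mu :: "int^'n \<Rightarrow> 'a::euclidean_space" and B :: real
  assumes B: "0 \<le> B" and lam: "\<And>v. norm (lam v) \<le> B * (1 + 2 * pi * l1 v)"
    and mu: "\<And>v. norm (mu v) \<le> B * (1 + 2 * pi * l1 v)"
begin

lemma summable_term:
  assumes c: "rapid c" and "\<And>x. cmod (\<phi> x) \<le> C"
  shows "(\<lambda>v. cmod (c v * cis (lam v \<bullet> x) * \<phi> (x + mu v))) summable_on UNIV"
    and "cmod (c v * cis (lam v \<bullet> x) * \<phi> (x + mu v)) \<le> C * cmod (c v)"
    and "(\<lambda>v. C * cmod (c v)) summable_on UNIV"
proof -
  show b: "cmod (c v * cis (lam v \<bullet> x) * \<phi> (x + mu v)) \<le> C * cmod (c v)" for v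
    using mult_left_mono[OF assms(2)[of "x + mu v"], of "cmod (c v)"] by (simp add: norm_mult mult.commute)
  show s: "(\<lambda>v. C * cmod (c v)) summable_on UNIV"
    by (intro summable_on_cmult_right rapid_abs_summable c)
  show "(\<lambda>v. cmod (c v * cis (lam v \<bullet> x) * \<phi> (x + mu v))) summable_on UNIV"
    by (rule Infinite_Sum.abs_summable_on_comparison_test'[OF s b])
qed

lemma schwartz_bounded:
  assumes "schwartz \<phi>"
  obtains C where "0 \<le> C" "\<And>x. cmod (\<phi> x) \<le> C"
  using schwartz_bound[OF assms, of 0 "[]"] by auto

lemma rapid_lam:
  assumes "rapid c"
  shows "rapid (\<lambda>v. c v * (\<i> * (lam v \<bullet> h)))"
proof (rule rapid_mono[OF assms, of _ "B * norm h" 1])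
  fix v
  have "\<bar>lam v \<bullet> h\<bar> \<le> norm (lam v) * norm h" by (rule Cauchy_Schwarz_ineq2)
  also have "\<dots> \<le> B * (1 + 2 * pi * l1 v) * norm h" by (intro mult_right_mono lam) auto
  finally have "cmod (c v) * \<bar>lam v \<bullet> h\<bar> \<le> cmod (c v) * (B * (1 + 2 * pi * l1 v) * norm h)"
    by (rule mult_left_mono) simp
  then show "cmod (c v * (\<i> * (lam v \<bullet> h))) \<le> cmod (c v) * (B * norm h * (1 + 2 * pi * l1 v) ^ 1)"
    by (simp add: norm_mult mult_ac)
qed

lemma msum_has_derivative:
  assumes c: "rapid c" and \<phi>: "schwartz \<phi>"
  shows "(msum lam mu c \<phi> has_derivative
    (\<lambda>h. msum lam mu (\<lambda>v. c v * (\<i> * (lam v \<bullet> h))) \<phi> x + msum lam mu c (directional_derivs [h] \<phi>) x)) (at x)"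
proof -
  obtain C0 where C0: "0 \<le> C0" "\<And>x. cmod (\<phi> x) \<le> C0" using schwartz_bounded[OF \<phi>] by metis
  obtain C1 where C1: "0 \<le> C1" "\<And>h x. cmod (directional_derivs [h] \<phi> x) \<le> C1 * norm h"
    using directional_derivative_linear_bound[OF \<phi>] by metis
  define f where "f v x = c v * cis (lam v \<bullet> x) * \<phi> (x + mu v)" for v x
  define f' where "f' v x h = c v * (\<i> * (lam v \<bullet> h)) * cis (lam v \<bullet> x) * \<phi> (x + mu v)
     + c v * cis (lam v \<bullet> x) * directional_derivs [h] \<phi> (x + mu v)" for v x h
  have "((\<lambda>x. \<Sum>\<^sub>\<infinity>v. f v x) has_derivative (\<lambda>h. \<Sum>\<^sub>\<infinity>v. f' v x h)) (at x)"
  proof (rule has_derivative_infsum)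
    show "(f v has_derivative f' v x) (at x)" for v x
    proof -
      have "((\<lambda>x. x + mu v) has_derivative (\<lambda>h. h)) (at x)" by (auto intro!: derivative_eq_intros)
      from has_derivative_compose[OF this smooth_has_derivative[OF schwartz_smooth[OF \<phi>], of "[]"]]
      have 1: "((\<lambda>x. \<phi> (x + mu v)) has_derivative (\<lambda>h. directional_derivs [h] \<phi> (x + mu v))) (at x)" by simp
      have "((\<lambda>x. exp (\<i> * complex_of_real (lam v \<bullet> x))) has_derivative (\<lambda>h. \<i> * complex_of_real (lam v \<bullet> h) * exp (\<i> * complex_of_real (lam v \<bullet> x)))) (at x)"
      proof -
        have g: "((\<lambda>x. \<i> * complex_of_real (lam v \<bullet> x)) has_derivative (\<lambda>h. \<i> * complex_of_real (lam v \<bullet> h))) (at x)"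
          by (intro has_derivative_mult_right has_derivative_of_real has_derivative_inner_right has_derivative_ident)
        show ?thesis
          using has_derivative_compose[OF g DERIV_exp[unfolded has_field_derivative_def]] by (simp add: mult.commute)
      qed
      then have 2: "((\<lambda>x. cis (lam v \<bullet> x)) has_derivative (\<lambda>h. \<i> * complex_of_real (lam v \<bullet> h) * cis (lam v \<bullet> x))) (at x)"
        by (simp add: cis_conv_exp)
      have "((\<lambda>x. c v * cis (lam v \<bullet> x) * \<phi> (x + mu v)) has_derivative
          (\<lambda>h. c v * cis (lam v \<bullet> x) * directional_derivs [h] \<phi> (x + mu v) + c v * (\<i> * complex_of_real (lam v \<bullet> h) * cis (lam v \<bullet> x)) * \<phi> (x + mu v))) (at x)"
        by (intro has_derivative_mult has_derivative_mult_right 1 2)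
      then show ?thesis unfolding f_def f'_def by (simp add: algebra_simps del: directional_derivs.simps)
    qed
    show "cmod (f v x) \<le> C0 * cmod (c v)" for v x
      unfolding f_def by (rule summable_term(2)[OF c C0(2)])
    show "(\<lambda>v. C0 * cmod (c v)) summable_on UNIV" by (rule summable_term(3)[OF c C0(2)])
    show "cmod (f' v x h) \<le> (B * C0 + C1) * (cmod (c v) * (1 + 2 * pi * l1 v) ^ 1) * norm h" for v x h
    proof -
      have w: "1 \<le> 1 + 2 * pi * l1 v" by (rule weight_ge_1)
      have "cmod (f' v x h) \<le> cmod (c v) * \<bar>lam v \<bullet> h\<bar> * cmod (\<phi> (x + mu v)) + cmod (c v) * cmod (directional_derivs [h] \<phi> (x + mu v))"
        unfolding f'_def by (rule norm_triangle_le) (simp add: norm_mult del: directional_derivs.simps)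
      also have "\<dots> \<le> cmod (c v) * (B * (1 + 2 * pi * l1 v) * norm h) * C0 + cmod (c v) * (C1 * norm h * (1 + 2 * pi * l1 v))"
      proof (intro add_mono mult_mono mult_left_mono C0)
        have "\<bar>lam v \<bullet> h\<bar> \<le> norm (lam v) * norm h" by (rule Cauchy_Schwarz_ineq2)
        also have "\<dots> \<le> B * (1 + 2 * pi * l1 v) * norm h" by (intro mult_right_mono lam) auto
        finally show "\<bar>lam v \<bullet> h\<bar> \<le> B * (1 + 2 * pi * l1 v) * norm h" .
        have "C1 * norm h * 1 \<le> C1 * norm h * (1 + 2 * pi * l1 v)" using C1(1) by (intro mult_left_mono w) auto
        then show "cmod (directional_derivs [h] \<phi> (x + mu v)) \<le> C1 * norm h * (1 + 2 * pi * l1 v)"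
          using C1(2)[of h "x + mu v"] by linarith
      qed (use B w in auto)
      finally show ?thesis by (simp add: algebra_simps)
    qed
    show "(\<lambda>v. (B * C0 + C1) * (cmod (c v) * (1 + 2 * pi * l1 v) ^ 1)) summable_on UNIV"
      using c unfolding rapid_def by (intro summable_on_cmult_right) blast
  qed
  moreover have "(\<Sum>\<^sub>\<infinity>v. f' v x h) = msum lam mu (\<lambda>v. c v * (\<i> * (lam v \<bullet> h))) \<phi> x + msum lam mu c (directional_derivs [h] \<phi>) x" for h
    unfolding f'_def msum_def
    by (rule infsum_add; rule abs_summable_summable)
      (rule summable_term(1)[OF rapid_lam[OF c] C0(2)] summable_term(1)[OF c C1(2)])+
  ultimately show ?thesis unfolding f_def msum_def[abs_def] by simp
qed

text \<open>Peetre's inequality costs a power of \<open>1 + norm (mu v)\<close>, of polynomial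
  growth in \<open>v\<close>, which the rapid decay of \<open>c\<close> absorbs.\<close>

lemma msum_decay:
  assumes c: "rapid c" and \<phi>: "schwartz \<phi>"
  shows "\<exists>C. \<forall>x. norm x ^ k * cmod (msum lam mu c \<phi> x) \<le> C"
proof -
  obtain C where C: "0 \<le> C" "\<And>x. (1 + norm x) ^ k * cmod (directional_derivs [] \<phi> x) \<le> C"
    using schwartz_bound[OF \<phi>] by metis
  have b: "norm x ^ k * cmod (c v * cis (lam v \<bullet> x) * \<phi> (x + mu v)) \<le> (1 + B) ^ k * C * (cmod (c v) * (1 + 2 * pi * l1 v) ^ k)" for x v
  proof -
    have w: "1 \<le> 1 + 2 * pi * l1 v" by (rule weight_ge_1)
    have "norm x ^ k \<le> (1 + norm x) ^ k" by (intro power_mono) auto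
    also have "\<dots> \<le> (1 + norm (mu v)) ^ k * (1 + norm (x + mu v)) ^ k" by (rule norm_shift_weight)
    also have "\<dots> \<le> ((1 + B) * (1 + 2 * pi * l1 v)) ^ k * (1 + norm (x + mu v)) ^ k"
      using mu[of v] w by (intro mult_right_mono power_mono) (auto simp: algebra_simps)
    finally have "norm x ^ k * cmod (\<phi> (x + mu v)) \<le> ((1 + B) * (1 + 2 * pi * l1 v)) ^ k * (1 + norm (x + mu v)) ^ k * cmod (\<phi> (x + mu v))"
      by (intro mult_right_mono) auto
    also have "\<dots> \<le> ((1 + B) * (1 + 2 * pi * l1 v)) ^ k * C"
      unfolding mult.assoc[of _ "(1 + norm (x + mu v)) ^ k"] using C(2)[of "x + mu v"] w B by (intro mult_left_mono) auto
    finally have "cmod (c v) * (norm x ^ k * cmod (\<phi> (x + mu v))) \<le> cmod (c v) * (((1 + B) * (1 + 2 * pi * l1 v)) ^ k * C)"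
      by (intro mult_left_mono) auto
    then show ?thesis by (simp add: norm_mult power_mult_distrib mult_ac)
  qed
  have "norm x ^ k * cmod (msum lam mu c \<phi> x) \<le> (\<Sum>\<^sub>\<infinity>v. (1 + B) ^ k * C * (cmod (c v) * (1 + 2 * pi * l1 v) ^ k))" for x
  proof -
    have "norm x ^ k * cmod (msum lam mu c \<phi> x) = cmod (\<Sum>\<^sub>\<infinity>v. complex_of_real (norm x ^ k) * (c v * cis (lam v \<bullet> x) * \<phi> (x + mu v)))"
      unfolding infsum_cmult_right' msum_def by (simp add: norm_mult norm_power)
    also have "\<dots> \<le> (\<Sum>\<^sub>\<infinity>v. (1 + B) ^ k * C * (cmod (c v) * (1 + 2 * pi * l1 v) ^ k))"
    proof (rule norm_infsum_le_infsum)
      show "cmod (complex_of_real (norm x ^ k) * (c v * cis (lam v \<bullet> x) * \<phi> (x + mu v))) \<le> (1 + B) ^ k * C * (cmod (c v) * (1 + 2 * pi * l1 v) ^ k)" for v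
        using b[of x v] by (simp add: norm_mult norm_power)
      show "(\<lambda>v. (1 + B) ^ k * C * (cmod (c v) * (1 + 2 * pi * l1 v) ^ k)) summable_on UNIV"
        using c unfolding rapid_def by (intro summable_on_cmult_right) blast
    qed
    finally show ?thesis .
  qed
  then show ?thesis by blast
qed

text \<open>By convention \<open>Q\<close> is zero on functions outside the Schwartz class, so the
  transposed quantization has to map Schwartz functions to Schwartz functions.\<close>

lemma schwartz_msum:
  assumes "rapid c" and "schwartz \<phi>"
  shows "schwartz (msum lam mu c \<phi>)"
proof (rule schwartz_coinduct[where P = "msums lam mu"])
  show "msums lam mu (msum lam mu c \<phi>)" by (intro msums.base assms)
next
  fix f :: "'a \<Rightarrow> complex" assume "msums lam mu f"
  then show "\<exists>f'. (\<forall>x. (f has_derivative f' x) (at x)) \<and> (\<forall>v. msums lam mu (\<lambda>x. f' x v))"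
  proof induction
    case (base c \<phi>)
    show ?case
      by (intro exI[of _ "\<lambda>x h. msum lam mu (\<lambda>v. c v * (\<i> * (lam v \<bullet> h))) \<phi> x + msum lam mu c (directional_derivs [h] \<phi>) x"] conjI allI
          msum_has_derivative msums.add msums.base rapid_lam schwartz_directional_derivs base)
  next
    case (add f g)
    then obtain f' g' where "\<And>x. (f has_derivative f' x) (at x)" "\<And>v. msums lam mu (\<lambda>x. f' x v)"
      "\<And>x. (g has_derivative g' x) (at x)" "\<And>v. msums lam mu (\<lambda>x. g' x v)" by blast
    then show ?case
      by (intro exI[of _ "\<lambda>x h. f' x h + g' x h"] conjI allI has_derivative_add msums.add)
  qed
next
  fix f :: "'a \<Rightarrow> complex" and k assume "msums lam mu f"
  then show "\<exists>C. \<forall>x. norm x ^ k * cmod (f x) \<le> C"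
  proof induction
    case (base c \<phi>)
    then show ?case by (rule msum_decay)
  next
    case (add f g)
    then obtain C1 C2 where C: "\<And>x. norm x ^ k * cmod (f x) \<le> C1" "\<And>x. norm x ^ k * cmod (g x) \<le> C2" by blast
    have "norm x ^ k * cmod (f x + g x) \<le> C1 + C2" for x
    proof -
      have "norm x ^ k * cmod (f x + g x) \<le> norm x ^ k * (cmod (f x) + cmod (g x))"
        by (intro mult_left_mono norm_triangle_ineq) auto
      then show ?thesis using C[of x] by (simp add: algebra_simps)
    qed
    then show ?case by blast
  qed
qed

end

section \<open>Weyl quantization of exponentials\<close>

definition lvec :: "int^('d + 'd) \<Rightarrow> real^'d" where "lvec v = int_vec (lpart v)"
definition mvec :: "int^('d + 'd) \<Rightarrow> real^'d" where "mvec v = int_vec (mpart v)"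

lemma norm_lvec_le: "norm (lvec v) \<le> 1 + 2 * pi * l1 v" and norm_mvec_le: "norm (mvec v) \<le> 1 + 2 * pi * l1 v"
proof -
  have p: "1 * l1 v \<le> 2 * pi * l1 v" using pi_ge_two by (intro mult_right_mono l1_nonneg) auto
  have s: "l1 v = (\<Sum>i\<in>UNIV. \<bar>of_int (v $ Inl i)\<bar>) + (\<Sum>i\<in>UNIV. \<bar>of_int (v $ Inr i)\<bar>)"
    unfolding l1_def UNIV_Plus_UNIV[symmetric] by (subst sum.Plus) auto
  have "norm (lvec v) \<le> (\<Sum>i\<in>UNIV. \<bar>lvec v $ i\<bar>)" "norm (mvec v) \<le> (\<Sum>i\<in>UNIV. \<bar>mvec v $ i\<bar>)"
    by (rule norm_le_l1_cart)+
  then have "norm (lvec v) \<le> (\<Sum>i\<in>UNIV. \<bar>of_int (v $ Inl i)\<bar>)" "norm (mvec v) \<le> (\<Sum>i\<in>UNIV. \<bar>of_int (v $ Inr i)\<bar>)"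
    by (simp_all add: lvec_def mvec_def int_vec_def lpart_def mpart_def)
  moreover have "0 \<le> (\<Sum>i\<in>UNIV. \<bar>real_of_int (v $ Inl i)\<bar>)" "0 \<le> (\<Sum>i\<in>UNIV. \<bar>real_of_int (v $ Inr i)\<bar>)"
    by (intro sum_nonneg; simp)+
  ultimately show "norm (lvec v) \<le> 1 + 2 * pi * l1 v" "norm (mvec v) \<le> 1 + 2 * pi * l1 v"
    using s p by linarith+
qed

lemma inner_lvec_mvec: "lvec v \<bullet> mvec v = of_int (pairing (lpart v) (mpart v))"
  by (simp add: lvec_def mvec_def inner_int_vec pairing_def) (simp add: int_vec_def)

lemma FT_shift_integral:
  fixes u :: "real^'d \<Rightarrow> complex"
  assumes u: "schwartz u" and r: "0 < r"
  shows "integrable lborel (\<lambda>\<xi>. cis (p \<bullet> \<xi>) * FT r u (\<xi> - q))"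
    and "(LINT \<xi>|lborel. cmod (cis (p \<bullet> \<xi>) * FT r u (\<xi> - q))) = (LINT \<xi>|lborel. cmod (FT r u \<xi>))"
    and "(LINT \<xi>|lborel. cis (r * (x \<bullet> \<xi>)) * FT r u (\<xi> - q)) = cis (r * (x \<bullet> q)) * ((2 * pi / r) ^ CARD('d) *\<^sub>R u x)"
proof -
  have [measurable]: "u \<in> borel_measurable borel" by (rule schwartz_measurable[OF u])
  have i: "integrable lborel (FT r u)" by (rule FT_integrable[OF u r])
  have "integrable lborel (\<lambda>\<xi>. FT r u (- q + 1 *\<^sub>R \<xi>))" by (rule integrable_affine[OF _ i]) simp
  then have "integrable lborel (\<lambda>\<xi>. FT r u (\<xi> - q))" by simp
  then show "integrable lborel (\<lambda>\<xi>. cis (p \<bullet> \<xi>) * FT r u (\<xi> - q))"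
    by (intro integrable_cis_mult) measurable
  have "(LINT \<xi>|lborel. complex_of_real (cmod (FT r u (\<xi> + - q)))) = (LINT \<xi>|lborel. complex_of_real (cmod (FT r u \<xi>)))"
    by (rule integral_translate) measurable
  then have "complex_of_real (LINT \<xi>|lborel. cmod (FT r u (\<xi> - q))) = complex_of_real (LINT \<xi>|lborel. cmod (FT r u \<xi>))"
    by simp
  then show "(LINT \<xi>|lborel. cmod (cis (p \<bullet> \<xi>) * FT r u (\<xi> - q))) = (LINT \<xi>|lborel. cmod (FT r u \<xi>))"
    by (simp add: norm_mult del: integral_complex_of_real)
  have "(LINT \<xi>|lborel. cis (r * (x \<bullet> \<xi>)) * FT r u (\<xi> - q)) = (LINT \<xi>|lborel. cis (r * (x \<bullet> (\<xi> + q))) * FT r u ((\<xi> + q) - q))"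
    by (rule integral_translate[symmetric]) measurable
  also have "\<dots> = (LINT \<xi>|lborel. cis (r * (x \<bullet> q)) * (cis (r * (x \<bullet> \<xi>)) * FT r u \<xi>))"
  proof -
    have "cis (r * (x \<bullet> (\<xi> + q))) = cis (r * (x \<bullet> q)) * cis (r * (x \<bullet> \<xi>))" for \<xi>
      by (simp add: cis_mult inner_add_right algebra_simps)
    then show ?thesis by (simp add: mult.assoc)
  qed
  also have "\<dots> = cis (r * (x \<bullet> q)) * (LINT \<xi>|lborel. cis (r * (x \<bullet> \<xi>)) * FT r u \<xi>)"
    by (rule integral_mult_right_zero)
  also have "(LINT \<xi>|lborel. cis (r * (x \<bullet> \<xi>)) * FT r u \<xi>) = (2 * pi / r) ^ CARD('d) *\<^sub>R u x"
    using fourier_inversion[OF u r] by simp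
  finally show "(LINT \<xi>|lborel. cis (r * (x \<bullet> \<xi>)) * FT r u (\<xi> - q)) = cis (r * (x \<bullet> q)) * ((2 * pi / r) ^ CARD('d) *\<^sub>R u x)" .
qed

text \<open>For one exponential, the midpoint splits its \<open>x\<close>-phase equally between
  \<open>x\<close> and \<open>y\<close>. The \<open>y\<close>-half shifts the argument of the
  Fourier transform, the \<open>\<xi>\<close>-phase moves the evaluation point by
  \<open>mvec v / N\<close>, and Fourier inversion concludes. The sum is exchanged with one integral
  at a time, since the double integral need not converge absolutely.\<close>

theorem weyl_fourier_series:
  fixes a :: "(real^'d) \<times> (real^'d) \<Rightarrow> complex" and c :: "int^('d + 'd) \<Rightarrow> complex"
  assumes N: "N \<ge> 1" and c: "rapid c" and u: "schwartz u"
    and a: "\<And>x \<xi>. a (x, \<xi>) = (\<Sum>\<^sub>\<infinity>v. c v * cis (2 * pi * (lvec v \<bullet> x + mvec v \<bullet> \<xi>)))"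
  shows "weyl (1 / (2 * pi * real N)) a u =
    msum (\<lambda>v. (2 * pi) *\<^sub>R lvec v) (\<lambda>v. (1 / real N) *\<^sub>R mvec v) (\<lambda>v. c v * cis (pi * (lvec v \<bullet> mvec v) / N)) u"
proof
  fix x
  define r where "r = 2 * pi * real N"
  have r: "0 < r" using N by (simp add: r_def)
  have [measurable]: "u \<in> borel_measurable borel" by (rule schwartz_measurable[OF u])
  have iu: "integrable lborel u" by (rule schwartz_integrable[OF u])
  \<comment> \<open>\<open>q\<close> is the frequency shift due to the half-phase in
    \<open>y\<close>; \<open>p\<close> joins the kernel phase in \<open>x\<close> with the
    \<open>\<xi>\<close>-phase of the symbol.\<close>
  define q where "q v = (1 / (2 * real N)) *\<^sub>R lvec v" for v :: "int^('d + 'd)"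
  define p where "p v = r *\<^sub>R x + (2 * pi) *\<^sub>R mvec v" for v :: "int^('d + 'd)"
  define k where "k v = c v * cis (pi * (lvec v \<bullet> x))" for v
  have k: "cmod (k v) = cmod (c v)" for v by (simp add: k_def norm_mult)
  define A where "A = (LINT y|lborel. cmod (u y))"
  define A' where "A' = (LINT \<xi>|lborel. cmod (FT r u \<xi>))"
  have inner: "(LINT y|lborel. exp (\<i> / complex_of_real (1 / (2 * pi * real N)) * complex_of_real ((x - y) \<bullet> \<xi>)) * a ((1 / 2) *\<^sub>R (x + y), \<xi>) * u y)
      = (\<Sum>\<^sub>\<infinity>v. k v * (cis (p v \<bullet> \<xi>) * FT r u (\<xi> - q v)))" for \<xi>
  proof -
    define f where "f v y = k v * cis (p v \<bullet> \<xi>) * (cis (- r * (y \<bullet> (\<xi> - q v))) * u y)" for v y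
    have e: "exp (\<i> / complex_of_real (1 / (2 * pi * real N)) * complex_of_real ((x - y) \<bullet> \<xi>)) = cis (r * ((x - y) \<bullet> \<xi>))" for y
      by (simp add: cis_conv_exp r_def mult_ac)
    have fe: "f v y = cis (r * ((x - y) \<bullet> \<xi>)) * (c v * cis (2 * pi * (lvec v \<bullet> ((1 / 2) *\<^sub>R (x + y)) + mvec v \<bullet> \<xi>))) * u y" for v y
    proof -
      have "pi * (lvec v \<bullet> x) + p v \<bullet> \<xi> + (- r * (y \<bullet> (\<xi> - q v)))
          = r * ((x - y) \<bullet> \<xi>) + 2 * pi * (lvec v \<bullet> ((1 / 2) *\<^sub>R (x + y)) + mvec v \<bullet> \<xi>)"
        using N by (simp add: p_def q_def r_def inner_add_left inner_add_right inner_diff_left inner_diff_right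
            inner_commute[of y] algebra_simps)
      then have "cis (pi * (lvec v \<bullet> x)) * cis (p v \<bullet> \<xi>) * cis (- r * (y \<bullet> (\<xi> - q v)))
          = cis (r * ((x - y) \<bullet> \<xi>)) * cis (2 * pi * (lvec v \<bullet> ((1 / 2) *\<^sub>R (x + y)) + mvec v \<bullet> \<xi>))"
        by (simp only: cis_mult)
      then show ?thesis by (simp add: f_def k_def) (simp add: mult_ac)
    qed
    have nf: "cmod (f v y) = cmod (c v) * cmod (u y)" for v y by (simp add: f_def norm_mult k)
    have "(LINT y|lborel. (\<Sum>\<^sub>\<infinity>v. f v y)) = (\<Sum>\<^sub>\<infinity>v. (LINT y|lborel. f v y))"
    proof (rule integral_infsum[of _ "\<lambda>v. cmod (c v) * A"])
      show "integrable lborel (f v)" for v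
        unfolding f_def by (intro integrable_mult_right integrable_cis_mult iu) measurable
      show "(LINT y|lborel. cmod (f v y)) \<le> cmod (c v) * A" for v by (simp add: nf A_def)
      show "(\<lambda>v. cmod (c v) * A) summable_on UNIV" by (intro summable_on_cmult_left rapid_abs_summable c)
      show "(\<lambda>v. cmod (f v y)) summable_on UNIV" for y
        unfolding nf by (intro summable_on_cmult_left rapid_abs_summable c)
    qed
    moreover have "(LINT y|lborel. f v y) = k v * (cis (p v \<bullet> \<xi>) * FT r u (\<xi> - q v))" for v
      unfolding f_def FT_def integral_mult_right_zero by (simp add: mult.assoc)
    moreover have "(\<Sum>\<^sub>\<infinity>v. f v y) = cis (r * ((x - y) \<bullet> \<xi>)) * a ((1 / 2) *\<^sub>R (x + y), \<xi>) * u y" for y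
      unfolding fe a by (simp only: infsum_cmult_left' infsum_cmult_right')
    ultimately show ?thesis unfolding e by simp
  qed
  have "(LINT \<xi>|lborel. (\<Sum>\<^sub>\<infinity>v. k v * (cis (p v \<bullet> \<xi>) * FT r u (\<xi> - q v))))
      = (\<Sum>\<^sub>\<infinity>v. (LINT \<xi>|lborel. k v * (cis (p v \<bullet> \<xi>) * FT r u (\<xi> - q v))))"
  proof (rule integral_infsum[of _ "\<lambda>v. cmod (c v) * A'"])
    show "integrable lborel (\<lambda>\<xi>. k v * (cis (p v \<bullet> \<xi>) * FT r u (\<xi> - q v)))" for v
      by (intro integrable_mult_right FT_shift_integral(1) u r)
    show "(LINT \<xi>|lborel. cmod (k v * (cis (p v \<bullet> \<xi>) * FT r u (\<xi> - q v)))) \<le> cmod (c v) * A'" for v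
      unfolding norm_mult[of "k v"] k integral_mult_right_zero FT_shift_integral(2)[OF u r] A'_def by simp
    show "(\<lambda>v. cmod (c v) * A') summable_on UNIV" by (intro summable_on_cmult_left rapid_abs_summable c)
    show "(\<lambda>v. cmod (k v * (cis (p v \<bullet> \<xi>) * FT r u (\<xi> - q v)))) summable_on UNIV" for \<xi>
    proof (rule Infinite_Sum.abs_summable_on_comparison_test')
      show "(\<lambda>v. cmod (c v) * A) summable_on UNIV" by (intro summable_on_cmult_left rapid_abs_summable c)
      show "cmod (k v * (cis (p v \<bullet> \<xi>) * FT r u (\<xi> - q v))) \<le> cmod (c v) * A" for v
        using norm_FT_le[OF iu] by (simp add: norm_mult k A_def mult_left_mono)
    qed
  qed
  also have "\<dots> = (\<Sum>\<^sub>\<infinity>v. complex_of_real (1 / real N ^ CARD('d)) * (c v * cis (pi * (lvec v \<bullet> mvec v) / N) * cis ((2 * pi) *\<^sub>R lvec v \<bullet> x) * u (x + (1 / real N) *\<^sub>R mvec v)))"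
  proof (rule infsum_cong)
    fix v :: "int^('d + 'd)"
    define x' where "x' = x + (1 / real N) *\<^sub>R mvec v"
    have p: "p v \<bullet> \<xi> = r * (x' \<bullet> \<xi>)" for \<xi>
      using N by (simp add: p_def x'_def r_def inner_add_left algebra_simps)
    \<comment> \<open>The two half-phases make up the modulation at \<open>x\<close>. As the second
      one is taken at \<open>x'\<close> rather than \<open>x\<close>, the Weyl phase
      \<open>pi * (lvec v \<bullet> mvec v) / N\<close> is left over.\<close>
    have "pi * (lvec v \<bullet> x) + r * (x' \<bullet> q v) = pi * (lvec v \<bullet> mvec v) / N + (2 * pi) *\<^sub>R lvec v \<bullet> x"
      using N by (simp add: x'_def q_def r_def inner_add_left inner_commute[of x] inner_commute[of "mvec v"] field_simps)
    then have cis: "cis (pi * (lvec v \<bullet> x)) * cis (r * (x' \<bullet> q v)) = cis (pi * (lvec v \<bullet> mvec v) / N) * cis ((2 * pi) *\<^sub>R lvec v \<bullet> x)"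
      by (simp only: cis_mult)
    have "2 * pi / r = 1 / real N" by (simp add: r_def)
    then have "(LINT \<xi>|lborel. k v * (cis (p v \<bullet> \<xi>) * FT r u (\<xi> - q v))) = k v * (cis (r * (x' \<bullet> q v)) * (complex_of_real (1 / real N ^ CARD('d)) * u x'))"
      unfolding p integral_mult_right_zero FT_shift_integral(3)[OF u r]
      by (simp add: scaleR_conv_of_real power_divide)
    also have "\<dots> = complex_of_real (1 / real N ^ CARD('d)) * (c v * (cis (pi * (lvec v \<bullet> mvec v) / N) * cis ((2 * pi) *\<^sub>R lvec v \<bullet> x)) * u x')"
      unfolding cis[symmetric] k_def by (simp only: mult_ac)
    finally show "(LINT \<xi>|lborel. k v * (cis (p v \<bullet> \<xi>) * FT r u (\<xi> - q v)))
       = complex_of_real (1 / real N ^ CARD('d)) * (c v * cis (pi * (lvec v \<bullet> mvec v) / N) * cis ((2 * pi) *\<^sub>R lvec v \<bullet> x) * u (x + (1 / real N) *\<^sub>R mvec v))"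
      unfolding x'_def by (simp only: mult.assoc)
  qed
  also have "\<dots> = complex_of_real (1 / real N ^ CARD('d)) * msum (\<lambda>v. (2 * pi) *\<^sub>R lvec v) (\<lambda>v. (1 / real N) *\<^sub>R mvec v) (\<lambda>v. c v * cis (pi * (lvec v \<bullet> mvec v) / N)) u x"
    unfolding infsum_cmult_right' msum_def ..
  finally show "weyl (1 / (2 * pi * real N)) a u x = msum (\<lambda>v. (2 * pi) *\<^sub>R lvec v) (\<lambda>v. (1 / real N) *\<^sub>R mvec v) (\<lambda>v. c v * cis (pi * (lvec v \<bullet> mvec v) / N)) u x"
    unfolding weyl_def inner using N by (simp add: power_divide)
qed

text \<open>The two factors of phase space are merged into one torus \<open>real^('d + 'd)\<close>.\<close>

theorem smooth_torus_fourier_series: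
  fixes a :: "(real^'d) \<times> (real^'d) \<Rightarrow> complex"
  assumes "smooth_torus a"
  shows "\<exists>c :: int^('d + 'd) \<Rightarrow> complex. rapid c \<and>
    (\<forall>x \<xi>. a (x, \<xi>) = (\<Sum>\<^sub>\<infinity>v. c v * cis (2 * pi * (lvec v \<bullet> x + mvec v \<bullet> \<xi>))))"
proof -
  define L :: "real^('d + 'd) \<Rightarrow> (real^'d) \<times> (real^'d)" where "L z = (\<chi> i. z $ Inl i, \<chi> i. z $ Inr i)" for z
  have L: "bounded_linear L"
    by (intro linear_conv_bounded_linear[THEN iffD1] linearI) (auto simp: L_def vec_eq_iff)
  have sa: "smooth a" using assms by (simp add: smooth_torus_def)
  have "smooth (a \<circ> L)"
  proof (rule smooth_coinduct[where P = "\<lambda>g. \<exists>f. smooth f \<and> g = f \<circ> L"])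
    fix g assume "\<exists>f. smooth f \<and> g = f \<circ> L"
    then obtain f where f: "smooth f" "g = f \<circ> L" by blast
    have "(g has_derivative (\<lambda>h. directional_derivs [L h] f (L x))) (at x)" for x
      using has_derivative_compose[OF bounded_linear_imp_has_derivative[OF L] smooth_has_derivative[OF f(1), of "[]"]]
      by (simp add: f(2) o_def)
    then show "\<exists>g'. (\<forall>x. (g has_derivative g' x) (at x)) \<and> (\<forall>v. \<exists>f. smooth f \<and> (\<lambda>x. g' x v) = f \<circ> L)"
      by (intro exI[of _ "\<lambda>x h. directional_derivs [L h] f (L x)"] conjI allI)
        (auto simp del: directional_derivs.simps simp: o_def intro: smooth_directional_derivs[OF f(1)])
  qed (use sa in blast)
  moreover have "periodic (a \<circ> L)"
    unfolding periodic_def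
  proof (intro allI)
    fix z :: "real^('d + 'd)" and k :: "int^('d + 'd)"
    have "L (z + int_vec k) = (fst (L z) + int_vec (lpart k), snd (L z) + int_vec (mpart k))"
      by (simp add: L_def int_vec_def lpart_def mpart_def vec_eq_iff)
    then show "(a \<circ> L) (z + int_vec k) = (a \<circ> L) z"
      using assms by (simp add: smooth_torus_def)
  qed
  ultimately obtain c where c: "rapid c" "\<And>z. (a \<circ> L) z = (\<Sum>\<^sub>\<infinity>k. c k * mode k z)"
    using fourier_series by blast
  have "a (x, \<xi>) = (\<Sum>\<^sub>\<infinity>v. c v * cis (2 * pi * (lvec v \<bullet> x + mvec v \<bullet> \<xi>)))" for x \<xi>
  proof -
    define z :: "real^('d + 'd)" where "z = (\<chi> j. case j of Inl i \<Rightarrow> x $ i | Inr i \<Rightarrow> \<xi> $ i)"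
    have "L z = (x, \<xi>)" by (simp add: L_def z_def vec_eq_iff)
    moreover have "int_vec v \<bullet> z = lvec v \<bullet> x + mvec v \<bullet> \<xi>" for v
      unfolding inner_int_vec lvec_def mvec_def UNIV_Plus_UNIV[symmetric]
      by (subst sum.Plus) (auto simp: z_def lpart_def mpart_def)
    ultimately show ?thesis using c(2)[of z] by (simp add: mode_def)
  qed
  with c(1) show ?thesis by blast
qed

section \<open>The distributions \<open>Q\<^sub>n\<close>\<close>

text \<open>Polynomials times a fixed modulated Gaussian form a class closed under
  differentiation.\<close>

inductive polyfn :: "('a::euclidean_space \<Rightarrow> complex) \<Rightarrow> bool" where
  const: "polyfn (\<lambda>_. z)"
| lin: "polyfn (\<lambda>x. complex_of_real (x \<bullet> w))"
| add: "polyfn p \<Longrightarrow> polyfn q \<Longrightarrow> polyfn (\<lambda>x. p x + q x)"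
| mult: "polyfn p \<Longrightarrow> polyfn q \<Longrightarrow> polyfn (\<lambda>x. p x * q x)"

section \<open>Modulated Gaussians as test functions\<close>

lemma polyfn_has_derivative:
  "polyfn p \<Longrightarrow> \<exists>p'. (\<forall>x. (p has_derivative p' x) (at x)) \<and> (\<forall>v. polyfn (\<lambda>x. p' x v))"
proof (induction rule: polyfn.induct)
  case (const z)
  show ?case by (intro exI[of _ "\<lambda>_ _. 0"]) (auto intro: polyfn.const)
next
  case (lin w)
  have "((\<lambda>x. complex_of_real (x \<bullet> w)) has_derivative (\<lambda>h. complex_of_real (h \<bullet> w))) (at x)" for x
    by (intro has_derivative_of_real has_derivative_inner_left has_derivative_ident)
  then show ?case by (intro exI[of _ "\<lambda>_ h. complex_of_real (h \<bullet> w)"]) (auto intro: polyfn.const)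
next
  case (add p q)
  then obtain p' q' where "\<And>x. (p has_derivative p' x) (at x)" "\<And>v. polyfn (\<lambda>x. p' x v)"
    "\<And>x. (q has_derivative q' x) (at x)" "\<And>v. polyfn (\<lambda>x. q' x v)" by blast
  then show ?case
    by (intro exI[of _ "\<lambda>x h. p' x h + q' x h"] conjI allI has_derivative_add polyfn.add)
next
  case (mult p q)
  then obtain p' q' where "\<And>x. (p has_derivative p' x) (at x)" "\<And>v. polyfn (\<lambda>x. p' x v)"
    "\<And>x. (q has_derivative q' x) (at x)" "\<And>v. polyfn (\<lambda>x. q' x v)" by blast
  then show ?case
    by (intro exI[of _ "\<lambda>x h. p x * q' x h + p' x h * q x"] conjI allI has_derivative_mult polyfn.add polyfn.mult mult.hyps)
qed

lemma polyfn_bound: "polyfn p \<Longrightarrow> \<exists>C m. 0 \<le> C \<and> (\<forall>x. cmod (p x) \<le> C * (1 + norm x) ^ m)"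
proof (induction rule: polyfn.induct)
  case (const z)
  show ?case by (intro exI[of _ "cmod z"] exI[of _ 0]) auto
next
  case (lin w)
  have "\<bar>x \<bullet> w\<bar> \<le> norm w * (1 + norm x) ^ 1" for x
  proof -
    have "norm w * (1 + norm x) ^ 1 = norm w + norm x * norm w" by (simp add: algebra_simps)
    then show ?thesis using Cauchy_Schwarz_ineq2[of x w] norm_ge_zero[of w] by linarith
  qed
  then show ?case by (intro exI[of _ "norm w"] exI[of _ 1]) auto
next
  case (add p q)
  then obtain C m D n where C: "0 \<le> C" "\<And>x. cmod (p x) \<le> C * (1 + norm x) ^ m"
    and D: "0 \<le> D" "\<And>x. cmod (q x) \<le> D * (1 + norm x) ^ n" by blast
  have "cmod (p x + q x) \<le> (C + D) * (1 + norm x) ^ (m + n)" for x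
  proof -
    have "C * (1 + norm x) ^ m \<le> C * (1 + norm x) ^ (m + n)" "D * (1 + norm x) ^ n \<le> D * (1 + norm x) ^ (m + n)"
      using C(1) D(1) by (intro mult_left_mono power_increasing; simp)+
    then show ?thesis using C(2)[of x] D(2)[of x] norm_triangle_ineq[of "p x" "q x"] by (simp add: distrib_right)
  qed
  then show ?case using C(1) D(1) by (intro exI[of _ "C + D"] exI[of _ "m + n"]) auto
next
  case (mult p q)
  then obtain C m D n where C: "0 \<le> C" "\<And>x. cmod (p x) \<le> C * (1 + norm x) ^ m"
    and D: "0 \<le> D" "\<And>x. cmod (q x) \<le> D * (1 + norm x) ^ n" by blast
  have "cmod (p x * q x) \<le> (C * D) * (1 + norm x) ^ (m + n)" for x
    using mult_mono[OF C(2)[of x] D(2)[of x]] C(1) by (simp add: norm_mult power_add mult_ac)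
  then show ?case using C(1) D(1) by (intro exI[of _ "C * D"] exI[of _ "m + n"]) auto
qed

lemma power_le_fact_exp:
  fixes t :: real
  assumes "0 \<le> t"
  shows "t ^ K \<le> fact K * exp t"
proof -
  have "(\<Sum>n\<in>{K}. t ^ n /\<^sub>R fact n) \<le> (\<Sum>n. t ^ n /\<^sub>R fact n)"
    using assms by (intro sum_le_suminf summable_exp_generic) auto
  then have "t ^ K / fact K \<le> exp t" by (simp add: exp_def divide_inverse mult.commute)
  then show ?thesis by (simp add: divide_le_eq mult.commute)
qed

lemma schwartz_modulated_gaussian:
  fixes w :: "'a::euclidean_space"
  shows "schwartz (\<lambda>x. cis (w \<bullet> x) * complex_of_real (exp (- (x \<bullet> x) / 2)))"
proof -
  define E where "E x = exp (\<i> * complex_of_real (x \<bullet> w) - complex_of_real ((x \<bullet> x) / 2))" for x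
  define P where "P f \<longleftrightarrow> (\<exists>p. polyfn p \<and> f = (\<lambda>x. p x * E x))" for f
  have "(\<lambda>x. cis (w \<bullet> x) * complex_of_real (exp (- (x \<bullet> x) / 2))) = (\<lambda>x. 1 * E x)"
  proof
    fix x
    have e: "cis s * complex_of_real (exp (- y)) = exp (\<i> * complex_of_real s - complex_of_real y)" for s y
      by (simp add: cis_conv_exp exp_diff exp_minus inverse_eq_divide exp_of_real)
    show "cis (w \<bullet> x) * complex_of_real (exp (- (x \<bullet> x) / 2)) = 1 * E x"
      using e[of "w \<bullet> x" "(x \<bullet> x) / 2"] by (simp add: E_def inner_commute)
  qed
  then have "P (\<lambda>x. cis (w \<bullet> x) * complex_of_real (exp (- (x \<bullet> x) / 2)))"
    unfolding P_def using polyfn.const[of 1] by metis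
  then show ?thesis
  proof (rule schwartz_coinduct)
    fix f assume "P f"
    then obtain p where p: "polyfn p" "f = (\<lambda>x. p x * E x)" by (auto simp: P_def)
    obtain p' where p': "\<And>x. (p has_derivative p' x) (at x)" "\<And>v. polyfn (\<lambda>x. p' x v)"
      using polyfn_has_derivative[OF p(1)] by blast
    define g' where "g' x h = \<i> * complex_of_real (h \<bullet> w) + (- 1) * complex_of_real (x \<bullet> h)" for x h
    have E: "(E has_derivative (\<lambda>h. g' x h * E x)) (at x)" for x
    proof -
      have "((\<lambda>x. \<i> * complex_of_real (x \<bullet> w) - complex_of_real ((x \<bullet> x) / 2)) has_derivative
          (\<lambda>h. \<i> * complex_of_real (h \<bullet> w) - complex_of_real ((x \<bullet> h + h \<bullet> x) / 2))) (at x)"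
      proof (intro has_derivative_diff has_derivative_mult_right has_derivative_of_real has_derivative_inner_left has_derivative_ident)
        show "((\<lambda>x. (x \<bullet> x) / 2) has_derivative (\<lambda>h. (x \<bullet> h + h \<bullet> x) / 2)) (at x)"
          using has_derivative_mult_right[OF has_derivative_inner[OF has_derivative_ident has_derivative_ident], of "1 / 2" x UNIV] by simp
      qed
      then have "((\<lambda>x. \<i> * complex_of_real (x \<bullet> w) - complex_of_real ((x \<bullet> x) / 2)) has_derivative g' x) (at x)"
        by (simp add: g'_def[abs_def] inner_commute)
      from has_derivative_compose[OF this DERIV_exp[unfolded has_field_derivative_def]]
      show ?thesis by (simp add: E_def[abs_def] mult.commute)
    qed
    have "(f has_derivative (\<lambda>h. (p x * g' x h + p' x h) * E x)) (at x)" for x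
      using has_derivative_mult[OF p'(1)[of x] E[of x]] by (simp add: p(2) algebra_simps)
    moreover have "P (\<lambda>x. (p x * g' x v + p' x v) * E x)" for v
      unfolding P_def g'_def
      by (intro exI[of _ "\<lambda>x. p x * (\<i> * complex_of_real (v \<bullet> w) + (- 1) * complex_of_real (x \<bullet> v)) + p' x v"] conjI refl
          polyfn.intros p(1) p'(2))
    ultimately show "\<exists>f'. (\<forall>x. (f has_derivative f' x) (at x)) \<and> (\<forall>v. P (\<lambda>x. f' x v))"
      by (intro exI[of _ "\<lambda>x h. (p x * g' x h + p' x h) * E x"]) auto
  next
    fix f k assume "P f"
    then obtain p where p: "polyfn p" "f = (\<lambda>x. p x * E x)" by (auto simp: P_def)
    obtain C m where C: "0 \<le> C" "\<And>x. cmod (p x) \<le> C * (1 + norm x) ^ m" using polyfn_bound[OF p(1)] by blast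
    have "norm x ^ k * cmod (f x) \<le> C * (fact (k + m) * exp 2)" for x
    proof -
      have E: "cmod (E x) = exp (- (norm x)\<^sup>2 / 2)" by (simp add: E_def power2_norm_eq_inner)
      \<comment> \<open>Completing the square: the exponent \<open>1 + norm x\<close>, which
        dominates the polynomial growth, is beaten by the Gaussian up to a constant.\<close>
      have "0 \<le> (norm x - 1)\<^sup>2" by simp
      then have q: "1 + norm x + - (norm x)\<^sup>2 / 2 \<le> 2" by (simp add: power2_diff)
      have "norm x ^ k * cmod (f x) \<le> (1 + norm x) ^ k * (C * (1 + norm x) ^ m * exp (- (norm x)\<^sup>2 / 2))"
        unfolding p(2) norm_mult E using C by (intro mult_mono power_mono mult_right_mono) auto
      also have "\<dots> = C * ((1 + norm x) ^ (k + m) * exp (- (norm x)\<^sup>2 / 2))" by (simp add: power_add mult_ac)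
      also have "\<dots> \<le> C * (fact (k + m) * exp (1 + norm x) * exp (- (norm x)\<^sup>2 / 2))"
        using C(1) by (intro mult_left_mono mult_right_mono power_le_fact_exp) auto
      also have "\<dots> = C * (fact (k + m) * exp (1 + norm x + - (norm x)\<^sup>2 / 2))"
        by (simp only: exp_add mult.assoc)
      also have "\<dots> \<le> C * (fact (k + m) * exp 2)"
        using C(1) q by (intro mult_left_mono) auto
      finally show ?thesis .
    qed
    then show "\<exists>C. \<forall>x. norm x ^ k * cmod (f x) \<le> C" by blast
  qed
qed

text \<open>The dependence on \<open>y\<close> is kept explicit and polynomial, because
  \<open>y\<close> is later displaced by \<open>mvec v / N\<close> and the bound has to be summed
  over \<open>v\<close>.\<close>

lemma schwartz_lattice_bound:
  fixes \<phi> :: "real^'d \<Rightarrow> complex"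
  assumes "schwartz \<phi>"
  obtains C where "0 \<le> C" "\<And>k y. cmod (\<phi> (int_vec k + y)) \<le> C * (1 + norm y) ^ (2 * CARD('d)) * (1 / (1 + 2 * pi * l1 k) ^ (2 * CARD('d)))"
proof -
  define K where "K = 2 * CARD('d)"
  obtain C where C: "0 \<le> C" "\<And>x. (1 + norm x) ^ K * cmod (directional_derivs [] \<phi> x) \<le> C"
    using schwartz_bound[OF assms] by metis
  have "cmod (\<phi> (int_vec k + y)) \<le> (C * (1 + 2 * pi * CARD('d)) ^ K) * (1 + norm y) ^ K * (1 / (1 + 2 * pi * l1 k) ^ K)" for k y
  proof -
    have w: "1 \<le> 1 + 2 * pi * l1 k" by (rule weight_ge_1)
    have "l1 k \<le> (\<Sum>i\<in>(UNIV :: 'd set). norm (int_vec k))"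
      unfolding l1_def by (intro sum_mono) (use component_le_norm_cart[of "int_vec k"] in \<open>simp add: int_vec_def\<close>)
    then have "2 * pi * l1 k \<le> 2 * pi * (CARD('d) * norm (int_vec k))" by (intro mult_left_mono) auto
    moreover have "0 \<le> norm (int_vec k)" "0 \<le> 2 * pi * CARD('d)" by auto
    moreover have "(1 + 2 * pi * CARD('d)) * (1 + norm (int_vec k)) = 1 + 2 * pi * CARD('d) + norm (int_vec k) + 2 * pi * (CARD('d) * norm (int_vec k))"
      by (simp add: algebra_simps)
    ultimately have "1 + 2 * pi * l1 k \<le> (1 + 2 * pi * CARD('d)) * (1 + norm (int_vec k))"
      by linarith
    then have "(1 + 2 * pi * l1 k) ^ K \<le> ((1 + 2 * pi * CARD('d)) * (1 + norm (int_vec k))) ^ K"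
      using w by (intro power_mono) auto
    also have "\<dots> = (1 + 2 * pi * CARD('d)) ^ K * (1 + norm (int_vec k)) ^ K" by (rule power_mult_distrib)
    also have "\<dots> \<le> (1 + 2 * pi * CARD('d)) ^ K * ((1 + norm y) ^ K * (1 + norm (int_vec k + y)) ^ K)"
      by (intro mult_left_mono norm_shift_weight) auto
    finally have "(1 + 2 * pi * l1 k) ^ K * cmod (\<phi> (int_vec k + y)) \<le> (1 + 2 * pi * CARD('d)) ^ K * ((1 + norm y) ^ K * (1 + norm (int_vec k + y)) ^ K) * cmod (\<phi> (int_vec k + y))"
      by (intro mult_right_mono) auto
    also have "\<dots> = (1 + 2 * pi * CARD('d)) ^ K * (1 + norm y) ^ K * ((1 + norm (int_vec k + y)) ^ K * cmod (\<phi> (int_vec k + y)))"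
      by (simp only: mult_ac)
    also have "\<dots> \<le> (1 + 2 * pi * CARD('d)) ^ K * (1 + norm y) ^ K * C"
      using C(2)[of "int_vec k + y"] by (intro mult_left_mono) auto
    finally have "cmod (\<phi> (int_vec k + y)) \<le> (1 + 2 * pi * CARD('d)) ^ K * (1 + norm y) ^ K * C / (1 + 2 * pi * l1 k) ^ K"
    proof -
      assume *: "(1 + 2 * pi * l1 k) ^ K * cmod (\<phi> (int_vec k + y)) \<le> (1 + 2 * pi * CARD('d)) ^ K * (1 + norm y) ^ K * C"
      have "0 < (1 + 2 * pi * l1 k) ^ K" using w by (intro zero_less_power) linarith
      from pos_le_divide_eq[OF this] * show ?thesis by (simp only: mult.commute)
    qed
    then show ?thesis by (simp add: mult_ac)
  qed
  then show ?thesis using that[of "C * (1 + 2 * pi * CARD('d)) ^ K"] C(1) by (simp add: K_def)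
qed

lemma schwartz_lattice_summable:
  fixes \<phi> :: "real^'d \<Rightarrow> complex"
  assumes "schwartz \<phi>"
  shows "(\<lambda>k. cmod (\<phi> (int_vec k + y))) summable_on UNIV"
proof -
  obtain C where C: "0 \<le> C" "\<And>k y. cmod (\<phi> (int_vec k + y)) \<le> C * (1 + norm y) ^ (2 * CARD('d)) * (1 / (1 + 2 * pi * l1 k) ^ (2 * CARD('d)))"
    using schwartz_lattice_bound[OF assms] by metis
  have "(\<lambda>k :: int^'d. C * (1 + norm y) ^ (2 * CARD('d)) * (1 / (1 + 2 * pi * l1 k) ^ (2 * CARD('d)))) summable_on UNIV"
    by (intro summable_on_cmult_right summable_weight)
  then show ?thesis by (rule Infinite_Sum.abs_summable_on_comparison_test') (rule C(2))
qed

definition ivec :: "nat^'d \<Rightarrow> int^'d" where "ivec n = (\<chi> i. int (n $ i))"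

text \<open>The values of \<open>Q N n\<close> extended to arbitrary integer indices. They are
  periodic modulo \<open>N\<close>, so cyclic shifts become plain additions of indices.\<close>

definition theta :: "nat \<Rightarrow> (real^'d \<Rightarrow> complex) \<Rightarrow> int^'d \<Rightarrow> complex" where
  "theta N \<phi> j = complex_of_real (real N powr (- real CARD('d) / 2)) * (\<Sum>\<^sub>\<infinity>k\<in>UNIV. \<phi> (int_vec k + node N j))"

section \<open>Lattice sums and linear independence\<close>

lemma Q_eq_theta: "schwartz \<phi> \<Longrightarrow> Q N n \<phi> = theta N \<phi> (ivec n)"
proof -
  have "(\<chi> i. real (n $ i) / real N) = node N (ivec n)"
    by (simp add: node_def ivec_def int_vec_def vec_eq_iff)
  then show "schwartz \<phi> \<Longrightarrow> Q N n \<phi> = theta N \<phi> (ivec n)" by (simp add: Q_def theta_def)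
qed

lemma theta_periodic:
  assumes "N \<ge> 1"
  shows "theta N \<phi> (j + (\<chi> i. int N * q $ i)) = theta N \<phi> j"
proof -
  have "(\<Sum>\<^sub>\<infinity>k. \<phi> (int_vec k + (node N j + int_vec q))) = (\<Sum>\<^sub>\<infinity>k. \<phi> (int_vec (k + q) + node N j))"
    by (rule infsum_cong) (simp add: add_ac)
  also have "\<dots> = (\<Sum>\<^sub>\<infinity>k. \<phi> (int_vec k + node N j))"
    by (rule infsum_reindex_bij_betw[of "\<lambda>k. k + q"]) (auto simp: bij_betw_def inj_on_def surj_def intro: exI[of _ "_ - q"])
  finally show ?thesis by (simp add: theta_def node_period[OF assms])
qed

lemma phase_eq_mode: "phase N l n = mode l (node N (ivec n))"
proof -
  have "int_vec l \<bullet> node N (ivec n) = of_int (pairing l (ivec n)) / N"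
    unfolding inner_int_vec by (simp add: node_def ivec_def int_vec_def pairing_def sum_divide_distrib)
  then show ?thesis by (simp add: phase_def mode_def ivec_def)
qed

lemma sum_mode_orthogonal:
  fixes m :: "int^'d"
  assumes N: "N \<ge> 1" and m: "\<not> int N dvd m $ i"
  shows "(\<Sum>l\<in>lattice_box {0..<int N}. mode l (node N m)) = 0"
proof -
  define T where "T = (\<Sum>l\<in>lattice_box {0..<int N}. mode l (node N m))"
  have md: "mode l (node N m) = cis (2 * pi * (of_int (pairing l m) / N))" for l
  proof -
    have "int_vec l \<bullet> node N m = of_int (pairing l m) / N"
      unfolding inner_int_vec by (simp add: node_def int_vec_def pairing_def sum_divide_distrib)
    then show ?thesis by (simp add: mode_def)
  qed
  have "(\<Sum>l\<in>lattice_box {0..<int N}. mode (l + axis i 1) (node N m)) = T"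
    unfolding T_def
  proof (rule sum_box_shift[OF N])
    fix j q :: "int^'d"
    have "pairing (\<chi> i. int N * q $ i) m = int N * pairing q m"
      by (simp add: pairing_def sum_distrib_left mult.assoc)
    then have "mode (\<chi> i. int N * q $ i) (node N m) = cis (2 * pi * of_int (pairing q m))"
      unfolding md using N by simp
    then have "mode (\<chi> i. int N * q $ i) (node N m) = 1" by (simp only: cis_int)
    then show "mode (j + (\<chi> i. int N * q $ i)) (node N m) = mode j (node N m)" by (simp add: mode_add)
  qed
  then have "T * mode (axis i 1) (node N m) = T"
    by (simp add: mode_add(2) T_def sum_distrib_right)
  moreover have "mode (axis i 1) (node N m) \<noteq> 1"
  proof
    assume "mode (axis i 1) (node N m) = 1"
    then obtain n :: int where "2 * pi * (of_int (m $ i) / N) = of_int n * (2 * pi)"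
      by (auto simp: md cis_eq_1_iff)
    then have "of_int (m $ i) = real_of_int (n * int N)" using N by (simp add: field_simps)
    then have "m $ i = n * int N" by (simp only: of_int_eq_iff)
    with m show False by simp
  qed
  ultimately show ?thesis unfolding T_def by (metis mult_cancel_left1 mult_eq_self_implies_10 mult.right_neutral mult_cancel_left)
qed

lemma finite_grid: "finite (grid N :: (nat^'d) set)"
proof -
  have "grid N \<subseteq> (\<lambda>g. \<chi> i. g i) ` (PiE (UNIV :: 'd set) (\<lambda>_. {..<N}))"
  proof
    fix n :: "nat^'d" assume "n \<in> grid N"
    then have "(\<lambda>i. n $ i) \<in> PiE UNIV (\<lambda>_. {..<N})" by (auto simp: grid_def)
    moreover have "n = (\<chi> i. n $ i)" by simp
    ultimately show "n \<in> (\<lambda>g. \<chi> i. g i) ` (PiE UNIV (\<lambda>_. {..<N}))" by blast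
  qed
  then show ?thesis by (rule finite_subset) (intro finite_imageI finite_PiE, auto)
qed

text \<open>Testing against modulated Gaussians yields a discrete Fourier transform of the
  coefficients, weighted by the positive lattice sums of a Gaussian.\<close>

lemma Q_comb_independent:
  fixes c :: "nat^'d \<Rightarrow> complex"
  assumes N: "N \<ge> 1" and zero: "\<And>\<phi>. Q_comb N c \<phi> = 0" and n: "n \<in> grid N"
  shows "c n = 0"
proof -
  define g where "g x = exp (- (x \<bullet> x) / 2)" for x :: "real^'d"
  define \<phi> where "\<phi> l x = cis (((2 * pi) *\<^sub>R int_vec l) \<bullet> x) * complex_of_real (g x)" for l :: "int^'d" and x
  have s: "schwartz (\<phi> l)" for l unfolding \<phi>_def g_def by (rule schwartz_modulated_gaussian)
  define S where "S n = (\<Sum>\<^sub>\<infinity>k. g (int_vec k + node N (ivec n)))" for n :: "nat^'d"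
  have sg: "(\<lambda>k. g (int_vec k + y)) summable_on UNIV" for y
    using schwartz_lattice_summable[OF s, of 0 y] by (simp add: \<phi>_def g_def)
  have Spos: "0 < S n" for n
  proof -
    have "(\<Sum>k\<in>{0}. g (int_vec k + node N (ivec n))) \<le> S n"
      unfolding S_def by (rule finite_sum_le_infsum[OF sg]) (auto simp: g_def)
    moreover have "0 < (\<Sum>k\<in>{0 :: int^'d}. g (int_vec k + node N (ivec n)))" by (simp add: g_def)
    ultimately show ?thesis by linarith
  qed
  define p where "p = real N powr (- real CARD('d) / 2)"
  have p0: "p \<noteq> 0" using N by (simp add: p_def)
  have Q: "Q N n (\<phi> l) = p * (mode l (node N (ivec n)) * S n)" for l n
  proof -
    have "\<phi> l (int_vec k + node N (ivec n)) = mode l (node N (ivec n)) * complex_of_real (g (int_vec k + node N (ivec n)))" for k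
    proof -
      have "cis (((2 * pi) *\<^sub>R int_vec l) \<bullet> y) = mode l y" for y by (simp add: mode_def)
      moreover have "mode l (int_vec k + node N (ivec n)) = mode l (node N (ivec n))"
        using periodic_mode[of l] unfolding periodic_def by (metis add.commute)
      ultimately show ?thesis by (simp add: \<phi>_def)
    qed
    then have "(\<Sum>\<^sub>\<infinity>k. \<phi> l (int_vec k + node N (ivec n))) = mode l (node N (ivec n)) * (\<Sum>\<^sub>\<infinity>k. complex_of_real (g (int_vec k + node N (ivec n))))"
      by (simp only: infsum_cmult_right')
    also have "(\<Sum>\<^sub>\<infinity>k. complex_of_real (g (int_vec k + node N (ivec n)))) = S n"
      unfolding S_def by (rule infsum_bounded_linear[OF bounded_linear_of_real sg])
    finally show ?thesis by (simp add: Q_eq_theta[OF s] theta_def p_def)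
  qed
  have z: "(\<Sum>m\<in>grid N. c m * (mode l (node N (ivec m)) * S m)) = 0" for l
  proof -
    have "complex_of_real p * (\<Sum>m\<in>grid N. c m * (mode l (node N (ivec m)) * S m)) = 0"
      using zero[of "\<phi> l"] by (simp add: Q_comb_def Q sum_distrib_left mult_ac)
    then show ?thesis using p0 by simp
  qed
  \<comment> \<open>Inverting the discrete transform isolates \<open>c n * S n\<close> up to the
    number of frequencies; \<open>S n > 0\<close> then allows division.\<close>
  have "(\<Sum>l\<in>lattice_box {0..<int N}. cnj (mode l (node N (ivec n))) * (\<Sum>m\<in>grid N. c m * (mode l (node N (ivec m)) * S m)))
      = (\<Sum>m\<in>grid N. c m * S m * (\<Sum>l\<in>lattice_box {0..<int N}. mode l (node N (ivec m - ivec n))))"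
  proof -
    have e: "node N (ivec m - ivec n) = node N (ivec m) + - node N (ivec n)" for m
      by (simp add: node_def scaleR_diff_right)
    have "mode l (node N (ivec m - ivec n)) = mode l (node N (ivec m)) * cnj (mode l (node N (ivec n)))" for l m
      unfolding e by (simp only: mode_add(1) mode_minus)
    then show ?thesis
      unfolding sum_distrib_left by (subst sum.swap) (simp add: mult_ac)
  qed
  also have "\<dots> = (\<Sum>m\<in>grid N. if m = n then c n * S n * card (lattice_box {0..<int N} :: (int^'d) set) else 0)"
  proof (rule sum.cong[OF refl])
    fix m :: "nat^'d" assume m: "m \<in> grid N"
    show "c m * S m * (\<Sum>l\<in>lattice_box {0..<int N}. mode l (node N (ivec m - ivec n)))
        = (if m = n then c n * S n * card (lattice_box {0..<int N} :: (int^'d) set) else 0)"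
    proof (cases "m = n")
      case True
      then show ?thesis by (simp add: node_def mode_def)
    next
      case False
      then obtain i where i: "m $ i \<noteq> n $ i" by (auto simp: vec_eq_iff)
      have lt: "m $ i < N" "n $ i < N" using m n by (auto simp: grid_def)
      have "\<not> int N dvd (ivec m - ivec n) $ i"
      proof
        assume "int N dvd (ivec m - ivec n) $ i"
        then have "int (m $ i) mod int N = int (n $ i) mod int N" by (simp add: ivec_def mod_eq_dvd_iff)
        then show False using i lt by simp
      qed
      then have "(\<Sum>l\<in>lattice_box {0..<int N}. mode l (node N (ivec m - ivec n))) = 0"
        by (rule sum_mode_orthogonal[OF N])
      then show ?thesis using False by simp
    qed
  qed
  also have "\<dots> = c n * S n * card (lattice_box {0..<int N} :: (int^'d) set)" using n by (simp add: finite_grid)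
  finally have "c n * S n * card (lattice_box {0..<int N} :: (int^'d) set) = 0" by (simp add: z)
  then show ?thesis using Spos[of n] N by (simp add: card_lattice_box)
qed

lemma Q_comb_cong: "(\<And>n. n \<in> grid N \<Longrightarrow> b n = c n) \<Longrightarrow> Q_comb N b = Q_comb N c"
  by (simp add: Q_comb_def fun_eq_iff)

text \<open>Linear independence gives the uniqueness that the definite description in
  \<open>coords\<close> depends on.\<close>

lemma coords_Q_comb:
  assumes N: "N \<ge> 1"
  shows "coords N (Q_comb N c) = (\<lambda>n. if n \<in> grid N then c n else 0)"
  unfolding coords_def
proof (rule the_equality)
  show "Q_comb N c = Q_comb N (\<lambda>n. if n \<in> grid N then c n else 0) \<and> (\<forall>n. n \<notin> grid N \<longrightarrow> (if n \<in> grid N then c n else 0) = 0)"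
    by (auto intro: Q_comb_cong)
  fix b assume b: "Q_comb N c = Q_comb N b \<and> (\<forall>n. n \<notin> grid N \<longrightarrow> b n = 0)"
  have "Q_comb N (\<lambda>n. b n - c n) \<phi> = 0" for \<phi>
  proof -
    have "Q_comb N (\<lambda>n. b n - c n) \<phi> = Q_comb N b \<phi> - Q_comb N c \<phi>"
      by (simp add: Q_comb_def left_diff_distrib sum_subtractf)
    then show ?thesis using b by simp
  qed
  then have "b n - c n = 0" if "n \<in> grid N" for n
    by (rule Q_comb_independent[OF N _ that])
  then show "b = (\<lambda>n. if n \<in> grid N then c n else 0)" using b by (auto simp: fun_eq_iff)
qed

lemma H_norm_Q_comb:
  assumes "N \<ge> 1"
  shows "H_norm N (Q_comb N c) = L2_set (\<lambda>n. cmod (c n)) (grid N)"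
  unfolding H_norm_def coords_Q_comb[OF assms] by (rule L2_set_cong) auto

lemma infsum_finite_sum:
  fixes f :: "'a \<Rightarrow> 'b \<Rightarrow> complex"
  assumes "finite A" and "\<And>n. n \<in> A \<Longrightarrow> f n summable_on B"
  shows "(\<Sum>\<^sub>\<infinity>v\<in>B. (\<Sum>n\<in>A. f n v)) = (\<Sum>n\<in>A. infsum (f n) B)"
proof -
  have "((\<lambda>v. \<Sum>n\<in>A. f n v) has_sum (\<Sum>n\<in>A. infsum (f n) B)) B"
    using assms
  proof (induction A rule: finite_induct)
    case (insert a A)
    then show ?case by (simp add: has_sum_add)
  qed simp
  then show ?thesis by (rule infsumI)
qed

text \<open>Negates the second half of the frequencies, matching the sign of \<open>\<xi>\<close> in the transpose.\<close>

definition flip :: "int^('d::finite + 'd) \<Rightarrow> int^('d + 'd)" where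
  "flip v = (\<chi> j. case j of Inl i \<Rightarrow> v $ Inl i | Inr i \<Rightarrow> - v $ Inr i)"

section \<open>Reflections and sums of coefficient families\<close>

lemma flip_flip [simp]: "flip (flip v) = v"
  by (simp add: flip_def vec_eq_iff split: sum.split)

lemma bij_flip: "bij_betw flip UNIV UNIV"
  by (rule bij_betwI[of flip UNIV UNIV flip]) auto

lemma flip_parts [simp]: "lpart (flip v) = lpart v" "mpart (flip v) = - mpart v"
  by (simp_all add: flip_def lpart_def mpart_def vec_eq_iff)

lemma l1_flip [simp]: "l1 (flip v) = l1 v"
proof -
  have "\<bar>real_of_int (flip v $ j)\<bar> = \<bar>real_of_int (v $ j)\<bar>" for j
    by (cases j) (simp_all add: flip_def)
  then show ?thesis by (simp add: l1_def)
qed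

lemma l1_uminus [simp]: "l1 (- v) = l1 v"
  by (simp add: l1_def)

lemma rapid_flip: "rapid c \<Longrightarrow> rapid (\<lambda>v. c (flip v))"
  unfolding rapid_def
proof
  fix k assume "\<forall>k. (\<lambda>v. cmod (c v) * (1 + 2 * pi * l1 v) ^ k) summable_on UNIV"
  then show "(\<lambda>v. cmod (c (flip v)) * (1 + 2 * pi * l1 v) ^ k) summable_on UNIV"
    using summable_on_reindex_bij_betw[OF bij_flip, of "\<lambda>v. cmod (c v) * (1 + 2 * pi * l1 v) ^ k"] by simp
qed

lemma bij_uminus: "bij_betw (uminus :: int^'n \<Rightarrow> int^'n) UNIV UNIV"
  by (rule bij_betwI[of uminus UNIV UNIV uminus]) auto

lemma rapid_uminus: "rapid c \<Longrightarrow> rapid (\<lambda>v. c (- v))"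
  unfolding rapid_def
proof
  fix k assume "\<forall>k. (\<lambda>v. cmod (c v) * (1 + 2 * pi * l1 v) ^ k) summable_on UNIV"
  then show "(\<lambda>v. cmod (c (- v)) * (1 + 2 * pi * l1 v) ^ k) summable_on UNIV"
    using summable_on_reindex_bij_betw[OF bij_uminus, of "\<lambda>v. cmod (c v) * (1 + 2 * pi * l1 v) ^ k"] by simp
qed

lemma rapid_add:
  assumes "rapid b" and "rapid c"
  shows "rapid (\<lambda>v. b v + c v)"
  unfolding rapid_def
proof
  fix k
  have "(\<lambda>v. cmod (b v) * (1 + 2 * pi * l1 v) ^ k + cmod (c v) * (1 + 2 * pi * l1 v) ^ k) summable_on UNIV"
    using assms unfolding rapid_def by (intro summable_on_add) auto
  then show "(\<lambda>v. cmod (b v + c v) * (1 + 2 * pi * l1 v) ^ k) summable_on UNIV"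
  proof (rule summable_on_comparison_test)
    fix v :: "int^'a"
    have w: "0 \<le> (1 + 2 * pi * l1 v) ^ k" using weight_ge_1[of v] by simp
    show "cmod (b v + c v) * (1 + 2 * pi * l1 v) ^ k \<le> cmod (b v) * (1 + 2 * pi * l1 v) ^ k + cmod (c v) * (1 + 2 * pi * l1 v) ^ k"
      using mult_right_mono[OF norm_triangle_ineq[of "b v" "c v"] w] by (simp add: distrib_right)
    show "0 \<le> cmod (b v + c v) * (1 + 2 * pi * l1 v) ^ k" using w by simp
  qed
qed

lemma rapid_cong_norm:
  assumes "rapid c" and "\<And>v. cmod (b v) = K * cmod (c v)"
  shows "rapid b" and "wsum k b = K * wsum k c"
proof -
  show "rapid b" by (rule rapid_mono[OF assms(1), of _ K 0]) (simp add: assms(2) mult.commute)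
  show "wsum k b = K * wsum k c" by (simp add: wsum_def assms(2) infsum_cmult_right'[symmetric] mult.assoc)
qed

lemma wsum_add_le:
  assumes "rapid b" and "rapid c"
  shows "wsum k (\<lambda>v. b v + c v) \<le> wsum k b + wsum k c"
proof -
  have s: "(\<lambda>v. cmod (f v) * (1 + 2 * pi * l1 v) ^ k) summable_on UNIV" if "rapid f" for f :: "int^'a \<Rightarrow> complex"
    using that unfolding rapid_def by blast
  have "wsum k (\<lambda>v. b v + c v) \<le> (\<Sum>\<^sub>\<infinity>v. cmod (b v) * (1 + 2 * pi * l1 v) ^ k + cmod (c v) * (1 + 2 * pi * l1 v) ^ k)"
    unfolding wsum_def
  proof (rule infsum_mono)
    fix v :: "int^'a"
    have w: "0 \<le> (1 + 2 * pi * l1 v) ^ k" using weight_ge_1[of v] by simp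
    show "cmod (b v + c v) * (1 + 2 * pi * l1 v) ^ k \<le> cmod (b v) * (1 + 2 * pi * l1 v) ^ k + cmod (c v) * (1 + 2 * pi * l1 v) ^ k"
      using mult_right_mono[OF norm_triangle_ineq[of "b v" "c v"] w] by (simp add: distrib_right)
  qed (intro summable_on_add s rapid_add assms)+
  also have "\<dots> = wsum k b + wsum k c" unfolding wsum_def by (intro infsum_add s assms)
  finally show ?thesis .
qed

text \<open>The half-phase of Weyl ordering. It turns the symmetry
  \<open>c (- v) = cnj (c v)\<close> of a real symbol into self-adjointness of the operator.\<close>

definition twist :: "nat \<Rightarrow> (int^('d::finite + 'd) \<Rightarrow> complex) \<Rightarrow> int^('d + 'd) \<Rightarrow> complex" where
  "twist N c v = c v * cis (pi * (lvec v \<bullet> mvec v) / N)"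

lemma twist_rapid: "rapid c \<Longrightarrow> rapid (twist N c)" and twist_wsum: "rapid c \<Longrightarrow> wsum k (twist N c) = wsum k c"
  using rapid_cong_norm[of c "twist N c" 1] by (auto simp: twist_def norm_mult)

lemma grid_shift:
  assumes N: "N \<ge> 1"
  shows "bij_betw (shift N m) (grid N) (grid N)"
proof (rule bij_betwI[of _ _ _ "shift N (- m)"])
  have "shift N m n \<in> grid N" if "n \<in> grid N" for m :: "int^'d" and n
  proof -
    have "nat ((int (n $ i) + m $ i) mod int N) < N" for i
      using N by (simp add: nat_less_iff)
    moreover have "n $ i div N = 0" for i using that by (simp add: grid_def)
    ultimately show ?thesis by (simp add: grid_def shift_def)
  qed
  then show "shift N m \<in> grid N \<rightarrow> grid N" "shift N (- m) \<in> grid N \<rightarrow> grid N" by auto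
qed (simp_all add: shift_add[OF N] shift_0[OF N])

text \<open>At lattice points the modulation depends only on the residue \<open>n\<close>, and the
  translation by \<open>mvec v / N\<close> moves the index. The lattice and frequency sums may be
  exchanged because polynomial growth in \<open>v\<close> is absorbed by \<open>e\<close>.\<close>

lemma Q_msum:
  fixes \<phi> :: "real^'d \<Rightarrow> complex"
  assumes N: "N \<ge> 1" and e: "rapid e" and \<phi>: "schwartz \<phi>"
  shows "Q N n (msum (\<lambda>v. (2 * pi) *\<^sub>R lvec v) (\<lambda>v. (1 / real N) *\<^sub>R mvec v) e \<phi>) =
    (\<Sum>\<^sub>\<infinity>v. e v * phase N (lpart v) n * theta N \<phi> (ivec n + mpart v))"
proof -
  define y where "y = node N (ivec n)"
  define f where "f k v = e v * phase N (lpart v) n * \<phi> (int_vec k + (y + (1 / real N) *\<^sub>R mvec v))" for k v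
  interpret modulated_sums "\<lambda>v :: int^('d + 'd). (2 * pi) *\<^sub>R lvec v" "\<lambda>v. (1 / real N) *\<^sub>R mvec v" "2 * pi"
  proof
    fix v :: "int^('d + 'd)"
    show "norm ((2 * pi) *\<^sub>R lvec v) \<le> 2 * pi * (1 + 2 * pi * l1 v)"
      using norm_lvec_le[of v] by simp
    have "norm ((1 / real N) *\<^sub>R mvec v) \<le> 1 * norm (mvec v)"
      unfolding norm_scaleR using N by (intro mult_right_mono) auto
    also have "\<dots> \<le> 2 * pi * (1 + 2 * pi * l1 v)"
      using norm_mvec_le[of v] pi_ge_two by (intro mult_mono) auto
    finally show "norm ((1 / real N) *\<^sub>R mvec v) \<le> 2 * pi * (1 + 2 * pi * l1 v)" .
  qed simp
  have sch: "schwartz (msum (\<lambda>v. (2 * pi) *\<^sub>R lvec v) (\<lambda>v. (1 / real N) *\<^sub>R mvec v) e \<phi>)"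
    by (rule schwartz_msum[OF e \<phi>])
  have m: "msum (\<lambda>v. (2 * pi) *\<^sub>R lvec v) (\<lambda>v. (1 / real N) *\<^sub>R mvec v) e \<phi> (int_vec k + y) = (\<Sum>\<^sub>\<infinity>v. f k v)" for k
  proof -
    have "cis (((2 * pi) *\<^sub>R lvec v) \<bullet> (int_vec k + y)) = phase N (lpart v) n" for v :: "int^('d + 'd)"
    proof -
      have "cis (((2 * pi) *\<^sub>R lvec v) \<bullet> (int_vec k + y)) = mode (lpart v) (y + int_vec k)"
        by (simp add: mode_def lvec_def add.commute)
      also have "\<dots> = mode (lpart v) y" using periodic_mode[of "lpart v"] by (simp add: periodic_def)
      finally show ?thesis by (simp add: phase_eq_mode y_def)
    qed
    then show ?thesis by (simp add: msum_def f_def add.assoc)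
  qed
  obtain C where C: "0 \<le> C" "\<And>k y. cmod (\<phi> (int_vec k + y)) \<le> C * (1 + norm y) ^ (2 * CARD('d)) * (1 / (1 + 2 * pi * l1 k) ^ (2 * CARD('d)))"
    using schwartz_lattice_bound[OF \<phi>] by metis
  define D where "D = C * ((2 + norm y) ^ (2 * CARD('d)))"
  define g where "g k = 1 / (1 + 2 * pi * l1 k) ^ (2 * CARD('d))" for k :: "int^'d"
  have g0: "0 \<le> g k" for k using weight_ge_1[of k] by (simp add: g_def)
  have fb: "cmod (f k v) \<le> D * (cmod (e v) * (1 + 2 * pi * l1 v) ^ (2 * CARD('d))) * g k" for k v
  proof -
    have w: "1 \<le> 1 + 2 * pi * l1 v" by (rule weight_ge_1)
    have "norm ((1 / real N) *\<^sub>R mvec v) \<le> 1 * norm (mvec v)"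
      unfolding norm_scaleR using N by (intro mult_right_mono) auto
    then have "1 + norm (y + (1 / real N) *\<^sub>R mvec v) \<le> 1 + norm y + (1 + 2 * pi * l1 v)"
      using norm_triangle_ineq[of y "(1 / real N) *\<^sub>R mvec v"] norm_mvec_le[of v] by linarith
    also have "\<dots> \<le> (2 + norm y) * (1 + 2 * pi * l1 v)"
      using mult_left_mono[OF w, of "1 + norm y"] by (simp add: algebra_simps)
    finally have "(1 + norm (y + (1 / real N) *\<^sub>R mvec v)) ^ (2 * CARD('d)) \<le> ((2 + norm y) * (1 + 2 * pi * l1 v)) ^ (2 * CARD('d))"
      by (intro power_mono) auto
    then have "C * (1 + norm (y + (1 / real N) *\<^sub>R mvec v)) ^ (2 * CARD('d)) * g k \<le> C * ((2 + norm y) * (1 + 2 * pi * l1 v)) ^ (2 * CARD('d)) * g k"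
      using C(1) g0 by (intro mult_right_mono mult_left_mono) auto
    then have "cmod (\<phi> (int_vec k + (y + (1 / real N) *\<^sub>R mvec v))) \<le> C * ((2 + norm y) * (1 + 2 * pi * l1 v)) ^ (2 * CARD('d)) * g k"
      using C(2)[of k "y + (1 / real N) *\<^sub>R mvec v"] unfolding g_def by linarith
    then have "cmod (e v) * cmod (\<phi> (int_vec k + (y + (1 / real N) *\<^sub>R mvec v))) \<le> cmod (e v) * (C * ((2 + norm y) * (1 + 2 * pi * l1 v)) ^ (2 * CARD('d)) * g k)"
      by (intro mult_left_mono) auto
    then show ?thesis by (simp add: f_def norm_mult D_def power_mult_distrib mult_ac)
  qed
  have gs: "g summable_on UNIV" unfolding g_def by (rule summable_weight)
  have es: "(\<lambda>v. cmod (e v) * (1 + 2 * pi * l1 v) ^ (2 * CARD('d))) summable_on UNIV"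
    using e unfolding rapid_def by blast
  have inner: "(\<lambda>v. cmod (f k v)) summable_on UNIV" for k
    by (rule Infinite_Sum.abs_summable_on_comparison_test'[OF summable_on_cmult_left[OF summable_on_cmult_right[OF es]] fb])
  have "(\<lambda>(k, v). f k v) summable_on UNIV \<times> UNIV"
  proof (rule abs_summable_summable)
    have "Infinite_Sum.abs_summable_on (\<lambda>(k, v). f k v) (Sigma UNIV (\<lambda>_. UNIV))"
    proof (rule Infinite_Sum.abs_summable_on_Sigma_iff[THEN iffD2], intro conjI ballI)
      show "Infinite_Sum.abs_summable_on (\<lambda>v. case (k, v) of (k, v) \<Rightarrow> f k v) UNIV" for k
        using inner by simp
      have "cmod (complex_of_real (\<Sum>\<^sub>\<infinity>v. cmod (f k v))) \<le> (D * wsum (2 * CARD('d)) e) * g k" for k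
      proof -
        have "(\<Sum>\<^sub>\<infinity>v. cmod (f k v)) \<le> (\<Sum>\<^sub>\<infinity>v. D * (cmod (e v) * (1 + 2 * pi * l1 v) ^ (2 * CARD('d))) * g k)"
          by (rule infsum_mono[OF inner summable_on_cmult_left[OF summable_on_cmult_right[OF es]] fb])
        also have "\<dots> = (D * wsum (2 * CARD('d)) e) * g k"
          unfolding wsum_def infsum_cmult_left' infsum_cmult_right' ..
        finally show ?thesis by (simp add: infsum_nonneg)
      qed
      from Infinite_Sum.abs_summable_on_comparison_test'[OF summable_on_cmult_right[OF gs] this]
      show "Infinite_Sum.abs_summable_on (\<lambda>k. infsum (\<lambda>v. norm (case (k, v) of (k, v) \<Rightarrow> f k v)) UNIV) UNIV"
        by simp
    qed
    then show "(\<lambda>x. norm (case x of (k, v) \<Rightarrow> f k v)) summable_on UNIV \<times> UNIV" by simp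
  qed
  then have swap: "(\<Sum>\<^sub>\<infinity>k. \<Sum>\<^sub>\<infinity>v. f k v) = (\<Sum>\<^sub>\<infinity>v. \<Sum>\<^sub>\<infinity>k. f k v)"
    by (rule infsum_swap_banach)
  define p where "p = complex_of_real (real N powr (- real CARD('d) / 2))"
  have th: "p * (\<Sum>\<^sub>\<infinity>k. f k v) = e v * phase N (lpart v) n * theta N \<phi> (ivec n + mpart v)" for v
  proof -
    have "node N (ivec n + mpart v) = y + (1 / real N) *\<^sub>R mvec v"
      by (simp add: node_add y_def) (simp add: node_def mvec_def)
    then show ?thesis by (simp add: f_def theta_def p_def infsum_cmult_right')
  qed
  have "Q N n (msum (\<lambda>v. (2 * pi) *\<^sub>R lvec v) (\<lambda>v. (1 / real N) *\<^sub>R mvec v) e \<phi>) = p * (\<Sum>\<^sub>\<infinity>k. \<Sum>\<^sub>\<infinity>v. f k v)"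
    by (simp add: Q_eq_theta[OF sch] theta_def p_def m y_def[symmetric])
  also have "\<dots> = (\<Sum>\<^sub>\<infinity>v. p * (\<Sum>\<^sub>\<infinity>k. f k v))" unfolding swap infsum_cmult_right' ..
  finally show ?thesis unfolding th .
qed

text \<open>Duality moves the index of \<open>Q\<close> by \<open>- mpart v\<close>. Reindexing the
  grid sum by \<open>shift\<close> transfers this displacement to the coefficients, where it is the
  action of \<open>trans_op\<close>.\<close>

theorem op_N_Q_comb:
  fixes a :: "(real^'d) \<times> (real^'d) \<Rightarrow> complex"
  assumes N: "N \<ge> 1" and c: "rapid c"
    and a: "\<And>x \<xi>. a (x, \<xi>) = (\<Sum>\<^sub>\<infinity>v. c v * cis (2 * pi * (lvec v \<bullet> x + mvec v \<bullet> \<xi>)))"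
  shows "op_N N a (Q_comb N (coeff X)) = Q_comb N (coeff (app (Op N (twist N c)) X))"
proof
  fix \<phi> :: "real^'d \<Rightarrow> complex"
  have H: "Q_comb N (coeff X) \<in> H_space N" by (simp add: H_space_def)
  show "op_N N a (Q_comb N (coeff X)) \<phi> = Q_comb N (coeff (app (Op N (twist N c)) X)) \<phi>"
  proof (cases "schwartz \<phi>")
    case False
    then show ?thesis using H by (simp add: op_N_def weyl_distribution_def Q_comb_def Q_def)
  next
    case True
    define e where "e v = c (flip v) * cis (pi * (lvec v \<bullet> mvec v) / N)" for v
    have e: "rapid e"
      by (rule rapid_cong_norm(1)[OF rapid_flip[OF c], of _ 1]) (simp add: e_def norm_mult)
    have "(case (x, \<xi>) of (x, \<xi>) \<Rightarrow> a (x, - \<xi>)) = (\<Sum>\<^sub>\<infinity>v. c (flip v) * cis (2 * pi * (lvec v \<bullet> x + mvec v \<bullet> \<xi>)))" for x \<xi>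
    proof -
      have "a (x, - \<xi>) = (\<Sum>\<^sub>\<infinity>v. c (flip v) * cis (2 * pi * (lvec (flip v) \<bullet> x + mvec (flip v) \<bullet> (- \<xi>))))"
        unfolding a by (rule infsum_reindex_bij_betw[OF bij_flip, symmetric])
      then show ?thesis by (simp add: lvec_def mvec_def)
    qed
    from weyl_fourier_series[OF N rapid_flip[OF c] True this]
    have w: "weyl (1 / (2 * pi * real N)) (\<lambda>(x, \<xi>). a (x, - \<xi>)) \<phi> = msum (\<lambda>v. (2 * pi) *\<^sub>R lvec v) (\<lambda>v. (1 / real N) *\<^sub>R mvec v) e \<phi>"
      unfolding e_def .
    define z where "z v n = c v * cis (- pi * (lvec v \<bullet> mvec v) / N) * phase N (lpart v) n * theta N \<phi> (ivec n - mpart v)" for v n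
    have Qn: "Q N n (weyl (1 / (2 * pi * real N)) (\<lambda>(x, \<xi>). a (x, - \<xi>)) \<phi>) = (\<Sum>\<^sub>\<infinity>v. z v n)" for n
    proof -
      have "Q N n (weyl (1 / (2 * pi * real N)) (\<lambda>(x, \<xi>). a (x, - \<xi>)) \<phi>) = (\<Sum>\<^sub>\<infinity>v. e v * phase N (lpart v) n * theta N \<phi> (ivec n + mpart v))"
        unfolding w by (rule Q_msum[OF N e True])
      also have "\<dots> = (\<Sum>\<^sub>\<infinity>v. e (flip v) * phase N (lpart (flip v)) n * theta N \<phi> (ivec n + mpart (flip v)))"
        by (rule infsum_reindex_bij_betw[OF bij_flip, symmetric])
      finally show ?thesis by (simp add: e_def z_def lvec_def mvec_def)
    qed
    have theta_grid: "\<exists>n\<in>grid N. theta N \<phi> j = theta N \<phi> (ivec n)" for j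
    proof -
      define n :: "nat^'d" where "n = (\<chi> i. nat (j $ i mod int N))"
      have "n \<in> grid N" using N by (simp add: n_def grid_def nat_less_iff)
      moreover have "j = ivec n + (\<chi> i. int N * (\<chi> i. j $ i div int N) $ i)"
        using N by (simp add: vec_eq_iff n_def ivec_def)
      then have "theta N \<phi> j = theta N \<phi> (ivec n)" using theta_periodic[OF N] by metis
      ultimately show ?thesis by blast
    qed
    \<comment> \<open>\<open>theta\<close> is periodic in each coordinate, so the finitely many
      values on the grid bound it everywhere.\<close>
    define M where "M = Max ((\<lambda>n. cmod (theta N \<phi> (ivec n))) ` grid N)"
    have M: "cmod (theta N \<phi> j) \<le> M" for j
      using theta_grid[of j] unfolding M_def by (auto intro!: Max_ge finite_imageI finite_grid)
    have sz: "(\<lambda>v. z v n) summable_on UNIV" for n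
    proof (rule abs_summable_summable)
      show "(\<lambda>v. norm (z v n)) summable_on UNIV"
      proof (rule Infinite_Sum.abs_summable_on_comparison_test')
        show "(\<lambda>v. cmod (c v) * M) summable_on UNIV" by (intro summable_on_cmult_left rapid_abs_summable c)
        show "cmod (z v n) \<le> cmod (c v) * M" for v
          using mult_left_mono[OF M] by (simp add: z_def norm_mult)
      qed
    qed
    define q where "q v n = twist N c v * phase N (lpart v) n * coeff X (shift N (mpart v) n)" for v n
    have "op_N N a (Q_comb N (coeff X)) \<phi> = (\<Sum>n\<in>grid N. coeff X n * (\<Sum>\<^sub>\<infinity>v. z v n))"
      using H True by (simp add: op_N_def weyl_distribution_def Q_comb_def Qn)
    also have "\<dots> = (\<Sum>n\<in>grid N. (\<Sum>\<^sub>\<infinity>v. coeff X n * z v n))" by (simp only: infsum_cmult_right')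
    also have "\<dots> = (\<Sum>\<^sub>\<infinity>v. (\<Sum>n\<in>grid N. coeff X n * z v n))"
      by (rule infsum_finite_sum[symmetric]) (intro finite_grid summable_on_cmult_right sz)+
    also have "\<dots> = (\<Sum>\<^sub>\<infinity>v. (\<Sum>n\<in>grid N. q v n * Q N n \<phi>))"
    proof (rule infsum_cong)
      fix v :: "int^('d + 'd)"
      have "(\<Sum>n\<in>grid N. coeff X n * z v n) = (\<Sum>n\<in>grid N. coeff X (shift N (mpart v) n) * z v (shift N (mpart v) n))"
        by (rule sum.reindex_bij_betw[OF grid_shift[OF N], symmetric])
      also have "\<dots> = (\<Sum>n\<in>grid N. q v n * Q N n \<phi>)"
      proof (rule sum.cong[OF refl])
        fix n :: "nat^'d"
        obtain r where r: "ivec (shift N (mpart v) n) = ivec n + mpart v + (\<chi> i. int N * (r $ i))"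
          using shift_int[OF N, of "mpart v" n] unfolding ivec_def by blast
        have "theta N \<phi> (ivec (shift N (mpart v) n) - mpart v) = theta N \<phi> (ivec n + (\<chi> i. int N * (r $ i)))"
          unfolding r by (simp add: algebra_simps)
        also have "\<dots> = Q N n \<phi>" unfolding theta_periodic[OF N] Q_eq_theta[OF True] ..
        finally have t: "theta N \<phi> (ivec (shift N (mpart v) n) - mpart v) = Q N n \<phi>" .
        \<comment> \<open>The transpose carries the half-phase with a minus sign. The shifted phase
          contributes twice the half-phase, which restores the sign in \<open>twist\<close>.\<close>
        have cc: "cis (- pi * (lvec v \<bullet> mvec v) / N) * cis (2 * pi * of_int (pairing (lpart v) (mpart v)) / N) = cis (pi * (lvec v \<bullet> mvec v) / N)"
          by (simp add: cis_mult inner_lvec_mvec)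
        show "coeff X (shift N (mpart v) n) * z v (shift N (mpart v) n) = q v n * Q N n \<phi>"
          unfolding z_def t phase_shift[OF N] q_def twist_def cc[symmetric] by (simp only: mult_ac)
      qed
      finally show "(\<Sum>n\<in>grid N. coeff X n * z v n) = (\<Sum>n\<in>grid N. q v n * Q N n \<phi>)" .
    qed
    also have "\<dots> = (\<Sum>n\<in>grid N. (\<Sum>\<^sub>\<infinity>v. q v n * Q N n \<phi>))"
    proof (rule infsum_finite_sum[OF finite_grid])
      fix n :: "nat^'d"
      have "(\<lambda>v. norm (q v n)) summable_on UNIV"
      proof (rule Infinite_Sum.abs_summable_on_comparison_test')
        show "(\<lambda>v. cmod (c v) * norm X) summable_on UNIV" by (intro summable_on_cmult_left rapid_abs_summable c)
        show "cmod (q v n) \<le> cmod (c v) * norm X" for v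
          using mult_left_mono[OF norm_coeff_le[of X "shift N (mpart v) n"], of "cmod (c v)"]
          by (simp add: q_def twist_def norm_mult)
      qed
      then show "(\<lambda>v. q v n * Q N n \<phi>) summable_on UNIV"
        by (rule summable_on_cmult_left[OF abs_summable_summable])
    qed
    also have "\<dots> = Q_comb N (coeff (app (Op N (twist N c)) X)) \<phi>"
      unfolding Q_comb_def coeff_Op[OF N twist_rapid[OF c]] q_def infsum_cmult_left' ..
    finally show ?thesis .
  qed
qed

section \<open>Transfer to operators on \<open>H\<^sub>N\<close>\<close>

text \<open>A relation rather than a map: \<open>Q_comb\<close> sees only the grid, so
  \<open>M\<close> is not determined by \<open>T\<close>, and \<open>T\<close> is tested only on
  \<open>H_space\<close>.\<close>

definition rep :: "nat \<Rightarrow> ('d::finite) operator \<Rightarrow> (nat^'d) bop \<Rightarrow> bool" where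
  "rep N T M \<longleftrightarrow> (\<forall>X. T (Q_comb N (coeff X)) = Q_comb N (coeff (app M X)))"

lemma Q_comb_linear:
  "Q_comb N (coeff (X + Y)) = Q_comb N (coeff X) + Q_comb N (coeff Y)"
  "Q_comb N (coeff (X - Y)) = Q_comb N (coeff X) - Q_comb N (coeff Y)"
  by (auto simp: Q_comb_def fun_eq_iff sum.distrib[symmetric] sum_subtractf[symmetric] algebra_simps intro!: sum.cong)

lemma rep_add: "rep N T M \<Longrightarrow> rep N T' M' \<Longrightarrow> rep N (T + T') (M + M')"
  by (simp add: rep_def Q_comb_linear)

lemma rep_diff: "rep N T M \<Longrightarrow> rep N T' M' \<Longrightarrow> rep N (T - T') (M - M')"
  by (simp add: rep_def Q_comb_linear)

lemma rep_comp: "rep N T M \<Longrightarrow> rep N T' M' \<Longrightarrow> rep N (T \<circ> T') (M * M')"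
  by (simp add: rep_def)

lemma rep_power: "rep N T M \<Longrightarrow> rep N (T ^^ k) (M ^ k)"
proof (induction k)
  case 0
  then show ?case by (simp add: rep_def)
next
  case (Suc k)
  from rep_comp[OF Suc.prems Suc.IH[OF Suc.prems]] show ?case
    unfolding funpow.simps power_Suc .
qed

lemma bounded_linear_Q_comb: "bounded_linear (\<lambda>X. Q_comb N (coeff X) \<phi>)"
  unfolding Q_comb_def
  by (intro bounded_linear_sum bounded_linear_mult_const bounded_linear_coeff)

text \<open>\<open>exp_op\<close> sums its series against each test function, and evaluating
  \<open>Q_comb\<close> there is a bounded linear functional of the operator, so the norm-convergent
  \<open>exp\<close> series can be tested term by term. The commutation hypothesis gives
  \<open>(z M)^k = z^k M^k\<close>.\<close>

lemma rep_exp: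
  fixes T :: "('d::finite) operator"
  assumes T: "rep N T M" and comm: "cmul z * M = M * cmul z"
  shows "rep N (exp_op z T) (exp (cmul z * M))"
  unfolding rep_def
proof (intro allI ext)
  fix X :: "(nat^'d) ell2" and \<phi> :: "real^'d \<Rightarrow> complex"
  have pow: "(cmul z * M) ^ k = cmul (z ^ k) * M ^ k" for k
  proof (induction k)
    case 0
    then show ?case by (simp add: cmul_simps(5))
  next
    case (Suc k)
    have "M * cmul (z ^ k) = cmul (z ^ k) * M" for k
    proof (induction k)
      case (Suc k)
      then show ?case by (simp add: cmul_simps(3)) (metis comm mult.assoc)
    qed (simp add: cmul_simps(5))
    then have "(cmul z * M) * (cmul (z ^ k) * M ^ k) = cmul z * cmul (z ^ k) * (M * M ^ k)"
      by (metis mult.assoc)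
    then show ?case by (simp add: Suc cmul_simps(3))
  qed
  have lin: "Q_comb N (coeff (app (cmul w) Y)) \<phi> = w * Q_comb N (coeff Y) \<phi>" for w Y
    by (simp add: Q_comb_def sum_distrib_left mult.assoc)
  have tm: "z ^ k / fact k * (T ^^ k) (Q_comb N (coeff X)) \<phi>
      = Q_comb N (coeff (app ((cmul z * M) ^ k /\<^sub>R fact k) X)) \<phi>" for k
  proof -
    have "Q_comb N (coeff (app ((cmul z * M) ^ k /\<^sub>R fact k) X)) \<phi> = Q_comb N (coeff (app (cmul (z ^ k / fact k)) (app (M ^ k) X))) \<phi>"
    proof -
      have "(cmul z * M) ^ k /\<^sub>R fact k = cmul (inverse (fact k) *\<^sub>R z ^ k) * M ^ k"
        by (simp add: pow cmul_simps(4))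
      also have "inverse (fact k) *\<^sub>R z ^ k = z ^ k / fact k"
        by (simp add: scaleR_conv_of_real divide_inverse mult.commute)
      finally show ?thesis by simp
    qed
    then show ?thesis using rep_power[OF T, of k] by (simp add: lin rep_def)
  qed
  have bl: "bounded_linear (\<lambda>K. Q_comb N (coeff (app K X)) \<phi>)"
    by (rule bounded_linear_compose[OF bounded_linear_Q_comb bounded_linear_app_left])
  have "(\<lambda>k. Q_comb N (coeff (app ((cmul z * M) ^ k /\<^sub>R fact k) X)) \<phi>) sums Q_comb N (coeff (app (exp (cmul z * M)) X)) \<phi>"
    by (rule bounded_linear.sums[OF bl exp_converges])
  then show "exp_op z T (Q_comb N (coeff X)) \<phi> = Q_comb N (coeff (app (exp (cmul z * M)) X)) \<phi>"
    unfolding exp_op_def tm by (rule sums_unique[symmetric])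
qed

lemma norm_ell2_restrict: "L2_set (\<lambda>n. cmod (coeff X n)) F \<le> norm X" if "finite F"
  unfolding L2_set_def using sum_coeff_le[OF that, of X] by (intro real_le_lsqrt) (auto intro: sum_nonneg)

text \<open>A vector of \<open>H_space\<close> is lifted by extending its coefficients by zero off
  the grid, which keeps its norm; dropping the coordinates off the grid afterwards cannot increase
  the norm.\<close>

lemma op_norm_rep:
  fixes T :: "('d::finite) operator"
  assumes N: "N \<ge> 1" and T: "rep N T M"
  shows "op_norm N T \<le> norm M"
  unfolding op_norm_def
proof (rule cSUP_least)
  have "Q_comb N (coeff (0 :: (nat^'d) ell2)) \<in> {u \<in> H_space N. H_norm N u \<le> 1}"
    by (simp add: H_space_def H_norm_Q_comb[OF N] L2_set_def)
  then show "{u \<in> (H_space N :: 'd distribution set). H_norm N u \<le> 1} \<noteq> {}" by blast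
next
  fix u :: "'d distribution" assume "u \<in> {u \<in> H_space N. H_norm N u \<le> 1}"
  then obtain c where u: "u = Q_comb N c" and le: "H_norm N u \<le> 1" by (auto simp: H_space_def)
  define f where "f n = (if n \<in> grid N then c n else 0)" for n
  have fin: "(\<Sum>n\<in>F. (cmod (f n))\<^sup>2) \<le> (L2_set (\<lambda>n. cmod (c n)) (grid N))\<^sup>2" if "finite F" for F
  proof -
    have "(\<Sum>n\<in>F. (cmod (f n))\<^sup>2) = (\<Sum>n\<in>F \<inter> grid N. (cmod (c n))\<^sup>2)"
      using that by (intro sum.mono_neutral_cong_right) (auto simp: f_def)
    also have "\<dots> \<le> (\<Sum>n\<in>grid N. (cmod (c n))\<^sup>2)" by (intro sum_mono2 finite_grid) auto
    finally show ?thesis by (simp add: L2_set_def sum_nonneg)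
  qed
  define X where "X = Abs_ell2 f"
  have X: "coeff X = f" unfolding X_def using square_summableI[OF fin] by (simp add: Abs_ell2_inverse)
  have uX: "u = Q_comb N (coeff X)" unfolding u X by (rule Q_comb_cong) (simp add: f_def)
  have nX: "norm X \<le> 1"
  proof (rule norm_ell2_leI)
    fix F :: "(nat^'d) set" assume "finite F"
    then have "(\<Sum>n\<in>F. (cmod (f n))\<^sup>2) \<le> (L2_set (\<lambda>n. cmod (c n)) (grid N))\<^sup>2" by (rule fin)
    also have "\<dots> \<le> 1\<^sup>2"
      using le unfolding u H_norm_Q_comb[OF N] by (intro power_mono) (auto simp: L2_set_nonneg)
    finally show "(\<Sum>i\<in>F. (cmod (coeff X i))\<^sup>2) \<le> 1\<^sup>2" by (simp add: X)
  qed simp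
  have "T u = Q_comb N (coeff (app M X))" using T uX by (simp add: rep_def)
  then have "H_norm N (T u) = L2_set (\<lambda>n. cmod (coeff (app M X) n)) (grid N)"
    by (simp add: H_norm_Q_comb[OF N])
  also have "\<dots> \<le> norm (app M X)" by (rule norm_ell2_restrict[OF finite_grid])
  also have "\<dots> \<le> norm M * norm X" by (rule norm_app)
  also have "\<dots> \<le> norm M * 1" by (intro mult_left_mono nX) auto
  finally show "H_norm N (T u) \<le> norm M" by simp
qed

text \<open>The expansion was obtained from a subsequence, and its uniqueness is not established.
  The symmetry is enforced instead by averaging \<open>c\<close> with its reflected conjugate
  \<open>b\<close>, which represents the same real function.\<close>

lemma real_fourier_series:
  fixes a :: "(real^'d) \<times> (real^'d) \<Rightarrow> complex"
  assumes "smooth_torus a" and real: "\<forall>z. a z \<in> \<real>"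
  shows "\<exists>c :: int^('d + 'd) \<Rightarrow> complex. rapid c \<and> (\<forall>v. c (- v) = cnj (c v)) \<and>
    (\<forall>x \<xi>. a (x, \<xi>) = (\<Sum>\<^sub>\<infinity>v. c v * cis (2 * pi * (lvec v \<bullet> x + mvec v \<bullet> \<xi>))))"
proof -
  obtain c :: "int^('d + 'd) \<Rightarrow> complex" where c: "rapid c"
    "\<And>x \<xi>. a (x, \<xi>) = (\<Sum>\<^sub>\<infinity>v. c v * cis (2 * pi * (lvec v \<bullet> x + mvec v \<bullet> \<xi>)))"
    using smooth_torus_fourier_series[OF assms(1)] by blast
  define b where "b v = cnj (c (- v))" for v
  have b: "rapid b" by (rule rapid_cong_norm(1)[OF rapid_uminus[OF c(1)], of _ 1]) (simp add: b_def)
  have sum: "(\<lambda>v. f v * cis (2 * pi * (lvec v \<bullet> x + mvec v \<bullet> \<xi>))) summable_on UNIV" if "rapid f" for f x \<xi>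
    by (rule abs_summable_summable) (use rapid_abs_summable[OF that] in \<open>simp add: norm_mult\<close>)
  have ab: "a (x, \<xi>) = (\<Sum>\<^sub>\<infinity>v. b v * cis (2 * pi * (lvec v \<bullet> x + mvec v \<bullet> \<xi>)))" for x \<xi>
  proof -
    have "a (x, \<xi>) = cnj (a (x, \<xi>))" using real by (metis Reals_cnj_iff)
    also have "\<dots> = (\<Sum>\<^sub>\<infinity>v. cnj (c v * cis (2 * pi * (lvec v \<bullet> x + mvec v \<bullet> \<xi>))))"
      unfolding c(2) by (rule infsum_bounded_linear[OF bounded_linear_cnj sum[OF c(1)], symmetric])
    also have "\<dots> = (\<Sum>\<^sub>\<infinity>v :: int^('d + 'd). cnj (c (- v) * cis (2 * pi * (lvec (- v) \<bullet> x + mvec (- v) \<bullet> \<xi>))))"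
      by (rule infsum_reindex_bij_betw[OF bij_uminus, symmetric])
    also have "\<dots> = (\<Sum>\<^sub>\<infinity>v. b v * cis (2 * pi * (lvec v \<bullet> x + mvec v \<bullet> \<xi>)))"
    proof (rule infsum_cong)
      fix v :: "int^('d + 'd)"
      have "lvec (- v) = - lvec v" "mvec (- v) = - mvec v" by (simp_all add: lvec_def mvec_def)
      then have "2 * pi * (lvec (- v) \<bullet> x + mvec (- v) \<bullet> \<xi>) = - (2 * pi * (lvec v \<bullet> x + mvec v \<bullet> \<xi>))"
        by (simp add: algebra_simps)
      then show "cnj (c (- v) * cis (2 * pi * (lvec (- v) \<bullet> x + mvec (- v) \<bullet> \<xi>))) = b v * cis (2 * pi * (lvec v \<bullet> x + mvec v \<bullet> \<xi>))"
        by (simp only: b_def complex_cnj_mult cis_cnj minus_minus)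
    qed
    finally show ?thesis .
  qed
  define d where "d v = (c v + b v) / 2" for v
  have "rapid d" by (rule rapid_cong_norm(1)[OF rapid_add[OF c(1) b], of _ "1 / 2"]) (simp add: d_def norm_divide)
  moreover have "d (- v) = cnj (d v)" for v by (simp add: d_def b_def add.commute)
  moreover have "a (x, \<xi>) = (\<Sum>\<^sub>\<infinity>v. d v * cis (2 * pi * (lvec v \<bullet> x + mvec v \<bullet> \<xi>)))" for x \<xi>
  proof -
    have "a (x, \<xi>) = (1 / 2) * (a (x, \<xi>) + a (x, \<xi>))" by simp
    also have "\<dots> = (1 / 2) * ((\<Sum>\<^sub>\<infinity>v. c v * cis (2 * pi * (lvec v \<bullet> x + mvec v \<bullet> \<xi>))) + (\<Sum>\<^sub>\<infinity>v. b v * cis (2 * pi * (lvec v \<bullet> x + mvec v \<bullet> \<xi>))))"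
      by (subst (1) c(2), subst ab) simp
    also have "\<dots> = (\<Sum>\<^sub>\<infinity>v. (1 / 2) * (c v * cis (2 * pi * (lvec v \<bullet> x + mvec v \<bullet> \<xi>)) + b v * cis (2 * pi * (lvec v \<bullet> x + mvec v \<bullet> \<xi>))))"
      unfolding infsum_cmult_right' by (simp only: infsum_add[OF sum[OF c(1)] sum[OF b]])
    finally show ?thesis by (simp add: d_def algebra_simps add_divide_distrib)
  qed
  ultimately show ?thesis by blast
qed

lemma strang_power:
  "(strang s A B ^^ n) X =
    (exp ((s / 2) *\<^sub>R A) * exp (s *\<^sub>R B) * exp ((s / 2) *\<^sub>R A)) ^ n * X *
    (exp ((s / 2) *\<^sub>R (- A)) * exp (s *\<^sub>R (- B)) * exp ((s / 2) *\<^sub>R (- A))) ^ n"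
proof (induction n)
  case (Suc n)
  define F where "F = exp ((s / 2) *\<^sub>R A) * exp (s *\<^sub>R B) * exp ((s / 2) *\<^sub>R A)"
  define G where "G = exp ((s / 2) *\<^sub>R (- A)) * exp (s *\<^sub>R (- B)) * exp ((s / 2) *\<^sub>R (- A))"
  have "strang s A B Y = F * Y * G" for Y
    by (simp only: strang_def conj_exp_def F_def G_def mult.assoc)
  moreover have "(strang s A B ^^ n) X = F ^ n * X * G ^ n"
    using Suc unfolding F_def G_def .
  ultimately have "(strang s A B ^^ Suc n) X = F * (F ^ n * X * G ^ n) * G"
    by (simp only: funpow.simps o_apply)
  also have "\<dots> = F ^ Suc n * X * G ^ Suc n"
    by (simp only: power_Suc[of F] power_Suc2[of G] mult.assoc)
  finally show ?case unfolding F_def G_def .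
qed simp

section \<open>Hamiltonians and their splitting error\<close>

context quantized
begin

text \<open>The generator \<open>\<i> / h\<close> times the quantization, with
  \<open>1 / h = 2 * pi * N\<close>. The factor \<open>2 * pi * \<i>\<close> sits in the
  coefficients, and \<open>real N\<close> stays outside as \<open>gen_Op\<close> expects.\<close>

definition hamiltonian :: "(int^('d + 'd) \<Rightarrow> complex) \<Rightarrow> (nat^'d) bop" where
  "hamiltonian c = real N *\<^sub>R opN (\<lambda>v. (2 * pi * \<i>) * twist N c v)"

lemma hamiltonian_coeffs:
  assumes "rapid c"
  shows "rapid (\<lambda>v. (2 * pi * \<i>) * twist N c v)"
    and "wsum k (\<lambda>v. (2 * pi * \<i>) * twist N c v) = 2 * pi * wsum k c"
  using rapid_cong_norm[OF twist_rapid[OF assms], of "\<lambda>v. (2 * pi * \<i>) * twist N c v" "2 * pi"]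
  by (auto simp: norm_mult twist_wsum[OF assms])

lemma hamiltonian_isometric:
  assumes c: "rapid c" and herm: "\<And>v. c (- v) = cnj (c v)"
  shows "isometric_generator (hamiltonian c)"
proof (rule isometric_generator_skew)
  fix x y
  have "app (opN (\<lambda>v. (2 * pi * \<i>) * twist N c v)) x \<bullet> y = - (x \<bullet> app (opN (\<lambda>v. (2 * pi * \<i>) * twist N c v)) y)"
  proof (rule Op_skew[OF N hamiltonian_coeffs(1)[OF c]])
    fix v :: "int^('d + 'd)"
    define t where "t = pi * (lvec v \<bullet> mvec v) / N"
    have l: "lvec (- v) \<bullet> mvec (- v) = lvec v \<bullet> mvec v" by (simp add: lvec_def mvec_def)
    have t2: "2 * pi * of_int (pairing (lpart v) (mpart v)) / N = 2 * t"
      by (simp add: t_def inner_lvec_mvec)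
    \<comment> \<open>The adjoint phase of a translation is twice the half-phase in
      \<open>twist\<close>, so together they reproduce the half-phase at \<open>- v\<close>.\<close>
    have "cis (- t) * cis (2 * t) = cis t" by (simp add: cis_mult)
    then show "(2 * pi * \<i>) * twist N c (- v) = - cnj ((2 * pi * \<i>) * twist N c v) * cis (2 * pi * of_int (pairing (lpart v) (mpart v)) / N)"
      unfolding t2 by (simp add: twist_def l herm t_def[symmetric] cis_cnj)
  qed
  then show "app (hamiltonian c) x \<bullet> y = - (x \<bullet> app (hamiltonian c) y)"
    by (simp add: hamiltonian_def)
qed

lemma hamiltonian_add:
  assumes "rapid b" and "rapid c"
  shows "hamiltonian (\<lambda>v. b v + c v) = hamiltonian b + hamiltonian c"
proof -
  have "(\<lambda>v. (2 * pi * \<i>) * twist N (\<lambda>v. b v + c v) v) = (\<lambda>v. (2 * pi * \<i>) * twist N b v + (2 * pi * \<i>) * twist N c v)"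
    by (simp add: twist_def fun_eq_iff algebra_simps)
  then show ?thesis
    by (simp only: hamiltonian_def Op_add[OF N hamiltonian_coeffs(1)[OF assms(1)] hamiltonian_coeffs(1)[OF assms(2)]] scaleR_add_right)
qed

text \<open>Triple commutators need generators of order 3, and these need one weight more than their
  order: hence \<open>wsum 4\<close>.\<close>

lemma hamiltonian_gen: "rapid c \<Longrightarrow> 2 * pi * wsum 4 c \<le> \<kappa> \<Longrightarrow> gen 3 \<kappa> (hamiltonian c)"
  unfolding hamiltonian_def
  by (rule gen_Op[OF hamiltonian_coeffs(1)], assumption)
    (simp only: hamiltonian_coeffs(2), simp add: numeral_eq_Suc)

lemma rep_exp_hamiltonian:
  fixes c :: "int^('d + 'd) \<Rightarrow> complex"
  assumes T: "rep N T (opN (twist N c))" and c: "rapid c"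
    and z: "z = complex_of_real r * (\<i> * of_real (2 * pi * real N))"
  shows "rep N (exp_op z T) (exp (r *\<^sub>R hamiltonian c))"
proof -
  have "cmul z * opN (twist N c) = opN (twist N c) * cmul z"
    by (rule Op_scale(2)[OF N twist_rapid[OF c]])
  from rep_exp[OF T this] have "rep N (exp_op z T) (exp (cmul z * opN (twist N c)))" .
  moreover have "cmul z * opN (twist N c) = r *\<^sub>R hamiltonian c"
  proof -
    have "z = (r * real N) *\<^sub>R (2 * pi * \<i>)" by (simp add: z scaleR_conv_of_real mult_ac)
    then have "cmul z = (r * real N) *\<^sub>R (cmul (2 * pi * \<i>) :: (nat^'d) bop)" by (simp only: cmul_simps(4))
    then show ?thesis
      by (simp add: hamiltonian_def Op_scale(1)[OF N twist_rapid[OF c]])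
  qed
  ultimately show ?thesis by simp
qed

lemma splitting_error:
  fixes ca cb co :: "int^('d + 'd) \<Rightarrow> complex"
  assumes ca: "rapid ca" "\<And>v. ca (- v) = cnj (ca v)" and cb: "rapid cb" "\<And>v. cb (- v) = cnj (cb v)"
    and co: "rapid co" and s: "0 \<le> s" and \<kappa>: "\<kappa> = 2 * pi * (wsum 4 ca + wsum 4 cb)"
  shows "norm ((strang s (hamiltonian ca) (hamiltonian cb) ^^ n) (opN (twist N co))
      - conj_exp (real n * s) (hamiltonian (\<lambda>v. ca v + cb v)) (opN (twist N co)))
    \<le> real n * (3 * s ^ 3 * (C 3 * \<kappa>) ^ 3 * exp (G 3 * \<kappa> * (real n * s)) * ((1 + J) ^ 3 * wsum 3 co))"
proof -
  have w: "0 \<le> wsum 4 ca" "0 \<le> wsum 4 cb" by (rule wsum_nonneg)+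
  then have \<kappa>0: "0 \<le> \<kappa>" unfolding \<kappa> by simp
  have ab: "rapid (\<lambda>v. ca v + cb v)" by (rule rapid_add[OF ca(1) cb(1)])
  note add = hamiltonian_add[OF ca(1) cb(1)]
  have "2 * pi * wsum 4 ca \<le> \<kappa>" "2 * pi * wsum 4 cb \<le> \<kappa>" "2 * pi * wsum 4 (\<lambda>v. ca v + cb v) \<le> \<kappa>"
    unfolding \<kappa> using w wsum_add_le[OF ca(1) cb(1), of 4] by (intro mult_left_mono; simp)+
  then have gens: "gen 3 \<kappa> (hamiltonian ca)" "gen 3 \<kappa> (hamiltonian cb)" "gen 3 \<kappa> (hamiltonian ca + hamiltonian cb)"
    using hamiltonian_gen ca(1) cb(1) ab add[symmetric] by auto
  have isos: "isometric_generator (hamiltonian ca)" "isometric_generator (hamiltonian cb)"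
    "isometric_generator (hamiltonian ca + hamiltonian cb)"
    unfolding add[symmetric] by (intro hamiltonian_isometric ca cb ab; simp add: ca(2) cb(2))+
  have "norm ((strang s (hamiltonian ca) (hamiltonian cb) ^^ n) (opN (twist N co))
      - conj_exp (real n * s) (hamiltonian ca + hamiltonian cb) (opN (twist N co)))
    \<le> real n * (3 * s ^ 3 * (C 3 * \<kappa>) ^ 3 * exp (G 3 * \<kappa> * (real n * s)) * sob 3 (opN (twist N co)))"
    by (rule strang_global_error[OF \<kappa>0 isos gens s])
  also have "\<dots> \<le> real n * (3 * s ^ 3 * (C 3 * \<kappa>) ^ 3 * exp (G 3 * \<kappa> * (real n * s)) * ((1 + J) ^ 3 * wsum 3 co))"
    using sob_Op[OF twist_rapid[OF co], of 3] twist_wsum[OF co] s \<kappa>0 C_nonneg[of 3]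
    by (intro mult_left_mono mult_nonneg_nonneg) auto
  finally show ?thesis unfolding add .
qed

end

theorem theorem11:
  fixes a b obs :: "(real^'d) \<times> (real^'d) \<Rightarrow> complex" and t :: real
  assumes "smooth_torus a" and "smooth_torus b" and "smooth_torus obs"
    and "\<forall>z. a z \<in> \<real>" and "\<forall>z. b z \<in> \<real>"
    and "t > 0"
  shows "\<exists>C::real. \<forall>(N::nat) (n::nat) (s::real). N \<ge> 1 \<longrightarrow> n \<ge> 1 \<longrightarrow> t = real n * s \<longrightarrow>
    (let h = complex_of_real (1 / (2 * pi * real N));
         t' = complex_of_real t;
         s' = complex_of_real s;
         A = op_N N a;
         B = op_N N b;
         Ob = op_N N obs;
         H = A + B;
         T = exp_op (\<i> * t' / h) H \<circ> Ob \<circ> exp_op (- \<i> * t' / h) H;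
         T2 = ((exp_op (\<i> * s' / (2 * h)) A \<circ> exp_op (\<i> * s' / h) B
                  \<circ> exp_op (\<i> * s' / (2 * h)) A) ^^ n)
              \<circ> Ob
              \<circ> ((exp_op (- \<i> * s' / (2 * h)) A \<circ> exp_op (- \<i> * s' / h) B
                  \<circ> exp_op (- \<i> * s' / (2 * h)) A) ^^ n)
     in op_norm N (T2 - T) \<le> C * s\<^sup>2)"
proof -
  obtain ca :: "int^('d + 'd) \<Rightarrow> complex" where ca: "rapid ca" "\<And>v. ca (- v) = cnj (ca v)"
    "\<And>x \<xi>. a (x, \<xi>) = (\<Sum>\<^sub>\<infinity>v. ca v * cis (2 * pi * (lvec v \<bullet> x + mvec v \<bullet> \<xi>)))"
    using real_fourier_series[OF assms(1,4)] by blast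
  obtain cb :: "int^('d + 'd) \<Rightarrow> complex" where cb: "rapid cb" "\<And>v. cb (- v) = cnj (cb v)"
    "\<And>x \<xi>. b (x, \<xi>) = (\<Sum>\<^sub>\<infinity>v. cb v * cis (2 * pi * (lvec v \<bullet> x + mvec v \<bullet> \<xi>)))"
    using real_fourier_series[OF assms(2,5)] by blast
  obtain co :: "int^('d + 'd) \<Rightarrow> complex" where co: "rapid co"
    "\<And>x \<xi>. obs (x, \<xi>) = (\<Sum>\<^sub>\<infinity>v. co v * cis (2 * pi * (lvec v \<bullet> x + mvec v \<bullet> \<xi>)))"
    using smooth_torus_fourier_series[OF assms(3)] by blast
  define \<kappa> where "\<kappa> = 2 * pi * (wsum 4 ca + wsum 4 cb)"
  \<comment> \<open>\<open>J0\<close>, \<open>\<kappa>\<close> and \<open>K\<close> are fixed before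
    \<open>N\<close>, \<open>n\<close> and \<open>s\<close>. Inside the locale \<open>J\<close>
    equals \<open>J0\<close> for every \<open>N\<close>, since it depends only on the
    dimension.\<close>
  define J0 where "J0 = real CARD(('d + 'd) option)"
  define K where "K = t * (3 * ((1 + 3 * J0) ^ 3 * \<kappa>) ^ 3 * exp (3 * (J0 + 2) * (1 + 3 * J0) ^ 3 * \<kappa> * t) * ((1 + J0) ^ 3 * wsum 3 co))"
  show ?thesis
  proof (intro exI[of _ K] allI impI)
    fix N n :: nat and s :: real
    assume N: "N \<ge> 1" and n: "n \<ge> 1" and ts: "t = real n * s"
    have s0: "0 \<le> s" using ts assms(6) by (metis less_imp_le linorder_not_le mult_nonneg_nonpos of_nat_0_le_iff)
    interpret quantized N "TYPE('d)" by unfold_locales (rule N)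
    define h where "h = complex_of_real (1 / (2 * pi * real N))"
    define A where "A = op_N N a"
    define B where "B = op_N N b"
    define Ob where "Ob = op_N N obs"
    have z: "\<i> * complex_of_real r / h = complex_of_real r * (\<i> * of_real (2 * pi * real N))"
      "- \<i> * complex_of_real r / h = complex_of_real (- r) * (\<i> * of_real (2 * pi * real N))"
      "\<i> * complex_of_real r / (2 * h) = complex_of_real (r / 2) * (\<i> * of_real (2 * pi * real N))"
      "- \<i> * complex_of_real r / (2 * h) = complex_of_real (- (r / 2)) * (\<i> * of_real (2 * pi * real N))" for r
      by (simp_all add: h_def)
    have rA: "rep N A (opN (twist N ca))" and rB: "rep N B (opN (twist N cb))" and rO: "rep N Ob (opN (twist N co))"
      unfolding rep_def A_def B_def Ob_def
      using op_N_Q_comb[OF N ca(1) ca(3)] op_N_Q_comb[OF N cb(1) cb(3)] op_N_Q_comb[OF N co(1) co(2)] by blast+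
    have tw: "twist N (\<lambda>v. ca v + cb v) = (\<lambda>v. twist N ca v + twist N cb v)"
      by (simp add: twist_def fun_eq_iff distrib_right)
    have rH: "rep N (A + B) (opN (twist N (\<lambda>v. ca v + cb v)))"
      unfolding tw Op_add[OF N twist_rapid[OF ca(1)] twist_rapid[OF cb(1)]] by (rule rep_add[OF rA rB])
    define KA where "KA = hamiltonian ca"
    define KB where "KB = hamiltonian cb"
    define KH where "KH = hamiltonian (\<lambda>v. ca v + cb v)"
    have rep_A: "rep N (exp_op z A) (exp (r *\<^sub>R KA))" if "z = complex_of_real r * (\<i> * of_real (2 * pi * real N))" for z r
      unfolding KA_def by (rule rep_exp_hamiltonian[OF rA ca(1) that])
    have rep_B: "rep N (exp_op z B) (exp (r *\<^sub>R KB))" if "z = complex_of_real r * (\<i> * of_real (2 * pi * real N))" for z r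
      unfolding KB_def by (rule rep_exp_hamiltonian[OF rB cb(1) that])
    have rep_H: "rep N (exp_op z (A + B)) (exp (r *\<^sub>R KH))" if "z = complex_of_real r * (\<i> * of_real (2 * pi * real N))" for z r
      unfolding KH_def by (rule rep_exp_hamiltonian[OF rH rapid_add[OF ca(1) cb(1)] that])
    \<comment> \<open>Matches the exponents with \<open>- \<i>\<close> to the factors
      \<open>exp (r *\<^sub>R (- K))\<close> in \<open>conj_exp\<close> and
      \<open>strang_power\<close>.\<close>
    have sw: "r *\<^sub>R (- L) = (- r) *\<^sub>R L" for r and L :: "(nat^'d) bop" by simp
    define T where "T = exp_op (\<i> * complex_of_real t / h) (A + B) \<circ> Ob \<circ> exp_op (- \<i> * complex_of_real t / h) (A + B)"
    have rT: "rep N T (conj_exp t KH (opN (twist N co)))"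
      unfolding T_def conj_exp_def sw by (intro rep_comp rep_H rO z)
    define T2 where "T2 = ((exp_op (\<i> * complex_of_real s / (2 * h)) A \<circ> exp_op (\<i> * complex_of_real s / h) B
                  \<circ> exp_op (\<i> * complex_of_real s / (2 * h)) A) ^^ n)
              \<circ> Ob
              \<circ> ((exp_op (- \<i> * complex_of_real s / (2 * h)) A \<circ> exp_op (- \<i> * complex_of_real s / h) B
                  \<circ> exp_op (- \<i> * complex_of_real s / (2 * h)) A) ^^ n)"
    have rT2: "rep N T2 ((strang s KA KB ^^ n) (opN (twist N co)))"
      unfolding T2_def strang_power sw by (intro rep_comp rep_power rep_A rep_B rO z)
    have "op_norm N (T2 - T) \<le> norm ((strang s KA KB ^^ n) (opN (twist N co)) - conj_exp t KH (opN (twist N co)))"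
      by (rule op_norm_rep[OF N rep_diff[OF rT2 rT]])
    also have "\<dots> \<le> real n * (3 * s ^ 3 * (C 3 * \<kappa>) ^ 3 * exp (G 3 * \<kappa> * (real n * s)) * ((1 + J) ^ 3 * wsum 3 co))"
      unfolding ts KA_def KB_def KH_def by (rule splitting_error[OF ca(1,2) cb(1,2) co(1) s0 \<kappa>_def])
    \<comment> \<open>One factor \<open>real n * s\<close> of the accumulated
      \<open>real n * s ^ 3\<close> is \<open>t\<close>, which is already contained in
      \<open>K\<close>.\<close>
    also have "\<dots> = K * s\<^sup>2"
      unfolding K_def ts[symmetric] C_def G_def J_def J0_def[symmetric]
      by (simp add: power2_eq_square power3_eq_cube ts mult_ac)
    finally have "op_norm N (T2 - T) \<le> K * s\<^sup>2" .
    then show "let h = complex_of_real (1 / (2 * pi * real N));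
         t' = complex_of_real t;
         s' = complex_of_real s;
         A = op_N N a;
         B = op_N N b;
         Ob = op_N N obs;
         H = A + B;
         T = exp_op (\<i> * t' / h) H \<circ> Ob \<circ> exp_op (- \<i> * t' / h) H;
         T2 = ((exp_op (\<i> * s' / (2 * h)) A \<circ> exp_op (\<i> * s' / h) B
                  \<circ> exp_op (\<i> * s' / (2 * h)) A) ^^ n)
              \<circ> Ob
              \<circ> ((exp_op (- \<i> * s' / (2 * h)) A \<circ> exp_op (- \<i> * s' / h) B
                  \<circ> exp_op (- \<i> * s' / (2 * h)) A) ^^ n)
     in op_norm N (T2 - T) \<le> K * s\<^sup>2"
      unfolding Let_def T_def T2_def A_def B_def Ob_def h_def .
  qed
qed

end
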